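(* Let $d>0$, $a'\neq0$ and $a_{22},k_{11},k_{22}$ be real numbers, and let $$B=\begin{pmatrix}0&0\\0&d\end{pmatrix},\quad A=\begin{pmatrix}a'&0\\0&a_{22}\end{pmatrix},\quad K=\begin{pmatrix}k_{11}&0\\0&k_{22}\end{pmatrix},\quad M=\begin{pmatrix}1\\1\end{pmatrix}.$$ Let $\omega$ be a nonempty open subset of $\mathbb T$, let $T>\ell(\omega)/|a'|$, and consider the system $$\partial_t f-B\partial_x^2f+A\partial_xf+Kf=Mu\mathbf 1_\omega\ \text{ in }(0,T)\times\mathbb T,\qquad f(0,\cdot)=f_0.$$ - If $a'\neq a_{22}$ and $k_{11}=k_{22}$, every initial condition $f_0=(f_0^{\mathrm h},f_0^{\mathrm p})\in L^2(\mathbb T)^2$ such that $\int_{\mathbb T}f_0^{\mathrm h}=\int_{\mathbb T}f_0^{\mathrm p}$ can be steered to $0$ in time $T$ with controls in $L^2$. - If $a'\neq a_{22}$ and $k_{11}\neq k_{22}$, every initial condition in $L^2(\mathbb T)^2$ can be steered to $0$ in time $T$ with controls in $L^2$. - If $a'=a_{22}$ and $\sqrt{(k_{22}-k_{11})/d}\notin\mathbb N$, every initial condition in $L^2(\mathbb T)^2$ can be steered to $0$ in time $T$ with controls in $L^2$. - If $a'=a_{22}$ and $n_0:=\sqrt{(k_{22}-k_{11})/d}\in\mathbb N$, every initial condition $f_0=(f_0^{\mathrm h},f_0^{\mathrm p})\in L^2(\mathbb T)^2$ such that $c_{n_0}(f_0^{\mathrm h})=c_{n_0}(f_0^{\mathrm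 p})$ and $c_{-n_0}(f_0^{\mathrm h})=c_{-n_0}(f_0^{\mathrm p})$ can be steered to $0$ in time $T$ with controls in $L^2$.
   Context: $\mathbb T=\mathbb R/(2\pi\mathbb Z)$; $c_n(g)$ denotes the $n$-th Fourier coefficient of $g$, i.e. $c_n(g)=\frac1{2\pi}\int_{\mathbb T}g(x)\mathrm e^{-\mathrm inx}\,\mathrm dx$; $\mathbb N$ contains $0$. The state is $f:[0,T]\times\mathbb T\to\mathbb R^2$ and the control is scalar, $u:[0,T]\times\mathbb T\to\mathbb R$. Solutions are those associated with the strongly continuous semigroup on $L^2(\mathbb T)^2$ generated by $-\mathcal L$, where $\mathcal Lf=-B\partial_x^2f+A\partial_xf+Kf$ with domain $H^1(\mathbb T)\times H^2(\mathbb T)$. "$f_0$ can be steered to $0$ in time $T$ with controls in $L^2$" means: there exists $u\in L^2((0,T)\times\omega)$ such that the solution with initial condition $f_0$ satisfies $f(T,\cdot)=0$. $\ell(\omega):=\sup\{|I| : I\text{ connected component of }\mathbb T\setminus\omega\}$, where $|I|$ is the length of $I$.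
   Formalization: In the third and fourth bullets the formal statement has √((k11−k22)/d) in place of √((k22−k11)/d): as printed the third bullet fails, e.g. for a'=a22, k11=k22+d, where c_1(f^h)−c_1(f^p) evolves independently of the control. *)

theory Defs
  imports "HOL-Analysis.Analysis"
begin

section \<open>The torus\<close>

quotient_type torus = real / "\<lambda>x y :: real. \<exists>k::int. x - y = 2 * pi * of_int k"
proof (rule equivpI)
  show "reflp (\<lambda>x y :: real. \<exists>k::int. x - y = 2 * pi * of_int k)"
    by (auto intro!: reflpI exI[of _ 0])
  show "symp (\<lambda>x y :: real. \<exists>k::int. x - y = 2 * pi * of_int k)"
  proof (rule sympI)
    fix x y :: real
    assume "\<exists>k::int. x - y = 2 * pi * of_int k"
    then obtain k :: int where "x - y = 2 * pi * of_int k" by blast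
    then show "\<exists>k::int. y - x = 2 * pi * of_int k"
      by (intro exI[of _ "- k"]) (simp add: algebra_simps)
  qed
  show "transp (\<lambda>x y :: real. \<exists>k::int. x - y = 2 * pi * of_int k)"
  proof (rule transpI)
    fix x y z :: real
    assume "\<exists>k::int. x - y = 2 * pi * of_int k" "\<exists>k::int. y - z = 2 * pi * of_int k"
    then obtain k l :: int where "x - y = 2 * pi * of_int k" "y - z = 2 * pi * of_int l"
      by blast
    then show "\<exists>k::int. x - z = 2 * pi * of_int k"
      by (intro exI[of _ "k + l"]) (simp add: algebra_simps)
  qed
qed

lift_definition to_torus :: "real \<Rightarrow> torus" is "\<lambda>x. x" .

instantiation torus :: topological_space
begin

definition open_torus :: "torus set \<Rightarrow> bool" where
  "open_torus U \<longleftrightarrow> open (to_torus -` U)"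

instance
  by standard (auto simp: open_torus_def vimage_Union intro: open_Int)

end

definition torus_measure :: "torus measure" where
  "torus_measure = distr (restrict_space lborel {0..<2 * pi}) borel to_torus"

text \<open>All lengths are nonnegative; inserting \<open>0\<close> only matters if the complement of \<open>\<omega>\<close> is
  empty, where the supremum is \<open>0\<close>.\<close>

definition gap_length :: "torus set \<Rightarrow> real" where
  "gap_length \<omega> = Sup (insert 0 (measure torus_measure ` components (- \<omega>)))"

lift_definition torus_exp :: "int \<Rightarrow> torus \<Rightarrow> complex" is "\<lambda>n x. cis (of_int n * x)"
proof -
  fix n :: int and x y :: real
  assume "\<exists>k::int. x - y = 2 * pi * of_int k"
  then obtain k :: int where k: "x = y + 2 * pi * of_int k"
    by (metis add.commute diff_add_cancel)
  have "cis (of_int n * x) = cis (of_int n * y) * cis (2 * pi * of_int (n * k))"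
    unfolding k cis_mult by (simp add: algebra_simps)
  also have "cis (2 * pi * of_int (n * k)) = 1"
    by (rule cis_multiple_2pi) simp
  finally show "cis (of_int n * x) = cis (of_int n * y)" by simp
qed

section \<open>The space of square-integrable real functions on the torus\<close>

definition square_integrable :: "'a measure \<Rightarrow> ('a \<Rightarrow> real) \<Rightarrow> bool" where
  "square_integrable M f \<longleftrightarrow> f \<in> borel_measurable M \<and> integrable M (\<lambda>x. (f x)\<^sup>2)"

lemma square_integrable_mult:
  assumes "square_integrable M f" "square_integrable M g"
  shows "integrable M (\<lambda>x. f x * g x)"
proof (rule Bochner_Integration.integrable_bound)
  show "integrable M (\<lambda>x. (f x)\<^sup>2 + (g x)\<^sup>2)"
    using assms by (auto simp: square_integrable_def)
  show "(\<lambda>x. f x * g x) \<in> borel_measurable M"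
    using assms by (auto simp: square_integrable_def)
  have "\<bar>a * b\<bar> \<le> a\<^sup>2 + b\<^sup>2" for a b :: real
  proof -
    have "2 * \<bar>a\<bar> * \<bar>b\<bar> \<le> a\<^sup>2 + b\<^sup>2"
      using sum_squares_bound[of "\<bar>a\<bar>" "\<bar>b\<bar>"] by simp
    moreover have "0 \<le> \<bar>a\<bar> * \<bar>b\<bar>" by simp
    ultimately show ?thesis unfolding abs_mult by linarith
  qed
  then show "AE x in M. norm (f x * g x) \<le> norm ((f x)\<^sup>2 + (g x)\<^sup>2)"
    by simp
qed

lemma square_integrable_zero: "square_integrable M (\<lambda>_. 0)"
  by (simp add: square_integrable_def)

lemma square_integrable_add:
  assumes "square_integrable M f" "square_integrable M g"
  shows "square_integrable M (\<lambda>x. f x + g x)"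
  using assms square_integrable_mult[OF assms]
  by (auto simp: square_integrable_def power2_sum mult.assoc)

lemma square_integrable_scale:
  "square_integrable M f \<Longrightarrow> square_integrable M (\<lambda>x. c * f x)"
  by (auto simp: square_integrable_def power_mult_distrib)

definition l2_rel :: "(torus \<Rightarrow> real) \<Rightarrow> (torus \<Rightarrow> real) \<Rightarrow> bool" where
  "l2_rel f g \<longleftrightarrow> square_integrable torus_measure f \<and> square_integrable torus_measure g
     \<and> (AE x in torus_measure. f x = g x)"

quotient_type l2 = "torus \<Rightarrow> real" / partial: l2_rel
proof (rule part_equivpI)
  show "\<exists>f. l2_rel f f"
    by (auto simp: l2_rel_def intro!: exI[of _ "\<lambda>_. 0"] square_integrable_zero)
  show "symp l2_rel"
    by (auto simp: l2_rel_def intro!: sympI)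
  show "transp l2_rel"
    by (auto simp: l2_rel_def intro!: transpI)
qed

lift_definition to_l2 :: "(torus \<Rightarrow> real) \<Rightarrow> l2" is
  "\<lambda>f. if square_integrable torus_measure f then f else (\<lambda>_. 0)"
  by (auto simp: l2_rel_def square_integrable_zero)

lift_definition integral_l2 :: "l2 \<Rightarrow> real" is "\<lambda>f. \<integral>x. f x \<partial>torus_measure"
  by (auto simp: l2_rel_def square_integrable_def intro!: integral_cong_AE)

lemma measurable_torus_exp [measurable]: "torus_exp n \<in> borel_measurable torus_measure"
proof -
  have "open (to_torus -` (torus_exp n -` U))" if "open U" for U
  proof -
    have "to_torus -` (torus_exp n -` U) = (\<lambda>x. cis (of_int n * x)) -` U"
      by (auto simp: torus_exp.abs_eq to_torus.abs_eq)
    moreover have "continuous_on UNIV (\<lambda>x. cis (of_int n * x))"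
      by (intro continuous_intros)
    ultimately show ?thesis
      using that by (simp add: open_vimage)
  qed
  then have "torus_exp n \<in> borel_measurable borel"
    by (intro borel_measurableI) (simp add: open_torus_def)
  then show ?thesis
    by (simp add: torus_measure_def)
qed

lift_definition fourier_coeff :: "int \<Rightarrow> l2 \<Rightarrow> complex" is
  "\<lambda>n f. 1 / (2 * of_real pi) * (\<integral>x. of_real (f x) * torus_exp (- n) x \<partial>torus_measure)"
proof -
  fix n f g assume "l2_rel f g"
  then have [measurable]: "f \<in> borel_measurable torus_measure" "g \<in> borel_measurable torus_measure"
    and "AE x in torus_measure. f x = g x"
    by (auto simp: l2_rel_def square_integrable_def)
  then have "(\<integral>x. of_real (f x) * torus_exp (- n) x \<partial>torus_measure)
      = (\<integral>x. of_real (g x) * torus_exp (- n) x \<partial>torus_measure)"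
    by (intro integral_cong_AE) auto
  then show "1 / (2 * of_real pi) * (\<integral>x. of_real (f x) * torus_exp (- n) x \<partial>torus_measure)
      = 1 / (2 * of_real pi) * (\<integral>x. of_real (g x) * torus_exp (- n) x \<partial>torus_measure)"
    by simp
qed

instantiation l2 :: real_inner
begin

lift_definition zero_l2 :: l2 is "\<lambda>_. 0"
  by (simp add: l2_rel_def square_integrable_zero)

lift_definition plus_l2 :: "l2 \<Rightarrow> l2 \<Rightarrow> l2" is "\<lambda>f g x. f x + g x"
  by (auto simp: l2_rel_def intro: square_integrable_add elim: eventually_elim2)

lift_definition scaleR_l2 :: "real \<Rightarrow> l2 \<Rightarrow> l2" is "\<lambda>c f x. c * f x"
  by (auto simp: l2_rel_def intro: square_integrable_scale)

lift_definition uminus_l2 :: "l2 \<Rightarrow> l2" is "\<lambda>f x. - f x"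
  by (auto simp: l2_rel_def square_integrable_def)

definition minus_l2 :: "l2 \<Rightarrow> l2 \<Rightarrow> l2" where
  "minus_l2 f g = f + (- g)"

lift_definition inner_l2 :: "l2 \<Rightarrow> l2 \<Rightarrow> real" is "\<lambda>f g. \<integral>x. f x * g x \<partial>torus_measure"
  unfolding l2_rel_def square_integrable_def
  by (rule integral_cong_AE) (auto elim: eventually_elim2)

definition norm_l2 :: "l2 \<Rightarrow> real" where
  "norm_l2 f = sqrt (inner f f)"

definition dist_l2 :: "l2 \<Rightarrow> l2 \<Rightarrow> real" where
  "dist_l2 f g = norm (f - g)"

definition sgn_l2 :: "l2 \<Rightarrow> l2" where
  "sgn_l2 f = inverse (norm f) *\<^sub>R f"

definition uniformity_l2 :: "(l2 \<times> l2) filter" where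
  "uniformity_l2 = (INF e\<in>{0 <..}. principal {(f, g). dist f g < e})"

definition open_l2 :: "l2 set \<Rightarrow> bool" where
  "open_l2 U \<longleftrightarrow> (\<forall>f\<in>U. \<forall>\<^sub>F (f', g) in uniformity. f' = f \<longrightarrow> g \<in> U)"

instance
proof
  fix f g h :: l2 and r s :: real
  show "f + g + h = f + (g + h)"
    by transfer (auto simp: l2_rel_def add.assoc intro!: square_integrable_add)
  show "f + g = g + f"
    by transfer (auto simp: l2_rel_def add.commute intro!: square_integrable_add)
  show "0 + f = f"
    by transfer (auto simp: l2_rel_def)
  show "- f + f = 0"
    by transfer (auto simp: l2_rel_def square_integrable_zero)
  show "f - g = f + - g"
    by (rule minus_l2_def)
  show "r *\<^sub>R (f + g) = r *\<^sub>R f + r *\<^sub>R g"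
    by transfer (auto simp: l2_rel_def distrib_left intro!: square_integrable_add square_integrable_scale)
  show "(r + s) *\<^sub>R f = r *\<^sub>R f + s *\<^sub>R f"
    by transfer (auto simp: l2_rel_def distrib_right intro!: square_integrable_add square_integrable_scale)
  show "r *\<^sub>R s *\<^sub>R f = (r * s) *\<^sub>R f"
    by transfer (auto simp: l2_rel_def mult.assoc intro!: square_integrable_scale)
  show "1 *\<^sub>R f = f"
    by transfer (auto simp: l2_rel_def)
  show "dist f g = norm (f - g)"
    by (rule dist_l2_def)
  show "sgn f = inverse (norm f) *\<^sub>R f"
    by (simp add: sgn_l2_def)
  show "uniformity = (INF e\<in>{0 <..}. principal {(f :: l2, g). dist f g < e})"
    by (rule uniformity_l2_def)
  show "open U \<longleftrightarrow> (\<forall>f\<in>U. \<forall>\<^sub>F (f', g) in uniformity. f' = f \<longrightarrow> g \<in> U)" for U :: "l2 set"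
    by (rule open_l2_def)
  show "inner f g = inner g f"
    by transfer (simp add: mult.commute)
  show "inner (f + g) h = inner f h + inner g h"
    by transfer (auto simp: l2_rel_def distrib_right square_integrable_mult)
  show "inner (r *\<^sub>R f) g = r * inner f g"
    by transfer (auto simp: mult.assoc)
  show "0 \<le> inner f f"
    by transfer simp
  show "inner f f = 0 \<longleftrightarrow> f = 0"
    by transfer (auto simp: l2_rel_def square_integrable_def power2_eq_square[symmetric]
        integral_nonneg_eq_0_iff_AE)
  show "norm f = sqrt (inner f f)"
    by (rule norm_l2_def)
qed

end

section \<open>Sobolev spaces on the torus\<close>

definition torus_deriv :: "(torus \<Rightarrow> real) \<Rightarrow> (torus \<Rightarrow> real) \<Rightarrow> bool" where
  "torus_deriv \<phi> \<psi> \<longleftrightarrow>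
     (\<forall>x. ((\<lambda>y. \<phi> (to_torus y)) has_real_derivative \<psi> (to_torus x)) (at x))"

definition smooth_torus :: "(torus \<Rightarrow> real) \<Rightarrow> bool" where
  "smooth_torus \<phi> \<longleftrightarrow> (\<exists>D. D 0 = \<phi> \<and> (\<forall>n::nat. torus_deriv (D n) (D (Suc n))))"

definition has_weak_deriv :: "l2 \<Rightarrow> l2 \<Rightarrow> bool" where
  "has_weak_deriv f g \<longleftrightarrow> (\<forall>\<phi> \<psi>. smooth_torus \<phi> \<and> torus_deriv \<phi> \<psi>
     \<longrightarrow> inner f (to_l2 \<psi>) = - inner g (to_l2 \<phi>))"

definition weak_deriv :: "l2 \<Rightarrow> l2" where
  "weak_deriv f = (THE g. has_weak_deriv f g)"

definition H1 :: "l2 set" where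
  "H1 = {f. \<exists>g. has_weak_deriv f g}"

definition H2 :: "l2 set" where
  "H2 = {f. \<exists>g\<in>H1. has_weak_deriv f g}"

section \<open>Strongly continuous semigroups\<close>

definition c0_semigroup :: "(real \<Rightarrow> 'a \<Rightarrow> 'a::real_normed_vector) \<Rightarrow> bool" where
  "c0_semigroup S \<longleftrightarrow> (\<forall>t\<ge>0. bounded_linear (S t)) \<and> (\<forall>x. S 0 x = x) \<and>
     (\<forall>s\<ge>0. \<forall>t\<ge>0. \<forall>x. S (s + t) x = S s (S t x)) \<and>
     (\<forall>x. ((\<lambda>t. S t x) \<longlongrightarrow> x) (at_right 0))"

definition has_generator ::
  "(real \<Rightarrow> 'a \<Rightarrow> 'a::real_normed_vector) \<Rightarrow> 'a set \<Rightarrow> ('a \<Rightarrow> 'a) \<Rightarrow> bool" where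
  "has_generator S D G \<longleftrightarrow>
     (\<forall>x y. ((\<lambda>h. (S h x - x) /\<^sub>R h) \<longlongrightarrow> y) (at_right 0) \<longleftrightarrow> x \<in> D \<and> y = G x)"

text \<open>The integral of a curve in a Hilbert space, tested against all vectors. It agrees with the
  Bochner integral whenever the latter exists, and does not need the space to be an instance of
  \<open>banach\<close> and \<open>second_countable_topology\<close>.\<close>

definition has_hilbert_integral :: "(real \<Rightarrow> 'a::real_inner) \<Rightarrow> 'a \<Rightarrow> real set \<Rightarrow> bool" where
  "has_hilbert_integral g y X \<longleftrightarrow>
     (\<forall>v. has_bochner_integral (lebesgue_on X) (\<lambda>s. inner (g s) v) (inner y v))"

section \<open>The parabolic-transport system\<close>

definition mat_act :: "real^2^2 \<Rightarrow> l2^2 \<Rightarrow> l2^2" where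
  "mat_act A f = (\<chi> i. \<Sum>j\<in>UNIV. (A $ i $ j) *\<^sub>R (f $ j))"

text \<open>The domain below only asks for one derivative of the first component. The value of
  \<^const>\<open>weak_deriv\<close> outside \<^const>\<open>H1\<close> is immaterial, as the first column of \<open>B\<close> will be zero.\<close>

definition op_L :: "real^2^2 \<Rightarrow> real^2^2 \<Rightarrow> real^2^2 \<Rightarrow> l2^2 \<Rightarrow> l2^2" where
  "op_L B A K f = - mat_act B (\<chi> i. weak_deriv (weak_deriv (f $ i)))
     + mat_act A (\<chi> i. weak_deriv (f $ i)) + mat_act K f"

definition dom_L :: "(l2^2) set" where
  "dom_L = {f. f $ 1 \<in> H1 \<and> f $ 2 \<in> H2}"

definition forcing :: "real^2 \<Rightarrow> torus set \<Rightarrow> (real \<times> torus \<Rightarrow> real) \<Rightarrow> real \<Rightarrow> l2^2" where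
  "forcing M \<omega> u s = (\<chi> i. (M $ i) *\<^sub>R to_l2 (\<lambda>x. u (s, x) * indicator \<omega> x))"

text \<open>Duhamel's formula for the semigroup generated by \<open>- L\<close>; a strongly continuous semigroup is
  determined on \<open>t \<ge> 0\<close> by its generator, so the choice of \<open>S\<close> is irrelevant.\<close>

definition is_solution ::
  "real^2^2 \<Rightarrow> real^2^2 \<Rightarrow> real^2^2 \<Rightarrow> real^2 \<Rightarrow> torus set \<Rightarrow> real
    \<Rightarrow> (real \<times> torus \<Rightarrow> real) \<Rightarrow> l2^2 \<Rightarrow> (real \<Rightarrow> l2^2) \<Rightarrow> bool" where
  "is_solution B A K M \<omega> T u f0 f \<longleftrightarrow>
     (\<exists>S. c0_semigroup S \<and> has_generator S dom_L (\<lambda>g. - op_L B A K g) \<and>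
        (\<forall>t\<in>{0..T}. has_hilbert_integral (\<lambda>s. S (t - s) (forcing M \<omega> u s))
           (f t - S t f0) {0<..<t}))"

definition steerable_to_0 ::
  "real^2^2 \<Rightarrow> real^2^2 \<Rightarrow> real^2^2 \<Rightarrow> real^2 \<Rightarrow> torus set \<Rightarrow> real \<Rightarrow> l2^2 \<Rightarrow> bool" where
  "steerable_to_0 B A K M \<omega> T f0 \<longleftrightarrow>
     (\<exists>u f. square_integrable (restrict_space (lborel \<Otimes>\<^sub>M torus_measure) ({0<..<T} \<times> \<omega>)) u
        \<and> is_solution B A K M \<omega> T u f0 f \<and> f T = 0)"

text \<open>On the frequency \<open>n\<close>, \<open>L\<close> acts as the diagonal matrix with entries \<open>\<i>na' + k\<^sub>1\<^sub>1\<close> and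
  \<open>dn\<^sup>2 + \<i>na\<^sub>2\<^sub>2 + k\<^sub>2\<^sub>2\<close>. If these entries coincide, the control cancels in the equation for the
  difference of the two Fourier coefficients, which is then not controllable. For \<open>a' = a\<^sub>2\<^sub>2\<close> this
  happens exactly at the following frequencies.\<close>

lemma resonant_frequency_iff:
  fixes d a k11 k22 :: real and n :: int
  assumes "d > 0"
  shows "\<i> * of_int n * of_real a + of_real k11
           = of_real d * (of_int n)\<^sup>2 + \<i> * of_int n * of_real a + of_real k22
         \<longleftrightarrow> sqrt ((k11 - k22) / d) = \<bar>of_int n\<bar>"
proof -
  have "\<i> * of_int n * of_real a + of_real k11
           = of_real d * (of_int n)\<^sup>2 + \<i> * of_int n * of_real a + of_real k22
         \<longleftrightarrow> k11 = d * (of_int n)\<^sup>2 + k22"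
    by (simp add: complex_eq_iff power2_eq_square)
  also have "\<dots> \<longleftrightarrow> (k11 - k22) / d = (of_int n)\<^sup>2"
    using assms by (auto simp: field_simps)
  also have "\<dots> \<longleftrightarrow> sqrt ((k11 - k22) / d) = sqrt ((of_int n)\<^sup>2)"
    unfolding real_sqrt_eq_iff ..
  finally show ?thesis by simp
qed

end

(* Both components are diagonal in the Fourier basis, so steering to 0 is a moment problem for the
   control u: against exp(l s - i n x) with l running through the transport symbols and the heat
   symbols. On a first time interval, longer than the largest gap divided by |a'|, every
   characteristic meets the control region, which gives an explicit exact control of the transport
   component alone. On the remaining short interval take u = Q w, where Q = d/dt + a' d/dx + k11:
   all transport moments of u vanish, and its heat moments are those of w, multiplied by the
   difference of the two symbols. Hence w only has to be a smooth null control of the heat equation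
   for initial data divided by these differences; a vanishing difference is harmless by the
   hypothesis on the initial condition. Such a w comes from flatness: cut off in time every mode of the
   free solution by a Gevrey function, restore the equation by a power series in space, and use
   the control region to close up the circle by a spatial cutoff. *)

theory Submission
  imports Defs "HOL-Complex_Analysis.Cauchy_Integral_Formula"
begin

subsection \<open>The torus as a quotient of the line\<close>

text \<open>Tested against exp(l s - i n x), Q turns by parts into the factor
  \<open>transport_symbol - l\<close>, which is zero on transport moments and the symbol difference
  on heat moments. The divided data are only known to be bounded, yet w is differentiated. The time
  bump therefore lives in the middle third of the short interval, where the free heat flow has
  decayed like exp(- d n^2 \<epsilon> / 3), which absorbs every power of n. The obstacle is the
  convergence of the series in space. Over one turn of the circle its m-th term costs (2 pi)^(2m) /
  ((2m)! d^m), and the m-th time derivative of the bump costs (m!)^2 R^m. Since (m!)^2 \<le> (2m)!,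
  Gevrey order 2 works as soon as (2 pi)^2 R / d < 1; R is chosen to make this ratio 1/2. The
  spatial functions come from first-order equations whose roots have real part 0 or a/d, so their
  bounds do not grow exponentially in |n|. In the heat stage only moments of the source are
  computed; the controlled state is never formed. The strict inequality on T is what leaves time for
  this second stage.\<close>

lemma to_torus_eq_iff: "to_torus x = to_torus y \<longleftrightarrow> (\<exists>k::int. x - y = 2 * pi * of_int k)"
  by transfer simp

lemma to_torus_period [simp]: "to_torus (x + 2 * pi * of_int k) = to_torus x"
  by (auto simp: to_torus_eq_iff)

lemma torus_exp_to_torus [simp]: "torus_exp n (to_torus x) = cis (of_int n * x)"
  by transfer simp

lemma torus_cases: obtains x where "X = to_torus x"
proof -
  have "\<exists>x. X = to_torus x" by (transfer, rule exI, rule exI[of _ 0]) simp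
  then show ?thesis using that by blast
qed

text \<open>The representative in [p, p + 2 pi). The base point p is a parameter because the circle
  is later cut open inside the control region.\<close>

lift_definition torus_rep :: "real \<Rightarrow> torus \<Rightarrow> real" is
  "\<lambda>p x. x - 2 * pi * of_int \<lfloor>(x - p) / (2 * pi)\<rfloor>"
proof -
  fix p x y :: real assume "\<exists>k::int. x - y = 2 * pi * of_int k"
  then obtain k :: int where k: "x = y + 2 * pi * of_int k" by (metis add.commute diff_add_cancel)
  have "(x - p) / (2 * pi) = (y - p) / (2 * pi) + of_int k" by (simp add: k field_simps)
  then show "x - 2 * pi * of_int \<lfloor>(x - p) / (2 * pi)\<rfloor> = y - 2 * pi * of_int \<lfloor>(y - p) / (2 * pi)\<rfloor>"
    by (simp add: k algebra_simps)
qed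

lemma to_torus_rep [simp]: "to_torus (torus_rep p X) = X"
proof (transfer, intro exI)
  fix p X :: real
  show "X - 2 * pi * of_int \<lfloor>(X - p) / (2 * pi)\<rfloor> - X = 2 * pi * of_int (- \<lfloor>(X - p) / (2 * pi)\<rfloor>)"
    by simp
qed

lemma torus_rep_ge: "p \<le> torus_rep p X"
proof transfer
  fix p X :: real
  have "2 * pi * of_int \<lfloor>(X - p) / (2 * pi)\<rfloor> \<le> 2 * pi * ((X - p) / (2 * pi))"
    by (intro mult_left_mono) auto
  then show "p \<le> X - 2 * pi * of_int \<lfloor>(X - p) / (2 * pi)\<rfloor>" by simp
qed

lemma torus_rep_less: "torus_rep p X < p + 2 * pi"
proof transfer
  fix p X :: real
  have "(X - p) / (2 * pi) < of_int \<lfloor>(X - p) / (2 * pi)\<rfloor> + 1" by linarith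
  then have "X - p < 2 * pi * (of_int \<lfloor>(X - p) / (2 * pi)\<rfloor> + 1)"
    by (subst (asm) pos_divide_less_eq) (auto simp: mult.commute)
  then show "X - 2 * pi * of_int \<lfloor>(X - p) / (2 * pi)\<rfloor> < p + 2 * pi" by (simp add: algebra_simps)
qed

lemma to_torus_inj:
  assumes "to_torus x = to_torus y" "x \<in> {p..<p + 2 * pi}" "y \<in> {p..<p + 2 * pi}"
  shows "x = y"
proof -
  obtain k :: int where k: "x - y = 2 * pi * of_int k" using assms(1) by (auto simp: to_torus_eq_iff)
  then have "\<bar>2 * pi * of_int k\<bar> < 2 * pi" using assms(2,3) by auto
  then have "2 * pi * \<bar>of_int k\<bar> < 2 * pi * 1" by (simp add: abs_mult)
  then have "\<bar>of_int k :: real\<bar> < 1" by (subst (asm) mult_less_cancel_left_pos) auto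
  then have "k = 0" by linarith
  then show ?thesis using k by simp
qed

lemma torus_rep_to_torus: "x \<in> {p..<p + 2 * pi} \<Longrightarrow> torus_rep p (to_torus x) = x"
  by (rule to_torus_inj[where p = p]) (auto simp: torus_rep_ge torus_rep_less)

text \<open>The preimage of the image is the union of all translates of V by multiples of 2
  pi.\<close>

lemma open_to_torus_image:
  assumes "open V" shows "open (to_torus ` V)"
proof -
  have "to_torus -` (to_torus ` V) = (\<Union>k::int. (+) (2 * pi * of_int k) ` V)"
  proof (intro set_eqI iffI)
    fix x assume "x \<in> to_torus -` (to_torus ` V)"
    then obtain v where "v \<in> V" "to_torus x = to_torus v" by auto
    then show "x \<in> (\<Union>k::int. (+) (2 * pi * of_int k) ` V)"
      by (auto simp: to_torus_eq_iff image_iff intro!: bexI[of _ v]) (metis add.commute diff_add_cancel)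
  qed (auto simp: add.commute)
  then show ?thesis unfolding open_torus_def
    using assms by (auto intro!: open_Union open_translation)
qed

lemma continuous_to_torus: "continuous_on UNIV to_torus"
  unfolding continuous_on_open_vimage[OF open_UNIV] by (simp add: open_torus_def)

lemma measurable_to_torus [measurable]: "to_torus \<in> borel_measurable borel"
  by (rule borel_measurable_continuous_onI[OF continuous_to_torus])

lemma closed_torus_singleton: "closed {to_torus p}"
proof -
  have "- {to_torus p} = to_torus ` {p<..<p + 2 * pi}"
  proof (intro set_eqI iffI)
    fix X assume "X \<in> - {to_torus p}"
    then have "torus_rep p X \<noteq> p" by (metis ComplD insertI1 to_torus_rep)
    then show "X \<in> to_torus ` {p<..<p + 2 * pi}"
      using torus_rep_ge[of p X] torus_rep_less[of p X]
      by (intro image_eqI[of _ _ "torus_rep p X"]) auto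
  next
    fix X assume "X \<in> to_torus ` {p<..<p + 2 * pi}"
    then obtain x where "X = to_torus x" "p < x" "x < p + 2 * pi" by auto
    then show "X \<in> - {to_torus p}"
      using to_torus_inj[of x p p] by auto
  qed
  then show ?thesis by (simp add: closed_def open_to_torus_image)
qed

text \<open>\<open>torus_rep p\<close> jumps only at the class of p, so the preimage of an open set
  is an open set together with at most that one point.\<close>

lemma measurable_torus_rep [measurable]: "torus_rep p \<in> borel_measurable borel"
proof (rule borel_measurableI)
  fix U :: "real set" assume U: "open U"
  have "torus_rep p -` U = to_torus ` (U \<inter> {p<..<p + 2 * pi}) \<union> (if p \<in> U then {to_torus p} else {})"
    (is "_ = ?R")
  proof (intro set_eqI iffI)
    fix X assume X: "X \<in> torus_rep p -` U"
    show "X \<in> ?R"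
    proof (cases "torus_rep p X = p")
      case True
      with X show ?thesis by simp (metis to_torus_rep)
    next
      case False
      then show ?thesis using X torus_rep_ge[of p X] torus_rep_less[of p X]
        by (intro UnI1 image_eqI[of _ _ "torus_rep p X"]) auto
    qed
  next
    fix X assume "X \<in> ?R"
    then show "X \<in> torus_rep p -` U" by (auto simp: torus_rep_to_torus split: if_splits)
  qed
  moreover have "to_torus ` (U \<inter> {p<..<p + 2 * pi}) \<in> sets borel"
    using U by (intro borel_open open_to_torus_image) auto
  moreover have "{to_torus p} \<in> sets borel" by (intro borel_closed closed_torus_singleton)
  ultimately show "torus_rep p -` U \<inter> space borel \<in> sets borel"
    by (simp only: space_borel Int_UNIV_right) (rule sets.Un, simp_all)
qed

lemma sets_torus_measure [simp, measurable_cong]: "sets torus_measure = sets borel"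
  by (simp add: torus_measure_def)

lemma space_torus_measure [simp]: "space torus_measure = UNIV"
  by (simp add: torus_measure_def)

lemma emeasure_periodic_shift:
  fixes B :: "real set"
  assumes "B \<in> sets borel" "\<And>x. x + c \<in> B \<longleftrightarrow> x \<in> B"
  shows "emeasure lborel (B \<inter> {a + c..<b + c}) = emeasure lborel (B \<inter> {a..<b})"
proof -
  have "emeasure lborel (B \<inter> {a + c..<b + c}) = emeasure (distr lborel borel ((+) c)) (B \<inter> {a + c..<b + c})"
    by (simp only: lborel_distr_plus)
  also have "\<dots> = emeasure lborel ((+) c -` (B \<inter> {a + c..<b + c}))"
    using assms(1) by (subst emeasure_distr) auto
  also have "(+) c -` (B \<inter> {a + c..<b + c}) = B \<inter> {a..<b}"
    by (simp add: set_eq_iff assms(2) add.commute[of c])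
  finally show ?thesis .
qed

text \<open>Reduce p to its representative q in [0, 2 pi), split the interval at 2 pi and move the
  overhang back by one period. Translations and the flat construction each bring their own cut,
  hence the free p.\<close>

lemma torus_measure_base: "torus_measure = distr (restrict_space lborel {p..<p + 2 * pi}) borel to_torus"
proof (rule measure_eqI)
  fix A assume "A \<in> sets torus_measure"
  then have A: "A \<in> sets borel" by simp
  define B where "B = to_torus -` A"
  have B: "B \<in> sets borel" using measurable_sets[OF measurable_to_torus A] by (simp add: B_def)
  have per: "x + 2 * pi * of_int k \<in> B \<longleftrightarrow> x \<in> B" for x k by (simp add: B_def)
  have em: "emeasure (distr (restrict_space lborel {p..<p + 2 * pi}) borel to_torus) A
      = emeasure lborel (B \<inter> {p..<p + 2 * pi})" for p
  proof -
    have "to_torus \<in> measurable (restrict_space lborel {p..<p + 2 * pi}) borel"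
      by (rule measurable_restrict_space1) simp
    then have "emeasure (distr (restrict_space lborel {p..<p + 2 * pi}) borel to_torus) A =
      emeasure (restrict_space lborel {p..<p + 2 * pi}) (B \<inter> {p..<p + 2 * pi})"
      using A by (subst emeasure_distr) (auto simp: B_def space_restrict_space)
    also have "\<dots> = emeasure lborel (B \<inter> {p..<p + 2 * pi})"
      by (subst emeasure_restrict_space) auto
    finally show ?thesis .
  qed
  define q where "q = torus_rep 0 (to_torus p)"
  have q: "0 \<le> q" "q < 2 * pi" using torus_rep_ge[of 0] torus_rep_less[of 0] by (auto simp: q_def)
  have "to_torus p = to_torus q" by (simp add: q_def)
  then obtain k where "p - q = 2 * pi * of_int k" by (auto simp: to_torus_eq_iff)
  then have p: "p = q + 2 * pi * of_int k" by simp
  have "emeasure lborel (B \<inter> {p..<p + 2 * pi}) = emeasure lborel (B \<inter> {q..<q + 2 * pi})"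
    using emeasure_periodic_shift[OF B per, of q k "q + 2 * pi"] by (simp add: p algebra_simps)
  also have "B \<inter> {q..<q + 2 * pi} = (B \<inter> {q..<2 * pi}) \<union> (B \<inter> {0 + 2 * pi..<q + 2 * pi})"
    using q by auto
  also have "emeasure lborel \<dots> = emeasure lborel (B \<inter> {q..<2 * pi}) + emeasure lborel (B \<inter> {0 + 2 * pi..<q + 2 * pi})"
    using B by (intro plus_emeasure[symmetric]) auto
  also have "emeasure lborel (B \<inter> {0 + 2 * pi..<q + 2 * pi}) = emeasure lborel (B \<inter> {0..<q})"
    using emeasure_periodic_shift[OF B per, of 0 1 q] by simp
  also have "emeasure lborel (B \<inter> {q..<2 * pi}) + emeasure lborel (B \<inter> {0..<q}) =
     emeasure lborel ((B \<inter> {q..<2 * pi}) \<union> (B \<inter> {0..<q}))"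
    using B by (intro plus_emeasure) auto
  also have "(B \<inter> {q..<2 * pi}) \<union> (B \<inter> {0..<q}) = B \<inter> {0..<0 + 2 * pi}" using q by auto
  finally have "emeasure (distr (restrict_space lborel {p..<p + 2 * pi}) borel to_torus) A =
      emeasure (distr (restrict_space lborel {0..<0 + 2 * pi}) borel to_torus) A"
    unfolding em .
  then show "emeasure torus_measure A = emeasure (distr (restrict_space lborel {p..<p + 2 * pi}) borel to_torus) A"
    by (simp add: torus_measure_def)
qed simp

lemma measurable_to_torus_restrict: "to_torus \<in> measurable (restrict_space lborel S) borel"
  by (rule measurable_restrict_space1) simp

lemma integral_torus:
  fixes f :: "torus \<Rightarrow> 'b::{banach, second_countable_topology}"
  assumes "f \<in> borel_measurable borel"
  shows "(\<integral>X. f X \<partial>torus_measure) = (LINT x:{p..<p + 2 * pi}|lborel. f (to_torus x))"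
  unfolding torus_measure_base[of p]
  using assms measurable_to_torus_restrict
  by (subst integral_distr) (auto simp: set_lebesgue_integral_def integral_restrict_space)

lemma integrable_torus_iff:
  fixes f :: "torus \<Rightarrow> 'b::{banach, second_countable_topology}"
  assumes "f \<in> borel_measurable borel"
  shows "integrable torus_measure f \<longleftrightarrow> set_integrable lborel {p..<p + 2 * pi} (\<lambda>x. f (to_torus x))"
  unfolding torus_measure_base[of p]
  using assms measurable_to_torus_restrict
  by (subst integrable_distr_eq) (auto simp: set_integrable_def integrable_restrict_space)

lemma nn_integral_torus:
  assumes "f \<in> borel_measurable borel"
  shows "(\<integral>\<^sup>+X. f X \<partial>torus_measure) = (\<integral>\<^sup>+x. f (to_torus x) * indicator {p..<p + 2 * pi} x \<partial>lborel)"
  unfolding torus_measure_base[of p]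
  using assms measurable_to_torus_restrict
  by (subst nn_integral_distr) (auto simp: nn_integral_restrict_space)

lemma emeasure_torus_UNIV: "emeasure torus_measure UNIV = 2 * pi"
  using nn_integral_torus[of "\<lambda>_. 1" 0] by (simp add: nn_integral_cmult_indicator)

interpretation torus_measure: finite_measure torus_measure
  by standard (simp add: emeasure_torus_UNIV)

lemma measure_torus_UNIV [simp]: "measure torus_measure UNIV = 2 * pi"
  by (simp add: measure_def emeasure_torus_UNIV)

subsection \<open>Fourier series in \<open>l2\<close>\<close>

lemma l2_cases: obtains f where "square_integrable torus_measure f" "F = to_l2 f"
proof -
  have "\<exists>f. square_integrable torus_measure f \<and> F = to_l2 f"
  proof transfer
    fix F assume "l2_rel F F"
    then show "\<exists>f. square_integrable torus_measure f \<and>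
        l2_rel F (if square_integrable torus_measure f then f else (\<lambda>_. 0))"
      by (intro exI[of _ F]) (auto simp: l2_rel_def)
  qed
  then show ?thesis using that by blast
qed

lemma to_l2_eq_iff:
  "square_integrable torus_measure f \<Longrightarrow> square_integrable torus_measure g \<Longrightarrow>
   to_l2 f = to_l2 g \<longleftrightarrow> (AE x in torus_measure. f x = g x)"
  by transfer (auto simp: l2_rel_def)

lemma to_l2_not_square_integrable: "\<not> square_integrable torus_measure f \<Longrightarrow> to_l2 f = 0"
  by transfer (auto simp: l2_rel_def square_integrable_zero)

lemma inner_to_l2:
  "square_integrable torus_measure f \<Longrightarrow> square_integrable torus_measure g \<Longrightarrow>
   inner (to_l2 f) (to_l2 g) = (\<integral>x. f x * g x \<partial>torus_measure)"
  by transfer simp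

lemma fourier_coeff_to_l2:
  "square_integrable torus_measure f \<Longrightarrow>
   fourier_coeff n (to_l2 f) = 1 / (2 * of_real pi) * (\<integral>x. of_real (f x) * torus_exp (- n) x \<partial>torus_measure)"
  by transfer simp

lemma integral_l2_to_l2:
  "square_integrable torus_measure f \<Longrightarrow> integral_l2 (to_l2 f) = (\<integral>x. f x \<partial>torus_measure)"
  by transfer simp

lemma to_l2_plus:
  "square_integrable torus_measure f \<Longrightarrow> square_integrable torus_measure g \<Longrightarrow>
   to_l2 f + to_l2 g = to_l2 (\<lambda>x. f x + g x)"
  by transfer (auto simp: l2_rel_def square_integrable_add)

lemma to_l2_scale:
  "square_integrable torus_measure f \<Longrightarrow> c *\<^sub>R to_l2 f = to_l2 (\<lambda>x. c * f x)"
  by transfer (auto simp: l2_rel_def square_integrable_scale)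

lemma norm_to_l2:
  "square_integrable torus_measure f \<Longrightarrow> (norm (to_l2 f))\<^sup>2 = (\<integral>x. (f x)\<^sup>2 \<partial>torus_measure)"
  by (simp add: inner_to_l2 power2_eq_square flip: power2_norm_eq_inner) (simp add: power2_norm_eq_inner inner_to_l2 flip: power2_eq_square)

lemma square_integrable_torus_integrable:
  "square_integrable torus_measure f \<Longrightarrow> integrable torus_measure f"
  using square_integrable_mult[of torus_measure f "\<lambda>_. 1"] by (auto simp: square_integrable_def)

lemma cmod_torus_exp [simp]: "cmod (torus_exp n X) = 1"
  by (cases X rule: torus_cases) simp

lemma measurable_torus_exp_borel [measurable]: "torus_exp n \<in> borel_measurable borel"
  using measurable_torus_exp[of n] by (simp add: measurable_cong_sets[OF sets_torus_measure refl])

lemma torus_exp_mult: "torus_exp m X * torus_exp n X = torus_exp (m + n) X"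
  by (cases X rule: torus_cases) (simp add: cis_mult algebra_simps)

lemma cnj_torus_exp: "cnj (torus_exp n X) = torus_exp (- n) X"
  by (cases X rule: torus_cases) (simp add: cis_cnj)

lemma torus_exp_0 [simp]: "torus_exp 0 X = 1"
  by (cases X rule: torus_cases) simp

lemma integral_torus_interval:
  fixes F :: "real \<Rightarrow> 'b::euclidean_space"
  assumes f: "f \<in> borel_measurable borel" and F: "continuous_on {p..p + 2 * pi} F"
    and eq: "\<And>x. x \<in> {p..<p + 2 * pi} \<Longrightarrow> f (to_torus x) = F x"
  shows "(\<integral>X. f X \<partial>torus_measure) = integral {p..p + 2 * pi} F" "integrable torus_measure f"
proof -
  have int: "set_integrable lborel {p..p + 2 * pi} F"
    by (rule borel_integrable_atLeastAtMost') (rule F)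
  have int': "set_integrable lborel {p..<p + 2 * pi} F"
    by (rule set_integrable_subset[OF int]) auto
  have "(\<integral>X. f X \<partial>torus_measure) = (LINT x:{p..<p + 2 * pi}|lborel. F x)"
    unfolding integral_torus[OF f, of p] using eq by (intro set_lebesgue_integral_cong) auto
  also have "\<dots> = integral {p..<p + 2 * pi} F"
    by (rule set_borel_integral_eq_integral(2)[OF int'])
  also have "\<dots> = integral {p..p + 2 * pi} F"
    by (rule integral_subset_negligible) (auto intro: negligible_subset[of "{p + 2 * pi}"])
  finally show "(\<integral>X. f X \<partial>torus_measure) = integral {p..p + 2 * pi} F" .
  show "integrable torus_measure f"
    unfolding integrable_torus_iff[OF f, of p] using int' eq
    by (subst set_integrable_cong[OF refl refl]) auto
qed

lemma has_vector_derivative_exp_real: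
  fixes a :: complex
  shows   "((\<lambda>x. exp (a * of_real x)) has_vector_derivative a * exp (a * of_real x)) (at x within S)"
proof -
  have "((\<lambda>z. exp (a * z)) has_field_derivative a * exp (a * of_real x)) (at (of_real x))"
    by (auto intro!: derivative_eq_intros)
  then show ?thesis by (rule has_vector_derivative_real_field)
qed

lemma integral_torus_exp: "(\<integral>X. torus_exp n X \<partial>torus_measure) = (if n = 0 then 2 * pi else 0)"
proof (cases "n = 0")
  case False
  have "(\<integral>X. torus_exp n X \<partial>torus_measure) = integral {0..0 + 2*pi} (\<lambda>x. cis (of_int n * x))"
    by (intro integral_torus_interval continuous_intros) auto
  also have "\<dots> = 0"
  proof -
    have "((\<lambda>x. (\<i> * of_int n) * exp ((\<i> * of_int n) * of_real x)) has_integral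
        (exp ((\<i> * of_int n) * of_real (2*pi)) - exp ((\<i> * of_int n) * of_real 0))) {0..2*pi}"
      by (intro fundamental_theorem_of_calculus has_vector_derivative_exp_real) simp
    then have "((\<lambda>x. (\<i> * of_int n) * cis (of_int n * x)) has_integral (cis (of_int n * (2*pi)) - 1)) {0..2*pi}"
      by (simp add: cis_conv_exp mult_ac)
    moreover have "cis (of_int n * (2*pi)) = 1"
      using cis_multiple_2pi[of "of_int n"] by (simp add: mult.commute)
    ultimately have "((\<lambda>x. (\<i> * of_int n) * cis (of_int n * x)) has_integral 0) {0..2*pi}" by simp
    then have "((\<lambda>x. (1 / (\<i> * of_int n)) * ((\<i> * of_int n) * cis (of_int n * x))) has_integral (1 / (\<i> * of_int n)) * 0) {0..2*pi}"
      by (rule has_integral_mult_right)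
    then show ?thesis using False by (simp add: integral_unique)
  qed
  finally show ?thesis using False by simp
qed (simp add: scaleR_conv_of_real)

section \<open>Completeness of the trigonometric system\<close>

inductive trigpoly :: "(real \<Rightarrow> complex) \<Rightarrow> bool" where
  mono: "trigpoly (\<lambda>x. c * cis (of_int n * x))"
| add: "trigpoly f \<Longrightarrow> trigpoly g \<Longrightarrow> trigpoly (\<lambda>x. f x + g x)"

lemma trigpoly_mult_mono: "trigpoly f \<Longrightarrow> trigpoly (\<lambda>x. c * cis (of_int n * x) * f x)"
proof (induction rule: trigpoly.induct)
  case (mono d m)
  have "(\<lambda>x. c * cis (of_int n * x) * (d * cis (of_int m * x))) = (\<lambda>x. (c * d) * cis (of_int (n + m) * x))"
    by (auto simp: fun_eq_iff cis_mult[symmetric] algebra_simps)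
  then show ?case by (simp only: trigpoly.mono)
next
  case (add f g)
  show ?case unfolding distrib_left using add.IH by (rule trigpoly.add)
qed

lemma trigpoly_mult: "trigpoly f \<Longrightarrow> trigpoly g \<Longrightarrow> trigpoly (\<lambda>x. f x * g x)"
proof (induction rule: trigpoly.induct)
  case (mono c n)
  then show ?case by (rule trigpoly_mult_mono)
next
  case (add f h)
  then show ?case unfolding distrib_right by (intro trigpoly.add) auto
qed

text \<open>On the unit circle a real linear form is a combination of cos and sin, hence of
  \<open>cis x\<close> and \<open>cis (- x)\<close>, and the span is closed under products. This
  connects Stone-Weierstrass with Fourier coefficients.\<close>

lemma trigpoly_real_polynomial:
  fixes g :: "complex \<Rightarrow> real"
  assumes "real_polynomial_function g"
  shows "trigpoly (\<lambda>x. of_real (g (cis x)))"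
  using assms
proof (induction rule: real_polynomial_function.induct)
  case (linear f)
  interpret bounded_linear f by fact
  have *: "of_real (f (cis x)) = ((of_real (f 1) - \<i> * of_real (f \<i>)) / 2) * cis (of_int 1 * x)
      + ((of_real (f 1) + \<i> * of_real (f \<i>)) / 2) * cis (of_int (- 1) * x)" for x
  proof -
    have "cis x = cos x *\<^sub>R 1 + sin x *\<^sub>R \<i>" by (simp add: complex_eq_iff)
    then have "f (cis x) = cos x * f 1 + sin x * f \<i>" by (simp add: add scaleR)
    then show ?thesis by (simp add: complex_eq_iff field_simps)
  qed
  show ?case unfolding * by (intro trigpoly.intros)
next
  case (const c)
  have "(\<lambda>x. of_real c) = (\<lambda>x. of_real c * cis (of_int 0 * x))" by (simp add: fun_eq_iff)
  then show ?case by (metis trigpoly.mono)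
next
  case (add f g)
  then show ?case by (simp add: trigpoly.add)
next
  case (mult f g)
  then show ?case by (simp add: trigpoly_mult)
qed

text \<open>The induction carries a torus version Q of P and its integrability along, because
  \<open>trigpoly\<close> speaks of functions on the line while the integrals are over the
  torus.\<close>

lemma integral_trigpoly_eq_0:
  fixes f :: "torus \<Rightarrow> real"
  assumes f: "integrable torus_measure f"
    and z: "\<And>n. (\<integral>X. of_real (f X) * torus_exp n X \<partial>torus_measure) = 0"
    and P: "trigpoly P"
  shows "\<exists>Q. (\<forall>x. Q (to_torus x) = P x) \<and> integrable torus_measure (\<lambda>X. of_real (f X) * Q X)
     \<and> (\<integral>X. of_real (f X) * Q X \<partial>torus_measure) = 0"
  using P
proof induction
  case (mono c n)
  have "integrable torus_measure (\<lambda>X. of_real (f X) * torus_exp n X)"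
    using f by (intro Bochner_Integration.integrable_bound[OF f]) (auto simp: norm_mult borel_measurable_integrable)
  then show ?case using z[of n]
    by (intro exI[of _ "\<lambda>X. c * torus_exp n X"]) (auto simp: mult.left_commute[of _ c])
next
  case (add g h)
  then obtain Q R where "\<forall>x. Q (to_torus x) = g x" "\<forall>x. R (to_torus x) = h x"
    "integrable torus_measure (\<lambda>X. of_real (f X) * Q X)" "(\<integral>X. of_real (f X) * Q X \<partial>torus_measure) = 0"
    "integrable torus_measure (\<lambda>X. of_real (f X) * R X)" "(\<integral>X. of_real (f X) * R X \<partial>torus_measure) = 0"
    by blast
  then show ?case
    by (intro exI[of _ "\<lambda>X. Q X + R X"]) (auto simp: distrib_left)
qed

text \<open>Stone-Weierstrass on the unit circle replaces \<psi> by a polynomial, whose integral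
  vanishes; the error is at most \<delta> times the L1 norm of f.\<close>

lemma integral_continuous_exp_eq_0:
  fixes f :: "torus \<Rightarrow> real"
  assumes f: "integrable torus_measure f"
    and z: "\<And>n. (\<integral>X. of_real (f X) * torus_exp n X \<partial>torus_measure) = 0"
    and \<psi>: "continuous_on UNIV \<psi>"
  shows "(\<integral>X. f X * \<psi> (torus_exp 1 X) \<partial>torus_measure) = 0"
proof -
  have fm [measurable]: "f \<in> borel_measurable torus_measure" using f by auto
  have [measurable]: "\<psi> \<in> borel_measurable borel" using \<psi> by (rule borel_measurable_continuous_onI)
  have "norm (\<integral>X. f X * \<psi> (torus_exp 1 X) \<partial>torus_measure) \<le> 0 + e" if e: "e > 0" for e
  proof -
    define C where "C = (\<integral>X. norm (f X) \<partial>torus_measure)"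
    have "C \<ge> 0" by (simp add: C_def)
    define \<delta> where "\<delta> = e / (C + 1)"
    have d: "\<delta> > 0" using e \<open>C \<ge> 0\<close> by (simp add: \<delta>_def)
    obtain g where g: "real_polynomial_function g" "\<And>z. z \<in> sphere 0 1 \<Longrightarrow> \<bar>\<psi> z - g z\<bar> < \<delta>"
      using Stone_Weierstrass_real_polynomial_function[of "sphere (0::complex) 1" \<psi> \<delta>] \<psi> d
      by (metis compact_sphere continuous_on_subset subset_UNIV)
    obtain Q :: "torus \<Rightarrow> complex" where Q: "\<And>x. Q (to_torus x) = of_real (g (cis x))"
      "integrable torus_measure (\<lambda>X. of_real (f X) * Q X)"
      "(\<integral>X. of_real (f X) * Q X \<partial>torus_measure) = 0"
      using integral_trigpoly_eq_0[OF f z trigpoly_real_polynomial[OF g(1)]] by blast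
    have Q': "Q X = of_real (g (torus_exp 1 X))" for X
      by (cases X rule: torus_cases) (simp add: Q)
    have Q2: "integrable torus_measure (\<lambda>X. of_real (f X * g (torus_exp 1 X)) :: complex)"
      using Q(2) by (simp add: Q')
    then have int: "integrable torus_measure (\<lambda>X. f X * g (torus_exp 1 X))"
      by (subst (asm) complex_of_real_integrable_eq)
    have Q0: "(\<integral>X. f X * g (torus_exp 1 X) \<partial>torus_measure) = 0"
    proof -
      have "(\<integral>X. of_real (f X * g (torus_exp 1 X)) \<partial>torus_measure) = (0::complex)"
        using Q(3) by (simp add: Q')
      then show ?thesis unfolding integral_complex_of_real by simp
    qed
    have le: "norm (f X * \<psi> (torus_exp 1 X) - f X * g (torus_exp 1 X)) \<le> \<delta> * norm (f X)" for X
    proof -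
      have "\<bar>\<psi> (torus_exp 1 X) - g (torus_exp 1 X)\<bar> \<le> \<delta>"
        using g(2)[of "torus_exp 1 X"] by simp
      then have "\<bar>\<psi> (torus_exp 1 X) - g (torus_exp 1 X)\<bar> * \<bar>f X\<bar> \<le> \<delta> * \<bar>f X\<bar>"
        by (rule mult_right_mono) simp
      then show ?thesis by (simp add: abs_mult[symmetric] algebra_simps)
    qed
    have int2: "integrable torus_measure (\<lambda>X. f X * \<psi> (torus_exp 1 X) - f X * g (torus_exp 1 X))"
    proof (rule Bochner_Integration.integrable_bound)
      show "integrable torus_measure (\<lambda>X. \<delta> * norm (f X))" using f by simp
      show "(\<lambda>X. f X * \<psi> (torus_exp 1 X) - f X * g (torus_exp 1 X)) \<in> borel_measurable torus_measure"
        using int by measurable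
    qed (use le d in \<open>auto simp: abs_mult\<close>)
    have "(\<integral>X. f X * \<psi> (torus_exp 1 X) \<partial>torus_measure)
        = (\<integral>X. f X * \<psi> (torus_exp 1 X) - f X * g (torus_exp 1 X) + f X * g (torus_exp 1 X) \<partial>torus_measure)"
      by simp
    also have "\<dots> = (\<integral>X. f X * \<psi> (torus_exp 1 X) - f X * g (torus_exp 1 X) \<partial>torus_measure)"
      by (subst Bochner_Integration.integral_add[OF int2 int]) (simp add: Q0)
    also have "norm \<dots> \<le> (\<integral>X. \<delta> * norm (f X) \<partial>torus_measure)"
      by (rule order_trans[OF Bochner_Integration.integral_norm_bound integral_mono])
         (use le f int2 in auto)
    also have "\<dots> = \<delta> * C" by (simp add: C_def)
    also have "\<dots> \<le> e" using \<open>C \<ge> 0\<close> e by (simp add: \<delta>_def field_simps)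
    finally show ?thesis by simp
  qed
  then have "norm (\<integral>X. f X * \<psi> (torus_exp 1 X) \<partial>torus_measure) \<le> 0" by (rule field_le_epsilon)
  then show ?thesis by simp
qed

text \<open>\<open>torus_exp 1\<close> identifies the torus with the unit circle in the plane, where
  distances are available: \<open>infdist\<close> to a nonempty W is continuous and vanishes exactly
  off U.\<close>

lemma torus_exp_closed_complement:
  assumes U: "open U"
  obtains W where "closed W" "\<And>Z. torus_exp 1 Z \<in> W \<longleftrightarrow> Z \<notin> U"
proof -
  define W where "W = cis ` (- (to_torus -` U) \<inter> {0..2 * pi})"
  have "closed (- (to_torus -` U))" using U by (auto simp: open_torus_def)
  then have "compact (- (to_torus -` U) \<inter> {0..2 * pi})"
    by (intro closed_Int_compact) auto
  then have "compact W" unfolding W_def by (intro compact_continuous_image continuous_intros)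
  then have W: "closed W" by (rule compact_imp_closed)
  have inW: "torus_exp 1 X \<in> W \<longleftrightarrow> X \<notin> U" for X
  proof
    assume "torus_exp 1 X \<in> W"
    then obtain y where y: "to_torus y \<notin> U" "torus_exp 1 X = cis y" unfolding W_def by auto
    obtain x where x: "X = to_torus x" by (rule torus_cases)
    from y x have "cis x = cis y" by simp
    then have "exp (\<i> * of_real x) = exp (\<i> * of_real y)" by (simp add: cis_conv_exp)
    then obtain n :: int where "\<i> * of_real x = \<i> * of_real y + (of_int (2 * n) * pi) * \<i>"
      by (auto simp: exp_eq)
    then have "x - y = 2 * pi * of_int n" by (simp add: complex_eq_iff)
    then have "to_torus x = to_torus y" by (auto simp: to_torus_eq_iff)
    then show "X \<notin> U" using y x by simp
  next
    assume X: "X \<notin> U"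
    have "torus_exp 1 X = cis (torus_rep 0 X)"
      by (metis mult_1 of_int_1 to_torus_rep torus_exp_to_torus)
    moreover have "torus_rep 0 X \<in> - (to_torus -` U) \<inter> {0..2 * pi}"
      using X torus_rep_ge[of 0 X] torus_rep_less[of 0 X] by simp
    ultimately show "torus_exp 1 X \<in> W" unfolding W_def by blast
  qed
  show ?thesis using that W inW by blast
qed

text \<open>The cutoffs \<open>min 1 (k * infdist z W)\<close> are continuous and tend pointwise to
  the indicator of U, so dominated convergence applies.\<close>

lemma set_integral_open_eq_0:
  fixes f :: "torus \<Rightarrow> real"
  assumes f: "integrable torus_measure f"
    and z: "\<And>n. (\<integral>X. of_real (f X) * torus_exp n X \<partial>torus_measure) = 0"
    and U: "open U"
  shows "(\<integral>X. f X * indicator U X \<partial>torus_measure) = 0"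
proof -
  have [measurable]: "f \<in> borel_measurable torus_measure" using f by auto
  have [measurable]: "U \<in> sets borel" using U by simp
  obtain W where W: "closed W" and inW: "\<And>X. torus_exp 1 X \<in> W \<longleftrightarrow> X \<notin> U"
    using torus_exp_closed_complement[OF U] by blast
  show ?thesis
  \<comment> \<open>\<open>infdist\<close> to the empty set is 0 by convention, so the case of the
    whole torus is separate.\<close>
  proof (cases "W = {}")
    case True
    then have "U = UNIV" using inW by auto
    then show ?thesis using z[of 0] by (simp del: integral_complex_of_real add: integral_complex_of_real)
  next
    case False
    define \<psi> where "\<psi> k z = min 1 (real k * infdist z W)" for k z
    have cont: "continuous_on UNIV (\<psi> k)" for k
      unfolding \<psi>_def by (intro continuous_intros)
    have [measurable]: "\<psi> k \<in> borel_measurable borel" for k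
      by (rule borel_measurable_continuous_onI[OF cont])
    have "(\<lambda>k. \<integral>X. f X * \<psi> k (torus_exp 1 X) \<partial>torus_measure) \<longlonglongrightarrow> (\<integral>X. f X * indicator U X \<partial>torus_measure)"
    proof (rule integral_dominated_convergence)
      show "integrable torus_measure (\<lambda>X. norm (f X))" using f by simp
      show "AE X in torus_measure. (\<lambda>k. f X * \<psi> k (torus_exp 1 X)) \<longlonglongrightarrow> f X * indicator U X"
      proof (intro always_eventually allI tendsto_intros)
        fix X
        show "(\<lambda>k. \<psi> k (torus_exp 1 X)) \<longlonglongrightarrow> indicator U X"
        proof (cases "X \<in> U")
          case True
          then have "torus_exp 1 X \<notin> W" using inW by simp
          then have pos: "infdist (torus_exp 1 X) W > 0"
            using W False by (metis in_closed_iff_infdist_zero infdist_nonneg less_eq_real_def)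
          obtain N :: nat where N: "1 / infdist (torus_exp 1 X) W < real N" using reals_Archimedean2 by blast
          have "\<forall>\<^sub>F k in sequentially. \<psi> k (torus_exp 1 X) = 1"
            using eventually_ge_at_top[of N]
          proof eventually_elim
            case (elim k)
            then have "1 / infdist (torus_exp 1 X) W < real k" using N by linarith
            then show ?case using pos by (simp add: \<psi>_def field_simps min_def)
          qed
          then show ?thesis using True by (simp add: tendsto_eventually)
        next
          case False
          then have "torus_exp 1 X \<in> W" using inW by simp
          then show ?thesis using False by (simp add: \<psi>_def)
        qed
      qed
      show "AE X in torus_measure. norm (f X * \<psi> k (torus_exp 1 X)) \<le> norm (f X)" for k
        by (auto simp: \<psi>_def abs_mult infdist_nonneg intro!: mult_left_le)
    qed measurable
    then show ?thesis
      using integral_continuous_exp_eq_0[OF f z cont] by (simp add: LIMSEQ_const_iff)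
  qed
qed

text \<open>Open sets are stable under intersection and generate the Borel sets, so the pi-lambda
  theorem extends the vanishing integrals to all Borel sets; the sets where f is positive or
  negative then force f = 0.\<close>

lemma AE_eq_0_if_fourier_0:
  fixes f :: "torus \<Rightarrow> real"
  assumes f: "integrable torus_measure f"
    and z: "\<And>n. (\<integral>X. of_real (f X) * torus_exp n X \<partial>torus_measure) = 0"
  shows "AE X in torus_measure. f X = 0"
proof -
  have [measurable]: "f \<in> borel_measurable torus_measure" using f by auto
  have *: "(LINT X:A|torus_measure. f X) = 0" if "A \<in> sigma_sets UNIV {U. open U}" for A
  proof (rule sigma_sets_induct_disjoint[of "{U. open U}" UNIV A])
    show "Int_stable {U::torus set. open U}" by (auto simp: Int_stable_def)
    show "A \<in> sigma_sets UNIV {U. open U}" by fact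
    show "(LINT X:U|torus_measure. f X) = 0" if "U \<in> {U. open U}" for U
      using set_integral_open_eq_0[OF f z, of U] that by (simp add: set_lebesgue_integral_def mult.commute)
    show "(LINT X:{}|torus_measure. f X) = 0" by (simp add: set_lebesgue_integral_def)
    have si: "set_integrable torus_measure B f" if "B \<in> sets borel" for B
      using f that unfolding set_integrable_def by (intro integrable_mult_indicator) auto
    have UN: "(LINT X:UNIV|torus_measure. f X) = 0"
      using set_integral_open_eq_0[OF f z, of UNIV] by (simp add: set_lebesgue_integral_def mult.commute)
    show "(LINT X:UNIV - B|torus_measure. f X) = 0"
      if "B \<in> sigma_sets UNIV {U. open U}" "(LINT X:B|torus_measure. f X) = 0" for B
    proof -
      have B: "B \<in> sets borel" using that(1) by (simp add: borel_def)
      have "(LINT X:(UNIV - B) \<union> B|torus_measure. f X) =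
          (LINT X:UNIV - B|torus_measure. f X) + (LINT X:B|torus_measure. f X)"
        using B by (intro set_integral_Un si) auto
      then show ?thesis using that(2) UN by simp
    qed
    show "(LINT X:(\<Union>i::nat. B i)|torus_measure. f X) = 0"
      if "disjoint_family B" "range B \<subseteq> sigma_sets UNIV {U. open U}" "\<And>i. (LINT X:B i|torus_measure. f X) = 0" for B
    proof -
      have B: "B i \<in> sets borel" for i using that(2) by (auto simp: borel_def)
      have "(LINT X:(\<Union>i. B i)|torus_measure. f X) = (\<Sum>i. (LINT X:(B i)|torus_measure. f X))"
        using B that(1) by (intro lebesgue_integral_countable_add si) (auto simp: disjoint_family_on_def)
      then show ?thesis using that(3) by simp
    qed
  qed auto
  then have A: "(LINT X:A|torus_measure. f X) = 0" if "A \<in> sets borel" for A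
    using that by (simp add: borel_def)
  have m1 [measurable]: "{X. f X > 0} \<in> sets borel" "{X. f X < 0} \<in> sets borel"
    using borel_measurable_integrable[OF f] by (auto simp: measurable_cong_sets[OF sets_torus_measure refl])
  have i: "integrable torus_measure (\<lambda>X. indicator B X * f X)" if "B \<in> sets borel" for B
    using integrable_mult_indicator[of B torus_measure f] that f by simp
  have "AE X in torus_measure. indicator {X. f X > 0} X * f X = 0"
    using A[OF m1(1)]
    by (subst integral_nonneg_eq_0_iff_AE[symmetric, OF i[OF m1(1)]])
       (auto simp: set_lebesgue_integral_def indicator_def)
  moreover have "AE X in torus_measure. - (indicator {X. f X < 0} X * f X) = 0"
    using A[OF m1(2)]
    by (subst integral_nonneg_eq_0_iff_AE[symmetric, OF integrable_minus[OF i[OF m1(2)]]])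
       (auto simp: set_lebesgue_integral_def indicator_def)
  ultimately show ?thesis
    by eventually_elim (auto simp: indicator_def split: if_splits)
qed

lemma l2_eq_0_if_fourier_0:
  assumes "\<And>n. fourier_coeff n F = 0"
  shows "F = 0"
proof -
  obtain f where f: "square_integrable torus_measure f" and F: "F = to_l2 f" by (rule l2_cases)
  have "(\<integral>X. of_real (f X) * torus_exp n X \<partial>torus_measure) = 0" for n
    using assms[of "-n"] f by (simp add: F fourier_coeff_to_l2)
  then have "AE X in torus_measure. f X = 0"
    using f by (intro AE_eq_0_if_fourier_0 square_integrable_torus_integrable)
  then have "F = to_l2 (\<lambda>_. 0)" unfolding F using f by (subst to_l2_eq_iff) (auto simp: square_integrable_zero)
  also have "\<dots> = 0" by transfer (auto simp: l2_rel_def square_integrable_zero)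
  finally show ?thesis .
qed


section \<open>Bessel, Riesz-Fischer and Parseval\<close>

lemma AE_summable_norm:
  fixes d :: "nat \<Rightarrow> 'a \<Rightarrow> 'b::{banach, second_countable_topology}"
  assumes d: "\<And>j. integrable M (d j)" and s: "summable (\<lambda>j. \<integral>x. norm (d j x) \<partial>M)"
  shows "AE x in M. summable (\<lambda>j. norm (d j x))"
proof -
  have [measurable]: "d j \<in> borel_measurable M" for j using d by auto
  have "(\<integral>\<^sup>+x. (\<Sum>j. ennreal (norm (d j x))) \<partial>M) = (\<Sum>j. \<integral>\<^sup>+x. ennreal (norm (d j x)) \<partial>M)"
    by (rule nn_integral_suminf) measurable
  also have "\<dots> = (\<Sum>j. ennreal (\<integral>x. norm (d j x) \<partial>M))"
    using d by (intro suminf_cong nn_integral_eq_integral) auto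
  also have "\<dots> = ennreal (\<Sum>j. \<integral>x. norm (d j x) \<partial>M)"
    by (intro suminf_ennreal2 s) simp
  finally have "(\<integral>\<^sup>+x. (\<Sum>j. ennreal (norm (d j x))) \<partial>M) \<noteq> \<infinity>" by simp
  then have "AE x in M. (\<Sum>j. ennreal (norm (d j x))) \<noteq> \<infinity>"
    by (intro nn_integral_noteq_infinite) measurable
  then show ?thesis
    by eventually_elim (intro summable_suminf_not_top, auto)
qed

lemma fourier_coeff_add [simp]: "fourier_coeff n (F + G) = fourier_coeff n F + fourier_coeff n G"
proof -
  obtain f where f: "square_integrable torus_measure f" "F = to_l2 f" by (rule l2_cases)
  obtain g where g: "square_integrable torus_measure g" "G = to_l2 g" by (rule l2_cases)
  have int: "integrable torus_measure (\<lambda>x. of_real (h x) * torus_exp (- n) x)" 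
    if "square_integrable torus_measure h" for h
    by (intro Bochner_Integration.integrable_bound[OF square_integrable_torus_integrable[OF that]])
       (use that in \<open>auto simp: norm_mult square_integrable_def\<close>)
  show ?thesis
    using f g int[OF f(1)] int[OF g(1)] 
    by (simp add: to_l2_plus fourier_coeff_to_l2 square_integrable_add distrib_right add_divide_distrib)
qed

lemma fourier_coeff_scaleR [simp]: "fourier_coeff n (c *\<^sub>R F) = of_real c * fourier_coeff n F"
proof -
  obtain f where f: "square_integrable torus_measure f" "F = to_l2 f" by (rule l2_cases)
  show ?thesis
    using f by (simp add: to_l2_scale fourier_coeff_to_l2 square_integrable_scale mult.assoc)
qed

lemma fourier_coeff_minus [simp]: "fourier_coeff n (- F) = - fourier_coeff n F"
  using fourier_coeff_scaleR[of n "-1" F] by simp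

lemma fourier_coeff_diff [simp]: "fourier_coeff n (F - G) = fourier_coeff n F - fourier_coeff n G"
  using fourier_coeff_add[of n F "- G"] by simp

lemma fourier_coeff_zero [simp]: "fourier_coeff n 0 = 0"
  using fourier_coeff_scaleR[of n 0 0] by simp

lemma l2_eqI: "(\<And>n. fourier_coeff n F = fourier_coeff n G) \<Longrightarrow> F = G"
  using l2_eq_0_if_fourier_0[of "F - G"] by simp

lemma fourier_coeff_uminus: "fourier_coeff (- n) F = cnj (fourier_coeff n F)"
proof -
  obtain f where f: "square_integrable torus_measure f" "F = to_l2 f" by (rule l2_cases)
  have "cnj (\<integral>x. of_real (f x) * torus_exp (- n) x \<partial>torus_measure) = (\<integral>x. of_real (f x) * torus_exp n x \<partial>torus_measure)"
    by (subst Bochner_Integration.integral_cnj[symmetric]) (simp add: cnj_torus_exp)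
  then show ?thesis using f by (simp add: fourier_coeff_to_l2)
qed

text \<open>The real part is taken because \<open>l2\<close> consists of real functions. For
  symmetric A and conjugate-symmetric a the sum is already real and is the usual partial Fourier
  sum.\<close>

definition trig_sum :: "(int \<Rightarrow> complex) \<Rightarrow> int set \<Rightarrow> torus \<Rightarrow> real" where
  "trig_sum a A X = Re (\<Sum>n\<in>A. a n * torus_exp n X)"

lemma measurable_trig_sum [measurable]: "trig_sum a A \<in> borel_measurable borel"
  unfolding trig_sum_def by measurable

lemma trig_sum_bound: "\<bar>trig_sum a A X\<bar> \<le> (\<Sum>n\<in>A. cmod (a n))"
proof -
  have "\<bar>trig_sum a A X\<bar> \<le> cmod (\<Sum>n\<in>A. a n * torus_exp n X)" unfolding trig_sum_def by (rule abs_Re_le_cmod)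
  also have "\<dots> \<le> (\<Sum>n\<in>A. cmod (a n * torus_exp n X))" by (rule norm_sum)
  finally show ?thesis by (simp add: norm_mult)
qed

lemma bounded_square_integrable_torus:
  fixes f :: "torus \<Rightarrow> real"
  assumes "f \<in> borel_measurable borel" "\<And>X. \<bar>f X\<bar> \<le> B"
  shows "square_integrable torus_measure f"
  unfolding square_integrable_def
proof (intro conjI)
  show m: "f \<in> borel_measurable torus_measure" using assms(1) by simp
  have "(f X)\<^sup>2 \<le> B\<^sup>2" for X using assms(2)[of X] by (intro power2_le_iff_abs_le[THEN iffD2]) auto
  then show "integrable torus_measure (\<lambda>X. (f X)\<^sup>2)"
    using m by (intro torus_measure.integrable_const_bound[of _ "B\<^sup>2"]) auto
qed

lemma square_integrable_trig_sum: "square_integrable torus_measure (trig_sum a A)"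
  by (rule bounded_square_integrable_torus[OF _ trig_sum_bound]) simp

lemma integrable_torus_exp [simp]: "integrable torus_measure (torus_exp n)"
  by (intro torus_measure.integrable_const_bound[of _ 1]) auto

lemma integrable_mult_torus_exp:
  fixes f :: "torus \<Rightarrow> complex"
  shows "integrable torus_measure f \<Longrightarrow> integrable torus_measure (\<lambda>X. f X * torus_exp n X)"
  by (rule Bochner_Integration.integrable_bound) (auto simp: norm_mult)

lemma integral_sum_torus_exp:
  fixes a :: "int \<Rightarrow> complex"
  assumes "finite A"
  shows "(\<integral>X. (\<Sum>n\<in>A. a n * torus_exp n X) * torus_exp (- m) X \<partial>torus_measure) = (if m \<in> A then 2 * pi * a m else 0)"
proof -
  have "(\<integral>X. (\<Sum>n\<in>A. a n * torus_exp n X) * torus_exp (- m) X \<partial>torus_measure)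
     = (\<integral>X. (\<Sum>n\<in>A. a n * torus_exp (n - m) X) \<partial>torus_measure)"
    by (simp add: sum_distrib_right mult.assoc torus_exp_mult)
  also have "\<dots> = (\<Sum>n\<in>A. \<integral>X. a n * torus_exp (n - m) X \<partial>torus_measure)"
    by (rule Bochner_Integration.integral_sum) simp
  also have "\<dots> = (\<Sum>n\<in>A. if n = m then 2 * pi * a m else 0)"
    by (intro sum.cong) (auto simp: integral_torus_exp)
  finally show ?thesis using assms by simp
qed

lemma fourier_coeff_trig_sum:
  assumes "finite A"
  shows "fourier_coeff m (to_l2 (trig_sum a A))
    = ((if m \<in> A then a m else 0) + (if - m \<in> A then cnj (a (- m)) else 0)) / 2"
proof -
  let ?Z = "\<lambda>X. \<Sum>n\<in>A. a n * torus_exp n X"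
  have "of_real (trig_sum a A X) * torus_exp (- m) X = (?Z X * torus_exp (- m) X + cnj (?Z X * torus_exp (- (- m)) X)) / 2" for X
  proof -
    have *: "of_real (Re z) * e = (z * e + cnj (z * e')) / 2" if "cnj e' = e" for z e e'
    proof -
      have "z * e + cnj (z * e') = (z + cnj z) * e" using that by (simp add: algebra_simps)
      then show ?thesis by (simp only: complex_add_cnj) simp
    qed
    show ?thesis unfolding trig_sum_def by (rule *) (simp only: cnj_torus_exp minus_minus)
  qed
  moreover have int: "integrable torus_measure (\<lambda>X. ?Z X * torus_exp n X)" for n
    by (rule integrable_mult_torus_exp) simp
  ultimately have "(\<integral>X. of_real (trig_sum a A X) * torus_exp (- m) X \<partial>torus_measure)
    = ((\<integral>X. ?Z X * torus_exp (- m) X \<partial>torus_measure) + cnj (\<integral>X. ?Z X * torus_exp (- (- m)) X \<partial>torus_measure)) / 2"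
    by (simp only: Bochner_Integration.integral_cnj[symmetric] integral_divide_zero Bochner_Integration.integral_add[OF int integrable_cnj[OF int]])
  then show ?thesis
    unfolding integral_sum_torus_exp[OF assms] fourier_coeff_to_l2[OF square_integrable_trig_sum]
    by (auto simp: field_simps)
qed

text \<open>Orthogonality gives equality for the complex sum; the real part can only be smaller in
  modulus.\<close>

lemma integral_trig_sum_squared:
  assumes "finite A"
  shows "(\<integral>X. (trig_sum a A X)\<^sup>2 \<partial>torus_measure) \<le> 2 * pi * (\<Sum>n\<in>A. (cmod (a n))\<^sup>2)"
proof -
  let ?Z = "\<lambda>X. \<Sum>n\<in>A. a n * torus_exp n X"
  have int: "integrable torus_measure (\<lambda>X. ?Z X * torus_exp n X)" for n
    by (rule integrable_mult_torus_exp) simp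
  have eq: "of_real ((cmod (?Z X))\<^sup>2) = (\<Sum>m\<in>A. cnj (a m) * (?Z X * torus_exp (- m) X))" for X
    unfolding complex_norm_square
    by (simp add: cnj_torus_exp sum_distrib_left mult_ac)
  have "complex_of_real (\<integral>X. (cmod (?Z X))\<^sup>2 \<partial>torus_measure) = (\<integral>X. of_real ((cmod (?Z X))\<^sup>2) \<partial>torus_measure)"
    by (rule integral_complex_of_real[symmetric])
  also have "\<dots> = (\<Sum>m\<in>A. cnj (a m) * (\<integral>X. ?Z X * torus_exp (- m) X \<partial>torus_measure))"
    unfolding eq using int by (subst Bochner_Integration.integral_sum) auto
  also have "\<dots> = of_real (2 * pi * (\<Sum>n\<in>A. (cmod (a n))\<^sup>2))"
    unfolding integral_sum_torus_exp[OF assms]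
    by (auto simp: sum_distrib_left complex_norm_square simp del: of_real_power intro!: sum.cong)
  finally have Z: "(\<integral>X. (cmod (?Z X))\<^sup>2 \<partial>torus_measure) = 2 * pi * (\<Sum>n\<in>A. (cmod (a n))\<^sup>2)"
    unfolding of_real_eq_iff .
  have "(\<integral>X. (trig_sum a A X)\<^sup>2 \<partial>torus_measure) \<le> (\<integral>X. (cmod (?Z X))\<^sup>2 \<partial>torus_measure)"
  proof (rule integral_mono)
    show "integrable torus_measure (\<lambda>X. (trig_sum a A X)\<^sup>2)"
      using square_integrable_trig_sum by (simp add: square_integrable_def)
    have "integrable torus_measure (\<lambda>X. complex_of_real ((cmod (?Z X))\<^sup>2))"
      unfolding eq using int by (intro Bochner_Integration.integrable_sum) auto
    then show "integrable torus_measure (\<lambda>X. (cmod (?Z X))\<^sup>2)" by (subst (asm) complex_of_real_integrable_eq)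
    show "(trig_sum a A X)\<^sup>2 \<le> (cmod (?Z X))\<^sup>2" for X
      unfolding trig_sum_def by (intro power2_le_iff_abs_le[THEN iffD2] abs_Re_le_cmod norm_ge_zero)
  qed
  then show ?thesis using Z by simp
qed

lemma inner_trig_sum:
  assumes "finite A"
  shows "inner F (to_l2 (trig_sum a A)) = 2 * pi * Re (\<Sum>n\<in>A. a n * cnj (fourier_coeff n F))"
proof -
  obtain f where f: "square_integrable torus_measure f" and F: "F = to_l2 f" by (rule l2_cases)
  have [simp]: "integrable torus_measure (\<lambda>X. of_real (f X) * torus_exp n X :: complex)" for n
    using square_integrable_torus_integrable[OF f] by (intro integrable_mult_torus_exp) simp
  have c: "(\<integral>X. of_real (f X) * torus_exp n X \<partial>torus_measure) = 2 * pi * cnj (fourier_coeff n F)" for n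
    using fourier_coeff_uminus[of n F, unfolded F fourier_coeff_to_l2[OF f, of "-n"]]
    by (simp add: F field_simps)
  have "f X * trig_sum a A X = Re (\<Sum>n\<in>A. a n * (of_real (f X) * torus_exp n X))" for X
  proof -
    have "(\<Sum>n\<in>A. a n * (of_real (f X) * torus_exp n X)) = of_real (f X) * (\<Sum>n\<in>A. a n * torus_exp n X)"
      by (simp only: sum_distrib_left mult.left_commute)
    then show ?thesis unfolding trig_sum_def by (simp only: Re_complex_of_real times_complex.sel) simp
  qed
  then have "(\<integral>X. f X * trig_sum a A X \<partial>torus_measure) = Re (\<integral>X. (\<Sum>n\<in>A. a n * (of_real (f X) * torus_exp n X)) \<partial>torus_measure)"
    by (simp only:) (intro integral_Re Bochner_Integration.integrable_sum integrable_mult_right, simp)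
  also have "(\<integral>X. (\<Sum>n\<in>A. a n * (of_real (f X) * torus_exp n X)) \<partial>torus_measure) = of_real (2 * pi) * (\<Sum>n\<in>A. a n * cnj (fourier_coeff n F))"
    by (subst Bochner_Integration.integral_sum) (auto simp: c sum_distrib_left intro!: sum.cong)
  also have "Re \<dots> = 2 * pi * Re (\<Sum>n\<in>A. a n * cnj (fourier_coeff n F))" by (simp only: Re_complex_of_real times_complex.sel) simp
  finally show ?thesis using f by (simp add: F inner_to_l2 square_integrable_trig_sum)
qed

text \<open>Expand the squared distance from F to the \<open>trig_sum\<close> of its own
  coefficients. The cross term is exact and the squared norm is bounded above, so the argument
  covers every finite A, symmetric or not.\<close>

lemma bessel:
  assumes "finite A"
  shows "2 * pi * (\<Sum>n\<in>A. (cmod (fourier_coeff n F))\<^sup>2) \<le> (norm F)\<^sup>2"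
proof -
  obtain f where f: "square_integrable torus_measure f" and F: "F = to_l2 f" by (rule l2_cases)
  define c where "c n = fourier_coeff n F" for n
  let ?s = "trig_sum c A"
  have [simp]: "integrable torus_measure (\<lambda>X. of_real (f X) * torus_exp n X :: complex)" for n
    using square_integrable_torus_integrable[OF f] by (intro integrable_mult_torus_exp) simp
  have s: "square_integrable torus_measure ?s" by (rule square_integrable_trig_sum)
  have i: "integrable torus_measure (\<lambda>X. (f X)\<^sup>2)" "integrable torus_measure (\<lambda>X. (?s X)\<^sup>2)"
    "integrable torus_measure (\<lambda>X. f X * ?s X)"
    using f s square_integrable_mult[OF f s] by (auto simp: square_integrable_def)
  have "(\<Sum>n\<in>A. c n * cnj (c n)) = of_real (\<Sum>n\<in>A. (cmod (c n))\<^sup>2)"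
    by (simp add: complex_norm_square del: of_real_power)
  then have fs: "(\<integral>X. f X * ?s X \<partial>torus_measure) = 2 * pi * (\<Sum>n\<in>A. (cmod (c n))\<^sup>2)"
    using inner_trig_sum[OF assms, of F c] f by (simp add: F inner_to_l2 square_integrable_trig_sum c_def)
  have "0 \<le> (\<integral>X. (f X - ?s X)\<^sup>2 \<partial>torus_measure)" by simp
  also have "\<dots> = (\<integral>X. ((f X)\<^sup>2 + (?s X)\<^sup>2) - 2 * (f X * ?s X) \<partial>torus_measure)"
    by (simp add: power2_diff mult.assoc)
  also have "\<dots> = (\<integral>X. (f X)\<^sup>2 \<partial>torus_measure) + (\<integral>X. (?s X)\<^sup>2 \<partial>torus_measure) - 2 * (\<integral>X. f X * ?s X \<partial>torus_measure)"
    using i by simp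
  also have "\<dots> \<le> (norm F)\<^sup>2 + 2 * pi * (\<Sum>n\<in>A. (cmod (c n))\<^sup>2) - 2 * (2 * pi * (\<Sum>n\<in>A. (cmod (c n))\<^sup>2))"
    using integral_trig_sum_squared[OF assms, of c] norm_to_l2[OF f] by (simp add: fs F)
  finally show ?thesis by (simp add: c_def)
qed

text \<open>The function is the almost everywhere limit of partial sums along a sparse sequence of
  index sets. Fatou's lemma gives the norm bound, dominated convergence the coefficients. The norm
  bound is what upgrades Bessel to Parseval afterwards.\<close>

lemma riesz_fischer_aux:
  assumes sym: "\<And>n. a (- n) = cnj (a n)" and summ: "(\<lambda>n::int. (cmod (a n))\<^sup>2) summable_on UNIV"
  shows "\<exists>F. (\<forall>n. fourier_coeff n F = a n) \<and> (norm F)\<^sup>2 \<le> 2 * pi * (\<Sum>\<^sub>\<infinity>n. (cmod (a n))\<^sup>2)"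
proof -
  define I where "I N = {- int N..int N}" for N
  define b where "b N = (\<Sum>n\<in>I N. (cmod (a n))\<^sup>2)" for N
  define B where "B = (\<Sum>\<^sub>\<infinity>n. (cmod (a n))\<^sup>2)"
  have I_mono: "I M \<subseteq> I N" if "M \<le> N" for M N using that by (auto simp: I_def)
  have fin [simp]: "finite (I N)" for N by (simp add: I_def)
  have b_le: "b N \<le> B" for N unfolding b_def B_def
    by (rule finite_sum_le_infsum[OF summ]) auto
  have b_mono: "b M \<le> b N" if "M \<le> N" for M N
    unfolding b_def using I_mono[OF that] by (intro sum_mono2) auto
  have "\<exists>N. \<forall>m\<ge>N. b m - b N < (1/4)^j" for j
  proof -
    have "convergent b"
      by (rule Bseq_mono_convergent[of b]) (use b_le b_mono in \<open>auto intro!: BseqI'[of _ B] simp: b_def sum_nonneg\<close>)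
    then have "Cauchy b" by (simp add: Cauchy_convergent_iff)
    moreover have "(1/4::real)^j > 0" by simp
    ultimately obtain N where "\<forall>m\<ge>N. \<forall>n\<ge>N. dist (b m) (b n) < (1/4)^j"
      unfolding Cauchy_def by blast
    then have "\<forall>m\<ge>N. b m - b N < (1/4)^j" by (force simp: dist_real_def)
    then show ?thesis ..
  qed
  then obtain N0 where N0: "\<And>j m. m \<ge> N0 j \<Longrightarrow> b m - b (N0 j) < (1/4)^j" by metis
  \<comment> \<open>Summing the thresholds makes them monotone in j.\<close>
  define N where "N j = (\<Sum>i\<le>j. N0 i)" for j
  have N_ge: "N0 j \<le> N j" for j unfolding N_def by (rule member_le_sum) auto
  have N_Suc: "N j \<le> N (Suc j)" for j by (simp add: N_def)
  \<comment> \<open>The extra summand j forces the index sets to exhaust the integers even when the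
    thresholds stay bounded.\<close>
  define S where "S j = trig_sum a (I (N j + j))" for j
  define D where "D j = I (N (Suc j) + Suc j) - I (N j + j)" for j
  define d where "d j X = S (Suc j) X - S j X" for j X
  have d: "d j X = trig_sum a (D j) X" for j X
  proof -
    have "I (N j + j) \<subseteq> I (N (Suc j) + Suc j)" using N_Suc[of j] by (intro I_mono) simp
    then show ?thesis unfolding d_def S_def trig_sum_def D_def
      by (subst sum_diff) auto
  qed
  have aD: "(\<Sum>n\<in>D j. (cmod (a n))\<^sup>2) \<le> (1/4)^j" for j
  proof -
    have sub: "I (N j + j) \<subseteq> I (N (Suc j) + Suc j)" using N_Suc[of j] by (intro I_mono) simp
    have "(\<Sum>n\<in>D j. (cmod (a n))\<^sup>2) = b (N (Suc j) + Suc j) - b (N j + j)"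
      unfolding D_def b_def using sub by (subst sum_diff) auto
    also have "\<dots> \<le> b (N (Suc j) + Suc j) - b (N0 j)"
      using b_mono[of "N0 j" "N j + j"] N_ge[of j] by simp
    also have "\<dots> \<le> (1/4)^j"
      using N0[of j "N (Suc j) + Suc j"] N_ge[of j] N_Suc[of j] by simp
    finally show ?thesis .
  qed
  have [measurable]: "S j \<in> borel_measurable borel" for j
    unfolding S_def by simp
  have [measurable]: "(\<lambda>X. d j X) \<in> borel_measurable borel" for j
    unfolding d_def by measurable
  have sqS: "square_integrable torus_measure (S j)" and sqd: "square_integrable torus_measure (d j)" for j
  proof -
    have "d j = trig_sum a (D j)" using d by auto
    then show "square_integrable torus_measure (S j)" "square_integrable torus_measure (d j)"
      by (auto simp: S_def square_integrable_trig_sum)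
  qed
  have dint [simp]: "integrable torus_measure (d j)" and Sint [simp]: "integrable torus_measure (S j)" for j
    using sqd sqS by (auto intro: square_integrable_torus_integrable)
  have dL1: "(\<integral>X. norm (d j X) \<partial>torus_measure) \<le> 2 * pi * (1/2)^j" for j
  proof -
    have le: "norm (d j X) \<le> ((1/2)^j + 2^j * (d j X)\<^sup>2) / 2" for X
    proof -
      \<comment> \<open>Weighted arithmetic-geometric mean: the weight \<open>2^j\<close> balances
        the constant against the squared L2 norm of order \<open>(1/4)^j\<close>, so both parts
        integrate to order \<open>(1/2)^j\<close>.\<close>
      have "0 \<le> (1 - 2^j * \<bar>d j X\<bar>)\<^sup>2" by simp
      then have "2 * (2^j * \<bar>d j X\<bar>) \<le> 1 + (2^j)\<^sup>2 * (d j X)\<^sup>2"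
        by (simp add: power2_diff power_mult_distrib)
      then have "(1/2)^j * (2 * (2^j * \<bar>d j X\<bar>)) \<le> (1/2)^j * (1 + (2^j)\<^sup>2 * (d j X)\<^sup>2)"
        by (intro mult_left_mono) auto
      moreover have "(1/2)^j * 2^j = (1::real)" by (simp flip: power_mult_distrib)
      ultimately show ?thesis
        by (simp add: power2_eq_square algebra_simps)
    qed
    have int: "integrable torus_measure (\<lambda>X. (d j X)\<^sup>2)" using sqd by (simp add: square_integrable_def)
    have "(\<integral>X. norm (d j X) \<partial>torus_measure) \<le> (\<integral>X. ((1/2)^j + 2^j * (d j X)\<^sup>2) / 2 \<partial>torus_measure)"
      using le int by (intro integral_mono) auto
    also have "\<dots> = (2 * pi * (1/2)^j + 2^j * (\<integral>X. (d j X)\<^sup>2 \<partial>torus_measure)) / 2"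
      using int by simp
    also have "\<dots> \<le> (2 * pi * (1/2)^j + 2^j * (2 * pi * (1/4)^j)) / 2"
    proof -
      have "(\<integral>X. (d j X)\<^sup>2 \<partial>torus_measure) \<le> 2 * pi * (\<Sum>n\<in>D j. (cmod (a n))\<^sup>2)"
        unfolding d by (rule integral_trig_sum_squared) (simp add: D_def)
      also have "\<dots> \<le> 2 * pi * (1/4)^j" using aD[of j] by (intro mult_left_mono) auto
      finally show ?thesis by simp
    qed
    also have "2^j * (2 * pi * (1/4)^j) = 2 * pi * (1/2)^j"
    proof -
      have "2^j * (1/4)^j = (1/2::real)^j" by (simp flip: power_mult_distrib)
      then show ?thesis by (metis mult.left_commute)
    qed
    finally show ?thesis by simp
  qed
  have summ1: "summable (\<lambda>j. \<integral>X. norm (d j X) \<partial>torus_measure)"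
    by (rule summable_comparison_test'[of "\<lambda>j. 2 * pi * (1/2)^j" 0])
       (use dL1 in \<open>auto intro!: summable_mult summable_geometric\<close>)
  have AE_s: "AE X in torus_measure. summable (\<lambda>j. norm (d j X))"
    by (rule AE_summable_norm[OF dint summ1])
  define w where "w X = norm (S 0 X) + (\<Sum>j. norm (d j X))" for X
  have wint: "integrable torus_measure w"
    unfolding w_def using AE_s summ1
    by (intro Bochner_Integration.integrable_add integrable_suminf) auto
  have S_sum: "S j X = S 0 X + (\<Sum>i<j. d i X)" for j X
    unfolding d_def by (subst sum_lessThan_telescope) simp
  define f where "f X = lim (\<lambda>j. S j X)" for X
  have fm [measurable]: "f \<in> borel_measurable borel"
    unfolding f_def by (rule borel_measurable_lim_metric) simp
  have AE_lim: "AE X in torus_measure. (\<lambda>j. S j X) \<longlonglongrightarrow> f X"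
    using AE_s
  proof eventually_elim
    case (elim X)
    then have "summable (\<lambda>j. d j X)" by (rule summable_norm_cancel)
    then have "convergent (\<lambda>j. S 0 X + (\<Sum>i<j. d i X))"
      by (intro convergent_add convergent_const) (simp add: summable_iff_convergent)
    then have "convergent (\<lambda>j. S j X)" by (simp only: S_sum[symmetric])
    then show ?case by (simp add: f_def convergent_LIMSEQ_iff)
  qed
  have AE_bd: "AE X in torus_measure. norm (S j X) \<le> w X" for j
    using AE_s
  proof eventually_elim
    case (elim X)
    have "norm (S j X) \<le> norm (S 0 X) + norm (\<Sum>i<j. d i X)" unfolding S_sum[of j] by (rule norm_triangle_ineq)
    also have "norm (\<Sum>i<j. d i X) \<le> (\<Sum>i<j. norm (d i X))" by (rule norm_sum)
    also have "\<dots> \<le> (\<Sum>i. norm (d i X))" by (rule sum_le_suminf[OF elim]) auto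
    finally show ?case by (simp add: w_def)
  qed
  have S2: "(\<integral>\<^sup>+X. ennreal ((S j X)\<^sup>2) \<partial>torus_measure) \<le> ennreal (2 * pi * B)" for j
  proof -
    have "(\<integral>\<^sup>+X. ennreal ((S j X)\<^sup>2) \<partial>torus_measure) = ennreal (\<integral>X. (S j X)\<^sup>2 \<partial>torus_measure)"
      using sqS by (intro nn_integral_eq_integral) (auto simp: square_integrable_def)
    also have "(\<integral>X. (S j X)\<^sup>2 \<partial>torus_measure) \<le> 2 * pi * b (N j + j)"
      unfolding S_def b_def by (rule integral_trig_sum_squared) simp
    also have "\<dots> \<le> 2 * pi * B" using b_le by (intro mult_left_mono) auto
    finally show ?thesis by (simp add: ennreal_leI)
  qed
  have "(\<integral>\<^sup>+X. ennreal ((f X)\<^sup>2) \<partial>torus_measure) = (\<integral>\<^sup>+X. liminf (\<lambda>j. ennreal ((S j X)\<^sup>2)) \<partial>torus_measure)"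
  proof (rule nn_integral_cong_AE, use AE_lim in eventually_elim)
    case (elim X)
    then have "(\<lambda>j. ennreal ((S j X)\<^sup>2)) \<longlonglongrightarrow> ennreal ((f X)\<^sup>2)" by (intro tendsto_intros tendsto_ennrealI)
    then show ?case by (rule lim_imp_Liminf[OF trivial_limit_sequentially, symmetric])
  qed
  also have "\<dots> \<le> liminf (\<lambda>j. \<integral>\<^sup>+X. ennreal ((S j X)\<^sup>2) \<partial>torus_measure)"
    by (rule nn_integral_liminf) simp
  also have "\<dots> \<le> ennreal (2 * pi * B)"
    using S2 by (intro Liminf_le) (auto)
  finally have f2: "(\<integral>\<^sup>+X. ennreal ((f X)\<^sup>2) \<partial>torus_measure) \<le> ennreal (2 * pi * B)" .
  have sqf: "square_integrable torus_measure f"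
    unfolding square_integrable_def
    by (intro conjI integrableI_nonneg) (use f2 in \<open>auto intro: le_less_trans\<close>)
  have B0: "B \<ge> 0" unfolding B_def by (intro infsum_nonneg) auto
  have "(norm (to_l2 f))\<^sup>2 \<le> 2 * pi * B"
    unfolding norm_to_l2[OF sqf] using B0 f2 sqf
    by (subst (asm) nn_integral_eq_integral) (auto simp: square_integrable_def)
  moreover have "fourier_coeff n (to_l2 f) = a n" for n
  proof -
    have "(\<lambda>j. \<integral>X. of_real (S j X) * torus_exp (- n) X \<partial>torus_measure) \<longlonglongrightarrow> (\<integral>X. of_real (f X) * torus_exp (- n) X \<partial>torus_measure)"
    proof (rule integral_dominated_convergence[where w = w])
      show "AE X in torus_measure. (\<lambda>j. of_real (S j X) * torus_exp (- n) X) \<longlonglongrightarrow> of_real (f X) * torus_exp (- n) X"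
        using AE_lim by eventually_elim (intro tendsto_intros)
      show "AE X in torus_measure. norm (of_real (S j X) * torus_exp (- n) X) \<le> w X" for j
        using AE_bd[of j] by eventually_elim (simp add: norm_mult)
    qed (use wint in auto)
    then have "(\<lambda>j. 1 / (2 * of_real pi) * (\<integral>X. of_real (S j X) * torus_exp (- n) X \<partial>torus_measure)) \<longlonglongrightarrow>
        1 / (2 * of_real pi) * (\<integral>X. of_real (f X) * torus_exp (- n) X \<partial>torus_measure)"
      by (intro tendsto_intros)
    then have lim: "(\<lambda>j. fourier_coeff n (to_l2 (S j))) \<longlonglongrightarrow> fourier_coeff n (to_l2 f)"
      using sqf sqS by (simp only: fourier_coeff_to_l2)
    have "\<forall>\<^sub>F j in sequentially. fourier_coeff n (to_l2 (S j)) = a n"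
      using eventually_ge_at_top[of "nat \<bar>n\<bar>"]
    proof eventually_elim
      case (elim j)
      then have "n \<in> I (N j + j)" "- n \<in> I (N j + j)" by (auto simp: I_def)
      then show ?case unfolding S_def by (subst fourier_coeff_trig_sum) (auto simp: sym)
    qed
    then have "(\<lambda>j. fourier_coeff n (to_l2 (S j))) \<longlonglongrightarrow> a n" by (rule tendsto_eventually)
    then show ?thesis using lim LIMSEQ_unique by blast
  qed
  ultimately show ?thesis unfolding B_def by blast
qed

lemma summable_fourier_coeff: "(\<lambda>n. (cmod (fourier_coeff n F))\<^sup>2) summable_on UNIV"
proof (rule nonneg_bdd_above_summable_on)
  show "bdd_above (sum (\<lambda>n. (cmod (fourier_coeff n F))\<^sup>2) ` {A. A \<subseteq> UNIV \<and> finite A})"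
    using bessel[of _ F] by (intro bdd_aboveI2[of _ _ "(norm F)\<^sup>2 / (2 * pi)"]) (auto simp: field_simps)
qed auto

text \<open>The function built from the coefficients of F equals F by completeness, so its norm
  bound is the reverse of Bessel's inequality.\<close>

theorem parseval: "((\<lambda>n. (cmod (fourier_coeff n F))\<^sup>2) has_sum (norm F)\<^sup>2 / (2 * pi)) UNIV"
proof -
  obtain G where G: "\<And>n. fourier_coeff n G = fourier_coeff n F"
    "(norm G)\<^sup>2 \<le> 2 * pi * (\<Sum>\<^sub>\<infinity>n. (cmod (fourier_coeff n F))\<^sup>2)"
    using riesz_fischer_aux[of "\<lambda>n. fourier_coeff n F", OF fourier_coeff_uminus summable_fourier_coeff] by blast
  have "G = F" by (rule l2_eqI) (rule G)
  moreover have "(\<Sum>\<^sub>\<infinity>n. (cmod (fourier_coeff n F))\<^sup>2) \<le> (norm F)\<^sup>2 / (2 * pi)"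
    by (rule infsum_le_finite_sums[OF summable_fourier_coeff]) (use bessel[of _ F] in \<open>auto simp: field_simps\<close>)
  ultimately have "(\<Sum>\<^sub>\<infinity>n. (cmod (fourier_coeff n F))\<^sup>2) = (norm F)\<^sup>2 / (2 * pi)"
    using G(2) by (intro antisym) (auto simp: field_simps)
  then show ?thesis using summable_fourier_coeff[of F] by (metis has_sum_infsum)
qed

theorem riesz_fischer:
  assumes "\<And>n. a (- n) = cnj (a n)" "(\<lambda>n::int. (cmod (a n))\<^sup>2) summable_on UNIV"
  shows "\<exists>F. \<forall>n. fourier_coeff n F = a n"
  using riesz_fischer_aux[of a, OF assms] by blast

text \<open>Polarization: both sides are a quarter of the difference of Parseval for F + G and F -
  G.\<close>

theorem parseval_inner: "((\<lambda>n. Re (fourier_coeff n F * cnj (fourier_coeff n G))) has_sum inner F G / (2 * pi)) UNIV"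
proof -
  have "((\<lambda>n. ((cmod (fourier_coeff n (F + G)))\<^sup>2 - (cmod (fourier_coeff n (F - G)))\<^sup>2) / 4) has_sum
      ((norm (F + G))\<^sup>2 / (2 * pi) - (norm (F - G))\<^sup>2 / (2 * pi)) / 4) UNIV"
    unfolding divide_inverse[of _ 4] diff_conv_add_uminus
    by (intro has_sum_cmult_left has_sum_add has_sum_uminusI parseval)
  moreover have "((cmod (fourier_coeff n (F + G)))\<^sup>2 - (cmod (fourier_coeff n (F - G)))\<^sup>2) / 4 = Re (fourier_coeff n F * cnj (fourier_coeff n G))" for n
    unfolding cmod_power2 by (simp add: power2_eq_square algebra_simps)
  moreover have "((norm (F + G))\<^sup>2 / (2 * pi) - (norm (F - G))\<^sup>2 / (2 * pi)) / 4 = inner F G / (2 * pi)"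
    by (simp add: power2_norm_eq_inner inner_add_left inner_add_right inner_diff_left inner_diff_right inner_commute field_simps)
  ultimately show ?thesis by (simp only:)
qed

subsection \<open>Fourier multipliers\<close>

text \<open>Meaningful only if the new coefficients are square summable and m is conjugate
  symmetric, which keeps the result a real function.\<close>

definition mult_op :: "(int \<Rightarrow> complex) \<Rightarrow> l2 \<Rightarrow> l2" where
  "mult_op m F = (THE G. \<forall>n. fourier_coeff n G = m n * fourier_coeff n F)"

lemma summable_fourier_mult:
  assumes "\<And>n. cmod (m n) \<le> K"
  shows "(\<lambda>n. (cmod (m n * fourier_coeff n F))\<^sup>2) summable_on UNIV"
proof (rule summable_on_comparison_test)
  show "(\<lambda>n. K\<^sup>2 * (cmod (fourier_coeff n F))\<^sup>2) summable_on UNIV"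
    by (intro summable_on_cmult_right summable_fourier_coeff)
  show "(cmod (m n * fourier_coeff n F))\<^sup>2 \<le> K\<^sup>2 * (cmod (fourier_coeff n F))\<^sup>2" for n
    using assms[of n] by (auto simp: norm_mult power_mult_distrib intro!: mult_right_mono power_mono)
qed auto

lemma fourier_coeff_mult_op_gen:
  assumes sym: "\<And>n. m (- n) = cnj (m n)"
    and summ: "(\<lambda>n. (cmod (m n * fourier_coeff n F))\<^sup>2) summable_on UNIV"
  shows "fourier_coeff n (mult_op m F) = m n * fourier_coeff n F"
proof -
  obtain G where G: "\<And>n. fourier_coeff n G = m n * fourier_coeff n F"
    using riesz_fischer[OF _ summ] by (auto simp: sym fourier_coeff_uminus)
  have "\<forall>n. fourier_coeff n (mult_op m F) = m n * fourier_coeff n F"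
    unfolding mult_op_def by (rule theI[of _ G]) (auto simp: G intro: l2_eqI)
  then show ?thesis ..
qed

lemma norm_le_fourier:
  assumes "\<And>n. cmod (fourier_coeff n F) \<le> K * cmod (fourier_coeff n G)" "K \<ge> 0"
  shows "norm F \<le> K * norm G"
proof -
  have "(norm F)\<^sup>2 / (2 * pi) \<le> K\<^sup>2 * ((norm G)\<^sup>2 / (2 * pi))"
    by (rule has_sum_mono[OF parseval has_sum_cmult_right[OF parseval]])
       (use assms(1) in \<open>auto simp flip: power_mult_distrib intro!: power_mono\<close>)
  then have "(norm F)\<^sup>2 \<le> (K * norm G)\<^sup>2" by (simp add: field_simps)
  then show ?thesis using assms(2) by (simp add: power2_le_iff_abs_le)
qed

lemma fourier_coeff_bound: "cmod (fourier_coeff n F) \<le> norm F"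
proof -
  have "2 * pi * (cmod (fourier_coeff n F))\<^sup>2 \<le> (norm F)\<^sup>2" using bessel[of "{n}" F] by simp
  moreover have "1 * (cmod (fourier_coeff n F))\<^sup>2 \<le> 2 * pi * (cmod (fourier_coeff n F))\<^sup>2"
    using pi_gt3 by (intro mult_right_mono) auto
  ultimately have "(cmod (fourier_coeff n F))\<^sup>2 \<le> (norm F)\<^sup>2" by linarith
  then show ?thesis by (rule power2_le_imp_le) simp
qed

lemma bounded_linear_fourier_coeff: "bounded_linear (fourier_coeff n)"
  by (rule bounded_linear_intro[of _ 1]) (auto simp: scaleR_conv_of_real fourier_coeff_bound)

lemma tendsto_fourier_coeff:
  "(g \<longlongrightarrow> G) Fl \<Longrightarrow> ((\<lambda>h. fourier_coeff n (g h)) \<longlongrightarrow> fourier_coeff n G) Fl"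
  by (rule bounded_linear.tendsto[OF bounded_linear_fourier_coeff])

text \<open>Dominated convergence on the Fourier side: the tail is small uniformly in h, and the
  finitely many remaining coefficients tend to 0. It yields both strong continuity and the generator
  of the multiplier semigroups.\<close>

lemma tendsto_0_fourier:
  fixes g :: "'b \<Rightarrow> l2"
  assumes dom: "\<forall>\<^sub>F h in Fl. \<forall>n. cmod (fourier_coeff n (g h)) \<le> K * cmod (fourier_coeff n G)"
    and lim: "\<And>n. ((\<lambda>h. fourier_coeff n (g h)) \<longlongrightarrow> 0) Fl"
  shows "(g \<longlongrightarrow> 0) Fl"
proof -
  define S where "S = (\<Sum>\<^sub>\<infinity>n. (cmod (fourier_coeff n G))\<^sup>2)"
  have "((\<lambda>h. (norm (g h))\<^sup>2) \<longlongrightarrow> 0) Fl"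
  proof (rule tendstoI)
    fix e :: real assume e: "e > 0"
    define \<delta> where "\<delta> = (e / (4 * pi)) / (K\<^sup>2 + 1)"
    have K1: "K\<^sup>2 + 1 > 0" by (metis add_pos_nonneg add.commute zero_le_power2 zero_less_one)
    then have d: "\<delta> > 0" using e by (simp add: \<delta>_def)
    obtain A where A: "finite A" "dist (\<Sum>n\<in>A. (cmod (fourier_coeff n G))\<^sup>2) S \<le> \<delta>"
      using infsum_finite_approximation[OF summable_fourier_coeff d, of G] unfolding S_def by blast
    have tail: "(\<Sum>\<^sub>\<infinity>n\<in>-A. (cmod (fourier_coeff n G))\<^sup>2) \<le> \<delta>"
    proof -
      have "(\<Sum>\<^sub>\<infinity>n\<in>UNIV - A. (cmod (fourier_coeff n G))\<^sup>2) = S - (\<Sum>\<^sub>\<infinity>n\<in>A. (cmod (fourier_coeff n G))\<^sup>2)"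
        unfolding S_def by (rule infsum_Diff[OF summable_fourier_coeff]) (auto intro: summable_on_finite A)
      then show ?thesis using A by (simp add: dist_real_def Compl_eq_Diff_UNIV)
    qed
    have "((\<lambda>h. \<Sum>n\<in>A. (cmod (fourier_coeff n (g h)))\<^sup>2) \<longlongrightarrow> (\<Sum>n\<in>A. (cmod 0)\<^sup>2)) Fl"
      by (intro tendsto_intros lim)
    then have "((\<lambda>h. \<Sum>n\<in>A. (cmod (fourier_coeff n (g h)))\<^sup>2) \<longlongrightarrow> 0) Fl" by simp
    then have ev: "\<forall>\<^sub>F h in Fl. (\<Sum>n\<in>A. (cmod (fourier_coeff n (g h)))\<^sup>2) < e / (4 * pi)"
      by (rule order_tendstoD) (use e in simp)
    show "\<forall>\<^sub>F h in Fl. dist ((norm (g h))\<^sup>2) 0 < e"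
      using ev dom
    proof eventually_elim
      case (elim h)
      have "(norm (g h))\<^sup>2 / (2 * pi) = (\<Sum>\<^sub>\<infinity>n. (cmod (fourier_coeff n (g h)))\<^sup>2)"
        using parseval[of "g h"] by (simp add: infsumI)
      also have "\<dots> = (\<Sum>\<^sub>\<infinity>n\<in>A \<union> -A. (cmod (fourier_coeff n (g h)))\<^sup>2)" by simp
      also have "\<dots> = (\<Sum>\<^sub>\<infinity>n\<in>A. (cmod (fourier_coeff n (g h)))\<^sup>2) + (\<Sum>\<^sub>\<infinity>n\<in>-A. (cmod (fourier_coeff n (g h)))\<^sup>2)"
        by (intro infsum_Un_disjoint summable_on_subset_banach[OF summable_fourier_coeff]) auto
      also have "(\<Sum>\<^sub>\<infinity>n\<in>-A. (cmod (fourier_coeff n (g h)))\<^sup>2) \<le> (\<Sum>\<^sub>\<infinity>n\<in>-A. K\<^sup>2 * (cmod (fourier_coeff n G))\<^sup>2)"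
        by (intro infsum_mono summable_on_cmult_right summable_on_subset_banach[OF summable_fourier_coeff])
           (use elim(2) in \<open>auto simp flip: power_mult_distrib intro!: power_mono\<close>)
      also have "\<dots> = K\<^sup>2 * (\<Sum>\<^sub>\<infinity>n\<in>-A. (cmod (fourier_coeff n G))\<^sup>2)"
        by (rule infsum_cmult_right') 
      also have "\<dots> \<le> K\<^sup>2 * \<delta>" using tail by (intro mult_left_mono) auto
      also have "\<dots> \<le> (K\<^sup>2 + 1) * \<delta>" using d by (intro mult_right_mono) auto
      also have "\<dots> = e / (4 * pi)" using K1 by (simp add: \<delta>_def)
      finally have "(norm (g h))\<^sup>2 / (2 * pi) < e / (4 * pi) + e / (4 * pi)"
        using elim(1) A(1) by simp
      then show ?case by (simp add: field_simps)
    qed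
  qed
  then have "((\<lambda>h. sqrt ((norm (g h))\<^sup>2)) \<longlongrightarrow> sqrt 0) Fl" by (rule tendsto_real_sqrt)
  then show ?thesis by (simp add: tendsto_norm_zero_iff)
qed

locale bounded_multiplier =
  fixes m :: "int \<Rightarrow> complex" and K :: real
  assumes sym: "m (- n) = cnj (m n)" and bound: "cmod (m n) \<le> K"
begin

lemma fourier_coeff [simp]: "fourier_coeff n (mult_op m F) = m n * fourier_coeff n F"
  by (rule fourier_coeff_mult_op_gen) (intro sym summable_fourier_mult[of m K] bound)+

lemma K_nonneg: "K \<ge> 0" using bound[of 0] norm_ge_zero order_trans by blast

lemma norm_mult_op: "norm (mult_op m F) \<le> K * norm F"
  using bound K_nonneg by (intro norm_le_fourier) (auto simp: norm_mult mult_right_mono)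

end

subsection \<open>Weak derivatives\<close>

lemma torus_deriv_continuous:
  assumes "torus_deriv \<phi> \<psi>"
  shows "continuous_on S (\<lambda>x. \<phi> (to_torus x))"
  using assms by (auto simp: torus_deriv_def intro!: continuous_at_imp_continuous_on DERIV_isCont)

lemma measurable_continuous_torus:
  assumes "continuous_on UNIV (\<lambda>x. f (to_torus x))"
  shows "f \<in> borel_measurable borel"
proof -
  have "(\<lambda>x. f (to_torus x)) \<in> borel_measurable borel" using assms by (rule borel_measurable_continuous_onI)
  from measurable_compose[OF measurable_torus_rep[of 0] this] show ?thesis by simp
qed

lemma continuous_square_integrable_torus:
  assumes "continuous_on UNIV (\<lambda>x. \<phi> (to_torus x))"
  shows "square_integrable torus_measure \<phi>"
proof -
  have "compact ((\<lambda>x. \<phi> (to_torus x)) ` {0..2 * pi})"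
    by (intro compact_continuous_image continuous_on_subset[OF assms]) auto
  from compact_imp_bounded[OF this]
  obtain B where B: "\<forall>x\<in>{0..2*pi}. \<bar>\<phi> (to_torus x)\<bar> \<le> B"
    by (auto simp: bounded_iff)
  have "\<bar>\<phi> X\<bar> \<le> B" for X
    using B[rule_format, of "torus_rep 0 X"] torus_rep_ge[of 0 X] torus_rep_less[of 0 X] by simp
  then show ?thesis
    by (rule bounded_square_integrable_torus[OF measurable_continuous_torus[OF assms]])
qed

lemma has_vector_derivative_cis:
  "((\<lambda>x. cis (c * x)) has_vector_derivative (\<i> * of_real c) * cis (c * x)) (at x within S)"
  using has_vector_derivative_exp_real[of "\<i> * of_real c" x S] by (simp add: cis_conv_exp mult_ac)

lemma fourier_coeff_deriv:
  assumes d: "torus_deriv \<phi> \<psi>" and c: "continuous_on UNIV (\<lambda>x. \<psi> (to_torus x))"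
  shows "fourier_coeff n (to_l2 \<psi>) = \<i> * of_int n * fourier_coeff n (to_l2 \<phi>)"
proof -
  have c': "continuous_on UNIV (\<lambda>x. \<phi> (to_torus x))" by (rule torus_deriv_continuous[OF d])
  have m: "\<phi> \<in> borel_measurable borel" "\<psi> \<in> borel_measurable borel"
    by (intro measurable_continuous_torus c c')+
  note cs = continuous_on_subset[OF c subset_UNIV] continuous_on_subset[OF c' subset_UNIV]
  have ex: "(\<integral>X. of_real (f X) * torus_exp (- n) X \<partial>torus_measure) = integral {0..0 + 2*pi} (\<lambda>x. of_real (f (to_torus x)) * cis (- of_int n * x))"
    if "continuous_on UNIV (\<lambda>x. f (to_torus x))" for f
  proof -
    have [measurable]: "f \<in> borel_measurable borel" by (rule measurable_continuous_torus[OF that])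
    show ?thesis
      by (rule integral_torus_interval) (auto intro!: continuous_intros continuous_on_subset[OF that])
  qed
  define F where "F x = of_real (\<phi> (to_torus x)) * cis (- of_int n * x)" for x
  have per: "F (2 * pi) = F 0"
  proof -
    have "to_torus (2 * pi) = to_torus 0" using to_torus_period[of 0 1] by simp
    moreover have "cis (- of_int n * (2 * pi)) = 1"
      using cis_multiple_2pi[of "of_int (- n)"] by (simp add: mult_ac)
    ultimately show ?thesis by (simp add: F_def)
  qed
  have "((\<lambda>x. of_real (\<psi> (to_torus x)) * cis (- of_int n * x) + of_real (\<phi> (to_torus x)) * ((\<i> * of_real (- of_int n)) * cis (- of_int n * x)))
      has_integral F (2 * pi) - F 0) {0..2*pi}"
    unfolding F_def
  proof (intro fundamental_theorem_of_calculus)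
    fix x :: real assume "x \<in> {0..2*pi}"
    have "((\<lambda>y. \<phi> (to_torus y)) has_vector_derivative \<psi> (to_torus x)) (at x within {0..2*pi})"
      using d unfolding torus_deriv_def
      by (auto simp: has_real_derivative_iff_has_vector_derivative intro: has_vector_derivative_at_within)
    then have "((\<lambda>y. complex_of_real (\<phi> (to_torus y))) has_vector_derivative of_real (\<psi> (to_torus x))) (at x within {0..2*pi})"
      by (rule bounded_linear.has_vector_derivative[OF bounded_linear_of_real])
    from has_vector_derivative_mult[OF this has_vector_derivative_cis[of "- of_int n" x]]
    show "((\<lambda>x. of_real (\<phi> (to_torus x)) * cis (- of_int n * x)) has_vector_derivative
       of_real (\<psi> (to_torus x)) * cis (- of_int n * x) + of_real (\<phi> (to_torus x)) * ((\<i> * of_real (- of_int n)) * cis (- of_int n * x)))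
       (at x within {0..2*pi})" by (simp add: add.commute)
  qed simp
  then have 1: "integral {0..2*pi} (\<lambda>x. of_real (\<psi> (to_torus x)) * cis (- of_int n * x) + of_real (\<phi> (to_torus x)) * ((\<i> * of_real (- of_int n)) * cis (- of_int n * x))) = 0"
    by (simp add: per integral_unique)
  have io: "(\<lambda>x. complex_of_real (f (to_torus x)) * cis (- of_int n * x)) integrable_on {0..2*pi}" 
    if "continuous_on UNIV (\<lambda>x. f (to_torus x))" for f
    by (intro integrable_continuous_real continuous_intros continuous_on_subset[OF that]) auto
  have "integral {0..2*pi} (\<lambda>x. of_real (\<psi> (to_torus x)) * cis (- of_int n * x) + (- (\<i> * of_int n)) * (of_real (\<phi> (to_torus x)) * cis (- of_int n * x))) = 0"
    by (rule trans[OF _ 1]) (rule Henstock_Kurzweil_Integration.integral_cong, simp add: algebra_simps)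
  then have "integral {0..2*pi} (\<lambda>x. of_real (\<psi> (to_torus x)) * cis (- of_int n * x))
    + (- (\<i> * of_int n)) * integral {0..2*pi} (\<lambda>x. of_real (\<phi> (to_torus x)) * cis (- of_int n * x)) = 0"
    by (subst (asm) Henstock_Kurzweil_Integration.integral_add[OF io[OF c] integrable_on_mult_right[OF io[OF c']]]) simp
  then have "integral {0..2*pi} (\<lambda>x. of_real (\<psi> (to_torus x)) * cis (- of_int n * x))
    = \<i> * of_int n * integral {0..2*pi} (\<lambda>x. of_real (\<phi> (to_torus x)) * cis (- of_int n * x))"
    by (simp add: algebra_simps)
  then show ?thesis
    using ex[OF c] ex[OF c'] by (simp add: fourier_coeff_to_l2 continuous_square_integrable_torus c c')
qed

lemma torus_deriv_trig_sum: "torus_deriv (trig_sum a A) (trig_sum (\<lambda>n. \<i> * of_int n * a n) A)"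
  unfolding torus_deriv_def
proof
  fix x
  have "((\<lambda>y. \<Sum>n\<in>A. a n * cis (of_int n * y)) has_vector_derivative
      (\<Sum>n\<in>A. a n * ((\<i> * of_real (of_int n)) * cis (of_int n * x)))) (at x)"
    by (intro has_vector_derivative_sum has_vector_derivative_mult_right has_vector_derivative_cis)
  then have "((\<lambda>y. Re (\<Sum>n\<in>A. a n * cis (of_int n * y))) has_vector_derivative
      Re (\<Sum>n\<in>A. a n * ((\<i> * of_real (of_int n)) * cis (of_int n * x)))) (at x)"
    by (rule bounded_linear.has_vector_derivative[OF bounded_linear_Re])
  then show "((\<lambda>y. trig_sum a A (to_torus y)) has_real_derivative trig_sum (\<lambda>n. \<i> * of_int n * a n) A (to_torus x)) (at x)"
    unfolding trig_sum_def has_real_derivative_iff_has_vector_derivative torus_exp_to_torus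
    by (simp only: mult_ac of_real_of_int_eq)
qed

lemma smooth_trig_sum: "smooth_torus (trig_sum a A)"
  unfolding smooth_torus_def
proof (intro exI[of _ "\<lambda>k. trig_sum (\<lambda>n. (\<i> * of_int n) ^ k * a n) A"] conjI allI)
  fix k
  show "torus_deriv (trig_sum (\<lambda>n. (\<i> * of_int n) ^ k * a n) A) (trig_sum (\<lambda>n. (\<i> * of_int n) ^ Suc k * a n) A)"
    using torus_deriv_trig_sum[of "\<lambda>n. (\<i> * of_int n) ^ k * a n" A] by (simp add: mult.assoc)
qed simp

text \<open>One direction tests with single-frequency trigonometric functions; the other is Parseval
  together with the classical rule for Fourier coefficients of a derivative.\<close>

lemma has_weak_deriv_iff:
  "has_weak_deriv F G \<longleftrightarrow> (\<forall>n. fourier_coeff n G = \<i> * of_int n * fourier_coeff n F)"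
proof
  assume F: "has_weak_deriv F G"
  show "\<forall>n. fourier_coeff n G = \<i> * of_int n * fourier_coeff n F"
  proof
    fix n
    define z where "z = \<i> * of_int n * cnj (fourier_coeff n F) + cnj (fourier_coeff n G)"
    have "Re (c * z) = 0" for c
    proof -
      have "inner F (to_l2 (trig_sum (\<lambda>m. \<i> * of_int m * c) {n})) = - inner G (to_l2 (trig_sum (\<lambda>m. c) {n}))"
        using F smooth_trig_sum[of "\<lambda>m. c" "{n}"] torus_deriv_trig_sum[of "\<lambda>m. c" "{n}"]
        unfolding has_weak_deriv_def by blast
      then have "2 * pi * (Re (\<i> * of_int n * c * cnj (fourier_coeff n F)) + Re (c * cnj (fourier_coeff n G))) = 0"
        unfolding inner_trig_sum[OF finite.insertI[OF finite.emptyI]]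
        by (simp add: distrib_left del: times_complex.sel)
      then have "Re (\<i> * of_int n * c * cnj (fourier_coeff n F)) + Re (c * cnj (fourier_coeff n G)) = 0"
        by (simp del: times_complex.sel)
      moreover have "c * z = \<i> * of_int n * c * cnj (fourier_coeff n F) + c * cnj (fourier_coeff n G)"
        by (simp add: z_def algebra_simps)
      ultimately show ?thesis by (simp only: plus_complex.sel)
    qed
    \<comment> \<open>The factors 1 and -i read off the real and the imaginary part of z.\<close>
    from this[of 1] this[of "- \<i>"] have "z = 0" by (simp add: complex_eq_iff)
    then have "cnj z = 0" by simp
    then have "- (\<i> * of_int n) * fourier_coeff n F + fourier_coeff n G = 0" by (simp add: z_def)
    then show "fourier_coeff n G = \<i> * of_int n * fourier_coeff n F" by (simp add: algebra_simps)
  qed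
next
  assume G: "\<forall>n. fourier_coeff n G = \<i> * of_int n * fourier_coeff n F"
  show "has_weak_deriv F G"
    unfolding has_weak_deriv_def
  proof (intro allI impI)
    fix \<phi> \<psi> assume a: "smooth_torus \<phi> \<and> torus_deriv \<phi> \<psi>"
    then obtain D where D: "D 0 = \<phi>" "\<And>k::nat. torus_deriv (D k) (D (Suc k))"
      unfolding smooth_torus_def by blast
    \<comment> \<open>Derivatives are unique, so \<psi> inherits the smoothness of \<phi> and is in
      particular continuous, as \<open>fourier_coeff_deriv\<close> requires.\<close>
    have "\<psi> = D 1"
    proof
      fix X
      obtain x where x: "X = to_torus x" by (rule torus_cases)
      show "\<psi> X = D 1 X"
        using a D(2)[of 0] D(1) DERIV_unique[of "\<lambda>y. \<phi> (to_torus y)" "\<psi> X" x "D 1 X"]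
        by (simp add: torus_deriv_def x)
    qed
    then have c: "continuous_on UNIV (\<lambda>x. \<psi> (to_torus x))"
      using torus_deriv_continuous[OF D(2)[of 1]] by simp
    have fc: "fourier_coeff n (to_l2 \<psi>) = \<i> * of_int n * fourier_coeff n (to_l2 \<phi>)" for n
      using fourier_coeff_deriv[OF _ c] a by blast
    have "Re (fourier_coeff n F * cnj (fourier_coeff n (to_l2 \<psi>))) = - Re (fourier_coeff n G * cnj (fourier_coeff n (to_l2 \<phi>)))" for n
      by (simp add: fc G algebra_simps)
    then have "((\<lambda>n. - Re (fourier_coeff n G * cnj (fourier_coeff n (to_l2 \<phi>)))) has_sum inner F (to_l2 \<psi>) / (2 * pi)) UNIV"
      using parseval_inner[of F "to_l2 \<psi>"] by (simp del: times_complex.sel)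
    moreover have "((\<lambda>n. - Re (fourier_coeff n G * cnj (fourier_coeff n (to_l2 \<phi>)))) has_sum - (inner G (to_l2 \<phi>) / (2 * pi))) UNIV"
      by (rule has_sum_uminusI[OF parseval_inner])
    ultimately have "inner F (to_l2 \<psi>) / (2 * pi) = - (inner G (to_l2 \<phi>) / (2 * pi))" by (rule has_sum_unique)
    then show "inner F (to_l2 \<psi>) = - inner G (to_l2 \<phi>)" by (simp add: field_simps)
  qed
qed

lemma has_weak_deriv_weak_deriv:
  assumes "F \<in> H1" shows "has_weak_deriv F (weak_deriv F)"
proof -
  obtain G where G: "has_weak_deriv F G" using assms by (auto simp: H1_def)
  show ?thesis unfolding weak_deriv_def
    by (rule theI[of _ G]) (use G in \<open>auto simp: has_weak_deriv_iff intro: l2_eqI\<close>)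
qed

lemma fourier_coeff_weak_deriv:
  "F \<in> H1 \<Longrightarrow> fourier_coeff n (weak_deriv F) = \<i> * of_int n * fourier_coeff n F"
  using has_weak_deriv_weak_deriv[of F] by (simp add: has_weak_deriv_iff)

lemma H1_iff: "F \<in> H1 \<longleftrightarrow> (\<lambda>n. (cmod (of_int n * fourier_coeff n F))\<^sup>2) summable_on UNIV"
proof
  assume "F \<in> H1"
  then show "(\<lambda>n. (cmod (of_int n * fourier_coeff n F))\<^sup>2) summable_on UNIV"
    using summable_fourier_coeff[of "weak_deriv F"] by (simp add: fourier_coeff_weak_deriv norm_mult)
next
  assume s: "(\<lambda>n. (cmod (of_int n * fourier_coeff n F))\<^sup>2) summable_on UNIV"
  have "\<exists>G. \<forall>n. fourier_coeff n G = \<i> * of_int n * fourier_coeff n F"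
    by (rule riesz_fischer) (use s in \<open>auto simp: fourier_coeff_uminus norm_mult\<close>)
  then show "F \<in> H1" by (auto simp: H1_def has_weak_deriv_iff)
qed

lemma H2_weak_deriv:
  assumes "F \<in> H2" shows "F \<in> H1" "weak_deriv F \<in> H1"
proof -
  obtain G where G: "G \<in> H1" "has_weak_deriv F G" using assms by (auto simp: H2_def)
  then show "F \<in> H1" by (auto simp: H1_def)
  then have "weak_deriv F = G" using G(2) by (intro l2_eqI) (simp add: fourier_coeff_weak_deriv has_weak_deriv_iff)
  then show "weak_deriv F \<in> H1" using G by simp
qed

lemma H2_iff: "F \<in> H2 \<longleftrightarrow> (\<lambda>n. (cmod ((of_int n)\<^sup>2 * fourier_coeff n F))\<^sup>2) summable_on UNIV"
proof
  assume F: "F \<in> H2"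
  then show "(\<lambda>n. (cmod ((of_int n)\<^sup>2 * fourier_coeff n F))\<^sup>2) summable_on UNIV"
    using summable_fourier_coeff[of "weak_deriv (weak_deriv F)"] H2_weak_deriv[OF F]
    by (simp add: fourier_coeff_weak_deriv norm_mult power2_eq_square mult.assoc)
next
  assume s: "(\<lambda>n. (cmod ((of_int n)\<^sup>2 * fourier_coeff n F))\<^sup>2) summable_on UNIV"
  have "F \<in> H1" unfolding H1_iff
  proof (rule summable_on_comparison_test[OF s])
    fix n :: int
    have "\<bar>real_of_int n\<bar> \<le> (real_of_int n)\<^sup>2"
      by (simp flip: of_int_abs of_int_power) (metis abs_le_square_iff abs_abs power2_abs int_one_le_iff_zero_less abs_ge_zero zero_le_power2 self_le_power zero_less_numeral abs_of_nonneg linorder_not_le nle_le power_zero_numeral pos2)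
    then show "(cmod (of_int n * fourier_coeff n F))\<^sup>2 \<le> (cmod ((of_int n)\<^sup>2 * fourier_coeff n F))\<^sup>2"
      by (intro power_mono) (auto simp: norm_mult norm_power intro!: mult_right_mono)
  qed auto
  then have "weak_deriv F \<in> H1"
    unfolding H1_iff[of "weak_deriv F"]
    using s by (simp add: fourier_coeff_weak_deriv norm_mult power2_eq_square mult.assoc)
  then show "F \<in> H2" using has_weak_deriv_weak_deriv[OF \<open>F \<in> H1\<close>] by (auto simp: H2_def)
qed

subsection \<open>Multiplier semigroups and Duhamel's formula\<close>

text \<open>Mean value inequality on the half-plane where Re is at least -\<kappa>: it is convex,
  contains 0, and the derivative is bounded there by exp \<kappa>. It controls the difference
  quotients of the semigroup uniformly in the frequency.\<close>

lemma norm_exp_minus_one_le: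
  assumes "- \<kappa> \<le> Re z" "0 \<le> \<kappa>"
  shows "cmod (exp (- z) - 1) \<le> exp \<kappa> * cmod z"
proof -
  have "cmod (exp (- z) - exp (- 0)) \<le> exp \<kappa> * cmod (z - 0)"
  proof (rule field_differentiable_bound[where S = "{w. Re w \<ge> - \<kappa>}" and f' = "\<lambda>w. - exp (- w)"])
    show "convex {w. - \<kappa> \<le> Re w}" by (rule convex_halfspace_Re_ge)
    show "((\<lambda>w. exp (- w)) has_field_derivative - exp (- w)) (at w within {w. - \<kappa> \<le> Re w})" for w
      by (auto intro!: derivative_eq_intros)
    show "norm (- exp (- w)) \<le> exp \<kappa>" if "w \<in> {w. - \<kappa> \<le> Re w}" for w
      using that by (simp add: norm_exp_eq_Re)
  qed (use assms in auto)
  then show ?thesis by simp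
qed

lemma exp_difference_quotient:
  "((\<lambda>h. (exp (- (of_real h * l)) - 1) / of_real h) \<longlongrightarrow> - l) (at_right 0)" for l :: complex
proof -
  have "((\<lambda>z. exp (- (z * l))) has_field_derivative - l) (at 0)"
    by (auto intro!: derivative_eq_intros)
  then have "((\<lambda>z. (exp (- (z * l)) - 1) / z) \<longlongrightarrow> - l) (at 0)"
    by (simp add: has_field_derivative_iff)
  moreover have "filterlim (\<lambda>h. complex_of_real h) (at 0) (at_right 0)"
    unfolding filterlim_at
    by (auto intro!: tendsto_eq_intros simp: eventually_at_filter)
  ultimately show ?thesis by (rule filterlim_compose)
qed

text \<open>A diagonal system with two components. The lower bound on the real parts makes exp(- t
  lam) a bounded multiplier; the conjugate symmetry keeps real functions real.\<close>

locale fourier_system =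
  fixes lam :: "2 \<Rightarrow> int \<Rightarrow> complex" and \<kappa> :: real
  assumes lam_sym: "lam i (- n) = cnj (lam i n)"
    and lam_re: "- \<kappa> \<le> Re (lam i n)" and \<kappa>_nonneg: "0 \<le> \<kappa>"
begin

definition S :: "real \<Rightarrow> l2^2 \<Rightarrow> l2^2" where
  "S t F = (\<chi> i. mult_op (\<lambda>n. exp (- (of_real t * lam i n))) (F $ i))"

lemma exp_bound: "0 \<le> t \<Longrightarrow> cmod (exp (- (of_real t * lam i n))) \<le> exp (\<kappa> * t)"
  using mult_left_mono[OF lam_re[of i n], of t] by (simp add: norm_exp_eq_Re mult.commute)

lemma mult: "0 \<le> t \<Longrightarrow> bounded_multiplier (\<lambda>n. exp (- (of_real t * lam i n))) (exp (\<kappa> * t))"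
  by standard (simp add: lam_sym exp_cnj, rule exp_bound)

lemma fourier_S: "0 \<le> t \<Longrightarrow> fourier_coeff n (S t F $ i) = exp (- (of_real t * lam i n)) * fourier_coeff n (F $ i)"
  by (simp add: S_def bounded_multiplier.fourier_coeff[OF mult])

lemma vec_l2_eqI: "(\<And>i n. fourier_coeff n (F $ i) = fourier_coeff n (G $ i)) \<Longrightarrow> F = (G :: l2^2)"
  by (simp add: vec_eq_iff l2_eqI)

lemma c0_semigroup_S: "c0_semigroup S"
  unfolding c0_semigroup_def
proof (intro conjI allI impI)
  fix t :: real assume t: "0 \<le> t"
  show "bounded_linear (S t)"
  proof (rule bounded_linear_intro[of _ "exp (\<kappa> * t)"])
    show "S t (F + G) = S t F + S t G" for F G
      by (rule vec_l2_eqI) (simp add: fourier_S t distrib_left)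
    show "S t (r *\<^sub>R F) = r *\<^sub>R S t F" for r F
      by (rule vec_l2_eqI) (simp add: fourier_S t)
    show "norm (S t F) \<le> norm F * exp (\<kappa> * t)" for F
    proof -
      have "norm (S t F) \<le> L2_set (\<lambda>i. exp (\<kappa> * t) * norm (F $ i)) UNIV"
        unfolding norm_vec_def[of "S t F"]
        by (rule L2_set_mono) (simp_all add: S_def bounded_multiplier.norm_mult_op[OF mult[OF t]])
      also have "\<dots> = exp (\<kappa> * t) * norm F"
        by (simp add: norm_vec_def L2_set_right_distrib)
      finally show ?thesis by (simp add: mult.commute)
    qed
  qed
next
  show "S 0 F = F" for F by (rule vec_l2_eqI) (simp add: fourier_S)
next
  fix s t :: real and F assume "0 \<le> s" "0 \<le> t"
  then show "S (s + t) F = S s (S t F)"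
    by (intro vec_l2_eqI) (simp add: fourier_S distrib_right mult_exp_exp flip: mult.assoc)
next
  fix F
  show "((\<lambda>t. S t F) \<longlongrightarrow> F) (at_right 0)"
  proof (rule vec_tendstoI)
    fix i
    have "((\<lambda>t. S t F $ i - F $ i) \<longlongrightarrow> 0) (at_right 0)"
    proof (rule tendsto_0_fourier[where K = "exp \<kappa> + 1" and G = "F $ i"])
      have "\<forall>\<^sub>F t in at_right 0. t < (1::real)" using eventually_at_right_less[of 0]
        by (intro eventually_at_rightI[of 0 1]) auto
      moreover have "\<forall>\<^sub>F t in at_right 0. 0 < (t::real)" by (rule eventually_at_right_less)
      ultimately show "\<forall>\<^sub>F t in at_right 0. \<forall>n. cmod (fourier_coeff n (S t F $ i - F $ i)) \<le> (exp \<kappa> + 1) * cmod (fourier_coeff n (F $ i))"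
      proof eventually_elim
        case (elim t)
        show ?case
        proof
          fix n
          have "cmod (exp (- (of_real t * lam i n))) \<le> exp \<kappa>"
            by (rule order_trans[OF exp_bound]) (use elim \<kappa>_nonneg in \<open>auto intro: mult_left_le\<close>)
          from order_trans[OF norm_triangle_ineq4 add_mono[OF this norm_one[THEN eq_refl]]]
          have "cmod (exp (- (of_real t * lam i n)) - 1) \<le> exp \<kappa> + 1" .
          then have "cmod ((exp (- (of_real t * lam i n)) - 1) * fourier_coeff n (F $ i)) \<le> (exp \<kappa> + 1) * cmod (fourier_coeff n (F $ i))"
            unfolding norm_mult by (rule mult_right_mono) simp
          then show "cmod (fourier_coeff n (S t F $ i - F $ i)) \<le> (exp \<kappa> + 1) * cmod (fourier_coeff n (F $ i))"
            using elim by (simp add: fourier_S algebra_simps)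
        qed
      qed
    next
      fix n
      have "((\<lambda>t. (exp (- (of_real t * lam i n)) - 1) * fourier_coeff n (F $ i)) \<longlongrightarrow> 0) (at_right 0)"
        by (auto intro!: tendsto_eq_intros)
      then show "((\<lambda>t. fourier_coeff n (S t F $ i - F $ i)) \<longlongrightarrow> 0) (at_right 0)"
        by (rule Lim_transform_eventually)
           (use eventually_at_right_less[of 0] in eventually_elim, simp add: fourier_S algebra_simps)
    qed
    then show "((\<lambda>t. S t F $ i) \<longlongrightarrow> F $ i) (at_right 0)" by (simp add: LIM_zero_iff)
  qed
qed

text \<open>If the quotients converge, their limit has coefficients - lam times those of F; being in
  \<open>l2\<close> these are square summable, so F lies in D. Conversely, on D the quotients are
  dominated by a multiple of the coefficients of the limit, and \<open>tendsto_0_fourier\<close>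
  applies.\<close>

lemma has_generator_S:
  assumes D: "\<And>F. F \<in> D \<longleftrightarrow> (\<forall>i. (\<lambda>n. (cmod (lam i n * fourier_coeff n (F $ i)))\<^sup>2) summable_on UNIV)"
    and G: "\<And>F i n. F \<in> D \<Longrightarrow> fourier_coeff n (G F $ i) = - lam i n * fourier_coeff n (F $ i)"
  shows "has_generator S D G"
  unfolding has_generator_def
proof (intro allI iffI)
  fix F H assume lim: "((\<lambda>h. (S h F - F) /\<^sub>R h) \<longlongrightarrow> H) (at_right 0)"
  have H: "fourier_coeff n (H $ i) = - lam i n * fourier_coeff n (F $ i)" for n i
  proof (rule tendsto_unique[OF trivial_limit_at_right_real])
    show "((\<lambda>h. fourier_coeff n (((S h F - F) /\<^sub>R h) $ i)) \<longlongrightarrow> fourier_coeff n (H $ i)) (at_right 0)"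
      by (intro tendsto_fourier_coeff tendsto_vec_nth lim)
    have "((\<lambda>h. (exp (- (of_real h * lam i n)) - 1) / of_real h * fourier_coeff n (F $ i)) \<longlongrightarrow> - lam i n * fourier_coeff n (F $ i)) (at_right 0)"
      by (intro tendsto_intros exp_difference_quotient)
    then show "((\<lambda>h. fourier_coeff n (((S h F - F) /\<^sub>R h) $ i)) \<longlongrightarrow> - lam i n * fourier_coeff n (F $ i)) (at_right 0)"
      by (rule Lim_transform_eventually)
         (use eventually_at_right_less[of 0] in eventually_elim, simp add: fourier_S field_simps)
  qed
  have "(\<lambda>n. (cmod (lam i n * fourier_coeff n (F $ i)))\<^sup>2) summable_on UNIV" for i
    using summable_fourier_coeff[of "H $ i"] by (simp add: H)
  then have F: "F \<in> D" by (simp add: D)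
  moreover have "H = G F" by (rule vec_l2_eqI) (simp add: H G[OF F])
  ultimately show "F \<in> D \<and> H = G F" by simp
next
  fix F H assume "F \<in> D \<and> H = G F"
  then have F: "F \<in> D" and H: "H = G F" by auto
  show "((\<lambda>h. (S h F - F) /\<^sub>R h) \<longlongrightarrow> H) (at_right 0)"
  proof (rule vec_tendstoI)
    fix i
    have fc: "fourier_coeff n (((S h F - F) /\<^sub>R h) $ i - H $ i) = ((exp (- (of_real h * lam i n)) - 1) / of_real h + lam i n) * fourier_coeff n (F $ i)"
      if "h > 0" for h n
      using that by (simp add: fourier_S H G[OF F] field_simps)
    have "((\<lambda>h. ((S h F - F) /\<^sub>R h) $ i - H $ i) \<longlongrightarrow> 0) (at_right 0)"
    proof (rule tendsto_0_fourier[where K = "exp \<kappa> + 1" and G = "H $ i"])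
      have "\<forall>\<^sub>F t in at_right 0. t < (1::real)"
        by (intro eventually_at_rightI[of 0 1]) auto
      moreover have "\<forall>\<^sub>F t in at_right 0. 0 < (t::real)" by (rule eventually_at_right_less)
      ultimately show "\<forall>\<^sub>F h in at_right 0. \<forall>n. cmod (fourier_coeff n (((S h F - F) /\<^sub>R h) $ i - H $ i)) \<le> (exp \<kappa> + 1) * cmod (fourier_coeff n (H $ i))"
      proof eventually_elim
        case (elim h)
        show ?case
        proof
          fix n
          have "cmod (exp (- (of_real h * lam i n)) - 1) \<le> exp \<kappa> * cmod (of_real h * lam i n)"
          proof (rule norm_exp_minus_one_le[OF _ \<kappa>_nonneg])
            have "h * - \<kappa> \<le> h * Re (lam i n)" using lam_re[of i n] elim by (intro mult_left_mono) auto
            moreover have "- \<kappa> \<le> h * - \<kappa>" using elim \<kappa>_nonneg by (simp add: mult_left_le_one_le)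
            ultimately show "- \<kappa> \<le> Re (of_real h * lam i n)" by simp
          qed
          then have "cmod ((exp (- (of_real h * lam i n)) - 1) / of_real h) \<le> exp \<kappa> * cmod (lam i n)"
            using elim by (simp add: norm_divide norm_mult field_simps)
          then have "cmod ((exp (- (of_real h * lam i n)) - 1) / of_real h + lam i n) \<le> (exp \<kappa> + 1) * cmod (lam i n)"
            by (intro norm_triangle_le) (simp add: distrib_right)
          then have "cmod ((exp (- (of_real h * lam i n)) - 1) / of_real h + lam i n) * cmod (fourier_coeff n (F $ i)) \<le> (exp \<kappa> + 1) * cmod (lam i n) * cmod (fourier_coeff n (F $ i))"
            by (rule mult_right_mono) simp
          then show "cmod (fourier_coeff n (((S h F - F) /\<^sub>R h) $ i - H $ i)) \<le> (exp \<kappa> + 1) * cmod (fourier_coeff n (H $ i))"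
            unfolding fc[OF elim(2)] by (simp add: norm_mult H G[OF F] mult.assoc)
        qed
      qed
    next
      fix n
      have "((\<lambda>h. ((exp (- (of_real h * lam i n)) - 1) / of_real h + lam i n) * fourier_coeff n (F $ i)) \<longlongrightarrow> 0) (at_right 0)"
        using tendsto_mult[OF tendsto_add[OF exp_difference_quotient[of "lam i n"] tendsto_const[of "lam i n"]] tendsto_const[of "fourier_coeff n (F $ i)"]]
        by simp
      then show "((\<lambda>h. fourier_coeff n (((S h F - F) /\<^sub>R h) $ i - H $ i)) \<longlongrightarrow> 0) (at_right 0)"
        by (rule Lim_transform_eventually)
           (use eventually_at_right_less[of 0] in eventually_elim, simp only: fc)
    qed
    then show "((\<lambda>h. ((S h F - F) /\<^sub>R h) $ i) \<longlongrightarrow> H $ i) (at_right 0)" by (simp only: LIM_zero_iff)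
  qed
qed

end

section \<open>Controls as curves in \<open>l2\<close> and the weak Duhamel integral\<close>

lemma sums_int_decode:
  fixes f :: "int \<Rightarrow> 'a::{topological_comm_monoid_add, t2_space}"
  assumes "(f has_sum s) UNIV"
  shows "(\<lambda>j. f (int_decode j)) sums s"
proof -
  have "((f \<circ> int_decode) has_sum s) UNIV"
    using assms by (subst has_sum_reindex[symmetric]) (simp_all add: inj_int_decode surj_int_decode)
  then show ?thesis by (intro has_sum_imp_sums) (simp add: comp_def)
qed

text \<open>Expand the integral of (\<mu> g - m)^2, with \<mu> the total mass and m the integral of
  g.\<close>

lemma (in finite_measure) integral_Cauchy_Schwarz_const:
  fixes g :: "'a \<Rightarrow> real"
  assumes g: "integrable M g" "integrable M (\<lambda>x. (g x)\<^sup>2)"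
  shows "(\<integral>x. g x \<partial>M)\<^sup>2 \<le> measure M (space M) * (\<integral>x. (g x)\<^sup>2 \<partial>M)"
proof (cases "measure M (space M) = 0")
  case True
  then have "emeasure M (space M) = 0" by (simp add: emeasure_eq_measure)
  then have "AE x in M. g x = 0" by (intro AE_I'[of "space M"]) (auto simp: null_setsI)
  then have "(\<integral>x. g x \<partial>M) = 0" by (rule integral_eq_zero_AE)
  then show ?thesis by (simp add: True)
next
  case False
  define \<mu> where "\<mu> = measure M (space M)"
  have mu: "\<mu> > 0" using False by (simp add: \<mu>_def order.strict_iff_order)
  define m where "m = (\<integral>x. g x \<partial>M)"
  have "0 \<le> (\<integral>x. (\<mu> * g x - m)\<^sup>2 \<partial>M)" by simp
  also have "\<dots> = (\<integral>x. (\<mu>\<^sup>2 * (g x)\<^sup>2 - (2 * \<mu> * m) * g x) + m\<^sup>2 \<partial>M)"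
    by (simp add: power2_diff power_mult_distrib algebra_simps)
  also have "\<dots> = (\<mu>\<^sup>2 * (\<integral>x. (g x)\<^sup>2 \<partial>M) - (2 * \<mu> * m) * m) + \<mu> * m\<^sup>2"
    using g by (simp add: m_def \<mu>_def)
  also have "\<dots> = \<mu> * (\<mu> * (\<integral>x. (g x)\<^sup>2 \<partial>M) - m\<^sup>2)" by (simp add: power2_eq_square algebra_simps)
  finally have "0 \<le> \<mu> * (\<integral>x. (g x)\<^sup>2 \<partial>M) - m\<^sup>2" using mu by (simp add: zero_le_mult_iff)
  then show ?thesis by (simp add: m_def \<mu>_def)
qed

text \<open>By the default of \<open>to_l2\<close> the slice is 0 at times where the section is not
  square integrable; for square-integrable u these times form a null set.\<close>

definition slice :: "(real \<times> torus \<Rightarrow> real) \<Rightarrow> real \<Rightarrow> l2" where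
  "slice u s = to_l2 (\<lambda>X. u (s, X))"

lemma square_integrable_slice_iff:
  assumes "square_integrable (lborel \<Otimes>\<^sub>M torus_measure) u"
  shows "square_integrable torus_measure (\<lambda>X. u (s, X)) \<longleftrightarrow> (\<integral>\<^sup>+X. ennreal ((u (s, X))\<^sup>2) \<partial>torus_measure) < \<infinity>"
proof -
  have [measurable]: "u \<in> borel_measurable (lborel \<Otimes>\<^sub>M torus_measure)" using assms by (simp add: square_integrable_def)
  have "(\<lambda>X. u (s, X)) \<in> borel_measurable torus_measure" by measurable
  then show ?thesis by (auto simp: square_integrable_def integrable_iff_bounded)
qed

lemma fourier_coeff_slice:
  "square_integrable torus_measure (\<lambda>X. u (s, X)) \<Longrightarrow>
   fourier_coeff n (slice u s) = 1 / (2 * of_real pi) * (\<integral>X. of_real (u (s, X)) * torus_exp (- n) X \<partial>torus_measure)"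
  by (simp add: slice_def fourier_coeff_to_l2)

lemma measurable_fourier_coeff_slice:
  assumes u: "square_integrable (lborel \<Otimes>\<^sub>M torus_measure) u"
  shows "(\<lambda>s. fourier_coeff n (slice u s)) \<in> borel_measurable borel"
proof -
  have [measurable]: "u \<in> borel_measurable (lborel \<Otimes>\<^sub>M torus_measure)" using u by (simp add: square_integrable_def)
  have "(\<lambda>s. fourier_coeff n (slice u s)) = (\<lambda>s. if (\<integral>\<^sup>+X. ennreal ((u (s, X))\<^sup>2) \<partial>torus_measure) < \<infinity>
     then 1 / (2 * of_real pi) * (\<integral>X. of_real (u (s, X)) * torus_exp (- n) X \<partial>torus_measure) else 0)"
    using square_integrable_slice_iff[OF u] fourier_coeff_slice
    by (auto simp: fun_eq_iff slice_def to_l2_not_square_integrable)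
  also have "\<dots> \<in> borel_measurable lborel" by measurable
  finally show ?thesis by simp
qed

lemma norm_slice_le:
  assumes u: "square_integrable (lborel \<Otimes>\<^sub>M torus_measure) u"
  shows "ennreal ((norm (slice u s))\<^sup>2) \<le> (\<integral>\<^sup>+X. ennreal ((u (s, X))\<^sup>2) \<partial>torus_measure)"
proof (cases "square_integrable torus_measure (\<lambda>X. u (s, X))")
  case True
  then show ?thesis
    by (subst nn_integral_eq_integral) (auto simp: slice_def norm_to_l2 square_integrable_def)
next
  case False
  then show ?thesis by (simp add: slice_def to_l2_not_square_integrable)
qed

lemma norm_slice_sums:
  "(\<lambda>j. (cmod (fourier_coeff (int_decode j) (slice u s)))\<^sup>2) sums ((norm (slice u s))\<^sup>2 / (2 * pi))"
  by (rule sums_int_decode[OF parseval])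

lemma integrable_norm_slice:
  assumes u: "square_integrable (lborel \<Otimes>\<^sub>M torus_measure) u"
  shows "integrable lborel (\<lambda>s. (norm (slice u s))\<^sup>2 / (2 * pi))"
proof -
  have [measurable]: "u \<in> borel_measurable (lborel \<Otimes>\<^sub>M torus_measure)"
    "(\<lambda>s. fourier_coeff n (slice u s)) \<in> borel_measurable borel" for n
    using u measurable_fourier_coeff_slice[OF u] by (auto simp: square_integrable_def)
  have "(\<lambda>s. (norm (slice u s))\<^sup>2 / (2 * pi)) = (\<lambda>s. \<Sum>j. (cmod (fourier_coeff (int_decode j) (slice u s)))\<^sup>2)"
    using norm_slice_sums[of u] by (simp add: sums_iff fun_eq_iff)
  also have "\<dots> \<in> borel_measurable lborel" by measurable
  finally have m: "(\<lambda>s. (norm (slice u s))\<^sup>2 / (2 * pi)) \<in> borel_measurable lborel" .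
  have "(\<lambda>s. (2 * pi) * ((norm (slice u s))\<^sup>2 / (2 * pi))) \<in> borel_measurable lborel"
    using m by (rule borel_measurable_times[OF borel_measurable_const])
  then have m': "(\<lambda>s. (norm (slice u s))\<^sup>2) \<in> borel_measurable lborel" by simp
  have "(\<integral>\<^sup>+s. ennreal ((norm (slice u s))\<^sup>2) \<partial>lborel) \<le> (\<integral>\<^sup>+s. (\<integral>\<^sup>+X. ennreal ((u (s, X))\<^sup>2) \<partial>torus_measure) \<partial>lborel)"
    by (intro nn_integral_mono norm_slice_le u)
  also have "\<dots> = (\<integral>\<^sup>+z. ennreal ((u z)\<^sup>2) \<partial>(lborel \<Otimes>\<^sub>M torus_measure))"
    by (rule torus_measure.nn_integral_fst) measurable
  also have "\<dots> < \<infinity>" using u by (auto simp: square_integrable_def integrable_iff_bounded)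
  finally have "integrable lborel (\<lambda>s. (norm (slice u s))\<^sup>2)"
    using m' by (intro integrableI_nonneg) auto
  then show ?thesis by simp
qed

lemma has_bochner_integral_lebesgue_on:
  fixes g :: "real \<Rightarrow> real"
  assumes g: "has_bochner_integral (restrict_space lborel A) g i" and A: "A \<in> sets borel"
  shows "has_bochner_integral (lebesgue_on A) g i"
proof -
  have "integrable (restrict_space lborel A) g" "integral\<^sup>L (restrict_space lborel A) g = i"
    using g by (auto simp: has_bochner_integral_iff)
  then have 1: "integrable lborel (\<lambda>x. indicator A x *\<^sub>R g x)" "(\<integral>x. indicator A x *\<^sub>R g x \<partial>lborel) = i"
    using A by (simp_all add: integrable_restrict_space integral_restrict_space)
  then have "integrable lebesgue (\<lambda>x. indicator A x *\<^sub>R g x)" "(\<integral>x. indicator A x *\<^sub>R g x \<partial>lebesgue) = i"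
    by (simp_all add: integrable_completion integral_completion borel_measurable_integrable)
  then show ?thesis
    using A by (simp add: has_bochner_integral_iff integrable_restrict_space integral_restrict_space)
qed

lemma integrable_restrict_interval:
  fixes g :: "real \<Rightarrow> 'b::{banach, second_countable_topology}"
  assumes "integrable lborel g" "A \<in> sets borel"
  shows "integrable (restrict_space lborel A) g"
  using integrable_mult_indicator[of A lborel g] assms by (simp add: integrable_restrict_space)

text \<open>The vector y is defined by its Fourier coefficients through Riesz-Fischer;
  Cauchy-Schwarz in time makes them square summable. The weak identity then follows by integrating
  the Parseval series term by term.\<close>

lemma weak_integral_multiplier:
  fixes m :: "int \<Rightarrow> real \<Rightarrow> complex"
  assumes u: "square_integrable (lborel \<Otimes>\<^sub>M torus_measure) u" and t: "0 \<le> t"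
    and mm: "\<And>n. m n \<in> borel_measurable borel"
    and mb: "\<And>s. s \<in> {0<..<t} \<Longrightarrow> bounded_multiplier (\<lambda>n. m n s) K" and K: "K \<ge> 0"
  shows "\<exists>y. (\<forall>n. fourier_coeff n y = (\<integral>s. m n s * fourier_coeff n (slice u s) \<partial>restrict_space lborel {0<..<t})) \<and>
    (\<forall>v. has_bochner_integral (restrict_space lborel {0<..<t}) (\<lambda>s. inner (mult_op (\<lambda>n. m n s) (slice u s)) v) (inner y v))"
proof -
  define M where "M = restrict_space lborel {0<..<t}"
  interpret M: finite_measure M
    by standard (use t in \<open>simp add: M_def space_restrict_space emeasure_restrict_space\<close>)
  have M_space: "space M = {0<..<t}" by (simp add: M_def space_restrict_space)
  have M_t: "measure M (space M) = t" using t by (simp add: M_space M_def measure_restrict_space)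
  have M_borel: "f \<in> borel_measurable borel \<Longrightarrow> f \<in> borel_measurable M" for f :: "real \<Rightarrow> 'b::topological_space"
    unfolding M_def by (rule measurable_restrict_space1) simp
  define e where "e = int_decode"
  define c where "c n s = fourier_coeff n (slice u s)" for n s
  have [measurable]: "c n \<in> borel_measurable M" "m n \<in> borel_measurable M" for n
    using measurable_fourier_coeff_slice[OF u, of n] mm[of n] by (auto simp: c_def[abs_def] intro!: M_borel)
  have m_le: "cmod (m n s) \<le> K" if "s \<in> space M" for n s
    using bounded_multiplier.bound[OF mb] that by (simp add: M_space)
  define N where "N s = (norm (slice u s))\<^sup>2 / (2 * pi)" for s
  have N: "integrable M N" unfolding M_def N_def
    by (intro integrable_restrict_interval integrable_norm_slice u) simp
  define b where "b j s = (cmod (c (e j) s))\<^sup>2" for j s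
  have [measurable]: "b j \<in> borel_measurable M" for j unfolding b_def by measurable
  have b_sums: "(\<lambda>j. b j s) sums N s" for s
    unfolding b_def c_def e_def N_def by (rule norm_slice_sums)
  have b_nonneg: "0 \<le> b j s" for j s by (simp add: b_def)
  have bN: "(\<Sum>j<k. b j s) \<le> N s" for k s
    using sum_le_suminf[of "\<lambda>j. b j s" "{..<k}"] b_sums[of s] b_nonneg by (simp add: sums_iff)
  have b_int: "integrable M (b j)" for j
  proof (rule Bochner_Integration.integrable_bound[OF N])
    have "b j s \<le> N s" for s
      using bN[of s "Suc j"] b_nonneg sum_nonneg[of "{..<j}" "\<lambda>j. b j s"] by simp
    then show "AE s in M. norm (b j s) \<le> norm (N s)" using b_nonneg by (auto simp: N_def)
  qed simp
  have b_summ: "summable (\<lambda>j. \<integral>s. b j s \<partial>M)"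
  proof (rule summableI_nonneg_bounded)
    show "0 \<le> (\<integral>s. b j s \<partial>M)" for j using b_nonneg by simp
    show "(\<Sum>j<k. \<integral>s. b j s \<partial>M) \<le> (\<integral>s. N s \<partial>M)" for k
    proof -
      have "(\<Sum>j<k. \<integral>s. b j s \<partial>M) = (\<integral>s. (\<Sum>j<k. b j s) \<partial>M)"
        by (rule Bochner_Integration.integral_sum[symmetric]) (rule b_int)
      also have "\<dots> \<le> (\<integral>s. N s \<partial>M)"
        using bN b_int N by (intro integral_mono Bochner_Integration.integrable_sum) auto
      finally show ?thesis .
    qed
  qed
  have c_int: "integrable M (\<lambda>s. cmod (c (e j) s))" for j
  proof (rule Bochner_Integration.integrable_bound)
    show "integrable M (\<lambda>s. 1 + b j s)" using b_int by simp
    have "x \<le> 1 + x\<^sup>2" for x :: real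
      using sum_squares_bound[of 1 x] zero_le_power2[of x] by (simp add: power2_eq_square) (smt (verit) zero_le_square)
    then show "AE s in M. norm (cmod (c (e j) s)) \<le> norm (1 + b j s)" by (auto simp: b_def)
  qed measurable
  define y where "y n = (\<integral>s. m n s * c n s \<partial>M)" for n
  have mc_int: "integrable M (\<lambda>s. m (e j) s * c (e j) s)" for j
  proof (rule Bochner_Integration.integrable_bound)
    show "integrable M (\<lambda>s. K * cmod (c (e j) s))" using c_int by simp
    show "AE s in M. norm (m (e j) s * c (e j) s) \<le> norm (K * cmod (c (e j) s))"
      using m_le K by (auto simp: norm_mult intro!: AE_I2 mult_right_mono)
  qed measurable
  have y_le: "(cmod (y (e j)))\<^sup>2 \<le> K\<^sup>2 * t * (\<integral>s. b j s \<partial>M)" for j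
  proof -
    have "cmod (y (e j)) \<le> (\<integral>s. cmod (m (e j) s * c (e j) s) \<partial>M)"
      unfolding y_def by (rule Bochner_Integration.integral_norm_bound)
    also have "\<dots> \<le> (\<integral>s. K * cmod (c (e j) s) \<partial>M)"
      using mc_int c_int m_le by (intro integral_mono integrable_norm) (auto simp: norm_mult intro!: mult_right_mono)
    finally have "cmod (y (e j)) \<le> K * (\<integral>s. cmod (c (e j) s) \<partial>M)" by simp
    then have "(cmod (y (e j)))\<^sup>2 \<le> (K * (\<integral>s. cmod (c (e j) s) \<partial>M))\<^sup>2" by (intro power_mono) auto
    also have "\<dots> = K\<^sup>2 * (\<integral>s. cmod (c (e j) s) \<partial>M)\<^sup>2" by (simp add: power_mult_distrib)
    also have "\<dots> \<le> K\<^sup>2 * (t * (\<integral>s. b j s \<partial>M))"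
      using M.integral_Cauchy_Schwarz_const[OF c_int[of j]] b_int[of j]
      by (intro mult_left_mono) (auto simp: b_def[abs_def] M_t)
    finally show ?thesis by (simp add: mult.assoc)
  qed
  have "summable (\<lambda>j. (cmod (y (e j)))\<^sup>2)"
    by (rule summable_comparison_test'[of "\<lambda>j. K\<^sup>2 * t * (\<integral>s. b j s \<partial>M)" 0])
       (use y_le b_summ in \<open>auto intro: summable_mult\<close>)
  then have "((\<lambda>n. (cmod (y n))\<^sup>2) \<circ> e) summable_on UNIV"
    by (intro norm_summable_imp_summable_on) (simp add: comp_def)
  then have "(\<lambda>n. (cmod (y n))\<^sup>2) summable_on UNIV"
    using summable_on_reindex[of int_decode UNIV "\<lambda>n. (cmod (y n))\<^sup>2", OF inj_int_decode]
    by (simp add: e_def surj_int_decode)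
  moreover have "y (- n) = cnj (y n)" for n
  proof -
    have "m (- n) s * c (- n) s = cnj (m n s * c n s)" if "s \<in> space M" for s
      using bounded_multiplier.sym[OF mb] that by (simp add: M_space c_def fourier_coeff_uminus)
    then have "y (- n) = (\<integral>s. cnj (m n s * c n s) \<partial>M)"
      unfolding y_def by (intro Bochner_Integration.integral_cong) auto
    then show ?thesis by (simp only: Bochner_Integration.integral_cnj y_def)
  qed
  ultimately obtain Y where Y: "\<And>n. fourier_coeff n Y = y n" using riesz_fischer[of y] by blast
  have "has_bochner_integral M (\<lambda>s. inner (mult_op (\<lambda>n. m n s) (slice u s)) v) (inner Y v)" for v
  proof -
    define d where "d j = fourier_coeff (e j) v" for j
    define f where "f j s = Re (m (e j) s * c (e j) s * cnj (d j))" for j s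
    have d_summ: "summable (\<lambda>j. (cmod (d j))\<^sup>2)"
      using sums_int_decode[OF parseval[of v]] by (simp add: sums_iff d_def e_def)
    \<comment> \<open>This majorant is summable for each s and remains summable after integration
      over time, which is what termwise integration asks for.\<close>
    have f_le: "norm (f j s) \<le> K * (b j s + (cmod (d j))\<^sup>2)" if "s \<in> space M" for j s
    proof -
      have "norm (f j s) \<le> cmod (m (e j) s * c (e j) s * cnj (d j))"
        unfolding f_def real_norm_def by (rule abs_Re_le_cmod)
      also have "\<dots> = cmod (m (e j) s) * (cmod (c (e j) s) * cmod (d j))" by (simp add: norm_mult mult.assoc)
      also have "\<dots> \<le> K * (cmod (c (e j) s) * cmod (d j))" using m_le[OF that] by (intro mult_right_mono) auto
      also have "\<dots> \<le> K * (b j s + (cmod (d j))\<^sup>2)"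
      proof (intro mult_left_mono K)
        have "0 \<le> cmod (c (e j) s) * cmod (d j)" by simp
        then show "cmod (c (e j) s) * cmod (d j) \<le> b j s + (cmod (d j))\<^sup>2"
          using sum_squares_bound[of "cmod (c (e j) s)" "cmod (d j)"] unfolding b_def by linarith
      qed
      finally show ?thesis .
    qed
    have f_int: "integrable M (f j)" for j
      unfolding f_def using mc_int by (intro integrable_Re integrable_mult_left) auto
    have f_summ: "summable (\<lambda>j. norm (f j s))" if "s \<in> space M" for s
      by (rule summable_comparison_test'[of "\<lambda>j. K * (b j s + (cmod (d j))\<^sup>2)" 0])
         (use f_le[OF that] b_sums[of s] d_summ in \<open>auto intro!: summable_mult summable_add simp: sums_iff\<close>)
    have f_summ2: "summable (\<lambda>j. \<integral>s. norm (f j s) \<partial>M)"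
    proof (rule summable_comparison_test'[of "\<lambda>j. K * ((\<integral>s. b j s \<partial>M) + t * (cmod (d j))\<^sup>2)" 0])
      show "summable (\<lambda>j. K * ((\<integral>s. b j s \<partial>M) + t * (cmod (d j))\<^sup>2))"
        by (intro summable_mult summable_add b_summ d_summ)
      fix j
      have "(\<integral>s. norm (f j s) \<partial>M) \<le> (\<integral>s. K * (b j s + (cmod (d j))\<^sup>2) \<partial>M)"
        using f_int b_int f_le by (intro integral_mono integrable_norm) auto
      also have "\<dots> = K * ((\<integral>s. b j s \<partial>M) + t * (cmod (d j))\<^sup>2)"
        using b_int by (simp add: M_t)
      finally show "norm (\<integral>s. norm (f j s) \<partial>M) \<le> K * ((\<integral>s. b j s \<partial>M) + t * (cmod (d j))\<^sup>2)" by simp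
    qed
    have inner_eq: "inner (mult_op (\<lambda>n. m n s) (slice u s)) v / (2 * pi) = (\<Sum>j. f j s)" if "s \<in> space M" for s
      using sums_int_decode[OF parseval_inner[of "mult_op (\<lambda>n. m n s) (slice u s)" v]]
        bounded_multiplier.fourier_coeff[OF mb] that
      by (simp add: sums_iff f_def c_def d_def e_def M_space del: times_complex.sel)
    have "AE s in M. summable (\<lambda>j. norm (f j s))" using f_summ by (intro AE_I2)
    note * = f_int this f_summ2
    have 1: "integrable M (\<lambda>s. \<Sum>j. f j s)" by (rule integrable_suminf[OF *])
    have 2: "(\<lambda>j. \<integral>s. f j s \<partial>M) sums (\<integral>s. (\<Sum>j. f j s) \<partial>M)" by (rule sums_integral[OF *])
    have "(\<integral>s. f j s \<partial>M) = Re (fourier_coeff (e j) Y * cnj (d j))" for j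
      unfolding f_def Y y_def using mc_int[of j]
      by (subst integral_Re) auto
    then have "(\<lambda>j. Re (fourier_coeff (e j) Y * cnj (d j))) sums (\<integral>s. (\<Sum>j. f j s) \<partial>M)" using 2 by simp
    then have 3: "(\<integral>s. (\<Sum>j. f j s) \<partial>M) = inner Y v / (2 * pi)"
      using sums_int_decode[OF parseval_inner[of Y v]] sums_unique2 unfolding d_def e_def by blast
    have "has_bochner_integral M (\<lambda>s. \<Sum>j. f j s) (inner Y v / (2 * pi))"
      using 1 3 by (simp add: has_bochner_integral_iff)
    then have "has_bochner_integral M (\<lambda>s. (2 * pi) * (\<Sum>j. f j s)) ((2 * pi) * (inner Y v / (2 * pi)))"
      by (rule has_bochner_integral_mult_right)
    moreover have "(2 * pi) * (\<Sum>j. f j s) = inner (mult_op (\<lambda>n. m n s) (slice u s)) v" if "s \<in> space M" for s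
      using inner_eq[OF that] by (simp add: field_simps)
    ultimately show ?thesis
      by (subst has_bochner_integral_cong[OF refl _ refl, where g = "\<lambda>s. (2 * pi) * (\<Sum>j. f j s)"]) auto
  qed
  then show ?thesis using Y unfolding y_def c_def M_def by blast
qed

context fourier_system
begin

text \<open>The coefficients of the state are recorded together with the weak integral, so that the
  final state can be read off frequency by frequency.\<close>

lemma duhamel:
  assumes u: "square_integrable (lborel \<Otimes>\<^sub>M torus_measure) u" and t: "0 \<le> t"
  shows "\<exists>G. has_hilbert_integral (\<lambda>s. S (t - s) (\<chi> i. slice u s)) (G - S t F0) {0<..<t} \<and>
    (\<forall>i n. fourier_coeff n (G $ i) = exp (- (of_real t * lam i n)) * fourier_coeff n (F0 $ i) +
       (\<integral>s. exp (- (of_real (t - s) * lam i n)) * fourier_coeff n (slice u s) \<partial>restrict_space lborel {0<..<t}))"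
proof -
  define Q where "Q i y \<longleftrightarrow> (\<forall>n. fourier_coeff n y = (\<integral>s. exp (- (of_real (t - s) * lam i n)) * fourier_coeff n (slice u s) \<partial>restrict_space lborel {0<..<t})) \<and>
    (\<forall>v. has_bochner_integral (restrict_space lborel {0<..<t}) (\<lambda>s. inner (mult_op (\<lambda>n. exp (- (of_real (t - s) * lam i n))) (slice u s)) v) (inner y v))" for i y
  have "\<exists>y. Q i y" for i
    unfolding Q_def
  proof (rule weak_integral_multiplier[OF u t, where K = "exp (\<kappa> * t)"])
    show "bounded_multiplier (\<lambda>n. exp (- (of_real (t - s) * lam i n))) (exp (\<kappa> * t))" if "s \<in> {0<..<t}" for s
    proof
      have s: "0 \<le> t - s" "t - s \<le> t" using that by auto
      show "exp (- (of_real (t - s) * lam i (- n))) = cnj (exp (- (of_real (t - s) * lam i n)))" for n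
        by (rule bounded_multiplier.sym[OF mult[OF s(1)]])
      show "cmod (exp (- (of_real (t - s) * lam i n))) \<le> exp (\<kappa> * t)" for n
        by (rule order_trans[OF exp_bound[OF s(1)]]) (use s \<kappa>_nonneg in \<open>auto intro!: mult_left_mono\<close>)
    qed
    show "(\<lambda>s. exp (- (of_real (t - s) * lam i n))) \<in> borel_measurable borel" for n
      by (intro borel_measurable_continuous_onI continuous_intros)
  qed simp
  then obtain y where "\<And>i. Q i (y i)" by metis
  then have y: "fourier_coeff n (y i) = (\<integral>s. exp (- (of_real (t - s) * lam i n)) * fourier_coeff n (slice u s) \<partial>restrict_space lborel {0<..<t})"
    and y2: "has_bochner_integral (restrict_space lborel {0<..<t}) (\<lambda>s. inner (mult_op (\<lambda>n. exp (- (of_real (t - s) * lam i n))) (slice u s)) v) (inner (y i) v)" for i n v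
    unfolding Q_def by blast+
  define Y where "Y = (\<chi> i. y i)"
  have "has_hilbert_integral (\<lambda>s. S (t - s) (\<chi> i. slice u s)) Y {0<..<t}"
    unfolding has_hilbert_integral_def
  proof
    fix v
    have "has_bochner_integral (lebesgue_on {0<..<t}) (\<lambda>s. \<Sum>i\<in>UNIV. inner (mult_op (\<lambda>n. exp (- (of_real (t - s) * lam i n))) (slice u s)) (v $ i)) (\<Sum>i\<in>UNIV. inner (y i) (v $ i))"
      by (intro has_bochner_integral_sum has_bochner_integral_lebesgue_on y2) simp
    then show "has_bochner_integral (lebesgue_on {0<..<t}) (\<lambda>s. inner (S (t - s) (\<chi> i. slice u s)) v) (inner Y v)"
      by (simp add: inner_vec_def S_def Y_def)
  qed
  then show ?thesis
    by (intro exI[of _ "Y + S t F0"]) (simp add: fourier_S t Y_def y)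
qed

end

subsection \<open>Steering as a moment problem\<close>

lemma pair_sigma_finite_lborel_torus: "pair_sigma_finite lborel torus_measure"
  by (intro pair_sigma_finite.intro lborel.sigma_finite_measure_axioms torus_measure.sigma_finite_measure_axioms)

lemma integrable_time_strip:
  fixes T :: real
  shows "integrable (lborel \<Otimes>\<^sub>M torus_measure) (indicator ({0<..<T} \<times> UNIV) :: _ \<Rightarrow> real)"
proof -
  have "emeasure (lborel \<Otimes>\<^sub>M torus_measure) ({0<..<T} \<times> UNIV) = emeasure lborel {0<..<T} * emeasure torus_measure UNIV"
    by (rule torus_measure.emeasure_pair_measure_Times) auto
  also have "\<dots> < \<infinity>" by (cases "0 \<le> T") (auto simp: emeasure_torus_UNIV ennreal_mult_less_top)
  finally show ?thesis
    by (intro integrable_real_indicator pair_measureI) auto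
qed

lemma norm_exp_mult_torus_exp_le:
  assumes "s \<in> {0<..<T}"
  shows "cmod (exp (of_real s * l) * torus_exp n Z) \<le> exp (\<bar>Re l\<bar> * T)"
  using assms order_trans[OF abs_ge_self[of "s * Re l"]] mult_left_mono[of s T "\<bar>Re l\<bar>"]
  by (simp add: norm_mult abs_mult mult.commute)

lemma integrable_control_weight:
  fixes u :: "real \<times> torus \<Rightarrow> real" and w :: "real \<times> torus \<Rightarrow> complex"
  assumes u: "square_integrable (lborel \<Otimes>\<^sub>M torus_measure) u"
    and supp: "\<And>s X. u (s, X) \<noteq> 0 \<Longrightarrow> s \<in> {0<..<T}"
    and w: "w \<in> borel_measurable (lborel \<Otimes>\<^sub>M torus_measure)" "\<And>s X. s \<in> {0<..<T} \<Longrightarrow> cmod (w (s, X)) \<le> C"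
  shows "integrable (lborel \<Otimes>\<^sub>M torus_measure) (\<lambda>z. of_real (u z) * w z)"
proof (rule Bochner_Integration.integrable_bound)
  have [measurable]: "u \<in> borel_measurable (lborel \<Otimes>\<^sub>M torus_measure)" using u by (simp add: square_integrable_def)
  note [measurable] = w(1)
  show "(\<lambda>z. of_real (u z) * w z) \<in> borel_measurable (lborel \<Otimes>\<^sub>M torus_measure)" by measurable
  show "integrable (lborel \<Otimes>\<^sub>M torus_measure) (\<lambda>z. C * (indicator ({0<..<T} \<times> UNIV) z + (u z)\<^sup>2))"
    using u by (intro integrable_mult_right Bochner_Integration.integrable_add integrable_time_strip) (auto simp: square_integrable_def)
  have "norm (of_real (u z) * w z) \<le> norm (C * (indicator ({0<..<T} \<times> UNIV) z + (u z)\<^sup>2))" for z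
  proof (cases z)
    case (Pair s X)
    show ?thesis
    proof (cases "u (s, X) = 0")
      case False
      then have s: "s \<in> {0<..<T}" by (rule supp)
      have C: "0 \<le> C" using w(2)[OF s, of X] norm_ge_zero order_trans by blast
      have "x \<le> 1 + x\<^sup>2" for x :: real
      proof -
        have "0 \<le> (x - 1)\<^sup>2" by simp
        then have "2 * x \<le> x\<^sup>2 + 1" by (simp add: power2_diff)
        moreover have "0 \<le> x\<^sup>2" by simp
        ultimately show ?thesis by linarith
      qed
      from this[of "\<bar>u (s, X)\<bar>"] have le: "\<bar>u (s, X)\<bar> \<le> 1 + (u (s, X))\<^sup>2" by simp
      have "\<bar>u (s, X)\<bar> * cmod (w (s, X)) \<le> (1 + (u (s, X))\<^sup>2) * C"
        by (intro mult_mono le w(2) s) auto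
      then show ?thesis using s C by (simp add: Pair norm_mult mult.commute)
    qed (simp add: Pair)
  qed
  then show "AE z in lborel \<Otimes>\<^sub>M torus_measure. norm (of_real (u z) * w z) \<le> norm (C * (indicator ({0<..<T} \<times> UNIV) z + (u z)\<^sup>2))"
    by simp
qed

text \<open>Fubini, after discarding the null set of times whose section is not square integrable.
  The factor 2 pi undoes the normalization of \<open>fourier_coeff\<close>.\<close>

lemma slice_moment:
  assumes u: "square_integrable (lborel \<Otimes>\<^sub>M torus_measure) u"
    and supp: "\<And>s X. u (s, X) \<noteq> 0 \<Longrightarrow> s \<in> {0<..<T}"
  shows "(\<integral>z. of_real (u z) * (exp (of_real (fst z) * l) * torus_exp (- n) (snd z)) \<partial>(lborel \<Otimes>\<^sub>M torus_measure))
    = 2 * pi * (\<integral>s. exp (of_real s * l) * fourier_coeff n (slice u s) \<partial>restrict_space lborel {0<..<T})"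
proof -
  interpret pair_sigma_finite lborel torus_measure by (rule pair_sigma_finite_lborel_torus)
  have um [measurable]: "u \<in> borel_measurable (lborel \<Otimes>\<^sub>M torus_measure)" using u by (simp add: square_integrable_def)
  let ?g = "\<lambda>z. of_real (u z) * (exp (of_real (fst z) * l) * torus_exp (- n) (snd z))"
  have int: "integrable (lborel \<Otimes>\<^sub>M torus_measure) ?g"
  proof (rule integrable_control_weight[OF u supp, where C = "exp (\<bar>Re l\<bar> * T)"])
    show "(\<lambda>z. exp (of_real (fst z) * l) * torus_exp (- n) (snd z)) \<in> borel_measurable (lborel \<Otimes>\<^sub>M torus_measure)"
      by measurable
    show "cmod (exp (of_real (fst (s, X)) * l) * torus_exp (- n) (snd (s, X))) \<le> exp (\<bar>Re l\<bar> * T)" if "s \<in> {0<..<T}" for s X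
      using norm_exp_mult_torus_exp_le[OF that] by simp
  qed
  have "(\<integral>\<^sup>+s. (\<integral>\<^sup>+X. ennreal ((u (s, X))\<^sup>2) \<partial>torus_measure) \<partial>lborel) = (\<integral>\<^sup>+z. ennreal ((u z)\<^sup>2) \<partial>(lborel \<Otimes>\<^sub>M torus_measure))"
    by (rule torus_measure.nn_integral_fst) measurable
  also have "\<dots> \<noteq> \<infinity>" using u by (auto simp: square_integrable_def integrable_iff_bounded)
  finally have "AE s in lborel. (\<integral>\<^sup>+X. ennreal ((u (s, X))\<^sup>2) \<partial>torus_measure) \<noteq> \<infinity>"
    by (intro nn_integral_noteq_infinite) measurable
  then have AEs: "AE s in lborel. square_integrable torus_measure (\<lambda>X. u (s, X))"
    by eventually_elim (simp add: square_integrable_slice_iff[OF u] less_top)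
  have [measurable]: "(\<lambda>s. fourier_coeff n (slice u s)) \<in> borel_measurable borel" by (rule measurable_fourier_coeff_slice[OF u])
  have "(\<integral>z. ?g z \<partial>(lborel \<Otimes>\<^sub>M torus_measure)) = (\<integral>s. (\<integral>X. ?g (s, X) \<partial>torus_measure) \<partial>lborel)"
    by (rule integral_fst'[OF int, symmetric])
  also have "\<dots> = (\<integral>s. 2 * pi * (indicator {0<..<T} s *\<^sub>R (exp (of_real s * l) * fourier_coeff n (slice u s))) \<partial>lborel)"
  proof (rule integral_cong_AE)
    show "(\<lambda>s. \<integral>X. ?g (s, X) \<partial>torus_measure) \<in> borel_measurable lborel" by measurable
    show "(\<lambda>s. 2 * pi * (indicator {0<..<T} s *\<^sub>R (exp (of_real s * l) * fourier_coeff n (slice u s)))) \<in> borel_measurable lborel"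
      by measurable
    show "AE s in lborel. (\<integral>X. ?g (s, X) \<partial>torus_measure) = 2 * pi * (indicator {0<..<T} s *\<^sub>R (exp (of_real s * l) * fourier_coeff n (slice u s)))"
      using AEs
    proof eventually_elim
      case (elim s)
      show ?case
      proof (cases "s \<in> {0<..<T}")
        case True
        have "(\<integral>X. ?g (s, X) \<partial>torus_measure) = (\<integral>X. exp (of_real s * l) * (of_real (u (s, X)) * torus_exp (- n) X) \<partial>torus_measure)"
          by (simp add: mult_ac)
        also have "\<dots> = exp (of_real s * l) * (2 * pi * fourier_coeff n (slice u s))"
          by (simp add: fourier_coeff_slice[OF elim])
        finally show ?thesis using True by simp
      next
        case False
        then have "u (s, X) = 0" for X using supp by blast
        then show ?thesis using False by simp
      qed
    qed
  qed
  also have "\<dots> = 2 * pi * (\<integral>s. indicator {0<..<T} s *\<^sub>R (exp (of_real s * l) * fourier_coeff n (slice u s)) \<partial>lborel)"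
    by (rule integral_mult_right_zero)
  also have "(\<integral>s. indicator {0<..<T} s *\<^sub>R (exp (of_real s * l) * fourier_coeff n (slice u s)) \<partial>lborel)
     = (\<integral>s. exp (of_real s * l) * fourier_coeff n (slice u s) \<partial>restrict_space lborel {0<..<T})"
    by (simp add: integral_restrict_space)
  finally show ?thesis .
qed

text \<open>Factor exp(- T lam) out of Duhamel's formula for the coefficients: the final state
  vanishes when the moment of the control cancels the initial coefficient.\<close>

lemma (in fourier_system) trajectory_to_0:
  assumes u: "square_integrable (lborel \<Otimes>\<^sub>M torus_measure) u" and T: "0 \<le> T"
    and supp: "\<And>s X. u (s, X) \<noteq> 0 \<Longrightarrow> s \<in> {0<..<T}"
    and mom: "\<And>i n. (\<integral>z. of_real (u z) * (exp (of_real (fst z) * lam i n) * torus_exp (- n) (snd z)) \<partial>(lborel \<Otimes>\<^sub>M torus_measure))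
       = - (2 * pi * fourier_coeff n (F0 $ i))"
  shows "\<exists>f. (\<forall>t\<in>{0..T}. has_hilbert_integral (\<lambda>s. S (t - s) (\<chi> i. slice u s)) (f t - S t F0) {0<..<t}) \<and> f T = 0"
proof -
  define Q where "Q t G \<longleftrightarrow> has_hilbert_integral (\<lambda>s. S (t - s) (\<chi> i. slice u s)) (G - S t F0) {0<..<t} \<and>
    (\<forall>i n. fourier_coeff n (G $ i) = exp (- (of_real t * lam i n)) * fourier_coeff n (F0 $ i) +
       (\<integral>s. exp (- (of_real (t - s) * lam i n)) * fourier_coeff n (slice u s) \<partial>restrict_space lborel {0<..<t}))" for t G
  have "\<exists>G. t \<ge> 0 \<longrightarrow> Q t G" for t
    using duhamel[OF u, of t F0] unfolding Q_def by blast
  then obtain f where f: "\<And>t. t \<ge> 0 \<Longrightarrow> Q t (f t)" by metis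
  have cancel: "J = - c" if "2 * pi * J = - (2 * pi * c)" for J c :: complex
  proof -
    have "(J + c) * complex_of_real pi = 0" using that by (simp add: distrib_right)
    then have "J + c = 0" by simp
    then show ?thesis by (simp add: eq_neg_iff_add_eq_0)
  qed
  have "f T = 0"
  proof (rule vec_l2_eqI)
    fix i n
    have "2 * pi * (\<integral>s. exp (of_real s * lam i n) * fourier_coeff n (slice u s) \<partial>restrict_space lborel {0<..<T}) = - (2 * pi * fourier_coeff n (F0 $ i))"
      using mom[of i n] slice_moment[OF u supp, where l = "lam i n" and n = n] by simp
    then have I: "(\<integral>s. exp (of_real s * lam i n) * fourier_coeff n (slice u s) \<partial>restrict_space lborel {0<..<T}) = - fourier_coeff n (F0 $ i)"
      by (rule cancel)
    have "exp (- (of_real (T - s) * lam i n)) * fourier_coeff n (slice u s) = exp (- (of_real T * lam i n)) * (exp (of_real s * lam i n) * fourier_coeff n (slice u s))" for s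
      by (simp add: mult_exp_exp algebra_simps flip: mult.assoc)
    then have eq: "(\<lambda>s. exp (- (of_real (T - s) * lam i n)) * fourier_coeff n (slice u s)) = (\<lambda>s. exp (- (of_real T * lam i n)) * (exp (of_real s * lam i n) * fourier_coeff n (slice u s)))"
      by (rule ext)
    have "fourier_coeff n (f T $ i) = exp (- (of_real T * lam i n)) * fourier_coeff n (F0 $ i) +
       (\<integral>s. exp (- (of_real (T - s) * lam i n)) * fourier_coeff n (slice u s) \<partial>restrict_space lborel {0<..<T})"
      using f[OF T] unfolding Q_def by blast
    then show "fourier_coeff n (f T $ i) = fourier_coeff n (0 $ i)"
      unfolding eq integral_mult_right_zero I by simp
  qed
  then show ?thesis using f unfolding Q_def by (intro exI[of _ f]) auto
qed

section \<open>Symbols of the two components and the domain of the generator\<close>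

lemma summable_fourier_dominated:
  assumes q: "(\<lambda>n. (cmod (q n * fourier_coeff n F))\<^sup>2) summable_on UNIV"
    and le: "\<And>n. cmod (p n) \<le> C1 * cmod (q n) + C2"
  shows "(\<lambda>n. (cmod (p n * fourier_coeff n F))\<^sup>2) summable_on UNIV"
proof (rule summable_on_comparison_test)
  show "(\<lambda>n. 2 * C1\<^sup>2 * (cmod (q n * fourier_coeff n F))\<^sup>2 + 2 * C2\<^sup>2 * (cmod (fourier_coeff n F))\<^sup>2) summable_on UNIV"
    by (intro summable_on_add summable_on_cmult_right q summable_fourier_coeff)
  fix n
  let ?c = "cmod (fourier_coeff n F)"
  have "cmod (p n * fourier_coeff n F) \<le> C1 * cmod (q n * fourier_coeff n F) + C2 * ?c"
    using mult_right_mono[OF le[of n], of ?c] by (simp add: norm_mult algebra_simps)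
  then have "(cmod (p n * fourier_coeff n F))\<^sup>2 \<le> (C1 * cmod (q n * fourier_coeff n F) + C2 * ?c)\<^sup>2"
    by (intro power_mono) auto
  also have "\<dots> \<le> 2 * (C1 * cmod (q n * fourier_coeff n F))\<^sup>2 + 2 * (C2 * ?c)\<^sup>2"
    using sum_squares_bound[of "C1 * cmod (q n * fourier_coeff n F)" "C2 * ?c"] unfolding power2_sum by linarith
  finally show "(cmod (p n * fourier_coeff n F))\<^sup>2 \<le> 2 * C1\<^sup>2 * (cmod (q n * fourier_coeff n F))\<^sup>2 + 2 * C2\<^sup>2 * ?c\<^sup>2"
    by (simp add: power_mult_distrib)
qed auto

text \<open>Fourier symbol of a d/dx + k; \<open>heat_symbol\<close> is that of - d d^2/dx^2 + a
  d/dx + k.\<close>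

definition transport_symbol :: "real \<Rightarrow> real \<Rightarrow> int \<Rightarrow> complex" where
  "transport_symbol a k n = \<i> * of_int n * of_real a + of_real k"

definition heat_symbol :: "real \<Rightarrow> real \<Rightarrow> real \<Rightarrow> int \<Rightarrow> complex" where
  "heat_symbol d a k n = of_real d * (of_int n)\<^sup>2 + \<i> * of_int n * of_real a + of_real k"

lemma abs_int_le_square: "\<bar>real_of_int n\<bar> \<le> (real_of_int n)\<^sup>2"
proof (cases "n = 0")
  case False
  then have "1 \<le> \<bar>real_of_int n\<bar>" by linarith
  then have "1 * \<bar>real_of_int n\<bar> \<le> \<bar>real_of_int n\<bar> * \<bar>real_of_int n\<bar>" by (intro mult_right_mono) auto
  then show ?thesis by (simp add: power2_eq_square abs_mult[symmetric])
qed simp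

lemma norm_heat_symbol_le: "0 \<le> d \<Longrightarrow> cmod (heat_symbol d a k n) \<le> (d + \<bar>a\<bar>) * (of_int n)\<^sup>2 + \<bar>k\<bar>"
proof -
  assume d: "0 \<le> d"
  have "cmod (heat_symbol d a k n) \<le> cmod (of_real d * (of_int n)\<^sup>2) + cmod (\<i> * of_int n * of_real a) + cmod (of_real k)"
    unfolding heat_symbol_def by (intro norm_triangle_le order_refl add_right_mono norm_triangle_ineq)
  also have "\<dots> = d * (of_int n)\<^sup>2 + \<bar>a\<bar> * \<bar>of_int n\<bar> + \<bar>k\<bar>"
    using d by (simp add: norm_mult norm_power mult.commute)
  also have "\<dots> \<le> d * (of_int n)\<^sup>2 + \<bar>a\<bar> * (of_int n)\<^sup>2 + \<bar>k\<bar>"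
    by (intro add_mono mult_left_mono abs_int_le_square) (use d in auto)
  finally show ?thesis by (simp add: distrib_right)
qed

lemma H1_iff_transport:
  assumes "a \<noteq> 0"
  shows "F \<in> H1 \<longleftrightarrow> (\<lambda>n. (cmod (transport_symbol a k n * fourier_coeff n F))\<^sup>2) summable_on UNIV"
  unfolding H1_iff
proof
  assume s: "(\<lambda>n. (cmod (of_int n * fourier_coeff n F))\<^sup>2) summable_on UNIV"
  show "(\<lambda>n. (cmod (transport_symbol a k n * fourier_coeff n F))\<^sup>2) summable_on UNIV"
  proof (rule summable_fourier_dominated[OF s])
    show "cmod (transport_symbol a k n) \<le> \<bar>a\<bar> * cmod (of_int n) + \<bar>k\<bar>" for n
      unfolding transport_symbol_def by (rule norm_triangle_le) (simp add: norm_mult mult.commute)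
  qed
next
  assume s: "(\<lambda>n. (cmod (transport_symbol a k n * fourier_coeff n F))\<^sup>2) summable_on UNIV"
  show "(\<lambda>n. (cmod (of_int n * fourier_coeff n F))\<^sup>2) summable_on UNIV"
  proof (rule summable_fourier_dominated[OF s])
    show "cmod (of_int n) \<le> (1 / \<bar>a\<bar>) * cmod (transport_symbol a k n) + 0" for n
      using abs_Im_le_cmod[of "transport_symbol a k n"] assms
      by (simp add: transport_symbol_def abs_mult field_simps)
  qed
qed

lemma H2_iff_heat:
  assumes "d > 0"
  shows "F \<in> H2 \<longleftrightarrow> (\<lambda>n. (cmod (heat_symbol d a k n * fourier_coeff n F))\<^sup>2) summable_on UNIV"
  unfolding H2_iff
proof
  assume s: "(\<lambda>n. (cmod ((of_int n)\<^sup>2 * fourier_coeff n F))\<^sup>2) summable_on UNIV"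
  show "(\<lambda>n. (cmod (heat_symbol d a k n * fourier_coeff n F))\<^sup>2) summable_on UNIV"
  proof (rule summable_fourier_dominated[OF s])
    show "cmod (heat_symbol d a k n) \<le> (d + \<bar>a\<bar>) * cmod ((of_int n)\<^sup>2) + \<bar>k\<bar>" for n
      using norm_heat_symbol_le[of d a k n] assms by (simp add: norm_power)
  qed
next
  assume s: "(\<lambda>n. (cmod (heat_symbol d a k n * fourier_coeff n F))\<^sup>2) summable_on UNIV"
  show "(\<lambda>n. (cmod ((of_int n)\<^sup>2 * fourier_coeff n F))\<^sup>2) summable_on UNIV"
  proof (rule summable_fourier_dominated[OF s])
    show "cmod ((of_int n)\<^sup>2) \<le> (1 / d) * cmod (heat_symbol d a k n) + \<bar>k\<bar> / d" for n
    proof -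
      have "Re (heat_symbol d a k n) = d * (of_int n)\<^sup>2 + k" by (simp add: heat_symbol_def power2_eq_square)
      then have "d * (of_int n)\<^sup>2 \<le> cmod (heat_symbol d a k n) + \<bar>k\<bar>"
        using complex_Re_le_cmod[of "heat_symbol d a k n"] by linarith
      then show ?thesis using assms by (simp add: norm_power field_simps)
    qed
  qed
qed

text \<open>The matrices are diagonal, and \<open>dom_L\<close> is exactly where the symbols keep
  the coefficients square summable, so the system is an instance of \<open>fourier_system\<close>.
  As u is supported in the control region, \<open>forcing\<close> is its plain slice in both
  components.\<close>

theorem steerable_if_moments:
  fixes d a' a22 k11 k22 T :: real
    and B A K :: "real^2^2" and M :: "real^2"
  assumes d: "d > 0" and a': "a' \<noteq> 0"
    and BAKM: "B = vector [vector [0, 0], vector [0, d]]"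
     "A = vector [vector [a', 0], vector [0, a22]]"
     "K = vector [vector [k11, 0], vector [0, k22]]"
     "M = vector [1, 1]"
    and \<omega>: "open \<omega>" and T: "0 \<le> T"
    and u: "square_integrable (lborel \<Otimes>\<^sub>M torus_measure) u"
    and supp: "\<And>s X. u (s, X) \<noteq> 0 \<Longrightarrow> s \<in> {0<..<T} \<and> X \<in> \<omega>"
    and mom1: "\<And>n. (\<integral>z. of_real (u z) * (exp (of_real (fst z) * transport_symbol a' k11 n) * torus_exp (- n) (snd z)) \<partial>(lborel \<Otimes>\<^sub>M torus_measure))
       = - (2 * pi * fourier_coeff n (f0 $ 1))"
    and mom2: "\<And>n. (\<integral>z. of_real (u z) * (exp (of_real (fst z) * heat_symbol d a22 k22 n) * torus_exp (- n) (snd z)) \<partial>(lborel \<Otimes>\<^sub>M torus_measure))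
       = - (2 * pi * fourier_coeff n (f0 $ 2))"
  shows "steerable_to_0 B A K M \<omega> T f0"
proof -
  define lam :: "2 \<Rightarrow> int \<Rightarrow> complex" where
    "lam i = (if i = 1 then transport_symbol a' k11 else heat_symbol d a22 k22)" for i
  interpret fourier_system lam "\<bar>k11\<bar> + \<bar>k22\<bar>"
  proof
    show "lam i (- n) = cnj (lam i n)" for i n
      by (simp add: lam_def transport_symbol_def heat_symbol_def)
    show "- (\<bar>k11\<bar> + \<bar>k22\<bar>) \<le> Re (lam i n)" for i n
    proof -
      have "0 \<le> d * (real_of_int n * real_of_int n)" using d by simp
      moreover have "Re (lam i n) = (if i = 1 then k11 else d * (real_of_int n * real_of_int n) + k22)"
        by (simp add: lam_def transport_symbol_def heat_symbol_def power2_eq_square)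
      ultimately show ?thesis by (auto simp only: split: if_splits)
    qed
  qed simp
  have gen: "has_generator S dom_L (\<lambda>g. - op_L B A K g)"
  proof (rule has_generator_S)
    show "F \<in> dom_L \<longleftrightarrow> (\<forall>i. (\<lambda>n. (cmod (lam i n * fourier_coeff n (F $ i)))\<^sup>2) summable_on UNIV)" for F
      by (simp add: dom_L_def forall_2 lam_def H1_iff_transport[OF a', of _ k11] H2_iff_heat[OF d, of _ a22 k22])
    show "fourier_coeff n ((- op_L B A K F) $ i) = - lam i n * fourier_coeff n (F $ i)" if "F \<in> dom_L" for F i n
    proof -
      have F: "F $ 1 \<in> H1" "F $ 2 \<in> H2" using that by (auto simp: dom_L_def)
      note wd = fourier_coeff_weak_deriv[OF F(1)] fourier_coeff_weak_deriv[OF H2_weak_deriv(1)[OF F(2)]]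
         fourier_coeff_weak_deriv[OF H2_weak_deriv(2)[OF F(2)]]
      consider "i = 1" | "i = 2" using exhaust_2 by blast
      then show ?thesis
        by cases (simp_all add: op_L_def mat_act_def BAKM sum_2 wd lam_def transport_symbol_def heat_symbol_def power2_eq_square algebra_simps)
    qed
  qed
  have mom: "(\<integral>z. of_real (u z) * (exp (of_real (fst z) * lam i n) * torus_exp (- n) (snd z)) \<partial>(lborel \<Otimes>\<^sub>M torus_measure))
       = - (2 * pi * fourier_coeff n (f0 $ i))" for i n
  proof -
    consider "i = 1" | "i = 2" using exhaust_2 by blast
    then show ?thesis by cases (simp_all add: lam_def mom1 mom2)
  qed
  have supp1: "u (s, X) \<noteq> 0 \<Longrightarrow> s \<in> {0<..<T}" for s X using supp by blast
  obtain f where f: "\<And>t. t \<in> {0..T} \<Longrightarrow> has_hilbert_integral (\<lambda>s. S (t - s) (\<chi> i. slice u s)) (f t - S t f0) {0<..<t}" "f T = 0"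
    using trajectory_to_0[of u T f0, OF u T] supp1 mom by blast
  have forcing: "forcing M \<omega> u s = (\<chi> i. slice u s)" for s
  proof -
    have "(\<lambda>x. u (s, x) * indicator \<omega> x) = (\<lambda>x. u (s, x))"
      using supp[of s] by (auto simp: fun_eq_iff indicator_def)
    then show ?thesis
      by (simp add: forcing_def slice_def vec_eq_iff forall_2 BAKM)
  qed
  have "is_solution B A K M \<omega> T u f0 f"
    unfolding is_solution_def forcing using c0_semigroup_S gen f(1) by blast
  moreover have "square_integrable (restrict_space (lborel \<Otimes>\<^sub>M torus_measure) ({0<..<T} \<times> \<omega>)) u"
  proof -
    have \<Omega>: "{0<..<T} \<times> \<omega> \<in> sets (lborel \<Otimes>\<^sub>M torus_measure)" using \<omega> by (intro pair_measureI) auto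
    have "integrable (restrict_space (lborel \<Otimes>\<^sub>M torus_measure) ({0<..<T} \<times> \<omega>)) (\<lambda>z. (u z)\<^sup>2)"
      using u \<Omega> integrable_mult_indicator[OF \<Omega>, of "\<lambda>z. (u z)\<^sup>2"]
      by (subst integrable_restrict_space) (auto simp: square_integrable_def)
    then show ?thesis using u by (auto simp: square_integrable_def intro: measurable_restrict_space1)
  qed
  ultimately show ?thesis unfolding steerable_to_0_def using f(2) by blast
qed

subsection \<open>Compactly supported Gevrey functions\<close>

text \<open>One term of the exponential series. It trades exponential smallness for k!, which
  becomes the second factorial of the Gevrey bound; the first comes from Cauchy's
  inequality.\<close>

lemma power_le_fact_exp:
  fixes y :: real
  assumes "0 \<le> y"
  shows "exp (- y) * y ^ k \<le> fact k"
proof -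
  have s: "(\<lambda>n. inverse (fact n) * y ^ n) sums exp y"
    using exp_converges[of y] by (simp add: scaleR_conv_of_real)
  have "(\<Sum>n\<in>{k}. inverse (fact n) * y ^ n) \<le> (\<Sum>n. inverse (fact n) * y ^ n)"
    by (rule sum_le_suminf) (use s assms in \<open>auto simp: sums_iff\<close>)
  then have "y ^ k \<le> fact k * exp y" using s by (simp add: sums_iff field_simps)
  then have "exp (- y) * y ^ k \<le> exp (- y) * (fact k * exp y)" by (intro mult_left_mono) auto
  also have "\<dots> = fact k" by (simp add: exp_minus)
  finally show ?thesis .
qed

lemma Re_inverse_nonneg: "0 \<le> Re z \<Longrightarrow> 0 \<le> Re (1 / z)"
  by (simp add: Re_divide)

text \<open>On this disc Re z \<ge> t / 2 and |z| \<le> 3 t / 2, so Re z / |z|^2 is at least (t / 2)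
  / (9 t^2 / 4).\<close>

lemma Re_inverse_ge:
  assumes t: "0 < t" and z: "cmod (z - of_real t) \<le> t / 2"
  shows "2 / (9 * t) \<le> Re (1 / z)"
proof -
  have "\<bar>Re (z - of_real t)\<bar> \<le> t / 2" using abs_Re_le_cmod z order_trans by blast
  then have "\<bar>Re z - t\<bar> \<le> t / 2" by (simp only: minus_complex.sel Re_complex_of_real)
  then have re: "t / 2 \<le> Re z" using abs_ge_minus_self[of "Re z - t"] by linarith
  have "cmod z \<le> cmod (z - of_real t) + cmod (of_real t)"
    using norm_triangle_ineq[of "z - of_real t" "of_real t"] by simp
  then have "cmod z \<le> 3 / 2 * t" using z t by simp
  then have "(cmod z)\<^sup>2 \<le> (3 / 2 * t)\<^sup>2" by (intro power_mono) auto
  then have n: "(cmod z)\<^sup>2 \<le> 9 / 4 * t\<^sup>2" by (simp add: power_mult_distrib power2_eq_square)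
  have pos: "0 < (cmod z)\<^sup>2" using re t by auto
  have "2 / (9 * t) = (t / 2) / (9 / 4 * t\<^sup>2)" using t by (simp add: power2_eq_square)
  also have "\<dots> \<le> Re z / (cmod z)\<^sup>2" using re n pos t by (intro frac_le) auto
  also have "\<dots> = Re (1 / z)" by (simp add: Re_divide cmod_power2)
  finally show ?thesis .
qed

text \<open>Used to glue the bump smoothly to 0 at both ends of its support.\<close>

lemma has_vector_derivative_0_if_quadratic:
  fixes g :: "real \<Rightarrow> complex"
  assumes "\<And>t. norm (g t) \<le> C * \<bar>t - t0\<bar>\<^sup>2"
  shows "(g has_vector_derivative 0) (at t0)"
proof -
  have g0: "g t0 = 0" using assms[of t0] by simp
  have "((\<lambda>y. norm (g y - g t0 - 0) / norm (y - t0)) \<longlongrightarrow> 0) (at t0)"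
  proof (rule tendsto_sandwich[of "\<lambda>_. 0" _ _ "\<lambda>y. C * \<bar>y - t0\<bar>"])
    show "\<forall>\<^sub>F y in at t0. norm (g y - g t0 - 0) / norm (y - t0) \<le> C * \<bar>y - t0\<bar>"
      unfolding eventually_at_filter using assms
      by (intro always_eventually) (auto simp: g0 field_simps power2_eq_square)
    show "((\<lambda>y. C * \<bar>y - t0\<bar>) \<longlongrightarrow> 0) (at t0)" by (auto intro!: tendsto_eq_intros)
  qed auto
  then show ?thesis
    unfolding has_vector_derivative_def has_derivative_iff_norm by simp
qed

text \<open>\<open>exp (- c / t - c / (1 - t))\<close> has Gevrey order \<open>2\<close>, the borderline case for the power series
  below, but a large \<open>c\<close> makes the constant \<open>R\<close> as small as needed.\<close>

theorem gevrey_bump: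
  fixes R :: real
  assumes "R > 0"
  shows "\<exists>\<phi> D C. (\<forall>k t. (\<phi> k has_vector_derivative \<phi> (Suc k) t) (at t)) \<and>
     (\<forall>k t. t \<notin> {0<..<1} \<longrightarrow> \<phi> k t = (0::complex)) \<and>
     (\<forall>k t. cmod (\<phi> k t) \<le> C * (fact k)\<^sup>2 * R ^ k) \<and>
     (\<forall>t. (D has_vector_derivative \<phi> 0 t) (at t)) \<and> (\<forall>t\<le>0. D t = 0) \<and> (\<forall>t\<ge>1. D t = 1)"
proof -
  \<comment> \<open>With the decay exponent y = 2 c / (9 \<tau>) and the Cauchy radius \<tau> / 2,
    the product (\<tau> / 2) y equals c / 9, and this must be 1 / R.\<close>
  define c where "c = 9 / R"
  have c: "c > 0" using assms by (simp add: c_def)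
  define f where "f z = exp (- (of_real c / z) - of_real c / (1 - z))" for z :: complex
  define \<psi> where "\<psi> k t = (if t \<in> {0<..<1} then (deriv ^^ k) f (of_real t) else 0)" for k and t :: real
  have \<psi>0: "\<psi> k t = 0" if "t \<notin> {0<..<1}" for k t
    unfolding \<psi>_def using that by (rule if_not_P)
  define S where "S = - {0, 1 :: complex}"
  have S: "open S" by (auto simp: S_def intro!: open_Compl finite_imp_closed)
  have holo: "f holomorphic_on S"
    unfolding f_def S_def by (intro holomorphic_intros) auto
  have inS: "of_real t \<in> S" if "t \<in> {0<..<1}" for t using that by (auto simp: S_def)
  \<comment> \<open>The radius is half the distance \<tau> to the nearer singularity. On that disc
    the nearer of the two terms 1 / z and 1 / (1 - z) has real part at least 2 / (9 \<tau>), and the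
    other a nonnegative one.\<close>
  have cauchy: "cmod ((deriv ^^ k) f (of_real t)) \<le> fact k * exp (- (2 * c / (9 * \<tau>))) / (\<tau> / 2) ^ k"
    if t: "t \<in> {0<..<1}" and \<tau>: "\<tau> = min t (1 - t)" for k t \<tau>
  proof (rule Cauchy_inequality)
    have \<tau>0: "0 < \<tau>" using t \<tau> by auto
    have main: "z \<in> S \<and> cmod (f z) \<le> exp (- (2 * c / (9 * \<tau>)))" if z: "cmod (z - of_real t) \<le> \<tau> / 2" for z
    proof -
      have re: "0 < Re z" "0 < Re (1 - z)"
      proof -
        have "\<bar>Re (z - of_real t)\<bar> \<le> \<tau> / 2" using abs_Re_le_cmod z order_trans by blast
        then have "\<bar>Re z - t\<bar> \<le> \<tau> / 2" by (simp only: minus_complex.sel Re_complex_of_real)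
        moreover have "\<tau> \<le> t" "\<tau> \<le> 1 - t" using \<tau> by auto
        ultimately have "0 < Re z" "Re z < 1" using \<tau>0 by linarith+
        then show "0 < Re z" "0 < Re (1 - z)" by auto
      qed
      then have "z \<in> S" by (auto simp: S_def)
      have "2 / (9 * \<tau>) \<le> Re (1 / z) + Re (1 / (1 - z))"
      proof (cases "t \<le> 1 - t")
        case True
        then have "2 / (9 * \<tau>) \<le> Re (1 / z)" using \<tau> \<tau>0 z by (intro Re_inverse_ge) auto
        then show ?thesis using Re_inverse_nonneg[of "1 - z"] re by linarith
      next
        case False
        have "cmod ((1 - z) - of_real (1 - t)) = cmod (z - of_real t)" by (simp add: norm_minus_commute)
        then have "2 / (9 * \<tau>) \<le> Re (1 / (1 - z))" using \<tau> \<tau>0 z False by (intro Re_inverse_ge) auto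
        then show ?thesis using Re_inverse_nonneg[of z] re by linarith
      qed
      then have "c * (2 / (9 * \<tau>)) \<le> c * (Re (1 / z) + Re (1 / (1 - z)))" using c by (intro mult_left_mono) auto
      moreover have "Re (- (of_real c / z) - of_real c / (1 - z)) = - (c * (Re (1 / z) + Re (1 / (1 - z))))"
        by (simp add: Re_divide algebra_simps add_divide_distrib)
      ultimately have "Re (- (of_real c / z) - of_real c / (1 - z)) \<le> - (2 * c / (9 * \<tau>))" by simp
      then show ?thesis using \<open>z \<in> S\<close> unfolding f_def norm_exp_eq_Re by simp
    qed
    have sub: "cball (of_real t) (\<tau> / 2) \<subseteq> S"
      using main by (auto simp: dist_norm norm_minus_commute)
    show "f holomorphic_on ball (of_real t) (\<tau> / 2)"
      by (rule holomorphic_on_subset[OF holo]) (use sub ball_subset_cball in blast)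
    show "continuous_on (cball (of_real t) (\<tau> / 2)) f"
      by (rule continuous_on_subset[OF holomorphic_on_imp_continuous_on[OF holo] sub])
    show "0 < \<tau> / 2" using \<tau>0 by simp
    show "cmod (f z) \<le> exp (- (2 * c / (9 * \<tau>)))" if "cmod (of_real t - z) = \<tau> / 2" for z
      using main[of z] that by (simp add: norm_minus_commute)
  qed
  have gevrey: "cmod (\<psi> k t) \<le> (fact k)\<^sup>2 * R ^ k" for k t
  proof (cases "t \<in> {0<..<1}")
    case True
    define \<tau> where "\<tau> = min t (1 - t)"
    have \<tau>0: "0 < \<tau>" using True by (auto simp: \<tau>_def)
    define y where "y = 2 * c / (9 * \<tau>)"
    have y: "0 < y" using c \<tau>0 by (simp add: y_def)
    have "(\<tau> / 2) * y = 1 / R" using \<tau>0 assms by (simp add: y_def c_def)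
    then have *: "(\<tau> / 2) ^ k * y ^ k = 1 / R ^ k" by (simp add: power_one_over flip: power_mult_distrib)
    have "cmod (\<psi> k t) \<le> fact k * exp (- y) / (\<tau> / 2) ^ k"
      using cauchy[OF True \<tau>_def] True by (simp add: \<psi>_def y_def)
    also have "\<dots> = fact k * (exp (- y) * y ^ k) * R ^ k"
    proof -
      have "1 / (\<tau> / 2) ^ k = y ^ k * R ^ k" using * \<tau>0 assms by (simp add: field_simps)
      then show ?thesis by (metis (no_types, opaque_lifting) mult.assoc mult.right_neutral times_divide_eq_right)
    qed
    also have "\<dots> \<le> fact k * fact k * R ^ k"
      using power_le_fact_exp[of y k] y assms by (intro mult_right_mono mult_left_mono) auto
    finally show ?thesis by (simp add: power2_eq_square)
  next
    case False
    show ?thesis using assms \<psi>0[OF False] by simp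
  qed
  \<comment> \<open>The exponential is traded for k + 2 powers of \<tau>: k of them cancel the
    Cauchy radius, and two remain as quadratic contact with 0.\<close>
  have quad: "\<exists>Q. \<forall>t. cmod (\<psi> k t) \<le> Q * \<bar>t\<bar>\<^sup>2 \<and> cmod (\<psi> k t) \<le> Q * \<bar>t - 1\<bar>\<^sup>2" for k
  proof (intro exI allI)
    fix t
    define Q where "Q = fact k * 2 ^ k * (fact (k + 2) * (9 / (2 * c)) ^ (k + 2))"
    have Q: "0 \<le> Q" using c by (simp add: Q_def)
    show "cmod (\<psi> k t) \<le> Q * \<bar>t\<bar>\<^sup>2 \<and> cmod (\<psi> k t) \<le> Q * \<bar>t - 1\<bar>\<^sup>2"
    proof (cases "t \<in> {0<..<1}")
      case True
      define \<tau> where "\<tau> = min t (1 - t)"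
      have \<tau>0: "0 < \<tau>" using True by (auto simp: \<tau>_def)
      define y where "y = 2 * c / (9 * \<tau>)"
      have y: "0 < y" using c \<tau>0 by (simp add: y_def)
      have "exp (- y) \<le> fact (k + 2) * (1 / y) ^ (k + 2)"
        using power_le_fact_exp[of y "k + 2"] y by (simp add: field_simps)
      also have "1 / y = 9 / (2 * c) * \<tau>" by (simp add: y_def)
      finally have e: "exp (- y) \<le> fact (k + 2) * (9 / (2 * c)) ^ (k + 2) * \<tau> ^ (k + 2)"
        by (simp only: power_mult_distrib mult.assoc)
      have "cmod (\<psi> k t) \<le> fact k * exp (- y) / (\<tau> / 2) ^ k"
        using cauchy[OF True \<tau>_def] True by (simp add: \<psi>_def y_def)
      also have "\<dots> \<le> fact k * (fact (k + 2) * (9 / (2 * c)) ^ (k + 2) * \<tau> ^ (k + 2)) / (\<tau> / 2) ^ k"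
        by (intro divide_right_mono mult_left_mono e) (use \<tau>0 in auto)
      also have "\<dots> = Q * \<tau>\<^sup>2"
      proof -
        have "a * (b * \<tau> ^ (k + 2)) / (\<tau> / 2) ^ k = a * 2 ^ k * b * \<tau>\<^sup>2" for a b :: real
          using \<tau>0 by (simp add: power_divide power_add power2_eq_square)
        then show ?thesis unfolding Q_def .
      qed
      finally have le: "cmod (\<psi> k t) \<le> Q * \<tau>\<^sup>2" .
      have "Q * \<tau>\<^sup>2 \<le> Q * \<bar>t\<bar>\<^sup>2" "Q * \<tau>\<^sup>2 \<le> Q * \<bar>t - 1\<bar>\<^sup>2"
        using \<tau>0 Q by (auto simp: \<tau>_def intro!: mult_left_mono power_mono)
      then show ?thesis using le by linarith
    next
      case False
      show ?thesis using Q \<psi>0[OF False] by simp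
    qed
  qed
  have \<psi>_deriv: "(\<psi> k has_vector_derivative \<psi> (Suc k) t) (at t)" for k t
  proof -
    consider "t \<in> {0<..<1}" | "t = 0" | "t = 1" | "t < 0" | "t > 1" by fastforce
    then show ?thesis
    proof cases
      case 1
      have "((deriv ^^ k) f has_field_derivative deriv ((deriv ^^ k) f) (of_real t)) (at (of_real t))"
        by (rule holomorphic_derivI[OF holomorphic_higher_deriv[OF holo S] S inS[OF 1]])
      then have "((\<lambda>x. (deriv ^^ k) f (of_real x)) has_vector_derivative deriv ((deriv ^^ k) f) (of_real t)) (at t)"
        by (rule has_vector_derivative_real_field)
      then have "(\<psi> k has_vector_derivative deriv ((deriv ^^ k) f) (of_real t)) (at t)"
        by (rule has_vector_derivative_transform_within_open[of _ _ _ "{0<..<1}"]) (use 1 in \<open>auto simp: \<psi>_def\<close>)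
      then show ?thesis using 1 by (simp add: \<psi>_def)
    next
      case 2
      obtain Q where "\<forall>t. cmod (\<psi> k t) \<le> Q * \<bar>t\<bar>\<^sup>2" using quad[of k] by blast
      then show ?thesis using 2 has_vector_derivative_0_if_quadratic[of "\<psi> k" Q 0] by (simp add: \<psi>_def)
    next
      case 3
      obtain Q where "\<forall>t. cmod (\<psi> k t) \<le> Q * \<bar>t - 1\<bar>\<^sup>2" using quad[of k] by blast
      then show ?thesis using 3 has_vector_derivative_0_if_quadratic[of "\<psi> k" Q 1] by (simp add: \<psi>_def)
    next
      case 4
      have "(\<psi> k has_vector_derivative 0) (at t)"
        by (rule has_vector_derivative_transform_within_open[of "\<lambda>_. 0" _ _ "{..<0}"]) (use 4 in \<open>auto simp: \<psi>_def\<close>)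
      then show ?thesis using 4 by (simp add: \<psi>_def)
    next
      case 5
      have "(\<psi> k has_vector_derivative 0) (at t)"
        by (rule has_vector_derivative_transform_within_open[of "\<lambda>_. 0" _ _ "{1<..}"]) (use 5 in \<open>auto simp: \<psi>_def\<close>)
      then show ?thesis using 5 by (simp add: \<psi>_def)
    qed
  qed
  have cont: "continuous_on A (\<psi> k)" for A k
    by (rule continuous_at_imp_continuous_on) (use \<psi>_deriv has_vector_derivative_continuous in blast)
  define I where "I = integral {0..1} (\<psi> 0)"
  \<comment> \<open>On the open unit interval the function is real and positive, so the total mass
    can be normalized to 1.\<close>
  have "Re I \<noteq> 0"
  proof
    assume "Re I = 0"
    have int: "(\<psi> 0) integrable_on {0..1}" by (intro integrable_continuous_real cont)
    have Re: "Re (\<psi> 0 t) = (if t \<in> {0<..<1} then exp (- (c / t) - c / (1 - t)) else 0)" for t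
    proof -
      have "f (of_real t) = of_real (exp (- (c / t) - c / (1 - t)))" by (simp add: f_def exp_of_real[symmetric])
      then show ?thesis by (simp add: \<psi>_def)
    qed
    have "integral {0..1} (\<lambda>t. Re (\<psi> 0 t)) = Re I"
      using integral_linear[OF int bounded_linear_Re] by (simp add: I_def comp_def)
    then have "integral {0..1} (\<lambda>t. Re (\<psi> 0 t)) = 0" using \<open>Re I = 0\<close> by simp
    moreover have "continuous_on {0..1} (\<lambda>t. Re (\<psi> 0 t))" by (intro continuous_intros cont)
    ultimately have "\<forall>t\<in>{0..1}. Re (\<psi> 0 t) = 0"
      by (subst (asm) integral_eq_0_iff) (auto simp: Re)
    then show False using Re[of "1/2"] by auto
  qed
  then have I: "I \<noteq> 0" by auto
  define \<phi> where "\<phi> k t = \<psi> k t / I" for k t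
  \<comment> \<open>Integration starts at -1 so that 0 is an interior point and the primitive has a
    two-sided derivative there.\<close>
  define D where "D t = integral {-1..t} (\<psi> 0) / I" for t
  have D0: "D t = 0" if "t \<le> 0" for t
  proof -
    have "integral {-1..t} (\<psi> 0) = integral {-1..t} (\<lambda>_. 0)"
      by (rule Henstock_Kurzweil_Integration.integral_cong) (use that in \<open>auto simp: \<psi>_def\<close>)
    then show ?thesis by (simp add: D_def)
  qed
  have D1: "D t = 1" if t: "t \<ge> 1" for t
  proof -
    have i: "\<psi> 0 integrable_on {a..b}" for a b by (intro integrable_continuous_real cont)
    have "integral {-1..t} (\<psi> 0) = integral {-1..0} (\<psi> 0) + (integral {0..1} (\<psi> 0) + integral {1..t} (\<psi> 0))"
      using t by (simp add: Henstock_Kurzweil_Integration.integral_combine i)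
    moreover have "integral {1..t} (\<psi> 0) = integral {1..t} (\<lambda>_. 0)"
      by (rule Henstock_Kurzweil_Integration.integral_cong) (auto simp: \<psi>_def)
    moreover have "integral {-1..0} (\<psi> 0) = 0" using D0[of 0] I by (simp add: D_def)
    ultimately show ?thesis using I by (simp add: D_def I_def)
  qed
  have D_deriv: "(D has_vector_derivative \<phi> 0 t) (at t)" for t
  proof (cases "t < 0")
    case True
    have "(D has_vector_derivative 0) (at t)"
      by (rule has_vector_derivative_transform_within_open[of "\<lambda>_. 0" _ _ "{..<0}"]) (use True D0 in auto)
    then show ?thesis using True by (simp add: \<phi>_def \<psi>_def)
  next
    case False
    have "((\<lambda>u. integral {-1..u} (\<psi> 0)) has_vector_derivative \<psi> 0 t) (at t within {-1..t + 1})"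
      by (rule integral_has_vector_derivative[OF cont]) (use False in auto)
    then have "((\<lambda>u. integral {-1..u} (\<psi> 0)) has_vector_derivative \<psi> 0 t) (at t)"
      using False by (simp add: at_within_Icc_at)
    then show ?thesis unfolding D_def[abs_def] \<phi>_def by (rule has_vector_derivative_divide)
  qed
  show ?thesis
  proof (intro exI[of _ \<phi>] exI[of _ D] exI[of _ "1 / cmod I"] conjI allI impI)
    show "(\<phi> k has_vector_derivative \<phi> (Suc k) t) (at t)" for k t
      unfolding \<phi>_def[abs_def] by (rule has_vector_derivative_divide[OF \<psi>_deriv])
    show "\<phi> k t = 0" if "t \<notin> {0<..<1}" for k t using \<psi>0[OF that] by (simp add: \<phi>_def)
    show "cmod (\<phi> k t) \<le> 1 / cmod I * (fact k)\<^sup>2 * R ^ k" for k t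
      using divide_right_mono[OF gevrey[of k t], of "cmod I"] by (simp add: \<phi>_def norm_divide mult.assoc)
  qed (use D_deriv D0 D1 in auto)
qed

lemma continuous_on_of_vector_derivative:
  fixes f :: "real \<Rightarrow> complex"
  assumes "\<And>x. x \<in> S \<Longrightarrow> (f has_vector_derivative f' x) (at x within S)"
  shows "continuous_on S f"
  unfolding continuous_on_eq_continuous_within
  using assms has_vector_derivative_continuous by blast

text \<open>The bump is squeezed into the middle third. Every derivative then costs 1 / \<eta>,
  which the Gevrey constant R \<eta> of the unscaled bump compensates. Keeping t \<ge> \<epsilon> /
  3 on the support gives the heat factors Gaussian decay in the frequency.\<close>

lemma time_bump:
  fixes R \<epsilon> :: real
  assumes R: "R > 0" and e: "\<epsilon> > 0"
  shows "\<exists>\<theta> C. (\<forall>k t. (\<theta> k has_vector_derivative \<theta> (Suc k) t) (at t)) \<and>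
     (\<forall>k t. t \<notin> {\<epsilon>/3<..<2*\<epsilon>/3} \<longrightarrow> \<theta> k t = (0::complex)) \<and>
     (\<forall>k t. cmod (\<theta> k t) \<le> C * (fact k)\<^sup>2 * R ^ k) \<and> C \<ge> 0 \<and>
     (\<theta> 0 has_integral 1) {0..\<epsilon>}"
proof -
  define \<eta> where "\<eta> = \<epsilon> / 3"
  have \<eta>: "\<eta> > 0" using e by (simp add: \<eta>_def)
  obtain \<phi> D C where *: "\<forall>k t. (\<phi> k has_vector_derivative \<phi> (Suc k) t) (at t)"
     "\<forall>k t. t \<notin> {0<..<1} \<longrightarrow> \<phi> k t = (0::complex)"
     "\<forall>k t. cmod (\<phi> k t) \<le> C * (fact k)\<^sup>2 * (R * \<eta>) ^ k"
     "\<forall>t. (D has_vector_derivative \<phi> 0 t) (at t)" "\<forall>t\<le>0. D t = 0" "\<forall>t\<ge>1. D t = 1"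
    using gevrey_bump[OF mult_pos_pos[OF R \<eta>]] by blast
  note \<phi> = *(1-3)[rule_format] and D = *(4-6)[rule_format]
  define \<theta> where "\<theta> k t = \<phi> k ((t - \<eta>) / \<eta>) / of_real (\<eta> ^ Suc k)" for k t
  have C0: "C \<ge> 0" using order_trans[OF norm_ge_zero \<phi>(3)[of 0 0]] by simp
  have lin: "((\<lambda>t. (t - \<eta>) / \<eta>) has_vector_derivative 1 / \<eta>) (at t)" for t
    using \<eta> by (auto intro!: derivative_eq_intros simp flip: has_real_derivative_iff_has_vector_derivative)
  have comp: "((\<lambda>t. g ((t - \<eta>) / \<eta>)) has_vector_derivative g' / of_real \<eta>) (at t)"
    if "(g has_vector_derivative g') (at ((t - \<eta>) / \<eta>))" for g :: "real \<Rightarrow> complex" and g' t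
    using vector_diff_chain_at[OF lin that] by (simp add: comp_def scaleR_conv_of_real divide_inverse mult.commute)
  show ?thesis
  proof (intro exI[of _ \<theta>] exI[of _ "C / \<eta>"] conjI allI impI)
    fix k t
    have "(\<theta> k has_vector_derivative \<phi> (Suc k) ((t - \<eta>) / \<eta>) / of_real \<eta> / of_real (\<eta> ^ Suc k)) (at t)"
      unfolding \<theta>_def[abs_def] by (intro has_vector_derivative_divide comp \<phi>)
    then show "(\<theta> k has_vector_derivative \<theta> (Suc k) t) (at t)" by (simp add: \<theta>_def mult_ac)
    show "\<theta> k t = 0" if "t \<notin> {\<epsilon>/3<..<2*\<epsilon>/3}"
    proof -
      have "(t - \<eta>) / \<eta> \<notin> {0<..<1}" using that \<eta> by (auto simp: \<eta>_def field_simps)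
      then show ?thesis by (simp add: \<theta>_def \<phi>(2))
    qed
    have "cmod (\<theta> k t) = cmod (\<phi> k ((t - \<eta>) / \<eta>)) / \<eta> ^ Suc k"
      using \<eta> by (simp add: \<theta>_def norm_divide norm_mult norm_power)
    also have "\<dots> \<le> C * (fact k)\<^sup>2 * (R * \<eta>) ^ k / \<eta> ^ Suc k" using \<eta> by (intro divide_right_mono \<phi>) auto
    also have "\<dots> = C / \<eta> * (fact k)\<^sup>2 * R ^ k" using \<eta> by (simp add: power_mult_distrib)
    finally show "cmod (\<theta> k t) \<le> C / \<eta> * (fact k)\<^sup>2 * R ^ k" .
    show "0 \<le> C / \<eta>" using C0 \<eta> by simp
    have "(\<theta> 0 has_integral D ((\<epsilon> - \<eta>) / \<eta>) - D ((0 - \<eta>) / \<eta>)) {0..\<epsilon>}"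
    proof (rule fundamental_theorem_of_calculus)
      show "((\<lambda>t. D ((t - \<eta>) / \<eta>)) has_vector_derivative \<theta> 0 t) (at t within {0..\<epsilon>})" for t
        using has_vector_derivative_at_within[OF comp[OF D(1)[of "(t - \<eta>) / \<eta>"]]] by (simp add: \<theta>_def)
    qed (use e in simp)
    moreover have "D ((\<epsilon> - \<eta>) / \<eta>) = 1" "D ((0 - \<eta>) / \<eta>) = 0"
      using \<eta> by (auto intro!: D simp: \<eta>_def field_simps)
    ultimately show "(\<theta> 0 has_integral 1) {0..\<epsilon>}" by simp
  qed
qed

text \<open>The difference of two smooth steps, one rising just after p and one just before p + 2
  pi. Bounds are kept up to order 3, the highest derivative of the cutoff that occurs in
  \<open>g'\<close>.\<close>

lemma space_cutoff:
  fixes p \<delta> :: real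
  assumes d: "0 < \<delta>" "\<delta> < pi"
  shows "\<exists>\<xi> C. (\<forall>k x. (\<xi> k has_vector_derivative \<xi> (Suc k) x) (at x)) \<and>
    (\<forall>x\<in>{p + \<delta>..p + 2 * pi - \<delta>}. \<xi> 0 x = (1::complex) \<and> (\<forall>k. \<xi> (Suc k) x = 0)) \<and>
    (\<forall>k. \<xi> k p = 0 \<and> \<xi> k (p + 2 * pi) = 0) \<and>
    (\<forall>k\<in>{..3}. \<forall>x\<in>{p..p + 2 * pi}. cmod (\<xi> k x) \<le> C)"
proof -
  obtain \<phi> D where *: "\<forall>k t. (\<phi> k has_vector_derivative \<phi> (Suc k) t) (at t)"
     "\<forall>k t. t \<notin> {0<..<1} \<longrightarrow> \<phi> k t = (0::complex)"
     "\<forall>t. (D has_vector_derivative \<phi> 0 t) (at t)" "\<forall>t\<le>0. D t = 0" "\<forall>t\<ge>1. D t = 1"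
    using gevrey_bump[OF zero_less_one] by blast
  note \<phi> = *(1-2)[rule_format] and D = *(3-5)[rule_format]
  \<comment> \<open>The numbering is shifted: \<open>G 0\<close> is the step D and
    \<open>G (Suc j)\<close> its derivatives.\<close>
  define G where "G k = (case k of 0 \<Rightarrow> D | Suc j \<Rightarrow> \<phi> j)" for k
  have G: "(G k has_vector_derivative G (Suc k) t) (at t)" for k t
    using \<phi>(1) D(1) by (cases k) (auto simp: G_def)
  have G0: "G k t = 0" if "t \<le> 0" for k t using that by (cases k) (auto simp: G_def D \<phi>)
  have G1: "G k t = (if k = 0 then 1 else 0)" if "1 \<le> t" for k t using that by (cases k) (auto simp: G_def D \<phi>)
  define \<xi> where "\<xi> k x = (G k ((x - p) / \<delta>) - G k ((x - (p + 2 * pi - \<delta>)) / \<delta>)) / of_real (\<delta> ^ k)" for k x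
  have comp: "((\<lambda>t. g ((t - q) / \<delta>)) has_vector_derivative g' / of_real \<delta>) (at t)"
    if "(g has_vector_derivative g') (at ((t - q) / \<delta>))" for g :: "real \<Rightarrow> complex" and g' t q
  proof -
    have lin: "((\<lambda>t. (t - q) / \<delta>) has_vector_derivative 1 / \<delta>) (at t)" for t
      using d by (auto intro!: derivative_eq_intros simp flip: has_real_derivative_iff_has_vector_derivative)
    show ?thesis using vector_diff_chain_at[OF lin that] by (simp add: comp_def scaleR_conv_of_real divide_inverse mult.commute)
  qed
  have deriv: "(\<xi> k has_vector_derivative \<xi> (Suc k) x) (at x)" for k x
  proof -
    have "(\<xi> k has_vector_derivative (G (Suc k) ((x - p) / \<delta>) / of_real \<delta> - G (Suc k) ((x - (p + 2 * pi - \<delta>)) / \<delta>) / of_real \<delta>) / of_real (\<delta> ^ k)) (at x)"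
      unfolding \<xi>_def[abs_def] by (intro has_vector_derivative_divide has_vector_derivative_diff comp G)
    then show ?thesis by (simp add: \<xi>_def mult_ac diff_divide_distrib)
  qed
  have "\<exists>C. \<forall>x\<in>{p..p + 2 * pi}. cmod (\<xi> k x) \<le> C" for k
  proof -
    have "continuous_on {p..p + 2 * pi} (\<xi> k)"
      by (rule continuous_on_of_vector_derivative[where f' = "\<xi> (Suc k)"]) (rule has_vector_derivative_at_within[OF deriv])
    then have "compact (\<xi> k ` {p..p + 2 * pi})" by (intro compact_continuous_image) auto
    from compact_imp_bounded[OF this] show ?thesis by (auto simp: bounded_iff)
  qed
  then obtain Ck where Ck: "\<And>k x. x \<in> {p..p + 2 * pi} \<Longrightarrow> cmod (\<xi> k x) \<le> Ck k" by metis
  show ?thesis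
  proof (intro exI[of _ \<xi>] exI[of _ "Max (Ck ` {..3})"] conjI allI ballI)
    show "(\<xi> k has_vector_derivative \<xi> (Suc k) x) (at x)" for k x by (rule deriv)
    fix x assume x: "x \<in> {p + \<delta>..p + 2 * pi - \<delta>}"
    have "1 \<le> (x - p) / \<delta>" "(x - (p + 2 * pi - \<delta>)) / \<delta> \<le> 0" using x d by (auto simp: field_simps)
    then show "\<xi> 0 x = 1" "\<xi> (Suc k) x = 0" for k by (auto simp: \<xi>_def G0 G1)
  next
    fix k
    have "(p - p) / \<delta> \<le> 0" "(p - (p + 2 * pi - \<delta>)) / \<delta> \<le> 0"
      using d pi_gt_zero by (auto simp: divide_le_0_iff)
    then show "\<xi> k p = 0" unfolding \<xi>_def by (simp only: G0) simp
    have "1 \<le> (p + 2 * pi - p) / \<delta>" "1 \<le> (p + 2 * pi - (p + 2 * pi - \<delta>)) / \<delta>" using d by (auto simp: field_simps)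
    then show "\<xi> k (p + 2 * pi) = 0" unfolding \<xi>_def by (simp only: G1) simp
  next
    fix k x assume "k \<in> {..3::nat}" "x \<in> {p..p + 2 * pi}"
    then show "cmod (\<xi> k x) \<le> Max (Ck ` {..3})"
      by (intro order_trans[OF Ck Max_ge]) auto
  qed
qed

subsection \<open>Flatness of the heat equation\<close>

text \<open>\<open>exp_int p r f\<close> solves \<open>y' = r y + f\<close>, \<open>y p = 0\<close>.\<close>

definition exp_int :: "real \<Rightarrow> complex \<Rightarrow> (real \<Rightarrow> complex) \<Rightarrow> real \<Rightarrow> complex" where
  "exp_int p r f x = exp (r * of_real x) * integral {p..x} (\<lambda>y. exp (- r * of_real y) * f y)"

lemma exp_int_deriv:
  assumes f: "continuous_on {p..q} f" and x: "x \<in> {p..q}"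
  shows "(exp_int p r f has_vector_derivative r * exp_int p r f x + f x) (at x within {p..q})"
proof -
  have "((\<lambda>x. integral {p..x} (\<lambda>y. exp (- r * of_real y) * f y)) has_vector_derivative exp (- r * of_real x) * f x) (at x within {p..q})"
    by (intro integral_has_vector_derivative continuous_intros f x)
  from has_vector_derivative_mult[OF has_vector_derivative_exp_real[of r] this]
  have "(exp_int p r f has_vector_derivative exp (r * of_real x) * (exp (- r * of_real x) * f x) +
     r * exp (r * of_real x) * integral {p..x} (\<lambda>y. exp (- r * of_real y) * f y)) (at x within {p..q})"
    unfolding exp_int_def[abs_def] .
  then show ?thesis by (simp add: exp_int_def mult.assoc[symmetric] mult_exp_exp add.commute)
qed

text \<open>The weights combine as exp(c (x - y)) exp(c (y - p)) = exp(c (x - p)), so iteration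
  reproduces the exponential instead of compounding it, and each step gains one power over its
  factorial.\<close>

lemma exp_int_bound:
  assumes f: "continuous_on {p..q} f" and x: "x \<in> {p..q}" and r: "Re r \<le> c"
    and b: "\<And>y. y \<in> {p..q} \<Longrightarrow> cmod (f y) \<le> exp (c * (y - p)) * (y - p) ^ j / fact j"
  shows "cmod (exp_int p r f x) \<le> exp (c * (x - p)) * (x - p) ^ Suc j / fact (Suc j)"
proof -
  have sub: "{p..x} \<subseteq> {p..q}" using x by auto
  have io: "(\<lambda>y. exp (r * of_real x) * (exp (- r * of_real y) * f y)) integrable_on {p..x}"
    by (intro integrable_continuous_real continuous_intros continuous_on_subset[OF f sub])
  have hi: "((\<lambda>y. exp (c * (x - p)) * ((y - p) ^ j / fact j)) has_integral exp (c * (x - p)) * ((x - p) ^ Suc j / fact (Suc j))) {p..x}"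
  proof (rule has_integral_mult_right)
    have "((\<lambda>y. (y - p) ^ j / fact j) has_integral (x - p) ^ Suc j / fact (Suc j) - (p - p) ^ Suc j / fact (Suc j)) {p..x}"
    proof (rule fundamental_theorem_of_calculus)
      show "((\<lambda>y. (y - p) ^ Suc j / fact (Suc j)) has_vector_derivative (y - p) ^ j / fact j) (at y within {p..x})" for y
      proof -
        have "((\<lambda>y. (y - p) ^ Suc j) has_real_derivative real (Suc j) * (y - p) ^ j) (at y within {p..x})"
          using DERIV_power[of "\<lambda>y. y - p" 1 y "{p..x}" "Suc j"] by (auto intro!: derivative_eq_intros simp del: power_Suc)
        from DERIV_cdivide[OF this, of "fact (Suc j)"] show ?thesis
          unfolding has_real_derivative_iff_has_vector_derivative[symmetric] by (simp del: of_nat_Suc)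
      qed
    qed (use x in simp)
    then show "((\<lambda>y. (y - p) ^ j / fact j) has_integral (x - p) ^ Suc j / fact (Suc j)) {p..x}" by simp
  qed
  have "exp_int p r f x = integral {p..x} (\<lambda>y. exp (r * of_real x) * (exp (- r * of_real y) * f y))"
    by (simp add: exp_int_def)
  also have "cmod \<dots> \<le> integral {p..x} (\<lambda>y. exp (c * (x - p)) * ((y - p) ^ j / fact j))"
  proof (rule Henstock_Kurzweil_Integration.integral_norm_bound_integral[OF io])
    show "(\<lambda>y. exp (c * (x - p)) * ((y - p) ^ j / fact j)) integrable_on {p..x}" using hi by blast
    fix y assume y: "y \<in> {p..x}"
    then have y': "y \<in> {p..q}" using sub by auto
    have "cmod (exp (r * of_real x) * (exp (- r * of_real y) * f y)) = exp (Re r * (x - y)) * cmod (f y)"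
      by (simp add: norm_mult right_diff_distrib mult_exp_exp flip: mult.assoc)
    also have "\<dots> \<le> exp (c * (x - y)) * (exp (c * (y - p)) * (y - p) ^ j / fact j)"
      using y r by (intro mult_mono b[OF y']) (auto intro: mult_right_mono)
    also have "\<dots> = exp (c * (x - p)) * ((y - p) ^ j / fact j)"
      by (simp add: mult_exp_exp algebra_simps flip: mult.assoc)
    finally show "cmod (exp (r * of_real x) * (exp (- r * of_real y) * f y)) \<le> exp (c * (x - p)) * ((y - p) ^ j / fact j)" .
  qed
  also have "\<dots> = exp (c * (x - p)) * (x - p) ^ Suc j / fact (Suc j)"
    unfolding integral_unique[OF hi] by simp
  finally show ?thesis .
qed

text \<open>The roots of \<open>- d r\<^sup>2 + a r + k = heat_symbol d a k n\<close> are \<open>\<i> n\<close> and \<open>a / d - \<i> n\<close>.\<close>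

definition heat_root :: "real \<Rightarrow> real \<Rightarrow> int \<Rightarrow> nat \<Rightarrow> complex" where
  "heat_root d a n j = (if odd j then \<i> * of_int n else of_real (a / d) - \<i> * of_int n)"

text \<open>Each second-order step (\<Lambda> - lam n) q = - Q is split into two first-order ones
  along the roots of the symbol. Their real parts 0 and a / d do not depend on n, which makes
  \<open>heat_iter_bound\<close> uniform in the frequency.\<close>

fun heat_iter :: "real \<Rightarrow> real \<Rightarrow> real \<Rightarrow> int \<Rightarrow> nat \<Rightarrow> real \<Rightarrow> complex" where
  "heat_iter p d a n 0 = (\<lambda>x. exp (\<i> * of_int n * of_real x))"
| "heat_iter p d a n (Suc j) = exp_int p (heat_root d a n j) (heat_iter p d a n j)"

lemma continuous_heat_iter: "continuous_on {p..q} (heat_iter p d a n j)"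
proof (induction j)
  case 0
  show ?case unfolding heat_iter.simps by (intro continuous_intros)
next
  case (Suc j)
  then show ?case unfolding heat_iter.simps
    by (rule continuous_on_of_vector_derivative[OF exp_int_deriv])
qed

lemma heat_iter_deriv:
  "x \<in> {p..q} \<Longrightarrow> (heat_iter p d a n (Suc j) has_vector_derivative
     heat_root d a n j * heat_iter p d a n (Suc j) x + heat_iter p d a n j x) (at x within {p..q})"
  unfolding heat_iter.simps by (rule exp_int_deriv[OF continuous_heat_iter])

lemma heat_iter_bound:
  assumes "x \<in> {p..q}"
  shows "cmod (heat_iter p d a n j x) \<le> exp (\<bar>a / d\<bar> * (x - p)) * (x - p) ^ j / fact j"
  using assms
proof (induction j arbitrary: x)
  case 0
  then show ?case by (simp add: norm_exp_eq_Re)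
next
  case (Suc j)
  show ?case unfolding heat_iter.simps
    by (rule exp_int_bound[OF continuous_heat_iter Suc.prems _ Suc.IH]) (use abs_ge_self[of "a / d"] in \<open>auto simp: heat_root_def\<close>)
qed

section \<open>Moments of series and products of controls\<close>

lemma measurable_torus_rep_continuous:
  fixes g :: "real \<Rightarrow> complex"
  assumes "continuous_on {p..p + 2 * pi} g"
  shows "(\<lambda>X. g (torus_rep p X)) \<in> borel_measurable borel"
proof -
  have "(\<lambda>x. indicator {p..p + 2 * pi} x *\<^sub>R g x) \<in> borel_measurable borel"
    using assms by (intro borel_measurable_continuous_on_indicator) auto
  from measurable_compose[OF measurable_torus_rep[of p] this]
  show ?thesis by (simp add: torus_rep_ge torus_rep_less less_imp_le)
qed

lemma integrable_bounded_in_time: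
  fixes F :: "real \<times> torus \<Rightarrow> complex"
  assumes F: "F \<in> borel_measurable (lborel \<Otimes>\<^sub>M torus_measure)"
    and le: "\<And>z. cmod (F z) \<le> C" and supp: "\<And>s X. s \<notin> {0<..<T} \<Longrightarrow> F (s, X) = 0"
  shows "integrable (lborel \<Otimes>\<^sub>M torus_measure) F"
proof (rule Bochner_Integration.integrable_bound[OF _ F])
  show "integrable (lborel \<Otimes>\<^sub>M torus_measure) (\<lambda>z. C * indicator ({0<..<T} \<times> UNIV) z)"
    by (intro integrable_mult_right integrable_time_strip)
  have "0 \<le> C" using le[of undefined] norm_ge_zero order_trans by blast
  then have "norm (F z) \<le> norm (C * indicator ({0<..<T} \<times> UNIV) z)" for z
    using le[of z] supp by (cases z) (auto simp: indicator_def)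
  then show "AE z in lborel \<Otimes>\<^sub>M torus_measure. norm (F z) \<le> norm (C * indicator ({0<..<T} \<times> UNIV) z)" by simp
qed

text \<open>Used twice: to sum the atoms of one mode, and then to sum the modes.\<close>

lemma suminf_controls:
  fixes F :: "nat \<Rightarrow> real \<times> torus \<Rightarrow> complex"
  assumes F: "\<And>m. F m \<in> borel_measurable (lborel \<Otimes>\<^sub>M torus_measure)"
    and le: "\<And>m z. cmod (F m z) \<le> M m" and M: "summable M"
    and supp: "\<And>m s X. s \<notin> {0<..<T} \<Longrightarrow> F m (s, X) = 0"
    and w: "w \<in> borel_measurable (lborel \<Otimes>\<^sub>M torus_measure)" "\<And>s X. s \<in> {0<..<T} \<Longrightarrow> cmod (w (s, X)) \<le> C"
  shows "(\<lambda>z. \<Sum>m. F m z) \<in> borel_measurable (lborel \<Otimes>\<^sub>M torus_measure)"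
    and "cmod (\<Sum>m. F m z) \<le> (\<Sum>m. M m)"
    and "(\<lambda>m. \<integral>z. F m z * w z \<partial>(lborel \<Otimes>\<^sub>M torus_measure)) sums (\<integral>z. (\<Sum>m. F m z) * w z \<partial>(lborel \<Otimes>\<^sub>M torus_measure))"
proof -
  let ?P = "lborel \<Otimes>\<^sub>M torus_measure"
  note [measurable] = F w(1)
  have summ: "summable (\<lambda>m. cmod (F m z))" for z
    by (rule summable_comparison_test'[OF M]) (use le in auto)
  show "(\<lambda>z. \<Sum>m. F m z) \<in> borel_measurable ?P" by measurable
  show "cmod (\<Sum>m. F m z) \<le> (\<Sum>m. M m)"
    by (rule order_trans[OF summable_norm[OF summ] suminf_le[OF le summ M]])
  have Fw_le: "cmod (F m z * w z) \<le> M m * \<bar>C\<bar>" for m z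
  proof (cases z)
    case (Pair s X)
    show ?thesis
    proof (cases "s \<in> {0<..<T}")
      case True
      have "cmod (w (s, X)) \<le> \<bar>C\<bar>" using w(2)[OF True, of X] by linarith
      then have "cmod (F m (s, X)) * cmod (w (s, X)) \<le> M m * \<bar>C\<bar>"
        using le order_trans[OF norm_ge_zero le] by (intro mult_mono) auto
      then show ?thesis by (simp add: Pair norm_mult)
    next
      case False
      then show ?thesis using order_trans[OF norm_ge_zero le[of m z]] by (simp add: Pair supp)
    qed
  qed
  have Fw_int: "integrable ?P (\<lambda>z. F m z * w z)" for m
    by (rule integrable_bounded_in_time[where T = T, OF _ Fw_le]) (auto simp: supp)
  have ind: "integrable ?P (\<lambda>z. indicator ({0<..<T} \<times> UNIV) z :: real)" by (rule integrable_time_strip)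
  define I where "I = (\<integral>z. indicator ({0<..<T} \<times> UNIV) z \<partial>?P :: real)"
  have "(\<lambda>m. \<integral>z. F m z * w z \<partial>?P) sums (\<integral>z. (\<Sum>m. F m z * w z) \<partial>?P)"
  proof (rule sums_integral[OF Fw_int])
    show "AE z in ?P. summable (\<lambda>m. norm (F m z * w z))"
      by (intro AE_I2) (simp add: norm_mult summable_mult2[OF summ])
    show "summable (\<lambda>m. \<integral>z. norm (F m z * w z) \<partial>?P)"
    proof (rule summable_comparison_test'[OF summable_mult2[OF M, of "\<bar>C\<bar> * I"]])
      fix m
      have "(\<integral>z. norm (F m z * w z) \<partial>?P) \<le> (\<integral>z. M m * \<bar>C\<bar> * indicator ({0<..<T} \<times> UNIV) z \<partial>?P)"
      proof (rule integral_mono)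
        show "norm (F m z * w z) \<le> M m * \<bar>C\<bar> * indicator ({0<..<T} \<times> UNIV) z" for z
          using Fw_le[of m z] by (cases z) (auto simp: indicator_def supp)
      qed (use Fw_int ind in auto)
      also have "\<dots> = M m * (\<bar>C\<bar> * I)" by (simp add: I_def)
      finally show "norm (\<integral>z. norm (F m z * w z) \<partial>?P) \<le> M m * (\<bar>C\<bar> * I)" by simp
    qed
  qed
  moreover have "(\<Sum>m. F m z * w z) = (\<Sum>m. F m z) * w z" for z
    by (rule suminf_mult2[symmetric]) (rule summable_norm_cancel[OF summ])
  ultimately show "(\<lambda>m. \<integral>z. F m z * w z \<partial>?P) sums (\<integral>z. (\<Sum>m. F m z) * w z \<partial>?P)" by simp
qed

text \<open>Fubini; \<open>torus_rep\<close> opens the circle at p, so \<gamma> may take different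
  values at the two ends of the interval.\<close>

lemma product_moment:
  fixes \<tau> \<gamma> :: "real \<Rightarrow> complex"
  assumes \<tau>: "continuous_on UNIV \<tau>" "\<And>t. t \<notin> {0<..<T} \<Longrightarrow> \<tau> t = 0"
    and \<gamma>: "continuous_on {p..p + 2 * pi} \<gamma>"
  shows "integrable (lborel \<Otimes>\<^sub>M torus_measure) (\<lambda>z. \<tau> (fst z) * \<gamma> (torus_rep p (snd z)) * (exp (of_real (fst z) * l) * torus_exp (- n) (snd z)))" (is "integrable _ ?F")
    and "(\<integral>z. \<tau> (fst z) * \<gamma> (torus_rep p (snd z)) * (exp (of_real (fst z) * l) * torus_exp (- n) (snd z)) \<partial>(lborel \<Otimes>\<^sub>M torus_measure))
     = integral {0..T} (\<lambda>t. \<tau> t * exp (of_real t * l)) * integral {p..p + 2 * pi} (\<lambda>x. \<gamma> x * cis (- of_int n * x))"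
proof -
  interpret pair_sigma_finite lborel torus_measure by (rule pair_sigma_finite_lborel_torus)
  have [measurable]: "\<tau> \<in> borel_measurable borel" using \<tau>(1) by (rule borel_measurable_continuous_onI)
  have gm [measurable]: "(\<lambda>X. \<gamma> (torus_rep p X)) \<in> borel_measurable borel" by (rule measurable_torus_rep_continuous[OF \<gamma>])
  define \<tau>e where "\<tau>e t = \<tau> t * exp (of_real t * l)" for t
  have \<tau>e0: "\<tau>e t = 0" if "t \<notin> {0<..<T}" for t using \<tau>(2)[OF that] by (simp add: \<tau>e_def)
  have \<tau>e_cont: "continuous_on A \<tau>e" for A
    unfolding \<tau>e_def[abs_def] by (intro continuous_intros continuous_on_subset[OF \<tau>(1)]) auto
  have [measurable]: "\<tau>e \<in> borel_measurable borel" by (rule borel_measurable_continuous_onI[OF \<tau>e_cont])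
  define \<gamma>e where "\<gamma>e X = \<gamma> (torus_rep p X) * torus_exp (- n) X" for X
  have [measurable]: "\<gamma>e \<in> borel_measurable borel" unfolding \<gamma>e_def[abs_def] by measurable
  have F: "?F z = \<tau>e (fst z) * \<gamma>e (snd z)" for z :: "real \<times> torus" by (simp add: \<tau>e_def \<gamma>e_def mult_ac)
  have bd: "\<exists>C. \<forall>x\<in>{a..b}. cmod (f x) \<le> C" if "continuous_on {a..b} f" for a b and f :: "real \<Rightarrow> complex"
    using compact_imp_bounded[OF compact_continuous_image[OF that]] by (auto simp: bounded_iff)
  obtain C1 where C1: "\<forall>t\<in>{0..T}. cmod (\<tau>e t) \<le> C1" using bd[OF \<tau>e_cont] by blast
  obtain C2 where C2: "\<forall>x\<in>{p..p + 2 * pi}. cmod (\<gamma> x) \<le> C2" using bd[OF \<gamma>] by blast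
  show int: "integrable (lborel \<Otimes>\<^sub>M torus_measure) ?F"
    unfolding F
  proof (rule integrable_bounded_in_time[where T = T and C = "\<bar>C1\<bar> * \<bar>C2\<bar>"])
    fix z :: "real \<times> torus"
    have "cmod (\<tau>e (fst z)) \<le> \<bar>C1\<bar>" 
    proof (cases "fst z \<in> {0<..<T}")
      case True then show ?thesis using C1 by (force intro: order_trans[OF _ abs_ge_self])
    qed (simp add: \<tau>e0)
    moreover have "cmod (\<gamma>e (snd z)) \<le> \<bar>C2\<bar>"
      using C2[rule_format, of "torus_rep p (snd z)"] torus_rep_ge[of p "snd z"] torus_rep_less[of "p" "snd z"]
      by (simp add: \<gamma>e_def norm_mult)
    ultimately show "cmod (\<tau>e (fst z) * \<gamma>e (snd z)) \<le> \<bar>C1\<bar> * \<bar>C2\<bar>" unfolding norm_mult by (intro mult_mono) auto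
  qed (auto simp: \<tau>e0)
  have "(\<integral>z. ?F z \<partial>(lborel \<Otimes>\<^sub>M torus_measure)) = (\<integral>s. (\<integral>X. \<tau>e s * \<gamma>e X \<partial>torus_measure) \<partial>lborel)"
    using integral_fst'[OF int] unfolding F by simp
  also have "\<dots> = (\<integral>s. \<tau>e s \<partial>lborel) * (\<integral>X. \<gamma>e X \<partial>torus_measure)" by simp
  also have "(\<integral>X. \<gamma>e X \<partial>torus_measure) = integral {p..p + 2 * pi} (\<lambda>x. \<gamma> x * cis (- of_int n * x))"
    by (rule integral_torus_interval) (auto intro!: continuous_intros \<gamma> simp: \<gamma>e_def torus_rep_to_torus)
  also have "(\<integral>s. \<tau>e s \<partial>lborel) = (LINT s:{0..T}|lborel. \<tau>e s)"
    unfolding set_lebesgue_integral_def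
    by (rule Bochner_Integration.integral_cong) (use \<tau>e0 in \<open>auto simp: indicator_def\<close>)
  also have "\<dots> = integral {0..T} \<tau>e"
    by (intro set_borel_integral_eq_integral borel_integrable_atLeastAtMost' \<tau>e_cont)
  finally show "(\<integral>z. ?F z \<partial>(lborel \<Otimes>\<^sub>M torus_measure))
     = integral {0..T} (\<lambda>t. \<tau> t * exp (of_real t * l)) * integral {p..p + 2 * pi} (\<lambda>x. \<gamma> x * cis (- of_int n * x))"
    unfolding \<tau>e_def[abs_def] .
qed

lemma integral_deriv_exp:
  fixes \<tau> :: "real \<Rightarrow> complex"
  assumes d: "\<And>t. (\<tau> has_vector_derivative \<tau>' t) (at t)" and z: "\<tau> 0 = 0" "\<tau> T = 0" and T: "0 \<le> T"
    and c: "continuous_on UNIV \<tau>'"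
  shows "integral {0..T} (\<lambda>t. \<tau>' t * exp (of_real t * l)) = - l * integral {0..T} (\<lambda>t. \<tau> t * exp (of_real t * l))"
proof -
  have c': "continuous_on UNIV \<tau>" by (rule continuous_on_of_vector_derivative) (use d in simp)
  have "((\<lambda>t. \<tau> t * (l * exp (l * of_real t)) + \<tau>' t * exp (l * of_real t)) has_integral
     \<tau> T * exp (l * of_real T) - \<tau> 0 * exp (l * of_real 0)) {0..T}"
    by (intro fundamental_theorem_of_calculus T has_vector_derivative_mult has_vector_derivative_exp_real
        has_vector_derivative_at_within[OF d])
  then have 1: "((\<lambda>t. l * (\<tau> t * exp (of_real t * l)) + \<tau>' t * exp (of_real t * l)) has_integral 0) {0..T}"
    by (simp add: z mult_ac)
  have i: "(\<lambda>t. f t * exp (of_real t * l)) integrable_on {0..T}" if "continuous_on UNIV f" for f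
    by (intro integrable_continuous_real continuous_intros continuous_on_subset[OF that]) auto
  have "l * integral {0..T} (\<lambda>t. \<tau> t * exp (of_real t * l)) + integral {0..T} (\<lambda>t. \<tau>' t * exp (of_real t * l)) = 0"
    using integral_unique[OF 1] i[OF c] i[OF c']
    by (simp add: Henstock_Kurzweil_Integration.integral_add integrable_on_mult_right)
  then show ?thesis by (simp add: eq_neg_iff_add_eq_0 add.commute)
qed

lemma integral_deriv_cis:
  fixes \<gamma> :: "real \<Rightarrow> complex"
  assumes d: "\<And>x. x \<in> {p..p + 2 * pi} \<Longrightarrow> (\<gamma> has_vector_derivative \<gamma>' x) (at x within {p..p + 2 * pi})"
    and per: "\<gamma> (p + 2 * pi) = \<gamma> p" and c: "continuous_on {p..p + 2 * pi} \<gamma>'"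
  shows "integral {p..p + 2 * pi} (\<lambda>x. \<gamma>' x * cis (- of_int n * x)) = \<i> * of_int n * integral {p..p + 2 * pi} (\<lambda>x. \<gamma> x * cis (- of_int n * x))"
proof -
  have c': "continuous_on {p..p + 2 * pi} \<gamma>" by (rule continuous_on_of_vector_derivative[OF d])
  have cis_per: "cis (- of_int n * (p + 2 * pi)) = cis (- of_int n * p)"
  proof -
    have "cis (- of_int n * (p + 2 * pi)) = cis (- of_int n * p) * cis (2 * pi * of_int (- n))"
      unfolding cis_mult by (simp add: algebra_simps)
    also have "cis (2 * pi * of_int (- n)) = 1" by (rule cis_multiple_2pi) simp
    finally show ?thesis by simp
  qed
  have "((\<lambda>x. \<gamma> x * ((\<i> * of_real (- of_int n)) * cis (- of_int n * x)) + \<gamma>' x * cis (- of_int n * x)) has_integral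
     \<gamma> (p + 2 * pi) * cis (- of_int n * (p + 2 * pi)) - \<gamma> p * cis (- of_int n * p)) {p..p + 2 * pi}"
    by (intro fundamental_theorem_of_calculus has_vector_derivative_mult has_vector_derivative_cis d) simp
  then have "((\<lambda>x. \<gamma> x * ((\<i> * of_real (- of_int n)) * cis (- of_int n * x)) + \<gamma>' x * cis (- of_int n * x)) has_integral 0) {p..p + 2 * pi}"
    unfolding cis_per per by simp
  then have 1: "((\<lambda>x. - (\<i> * of_int n) * (\<gamma> x * cis (- of_int n * x)) + \<gamma>' x * cis (- of_int n * x)) has_integral 0) {p..p + 2 * pi}"
    by (simp add: mult_ac)
  have i: "(\<lambda>x. f x * cis (- of_int n * x)) integrable_on {p..p + 2 * pi}" if "continuous_on {p..p + 2 * pi} f" for f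
    by (intro integrable_continuous_real continuous_intros that)
  have "- (\<i> * of_int n) * integral {p..p + 2 * pi} (\<lambda>x. \<gamma> x * cis (- of_int n * x)) + integral {p..p + 2 * pi} (\<lambda>x. \<gamma>' x * cis (- of_int n * x)) = 0"
    unfolding integral_unique[OF 1, symmetric] integral_mult_right[symmetric]
    by (rule Henstock_Kurzweil_Integration.integral_add[symmetric, OF integrable_on_mult_right[OF i[OF c']] i[OF c]])
  then show ?thesis by (simp add: algebra_simps)
qed

lemma heat_symbol_root: "heat_symbol d a k n = - of_real d * (\<i> * of_int n)\<^sup>2 + of_real a * (\<i> * of_int n) + of_real k"
  by (simp add: heat_symbol_def power_mult_distrib mult_ac)

text \<open>The left-hand side is the derivative of the boundary form that arises when \<open>\<Lambda> (x0 a0)\<close> is integrated by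
  parts against \<open>e = exp (- w x)\<close>, where \<open>\<Lambda> = - D \<partial>\<^sup>2 + A \<partial> + K\<close>; the \<open>xi\<close> and \<open>ai\<close> stand for the successive
  derivatives of the cutoff and of the function it localises.\<close>

lemma commutator_identity:
  fixes D A K L w e x0 x1 x2 a0 a1 a2 :: complex
  shows "(- D * ((x0 * a1 + x1 * a0) + w * (x0 * a0)) + A * (x0 * a0)) * (- w * e)
     + (- D * (((x0 * a2 + x1 * a1) + (x1 * a1 + x2 * a0)) + w * (x0 * a1 + x1 * a0)) + A * (x0 * a1 + x1 * a0)) * e
     = (- 2 * D * x1 * a1 - D * x2 * a0 + A * x1 * a0) * e
       - ((- D * w\<^sup>2 + A * w + K - L) * (x0 * a0 * e) + x0 * (D * a2 - A * a1 - (K - L) * a0) * e)"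
  by algebra

text \<open>\<open>\<theta> k\<close> and \<open>\<xi> k\<close> are the k-th derivatives of the
  time bump and of the spatial cutoff; \<open>a1\<close> and \<open>k1\<close> belong to the
  transport component, \<open>d\<close>, \<open>a\<close>, \<open>k\<close> to the heat component.
  The value of R makes (2 pi)^2 R / d = 1/2, the ratio of the geometric majorant.\<close>

locale flat_control =
  fixes d a k a1 k1 \<epsilon> p \<delta> :: real and \<theta> :: "nat \<Rightarrow> real \<Rightarrow> complex" and C R :: real
    and \<xi> :: "nat \<Rightarrow> real \<Rightarrow> complex" and Cx :: real
  assumes d: "d > 0" and \<epsilon>: "\<epsilon> > 0" and R: "R = d / (2 * (2 * pi)\<^sup>2)"
    and \<theta>_deriv: "\<And>k t. (\<theta> k has_vector_derivative \<theta> (Suc k) t) (at t)"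
    and \<theta>_supp: "\<And>k t. t \<notin> {\<epsilon>/3<..<2*\<epsilon>/3} \<Longrightarrow> \<theta> k t = 0"
    and \<theta>_bound: "\<And>k t. cmod (\<theta> k t) \<le> C * (fact k)\<^sup>2 * R ^ k" and C: "C \<ge> 0"
    and \<theta>_int: "(\<theta> 0 has_integral 1) {0..\<epsilon>}"
    and \<xi>_deriv: "\<And>k x. (\<xi> k has_vector_derivative \<xi> (Suc k) x) (at x)"
    and \<xi>_one: "\<And>x. x \<in> {p + \<delta>..p + 2 * pi - \<delta>} \<Longrightarrow> \<xi> 0 x = 1"
    and \<xi>_flat: "\<And>k x. x \<in> {p + \<delta>..p + 2 * pi - \<delta>} \<Longrightarrow> \<xi> (Suc k) x = 0"
    and \<xi>_ends: "\<And>k. \<xi> k p = 0" "\<And>k. \<xi> k (p + 2 * pi) = 0"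
    and \<xi>_bound: "\<And>k x. k \<le> 3 \<Longrightarrow> x \<in> {p..p + 2 * pi} \<Longrightarrow> cmod (\<xi> k x) \<le> Cx"
begin

abbreviation "lam \<equiv> heat_symbol d a k"
abbreviation "tau \<equiv> transport_symbol a1 k1"
abbreviation "P \<equiv> heat_iter p d a"
abbreviation "r n \<equiv> \<i> * complex_of_int n"
abbreviation "r' n \<equiv> complex_of_real (a / d) - \<i> * complex_of_int n"
abbreviation "X \<equiv> {p..p + 2 * pi}"

text \<open>With \<open>\<Lambda> = - d \<partial>\<^sup>2 + a \<partial> + k\<close>, the functions \<open>Q n m\<close> satisfy \<open>Q n 0 x = exp (i n x)\<close> and
  \<open>(\<Lambda> - lam n) (Q n (m + 1)) = - Q n m\<close>; \<open>q0\<close>, \<open>q1\<close>, \<open>q2\<close> are the derivatives of \<open>Q n (m + 1)\<close>.\<close>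

definition "Q n m x = P n (2 * m) x / of_real d ^ m"
definition "q0 n m x = P n (2 * m + 2) x / of_real d ^ Suc m"
definition "q1 n m x = (r n * P n (2 * m + 2) x + P n (2 * m + 1) x) / of_real d ^ Suc m"
definition "q2 n m x = (r n * (r n * P n (2 * m + 2) x + P n (2 * m + 1) x)
  + (r' n * P n (2 * m + 1) x + P n (2 * m) x)) / of_real d ^ Suc m"

lemma Q_Suc: "Q n (Suc m) x = q0 n m x"
  by (simp add: Q_def q0_def)

lemma P_deriv:
  assumes "x \<in> X"
  shows "(P n (2 * m + 2) has_vector_derivative r n * P n (2 * m + 2) x + P n (2 * m + 1) x) (at x within X)"
    and "(P n (2 * m + 1) has_vector_derivative r' n * P n (2 * m + 1) x + P n (2 * m) x) (at x within X)"
  using heat_iter_deriv[OF assms, of d a n "2 * m + 1"] heat_iter_deriv[OF assms, of d a n "2 * m"]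
  by (simp_all add: heat_root_def del: heat_iter.simps)

lemma q0_deriv: "x \<in> X \<Longrightarrow> (q0 n m has_vector_derivative q1 n m x) (at x within X)"
  unfolding q0_def[abs_def] q1_def by (intro has_vector_derivative_divide P_deriv)

lemma q1_deriv: "x \<in> X \<Longrightarrow> (q1 n m has_vector_derivative q2 n m x) (at x within X)"
  unfolding q1_def[abs_def] q2_def
  by (intro has_vector_derivative_divide has_vector_derivative_add has_vector_derivative_mult_right P_deriv)

text \<open>The roots \<open>r n\<close> and \<open>r' n\<close> add up to a / d and
  \<open>r n\<close> is a root of \<Lambda> - lam n, so this operator is - d times the product of
  the two first-order factors; dividing by d at each step absorbs the constant.\<close>

lemma ode: "Q n m x = of_real d * q2 n m x - of_real a * q1 n m x - (of_real k - lam n) * q0 n m x"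
proof -
  have d0: "complex_of_real d \<noteq> 0" using d by simp
  define D where "D = complex_of_real d ^ m"
  have D: "D \<noteq> 0" using d0 by (simp add: D_def)
  define b where "b = complex_of_real (a / d)"
  have a: "complex_of_real a = of_real d * b" using d by (simp add: b_def)
  show ?thesis
    unfolding Q_def q0_def q1_def q2_def heat_symbol_root power_Suc D_def[symmetric] b_def[symmetric] a
    using d0 D by (simp add: field_simps power2_eq_square)
qed

text \<open>\<open>g n m\<close> is the commutator \<open>[\<Lambda>, \<xi> 0] (Q n (m + 1))\<close>, which vanishes where the cutoff is constant.\<close>

definition "g n m x = - 2 * of_real d * \<xi> 1 x * q1 n m x - of_real d * \<xi> 2 x * q0 n m x + of_real a * \<xi> 1 x * q0 n m x"
definition "g' n m x = - 2 * of_real d * (\<xi> 1 x * q2 n m x + \<xi> 2 x * q1 n m x)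
   - of_real d * (\<xi> 2 x * q1 n m x + \<xi> 3 x * q0 n m x) + of_real a * (\<xi> 1 x * q1 n m x + \<xi> 2 x * q0 n m x)"

lemma \<xi>_deriv': "(\<xi> 0 has_vector_derivative \<xi> 1 x) (at x within S)" "(\<xi> 1 has_vector_derivative \<xi> 2 x) (at x within S)"
  "(\<xi> 2 has_vector_derivative \<xi> 3 x) (at x within S)"
  using \<xi>_deriv[of 0 x] \<xi>_deriv[of 1 x] \<xi>_deriv[of 2 x]
  by (auto intro: has_vector_derivative_at_within simp: numeral_2_eq_2 numeral_3_eq_3)

lemma g_deriv: "x \<in> X \<Longrightarrow> (g n m has_vector_derivative g' n m x) (at x within X)"
  unfolding g_def[abs_def] g'_def mult.assoc
  by (intro has_vector_derivative_add has_vector_derivative_diff has_vector_derivative_mult_right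
      has_vector_derivative_mult \<xi>_deriv' q0_deriv q1_deriv)

text \<open>Let \<Theta> be a primitive of \<open>\<theta> 0\<close>. The heat operator d/dt +
  \<Lambda> maps \<Theta> exp(- lam n t) e^(inx) to \<open>h n 0\<close> e^(inx), and by
  \<open>ode\<close> it maps the sum of all \<open>h n m * Q n (m + 1)\<close> to the negative of
  that. Multiplying the second sum by the cutoff leaves the source with time factors
  \<open>h n (j - 1)\<close> and these profiles: a part where the cutoff is not 1, and the
  commutators.\<close>

definition "G n j x = (case j of 0 \<Rightarrow> (1 - \<xi> 0 x) * P n 0 x | Suc m \<Rightarrow> g n m x)"
definition "G' n j x = (case j of 0 \<Rightarrow> (1 - \<xi> 0 x) * (r n * P n 0 x) - \<xi> 1 x * P n 0 x | Suc m \<Rightarrow> g' n m x)"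

lemma P0_deriv: "(P n 0 has_vector_derivative r n * P n 0 x) (at x within S)"
  using has_vector_derivative_exp_real[of "r n" x S] by simp

lemma G_deriv: "x \<in> X \<Longrightarrow> (G n j has_vector_derivative G' n j x) (at x within X)"
proof (cases j)
  case 0
  have "((\<lambda>x. (1 - \<xi> 0 x) * P n 0 x) has_vector_derivative (1 - \<xi> 0 x) * (r n * P n 0 x) + (0 - \<xi> 1 x) * P n 0 x) (at x within X)"
    by (intro has_vector_derivative_mult has_vector_derivative_diff has_vector_derivative_const \<xi>_deriv' P0_deriv)
  then show ?thesis by (simp add: G_def[abs_def] G'_def 0 algebra_simps)
next
  case (Suc m)
  then show "x \<in> X \<Longrightarrow> ?thesis" using g_deriv by (simp add: G_def[abs_def] G'_def)
qed

lemma exp_period: "exp (r n * of_real (p + 2 * pi)) = exp (r n * of_real p)"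
proof -
  have "exp (r n * of_real (p + 2 * pi)) = exp (r n * of_real p) * cis (2 * pi * of_int n)"
    by (simp add: cis_conv_exp distrib_left exp_add mult_ac)
  also have "cis (2 * pi * of_int n) = 1" by (rule cis_multiple_2pi) simp
  finally show ?thesis by simp
qed

lemma G_period: "G n j (p + 2 * pi) = G n j p"
proof (cases j)
  case 0
  then show ?thesis using exp_period[of n] by (simp add: G_def \<xi>_ends)
qed (simp add: G_def g_def \<xi>_ends)

lemma G_supp: "x \<in> {p + \<delta>..p + 2 * pi - \<delta>} \<Longrightarrow> G n j x = 0 \<and> G' n j x = 0"
  using \<xi>_flat[of x 0] \<xi>_flat[of x 1] \<xi>_flat[of x 2]
  by (auto simp: G_def G'_def g_def g'_def \<xi>_one numeral_2_eq_2 numeral_3_eq_3 split: nat.split)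

lemma continuous_on_q: "continuous_on X (q0 n m)" "continuous_on X (q1 n m)" "continuous_on X (q2 n m)"
  unfolding q0_def[abs_def] q1_def[abs_def] q2_def[abs_def]
  using d by (auto intro!: continuous_intros continuous_heat_iter simp del: heat_iter.simps)

lemma continuous_on_\<xi>: "continuous_on S (\<xi> j)"
  by (rule continuous_on_of_vector_derivative) (rule has_vector_derivative_at_within[OF \<xi>_deriv])

lemma continuous_on_G: "continuous_on X (G n j)"
  by (rule continuous_on_of_vector_derivative[OF G_deriv])

lemma continuous_on_G': "continuous_on X (G' n j)"
  unfolding G'_def[abs_def] g'_def
  by (cases j) (auto intro!: continuous_intros continuous_heat_iter continuous_on_q continuous_on_\<xi> simp del: heat_iter.simps)

text \<open>Only the bump is differentiated, not the heat factor; hence the extra term - lam n in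
  \<open>h_deriv\<close>, which cancels against \<Lambda>.\<close>

definition "h n m t = \<theta> m t * exp (- lam n * of_real t)"

lemma h_deriv: "(h n m has_vector_derivative h n (Suc m) t - lam n * h n m t) (at t)"
proof -
  have "(h n m has_vector_derivative \<theta> m t * (- lam n * exp (- lam n * of_real t)) + \<theta> (Suc m) t * exp (- lam n * of_real t)) (at t)"
    unfolding h_def[abs_def] by (intro has_vector_derivative_mult has_vector_derivative_exp_real \<theta>_deriv)
  then show ?thesis by (simp add: h_def algebra_simps)
qed

lemma continuous_on_h: "continuous_on S (h n m)"
  by (rule continuous_on_of_vector_derivative) (rule has_vector_derivative_at_within[OF h_deriv])

lemma h_supp: "t \<notin> {\<epsilon>/3<..<2*\<epsilon>/3} \<Longrightarrow> h n m t = 0"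
  by (simp add: h_def \<theta>_supp)

section \<open>Time and space moments of the source, and the atoms\<close>

definition "Th n m l = integral {0..\<epsilon>} (\<lambda>t. h n m t * exp (of_real t * l))"

text \<open>Integration by parts in time; the bump vanishes at both ends of the interval.\<close>

lemma Th_Suc: "Th n (Suc m) l = (lam n - l) * Th n m l"
proof -
  have i: "(\<lambda>t. h n m t * exp (of_real t * l)) integrable_on {0..\<epsilon>}" for m
    by (intro integrable_continuous_real continuous_intros continuous_on_h)
  have "integral {0..\<epsilon>} (\<lambda>t. (h n (Suc m) t - lam n * h n m t) * exp (of_real t * l)) = - l * Th n m l"
    unfolding Th_def
    by (rule integral_deriv_exp[OF h_deriv]) (use \<epsilon> h_supp in \<open>auto intro!: continuous_intros continuous_on_h\<close>)
  moreover have "integral {0..\<epsilon>} (\<lambda>t. (h n (Suc m) t - lam n * h n m t) * exp (of_real t * l)) = Th n (Suc m) l - lam n * Th n m l"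
    unfolding Th_def using i
    by (simp add: left_diff_distrib mult.assoc Henstock_Kurzweil_Integration.integral_diff integrable_on_mult_right)
  ultimately show ?thesis by (simp add: algebra_simps)
qed

lemma Th_0: "Th n 0 (lam n) = 1"
proof -
  have "(\<lambda>t. h n 0 t * exp (of_real t * lam n)) = \<theta> 0"
    by (simp add: h_def fun_eq_iff mult.assoc mult_exp_exp mult.commute)
  then show ?thesis unfolding Th_def using \<theta>_int by (simp add: integral_unique)
qed

definition "Xh n j i = integral X (\<lambda>x. G n j x * cis (- of_int i * x))"
definition "Y n m i = integral X (\<lambda>x. \<xi> 0 x * Q n m x * cis (- of_int i * x))"

lemma continuous_on_Q: "continuous_on X (Q n m)"
  unfolding Q_def[abs_def] using d by (auto intro!: continuous_intros continuous_heat_iter simp del: heat_iter.simps)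

lemma Xh_0: "Xh n 0 i = (if n = i then 2 * pi else 0) - Y n 0 i"
proof -
  have ie: "(\<lambda>x. P n 0 x * cis (- of_int i * x)) integrable_on X" "(\<lambda>x. \<xi> 0 x * Q n 0 x * cis (- of_int i * x)) integrable_on X"
    by (intro integrable_continuous_real continuous_intros continuous_heat_iter continuous_on_\<xi> continuous_on_Q)+
  have "Xh n 0 i = integral X (\<lambda>x. P n 0 x * cis (- of_int i * x) - \<xi> 0 x * Q n 0 x * cis (- of_int i * x))"
    unfolding Xh_def by (rule Henstock_Kurzweil_Integration.integral_cong) (simp add: G_def Q_def algebra_simps)
  also have "\<dots> = integral X (\<lambda>x. P n 0 x * cis (- of_int i * x)) - Y n 0 i"
    unfolding Y_def by (rule Henstock_Kurzweil_Integration.integral_diff[OF ie])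
  also have "integral X (\<lambda>x. P n 0 x * cis (- of_int i * x)) = integral X (\<lambda>x. cis (of_int (n - i) * x))"
    by (rule Henstock_Kurzweil_Integration.integral_cong) (simp add: cis_conv_exp mult_exp_exp algebra_simps)
  also have "\<dots> = (\<integral>X. torus_exp (n - i) X \<partial>torus_measure)"
    by (intro integral_torus_interval(1)[symmetric] continuous_intros) auto
  also have "\<dots> = (if n = i then 2 * pi else 0)" by (simp add: integral_torus_exp)
  finally show ?thesis .
qed

text \<open>Two integrations by parts move \<Lambda> onto the exponential, where it acts as lam i.
  The boundary terms vanish because the cutoff and its derivatives vanish at both ends, although
  \<open>Q\<close> is not periodic.\<close>

lemma Xh_Suc: "Xh n (Suc m) i = (lam i - lam n) * Y n (Suc m) i + Y n m i"
proof -
  let ?e = "\<lambda>x. cis (- of_int i * x)"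
  define Fb where "Fb x = (- of_real d * ((\<xi> 0 x * q1 n m x + \<xi> 1 x * q0 n m x) + r i * (\<xi> 0 x * q0 n m x)) + of_real a * (\<xi> 0 x * q0 n m x)) * ?e x" for x
  have cis': "(?e has_vector_derivative - r i * ?e x) (at x within X)" for x
    using has_vector_derivative_cis[of "- of_int i" x X] by simp
  have "((\<lambda>x. (- of_real d * ((\<xi> 0 x * q1 n m x + \<xi> 1 x * q0 n m x) + r i * (\<xi> 0 x * q0 n m x)) + of_real a * (\<xi> 0 x * q0 n m x)) * (- r i * ?e x)
     + (- of_real d * (((\<xi> 0 x * q2 n m x + \<xi> 1 x * q1 n m x) + (\<xi> 1 x * q1 n m x + \<xi> 2 x * q0 n m x)) + r i * (\<xi> 0 x * q1 n m x + \<xi> 1 x * q0 n m x)) + of_real a * (\<xi> 0 x * q1 n m x + \<xi> 1 x * q0 n m x)) * ?e x)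
     has_integral Fb (p + 2 * pi) - Fb p) X"
    unfolding Fb_def
    by (intro fundamental_theorem_of_calculus has_vector_derivative_mult has_vector_derivative_add
        has_vector_derivative_mult_right \<xi>_deriv' q0_deriv q1_deriv cis') simp_all
  moreover have "Fb (p + 2 * pi) - Fb p = 0" by (simp add: Fb_def \<xi>_ends)
  moreover have "(- of_real d * ((\<xi> 0 x * q1 n m x + \<xi> 1 x * q0 n m x) + r i * (\<xi> 0 x * q0 n m x)) + of_real a * (\<xi> 0 x * q0 n m x)) * (- r i * ?e x)
     + (- of_real d * (((\<xi> 0 x * q2 n m x + \<xi> 1 x * q1 n m x) + (\<xi> 1 x * q1 n m x + \<xi> 2 x * q0 n m x)) + r i * (\<xi> 0 x * q1 n m x + \<xi> 1 x * q0 n m x)) + of_real a * (\<xi> 0 x * q1 n m x + \<xi> 1 x * q0 n m x)) * ?e x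
     = G n (Suc m) x * ?e x - ((lam i - lam n) * (\<xi> 0 x * Q n (Suc m) x * ?e x) + \<xi> 0 x * Q n m x * ?e x)" for x
  proof -
    have G: "G n (Suc m) x = g n m x" by (simp add: G_def)
    show ?thesis unfolding Q_Suc G g_def ode[of n m x] heat_symbol_root[of d a k i]
      by (rule commutator_identity)
  qed
  ultimately have "((\<lambda>x. G n (Suc m) x * ?e x - ((lam i - lam n) * (\<xi> 0 x * Q n (Suc m) x * ?e x) + \<xi> 0 x * Q n m x * ?e x)) has_integral 0) X"
    by (simp only:)
  moreover have iG: "(\<lambda>x. G n (Suc m) x * ?e x) integrable_on X"
    by (intro integrable_continuous_real continuous_intros continuous_on_G)
  moreover have iY: "(\<lambda>x. \<xi> 0 x * Q n m x * ?e x) integrable_on X" for m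
    by (intro integrable_continuous_real continuous_intros continuous_on_\<xi> continuous_on_Q)
  ultimately have "Xh n (Suc m) i - ((lam i - lam n) * Y n (Suc m) i + Y n m i) = 0"
    unfolding Xh_def Y_def
    by (subst (asm) has_integral_iff)
       (simp add: Henstock_Kurzweil_Integration.integral_diff Henstock_Kurzweil_Integration.integral_add integrable_on_mult_right integrable_add)
  then show ?thesis by simp
qed

text \<open>The factor lam i - lam n from space is the negative of the factor that
  \<open>Th_Suc\<close> produces in time, so consecutive terms cancel.\<close>

lemma telescope: "(\<Sum>m<N. Th n m (lam i) * Xh n (Suc m) i) = Th n 0 (lam i) * Y n 0 i - Th n N (lam i) * Y n N i"
  by (induction N) (simp_all add: Xh_Suc Th_Suc algebra_simps)

text \<open>Each \<open>atom n j\<close> is \<open>(\<partial>\<^sub>t + a1 \<partial>\<^sub>x + k1)\<close> applied to the product \<open>h n (j - 1) t * G n j x\<close>, hence all its transport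
  moments vanish. The index \<open>j - 1\<close> is truncated: both \<open>j = 0\<close> and \<open>j = 1\<close> use \<open>h n 0\<close>.\<close>

definition atom :: "int \<Rightarrow> nat \<Rightarrow> real \<times> torus \<Rightarrow> complex" where
  "atom n j z = (h n (Suc (j - 1)) (fst z) - lam n * h n (j - 1) (fst z)) * G n j (torus_rep p (snd z))
     + h n (j - 1) (fst z) * (of_real a1 * G' n j (torus_rep p (snd z)) + of_real k1 * G n j (torus_rep p (snd z)))"

lemma h_meas [measurable]: "h n m \<in> borel_measurable borel"
  by (rule borel_measurable_continuous_onI) (rule continuous_on_h)

lemma atom_meas [measurable]: "atom n j \<in> borel_measurable (lborel \<Otimes>\<^sub>M torus_measure)"
proof -
  have [measurable]: "(\<lambda>X. G n j (torus_rep p X)) \<in> borel_measurable borel" "(\<lambda>X. G' n j (torus_rep p X)) \<in> borel_measurable borel"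
    by (rule measurable_torus_rep_continuous[OF continuous_on_G] measurable_torus_rep_continuous[OF continuous_on_G'])+
  show ?thesis unfolding atom_def[abs_def] by measurable
qed

lemma atom_supp: "s \<notin> {0<..<\<epsilon>} \<Longrightarrow> atom n j (s, Z) = 0"
  using \<epsilon> h_supp[of s] by (auto simp: atom_def)

lemma atom_supp_space: "torus_rep p Z \<in> {p + \<delta>..p + 2 * pi - \<delta>} \<Longrightarrow> atom n j (s, Z) = 0"
  using G_supp by (simp add: atom_def)

text \<open>By parts, the time derivative becomes - l and the space derivative becomes the factor of
  the frequency i, so the transport operator contributes \<open>tau i - l\<close>. Periodicity of
  \<open>G\<close> removes the boundary terms in space.\<close>

lemma atom_moment:
  "(\<integral>z. atom n j z * (exp (of_real (fst z) * l) * torus_exp (- i) (snd z)) \<partial>(lborel \<Otimes>\<^sub>M torus_measure))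
    = (tau i - l) * (Th n (j - 1) l * Xh n j i)"
proof -
  let ?w = "\<lambda>z :: real \<times> torus. exp (of_real (fst z) * l) * torus_exp (- i) (snd z)"
  let ?P = "lborel \<Otimes>\<^sub>M torus_measure"
  define hd where "hd t = h n (Suc (j - 1)) t - lam n * h n (j - 1) t" for t
  define Gd where "Gd x = of_real a1 * G' n j x + of_real k1 * G n j x" for x
  have hd: "continuous_on UNIV hd" "\<And>t. t \<notin> {0<..<\<epsilon>} \<Longrightarrow> hd t = 0"
    unfolding hd_def[abs_def] using \<epsilon> by (auto intro!: continuous_intros continuous_on_h simp: h_supp)
  have h: "continuous_on UNIV (h n (j - 1))" "\<And>t. t \<notin> {0<..<\<epsilon>} \<Longrightarrow> h n (j - 1) t = 0"
    using \<epsilon> by (auto intro!: continuous_on_h simp: h_supp)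
  have Gd: "continuous_on X Gd" unfolding Gd_def[abs_def]
    by (intro continuous_intros continuous_on_G continuous_on_G')
  have "(\<integral>z. atom n j z * ?w z \<partial>?P) = (\<integral>z. hd (fst z) * G n j (torus_rep p (snd z)) * ?w z + h n (j - 1) (fst z) * Gd (torus_rep p (snd z)) * ?w z \<partial>?P)"
    by (simp add: atom_def hd_def Gd_def distrib_right)
  also have "\<dots> = integral {0..\<epsilon>} (\<lambda>t. hd t * exp (of_real t * l)) * Xh n j i
      + Th n (j - 1) l * integral X (\<lambda>x. Gd x * cis (- of_int i * x))"
    unfolding Xh_def Th_def
    using product_moment[OF hd continuous_on_G, where l = l and n = i] product_moment[OF h Gd, where l = l and n = i]
    by (subst Bochner_Integration.integral_add) auto
  also have "integral {0..\<epsilon>} (\<lambda>t. hd t * exp (of_real t * l)) = - l * Th n (j - 1) l"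
    unfolding Th_def hd_def
    by (rule integral_deriv_exp[OF h_deriv]) (use \<epsilon> h_supp in \<open>auto intro!: continuous_intros continuous_on_h\<close>)
  also have "integral X (\<lambda>x. Gd x * cis (- of_int i * x)) = of_real a1 * (r i * Xh n j i) + of_real k1 * Xh n j i"
  proof -
    have i1: "(\<lambda>x. G' n j x * cis (- of_int i * x)) integrable_on X" "(\<lambda>x. G n j x * cis (- of_int i * x)) integrable_on X"
      by (intro integrable_continuous_real continuous_intros continuous_on_G continuous_on_G')+
    have "integral X (\<lambda>x. Gd x * cis (- of_int i * x)) = integral X (\<lambda>x. of_real a1 * (G' n j x * cis (- of_int i * x)) + of_real k1 * (G n j x * cis (- of_int i * x)))"
      by (simp add: Gd_def algebra_simps)
    also have "\<dots> = of_real a1 * integral X (\<lambda>x. G' n j x * cis (- of_int i * x)) + of_real k1 * Xh n j i"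
      unfolding Xh_def integral_mult_right[symmetric]
      by (rule Henstock_Kurzweil_Integration.integral_add) (intro integrable_on_mult_right i1)+
    also have "integral X (\<lambda>x. G' n j x * cis (- of_int i * x)) = r i * Xh n j i"
      unfolding Xh_def by (rule integral_deriv_cis[OF G_deriv G_period continuous_on_G'])
    finally show ?thesis .
  qed
  finally show ?thesis by (simp add: transport_symbol_def algebra_simps)
qed

end

section \<open>Convergence estimates for the atoms\<close>

lemma fact_square_le: "(fact m)\<^sup>2 \<le> (fact (2 * m) :: real)"
proof -
  have "fact m * fact m \<le> (fact (m + m) :: nat)"
    by (intro dvd_imp_le fact_fact_dvd_fact) simp
  then have "real (fact m * fact m) \<le> real (fact (m + m))" by (simp only: of_nat_le_iff)
  then show ?thesis by (simp add: power2_eq_square mult_2)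
qed

text \<open>The quadratic factor arises because the atoms contain one more time derivative, which
  raises (m!)^2 to ((m + 1)!)^2.\<close>

lemma summable_square_half: "summable (\<lambda>j::nat. (real j + 1)\<^sup>2 * (1 / 2) ^ j)"
proof (rule summable_comparison_test'[of "\<lambda>j. 18 * (3 / 4) ^ j" 0])
  show "summable (\<lambda>j. 18 * (3 / 4 :: real) ^ j)" by (intro summable_mult summable_geometric) simp
  have "(real j + 1)\<^sup>2 \<le> 18 * (3 / 2) ^ j" for j
  proof (induction j)
    case 0 then show ?case by simp
  next
    case (Suc j)
    show ?case
    proof (cases "j \<ge> 4")
      case True
      \<comment> \<open>From j = 4 on, the square grows by a factor of at most 3/2 per step; the
        smaller indices are checked by hand.\<close>
      have "0 \<le> (real j - 4) * (real j + 2)" using True by simp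
      then have "(real j + 2)\<^sup>2 \<le> 3 / 2 * (real j + 1)\<^sup>2"
        by (simp add: power2_eq_square algebra_simps)
      also have "\<dots> \<le> 3 / 2 * (18 * (3 / 2) ^ j)" using Suc by simp
      finally show ?thesis by (simp add: algebra_simps)
    next
      case False
      then have "j \<in> {0, 1, 2, 3}" by auto
      then show ?thesis by (auto simp: power2_eq_square power3_eq_cube)
    qed
  qed
  then have "(real j + 1)\<^sup>2 * (1 / 2) ^ j \<le> 18 * (3 / 2) ^ j * (1 / 2) ^ j" for j
    by (intro mult_right_mono) auto
  also have "18 * (3 / 2) ^ j * (1 / 2) ^ j = 18 * (3 / 4 :: real) ^ j" for j
    by (simp add: mult.assoc flip: power_mult_distrib)
  finally show "norm ((real j + 1)\<^sup>2 * (1 / 2) ^ j) \<le> 18 * (3 / 4) ^ j" for j by simp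
qed

text \<open>The enumeration reaches the integer i only at an index of size at most about 2 |i|, so
  the terms are bounded by a multiple of 1 / m^2.\<close>

lemma summable_int_decode: "summable (\<lambda>m. 1 / (1 + (real_of_int (int_decode m))\<^sup>2))"
proof (rule summable_comparison_test'[of "\<lambda>m. 16 * inverse ((real (Suc m))\<^sup>2)" 0])
  show "summable (\<lambda>m. 16 * inverse ((real (Suc m))\<^sup>2))"
    using inverse_power_summable[of 2, where 'a = real]
    by (intro summable_mult) (subst summable_Suc_iff[of "\<lambda>m. inverse ((real m)\<^sup>2)"], simp)
  fix m
  have "int m \<le> 2 * \<bar>int_decode m\<bar> + 1"
    by (cases "even m") (auto simp: int_decode_def sum_decode_def elim!: evenE oddE)
  then have "real m \<le> 2 * \<bar>real_of_int (int_decode m)\<bar> + 1" by linarith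
  then have "real (Suc m) \<le> 2 * \<bar>real_of_int (int_decode m)\<bar> + 2" by simp
  then have "(real (Suc m))\<^sup>2 \<le> (2 * \<bar>real_of_int (int_decode m)\<bar> + 2)\<^sup>2" by (intro power_mono) auto
  also have "\<dots> \<le> 16 * (1 + (real_of_int (int_decode m))\<^sup>2)"
  proof -
    have "(2 * y + 2)\<^sup>2 \<le> 16 * (1 + y\<^sup>2)" for y :: real
    proof -
      have "0 \<le> 4 * (y - 1)\<^sup>2 + 8 * y\<^sup>2 + 8" by simp
      then show ?thesis by (simp add: power2_eq_square algebra_simps)
    qed
    from this[of "\<bar>real_of_int (int_decode m)\<bar>"] show ?thesis by (simp only: power2_abs)
  qed
  finally have "(real (Suc m))\<^sup>2 \<le> 16 * (1 + (real_of_int (int_decode m))\<^sup>2)" .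
  then show "norm (1 / (1 + (real_of_int (int_decode m))\<^sup>2)) \<le> 16 * inverse ((real (Suc m))\<^sup>2)"
    by (simp add: divide_simps add_pos_nonneg del: of_nat_Suc)
qed

context flat_control
begin

definition "E = exp (\<bar>a / d\<bar> * (2 * pi))"
text \<open>One bound for the three iterates of order 2m, 2m + 1 and 2m + 2: the largest power over
  the smallest factorial.\<close>

definition "Bm m = E * (2 * pi) ^ (2 * m + 2) / fact (2 * m)"
text \<open>Dominates 1 + |r n| + |r' n|; its square pays for two space derivatives.\<close>

definition "v n = 1 + \<bar>real_of_int n\<bar> + (\<bar>a / d\<bar> + \<bar>real_of_int n\<bar>)"
text \<open>Bounds |exp(- lam n t)| on the support of the bump: k contributes at most exp(|k|
  \<epsilon>), and t \<ge> \<epsilon> / 3 gives the Gaussian factor.\<close>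

definition "\<kappa> n = exp (\<bar>k\<bar> * \<epsilon>) * exp (- (d * \<epsilon> / 3 * (real_of_int n)\<^sup>2))"
definition "A0 = E * (2 * pi)\<^sup>2 / d"
text \<open>The coefficients of \<open>g'\<close>, namely 2 d, d and |a|, each multiply a sum of two
  products: 4 d + 2 d + 2 |a|.\<close>

definition "Cg = (6 * d + 2 * \<bar>a\<bar>) * Cx"
text \<open>Everything in the bound of an atom that depends on the mode n; \<open>DD\<close>
  collects the rest.\<close>

definition "ze n = \<kappa> n * (v n)\<^sup>2 * (1 + R + cmod (lam n) + \<bar>a1\<bar> + \<bar>k1\<bar>)"
definition "DD = C * (2 * Cg * A0 + (1 + 2 * Cx))"

lemma E_pos: "E > 0" by (simp add: E_def)
lemma Cx: "Cx \<ge> 0" using \<xi>_bound[of 0 p] by (simp add: \<xi>_ends)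
lemma R_pos: "R > 0" using d by (simp add: R)
lemma v_ge_1: "v n \<ge> 1" by (simp add: v_def)
lemma v_sq_ge: "v n \<le> (v n)\<^sup>2" "1 \<le> (v n)\<^sup>2"
  using v_ge_1[of n] by (simp_all add: power2_eq_square mult_le_cancel_left1 mult_ge1_I)
lemma Cg: "Cg \<ge> 0" using d Cx by (simp add: Cg_def)
lemma A0: "A0 \<ge> 0" using d E_pos by (simp add: A0_def)
lemma \<kappa>_pos: "\<kappa> n > 0" by (simp add: \<kappa>_def)
lemma Bm_nonneg: "Bm m \<ge> 0" using E_pos by (simp add: Bm_def)

lemma P_bound_gen:
  assumes x: "x \<in> X"
  shows "cmod (P n j x) \<le> E * (2 * pi) ^ j / fact j"
proof -
  have "cmod (P n j x) \<le> exp (\<bar>a / d\<bar> * (x - p)) * (x - p) ^ j / fact j" by (rule heat_iter_bound[OF x])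
  also have "\<dots> \<le> E * (2 * pi) ^ j / fact j"
  proof -
    have "\<bar>a / d\<bar> * (x - p) \<le> \<bar>a / d\<bar> * (2 * pi)" using x by (intro mult_left_mono) auto
    then have "exp (\<bar>a / d\<bar> * (x - p)) \<le> E" unfolding E_def exp_le_cancel_iff .
    then show ?thesis
      using x E_pos by (intro divide_right_mono mult_mono power_mono) auto
  qed
  finally show ?thesis .
qed

lemma P_bound:
  assumes x: "x \<in> X" and j: "2 * m \<le> j" "j \<le> 2 * m + 2"
  shows "cmod (P n j x) \<le> Bm m"
proof -
  have L: "1 \<le> 2 * pi" using pi_gt3 by simp
  have "cmod (P n j x) \<le> E * (2 * pi) ^ j / fact j" by (rule P_bound_gen[OF x])
  also have "\<dots> \<le> E * (2 * pi) ^ (2 * m + 2) / fact (2 * m)"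
    using E_pos j L by (intro frac_le mult_left_mono power_increasing fact_mono) auto
  finally show ?thesis unfolding Bm_def .
qed

lemma q_bound:
  assumes x: "x \<in> X"
  shows "cmod (q0 n m x) \<le> (v n)\<^sup>2 * Bm m / d ^ Suc m" (is ?A)
    and "cmod (q1 n m x) \<le> (v n)\<^sup>2 * Bm m / d ^ Suc m" (is ?B)
    and "cmod (q2 n m x) \<le> (v n)\<^sup>2 * Bm m / d ^ Suc m" (is ?C)
proof -
  let ?y = "\<bar>real_of_int n\<bar>" and ?y' = "\<bar>a / d\<bar> + \<bar>real_of_int n\<bar>"
  have P: "cmod (P n (2 * m + 2) x) \<le> Bm m" "cmod (P n (2 * m + 1) x) \<le> Bm m" "cmod (P n (2 * m) x) \<le> Bm m"
    by (rule P_bound[OF x]; simp)+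
  have r: "cmod (r n) \<le> ?y" by (simp add: norm_mult)
  have r': "cmod (r' n) \<le> ?y'" by (rule order_trans[OF norm_triangle_ineq4]) (simp add: norm_mult norm_divide)
  have d': "cmod (of_real d ^ Suc m) = d ^ Suc m" using d by (simp add: norm_power norm_mult)
  have n1: "cmod (r n * P n (2 * m + 2) x + P n (2 * m + 1) x) \<le> (?y + 1) * Bm m"
    by (rule norm_triangle_le, unfold norm_mult distrib_right mult_1) (intro add_mono mult_mono P r; simp add: Bm_nonneg)
  have n2: "cmod (r n * (r n * P n (2 * m + 2) x + P n (2 * m + 1) x) + (r' n * P n (2 * m + 1) x + P n (2 * m) x))
     \<le> ?y * ((?y + 1) * Bm m) + (?y' * Bm m + Bm m)"
    unfolding norm_mult
    by (intro norm_triangle_le add_mono order_trans[OF norm_mult_ineq] mult_mono n1 P r r')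
       (simp_all add: Bm_nonneg)
  have sq: "y * (y + 1) + z + 1 \<le> (1 + y + z)\<^sup>2" if "0 \<le> y" "0 \<le> z" for y z :: real
  proof -
    have "0 \<le> y + 2 * y * z + z\<^sup>2 + z" using that by simp
    then show ?thesis by (simp add: power2_eq_square algebra_simps)
  qed
  have vv: "?y * (?y + 1) + ?y' + 1 \<le> (v n)\<^sup>2"
    unfolding v_def by (rule sq) (intro abs_ge_zero add_nonneg_nonneg)+
  have v1: "?y + 1 \<le> (v n)\<^sup>2" using v_sq_ge(1)[of n] unfolding v_def by linarith
  have fin: "cmod (z / of_real d ^ Suc m) \<le> (v n)\<^sup>2 * Bm m / d ^ Suc m" if "cmod z \<le> (v n)\<^sup>2 * Bm m" for z
    unfolding norm_divide d' using that d by (intro divide_right_mono) auto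
  show ?A unfolding q0_def
    by (rule fin, rule order_trans[OF P(1)]) (use v_sq_ge(2)[of n] Bm_nonneg[of m] in \<open>simp add: mult_le_cancel_right1\<close>)
  show ?B unfolding q1_def
    by (rule fin, rule order_trans[OF n1]) (intro mult_right_mono v1 Bm_nonneg)
  show ?C unfolding q2_def
    by (rule fin, rule order_trans[OF n2])
       (use mult_right_mono[OF vv Bm_nonneg[of m]] in \<open>simp add: algebra_simps\<close>)
qed

lemma G_bound_Suc:
  assumes x: "x \<in> X"
  shows "cmod (G n (Suc m) x) \<le> Cg * ((v n)\<^sup>2 * Bm m / d ^ Suc m)"
    and "cmod (G' n (Suc m) x) \<le> Cg * ((v n)\<^sup>2 * Bm m / d ^ Suc m)"
proof -
  define q where "q = (v n)\<^sup>2 * Bm m / d ^ Suc m"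
  note qb = q_bound[OF x, of n m, folded q_def]
  have q: "0 \<le> q" using d by (simp add: q_def Bm_nonneg)
  have \<xi>: "cmod (\<xi> 1 x) \<le> Cx" "cmod (\<xi> 2 x) \<le> Cx" "cmod (\<xi> 3 x) \<le> Cx"
    using x by (auto intro!: \<xi>_bound)
  have m: "cmod (\<xi> i x * z) \<le> Cx * q" if "cmod (\<xi> i x) \<le> Cx" "cmod z \<le> q" for i z
    unfolding norm_mult using that Cx by (intro mult_mono) auto
  have sc: "cmod (of_real b * z) \<le> \<bar>b\<bar> * (c * (Cx * q))" if "cmod z \<le> c * (Cx * q)" for b z and c :: real
    unfolding norm_mult norm_of_real using that by (intro mult_left_mono) auto
  have m2: "cmod (\<xi> i x * z + \<xi> j x * y) \<le> 2 * (Cx * q)"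
    if "cmod (\<xi> i x) \<le> Cx" "cmod z \<le> q" "cmod (\<xi> j x) \<le> Cx" "cmod y \<le> q" for i j z y
    using norm_triangle_le[of "\<xi> i x * z" "\<xi> j x * y" "2 * (Cx * q)"] m[OF that(1,2)] m[OF that(3,4)] by simp
  have "G n (Suc m) x = of_real (- 2 * d) * (\<xi> 1 x * q1 n m x) - of_real d * (\<xi> 2 x * q0 n m x) + of_real a * (\<xi> 1 x * q0 n m x)"
    by (simp add: G_def g_def mult.assoc)
  also have "cmod \<dots> \<le> \<bar>- 2 * d\<bar> * (1 * (Cx * q)) + \<bar>d\<bar> * (1 * (Cx * q)) + \<bar>a\<bar> * (1 * (Cx * q))"
    by (intro norm_triangle_le[OF add_mono] order_trans[OF norm_triangle_ineq4] add_mono sc) (simp_all only: mult_1 m \<xi> qb)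
  also have "\<dots> \<le> Cg * q"
    unfolding Cg_def using d Cx q by (simp add: algebra_simps)
  finally show "cmod (G n (Suc m) x) \<le> Cg * ((v n)\<^sup>2 * Bm m / d ^ Suc m)" unfolding q_def .
  have "G' n (Suc m) x = of_real (- 2 * d) * (\<xi> 1 x * q2 n m x + \<xi> 2 x * q1 n m x)
     - of_real d * (\<xi> 2 x * q1 n m x + \<xi> 3 x * q0 n m x) + of_real a * (\<xi> 1 x * q1 n m x + \<xi> 2 x * q0 n m x)"
    by (simp add: G'_def g'_def)
  also have "cmod \<dots> \<le> \<bar>- 2 * d\<bar> * (2 * (Cx * q)) + \<bar>d\<bar> * (2 * (Cx * q)) + \<bar>a\<bar> * (2 * (Cx * q))"
    by (intro norm_triangle_le[OF add_mono] order_trans[OF norm_triangle_ineq4] add_mono sc) (simp_all only: m2 \<xi> qb)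
  also have "\<dots> \<le> Cg * q"
    unfolding Cg_def using d Cx q by (simp add: algebra_simps)
  finally show "cmod (G' n (Suc m) x) \<le> Cg * ((v n)\<^sup>2 * Bm m / d ^ Suc m)" unfolding q_def .
qed

lemma G_bound_0:
  assumes x: "x \<in> X"
  shows "cmod (G n 0 x) \<le> (1 + 2 * Cx) * (v n)\<^sup>2" "cmod (G' n 0 x) \<le> (1 + 2 * Cx) * (v n)\<^sup>2"
proof -
  have P0: "cmod (P n 0 x) = 1" by simp
  have \<xi>: "cmod (\<xi> 0 x) \<le> Cx" "cmod (\<xi> 1 x) \<le> Cx" using x by (auto intro!: \<xi>_bound)
  have 1: "cmod (1 - \<xi> 0 x) \<le> 1 + Cx" using norm_triangle_ineq4[of 1 "\<xi> 0 x"] \<xi>(1) by simp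
  have "cmod (G n 0 x) \<le> 1 + Cx" using 1 P0 by (simp add: G_def norm_mult del: heat_iter.simps)
  also have "\<dots> \<le> (1 + 2 * Cx) * 1" using Cx by simp
  also have "\<dots> \<le> (1 + 2 * Cx) * (v n)\<^sup>2" using Cx v_sq_ge[of n] by (intro mult_left_mono) auto
  finally show "cmod (G n 0 x) \<le> (1 + 2 * Cx) * (v n)\<^sup>2" .
  have y: "\<bar>real_of_int n\<bar> \<le> v n" by (simp add: v_def)
  have "cmod (G' n 0 x) \<le> cmod ((1 - \<xi> 0 x) * (r n * P n 0 x)) + cmod (\<xi> 1 x * P n 0 x)"
    unfolding G'_def by (simp only: nat.case) (rule norm_triangle_ineq4)
  also have "\<dots> = cmod (1 - \<xi> 0 x) * \<bar>real_of_int n\<bar> + cmod (\<xi> 1 x)"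
    unfolding norm_mult P0 by (simp add: norm_mult)
  also have "\<dots> \<le> (1 + Cx) * v n + Cx * v n"
    using 1 \<xi>(2) y v_ge_1[of n] Cx by (intro add_mono mult_mono order_trans[OF \<xi>(2)]) (auto simp: mult_le_cancel_left1)
  also have "\<dots> = (1 + 2 * Cx) * v n" by (simp add: algebra_simps)
  also have "\<dots> \<le> (1 + 2 * Cx) * (v n)\<^sup>2" using Cx v_sq_ge[of n] by (intro mult_left_mono) auto
  finally show "cmod (G' n 0 x) \<le> (1 + 2 * Cx) * (v n)\<^sup>2" .
qed

lemma h_bound: "cmod (h n m t) \<le> \<kappa> n * C * ((fact m)\<^sup>2 * R ^ m)"
proof (cases "t \<in> {\<epsilon>/3<..<2*\<epsilon>/3}")
  case True
  have "Re (lam n) = d * (real_of_int n)\<^sup>2 + k" by (simp add: heat_symbol_def power2_eq_square)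
  moreover have "\<epsilon> / 3 * (d * (real_of_int n)\<^sup>2) \<le> t * (d * (real_of_int n)\<^sup>2)"
    using True d by (intro mult_right_mono) auto
  moreover have "- (\<epsilon> * \<bar>k\<bar>) \<le> t * k"
  proof -
    have "\<bar>t * k\<bar> \<le> \<epsilon> * \<bar>k\<bar>" unfolding abs_mult using True \<epsilon> by (intro mult_right_mono) auto
    then show ?thesis using abs_ge_minus_self[of "t * k"] by linarith
  qed
  ultimately have "- (t * Re (lam n)) \<le> \<bar>k\<bar> * \<epsilon> + - (d * \<epsilon> / 3 * (real_of_int n)\<^sup>2)"
    by (simp add: algebra_simps)
  then have "exp (- (t * Re (lam n))) \<le> \<kappa> n" unfolding \<kappa>_def exp_add[symmetric] exp_le_cancel_iff .
  then have e: "cmod (exp (- lam n * of_real t)) \<le> \<kappa> n" by (simp add: mult.commute)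
  have "cmod (h n m t) = cmod (\<theta> m t) * cmod (exp (- lam n * of_real t))" by (simp only: h_def norm_mult)
  also have "\<dots> \<le> (C * (fact m)\<^sup>2 * R ^ m) * \<kappa> n" using C R_pos by (intro mult_mono \<theta>_bound e) auto
  finally show ?thesis by (simp add: mult_ac)
next
  case False
  then show ?thesis using C R_pos \<kappa>_pos[of n] by (simp add: h_supp)
qed

text \<open>Here the loss in time meets the gain in space: (m!)^2 / (2m)! is at most 1 because the
  central binomial coefficient is at least 1, and the choice of R turns the remaining powers into
  \<open>(1/2) ^ m\<close>.\<close>

lemma geometric_factor: "Bm m / d ^ Suc m * ((fact m)\<^sup>2 * R ^ m) \<le> A0 * (1 / 2) ^ m"
proof -
  define f where "f = (fact (2 * m) :: real)"
  have f: "f > 0" by (simp add: f_def)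
  have RL: "(2 * pi)\<^sup>2 * R / d = 1 / 2" using d by (simp add: R field_simps)
  have four: "(2::real) ^ m * 2 ^ m = 4 ^ m" by (simp flip: power_mult_distrib)
  have "Bm m / d ^ Suc m * ((fact m)\<^sup>2 * R ^ m) = A0 * ((2 * pi)\<^sup>2 * R / d) ^ m * ((fact m)\<^sup>2 / f)"
    unfolding Bm_def A0_def f_def[symmetric] using f d
    by (simp add: power_mult_distrib power_divide power_add power_mult power2_eq_square field_simps four)
  also have "\<dots> \<le> A0 * (1 / 2) ^ m * 1"
    unfolding RL using A0 f fact_square_le[of m] by (intro mult_left_mono) (auto simp: f_def)
  finally show ?thesis by simp
qed

lemma atom_bound_gen:
  assumes "cmod (h n (j - 1) s) \<le> H" "cmod (h n (Suc (j - 1)) s) \<le> H'"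
    and "\<And>x. x \<in> X \<Longrightarrow> cmod (G n j x) \<le> Gb" "\<And>x. x \<in> X \<Longrightarrow> cmod (G' n j x) \<le> Gb"
  shows "cmod (atom n j (s, Z)) \<le> (H' + cmod (lam n) * H) * Gb + H * ((\<bar>a1\<bar> + \<bar>k1\<bar>) * Gb)"
proof -
  define x where "x = torus_rep p Z"
  have x: "x \<in> X" using torus_rep_ge[of p Z] torus_rep_less[of p Z] by (simp add: x_def)
  have nn: "0 \<le> H" "0 \<le> H'" "0 \<le> Gb" using assms(1,2) assms(3)[OF x] by (meson norm_ge_zero order_trans)+
  have 1: "cmod (h n (Suc (j - 1)) s - lam n * h n (j - 1) s) \<le> H' + cmod (lam n) * H"
    using assms(1,2) by (intro order_trans[OF norm_triangle_ineq4] add_mono) (auto simp: norm_mult intro!: mult_left_mono)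
  have 2: "cmod (of_real a1 * G' n j x + of_real k1 * G n j x) \<le> (\<bar>a1\<bar> + \<bar>k1\<bar>) * Gb"
    using assms(3,4)[OF x] by (intro norm_triangle_le) (auto simp: norm_mult distrib_right intro!: add_mono mult_left_mono)
  have "cmod (atom n j (s, Z)) \<le> cmod ((h n (Suc (j - 1)) s - lam n * h n (j - 1) s) * G n j x) + cmod (h n (j - 1) s * (of_real a1 * G' n j x + of_real k1 * G n j x))"
    unfolding atom_def fst_conv snd_conv x_def by (rule norm_triangle_ineq)
  also have "\<dots> \<le> (H' + cmod (lam n) * H) * Gb + H * ((\<bar>a1\<bar> + \<bar>k1\<bar>) * Gb)"
    unfolding norm_mult using 1 2 assms(1) assms(3)[OF x] nn
    by (intro add_mono mult_mono) auto
  finally show ?thesis .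
qed

text \<open>The dominant term carries the extra time derivative, worth (m + 1)^2 R. The atom j = 0
  has no iterate in it and is bounded directly.\<close>

lemma atom_bound: "cmod (atom n j z) \<le> DD * ze n * ((real j + 1)\<^sup>2 * (1 / 2) ^ j)"
proof (cases z)
  case (Pair s Z)
  define V where "V = R + cmod (lam n) + \<bar>a1\<bar> + \<bar>k1\<bar>"
  have V: "0 \<le> V" using R_pos by (simp add: V_def)
  have ze: "ze n = \<kappa> n * (v n)\<^sup>2 * (1 + V)" by (simp add: ze_def V_def)
  have K0: "0 \<le> \<kappa> n * C" using \<kappa>_pos[of n] C by simp
  show ?thesis
  proof (cases j)
    case 0
    have "cmod (atom n j z) \<le> (\<kappa> n * C * R + cmod (lam n) * (\<kappa> n * C)) * ((1 + 2 * Cx) * (v n)\<^sup>2) + (\<kappa> n * C) * ((\<bar>a1\<bar> + \<bar>k1\<bar>) * ((1 + 2 * Cx) * (v n)\<^sup>2))"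
      unfolding Pair
      by (rule atom_bound_gen) (use h_bound[of n 0 s] h_bound[of n 1 s] G_bound_0 0 in \<open>auto simp del: power_Suc\<close>)
    also have "\<dots> = C * (1 + 2 * Cx) * (\<kappa> n * (v n)\<^sup>2 * V)" by (simp add: V_def algebra_simps)
    also have "\<dots> \<le> DD * ze n"
    proof (intro mult_mono)
      show "C * (1 + 2 * Cx) \<le> DD" unfolding DD_def using C Cg A0 by (intro mult_left_mono) auto
      show "\<kappa> n * (v n)\<^sup>2 * V \<le> ze n" unfolding ze using \<kappa>_pos[of n] by (intro mult_left_mono) auto
      show "0 \<le> DD" unfolding DD_def using C Cg A0 Cx by simp
      show "0 \<le> \<kappa> n * (v n)\<^sup>2 * V" using \<kappa>_pos[of n] V by simp
    qed
    finally show ?thesis using 0 by simp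
  next
    case (Suc m)
    define H where "H = \<kappa> n * C * ((fact m)\<^sup>2 * R ^ m)"
    define Gb where "Gb = Cg * ((v n)\<^sup>2 * Bm m / d ^ Suc m)"
    have H0: "0 \<le> H" "0 \<le> Gb" unfolding H_def Gb_def using K0 R_pos Cg Bm_nonneg[of m] d by auto
    have HG: "H * Gb \<le> C * Cg * A0 * (\<kappa> n * (v n)\<^sup>2) * (1 / 2) ^ m"
    proof -
      have "H * Gb = (\<kappa> n * C * Cg * (v n)\<^sup>2) * (Bm m / d ^ Suc m * ((fact m)\<^sup>2 * R ^ m))"
        by (simp add: H_def Gb_def mult_ac)
      also have "\<dots> \<le> (\<kappa> n * C * Cg * (v n)\<^sup>2) * (A0 * (1 / 2) ^ m)"
        using K0 Cg by (intro mult_left_mono geometric_factor) auto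
      finally show ?thesis by (simp add: mult_ac)
    qed
    have m1: "1 \<le> (real m + 1)\<^sup>2" by (simp add: power2_eq_square algebra_simps)
    have "cmod (atom n j z) \<le> ((real m + 1)\<^sup>2 * R * H + cmod (lam n) * H) * Gb + H * ((\<bar>a1\<bar> + \<bar>k1\<bar>) * Gb)"
      unfolding Pair
    proof (rule atom_bound_gen)
      show "cmod (h n (j - 1) s) \<le> H" using h_bound[of n m s] by (simp add: Suc H_def)
      have "cmod (h n (Suc m) s) \<le> \<kappa> n * C * ((fact (Suc m))\<^sup>2 * R ^ Suc m)" by (rule h_bound)
      also have "\<dots> = (real m + 1)\<^sup>2 * R * H" by (simp add: H_def power_mult_distrib mult_ac add.commute)
      finally show "cmod (h n (Suc (j - 1)) s) \<le> (real m + 1)\<^sup>2 * R * H" by (simp add: Suc)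
    qed (use G_bound_Suc Suc in \<open>auto simp: Gb_def\<close>)
    also have "\<dots> = (real m + 1)\<^sup>2 * (R * (H * Gb)) + 1 * ((cmod (lam n) + \<bar>a1\<bar> + \<bar>k1\<bar>) * (H * Gb))"
      by (simp add: algebra_simps)
    also have "\<dots> \<le> (real m + 1)\<^sup>2 * (R * (H * Gb)) + (real m + 1)\<^sup>2 * ((cmod (lam n) + \<bar>a1\<bar> + \<bar>k1\<bar>) * (H * Gb))"
      using m1 H0 by (intro add_left_mono mult_right_mono) auto
    also have "\<dots> = (real m + 1)\<^sup>2 * V * (H * Gb)" by (simp add: V_def algebra_simps)
    also have "\<dots> \<le> (real m + 1)\<^sup>2 * V * (C * Cg * A0 * (\<kappa> n * (v n)\<^sup>2) * (1 / 2) ^ m)"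
      using V by (intro mult_left_mono HG) auto
    \<comment> \<open>The shift j = m + 1 makes \<open>(1/2) ^ m\<close> equal to twice
      \<open>(1/2) ^ j\<close>; this is the factor 2 in \<open>DD\<close>.\<close>
    also have "\<dots> = (2 * (C * Cg * A0)) * (\<kappa> n * (v n)\<^sup>2 * V) * ((real m + 1)\<^sup>2 * (1 / 2) ^ j)"
      by (simp add: Suc)
    also have "\<dots> \<le> DD * ze n * ((real j + 1)\<^sup>2 * (1 / 2) ^ j)"
    proof (intro mult_mono)
      show "2 * (C * Cg * A0) \<le> DD" unfolding DD_def using C Cx by (simp add: algebra_simps)
      show "\<kappa> n * (v n)\<^sup>2 * V \<le> ze n" unfolding ze using \<kappa>_pos[of n] by (intro mult_left_mono) auto
      show "(real m + 1)\<^sup>2 \<le> (real j + 1)\<^sup>2" using Suc by (intro power_mono) auto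
      show "0 \<le> DD" unfolding DD_def using C Cg A0 Cx by simp
      show "0 \<le> \<kappa> n * (v n)\<^sup>2 * V" using \<kappa>_pos[of n] V by simp
      then show "0 \<le> DD * ze n" unfolding DD_def ze using C Cg A0 Cx \<kappa>_pos[of n] V by simp
    qed auto
    finally show ?thesis .
  qed
qed

text \<open>A Gaussian in n beats any polynomial; summability over the modes is all that is asked
  for.\<close>

lemma ze_bound: "\<exists>K. \<forall>n. ze n \<le> K / (1 + (real_of_int n)\<^sup>2)"
proof -
  define c where "c = d * \<epsilon> / 3"
  have c: "c > 0" using d \<epsilon> by (simp add: c_def)
  define v0 where "v0 = 2 + \<bar>a / d\<bar>"
  define l0 where "l0 = 1 + R + (d + \<bar>a\<bar>) + \<bar>k\<bar> + \<bar>a1\<bar> + \<bar>k1\<bar>"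
  define K where "K = exp (\<bar>k\<bar> * \<epsilon>) * exp c * (6 / c ^ 3) * (2 * v0\<^sup>2) * l0"
  show ?thesis
  proof (intro exI[of _ K] allI)
    fix n
    define y where "y = (real_of_int n)\<^sup>2"
    have y: "0 \<le> y" by (simp add: y_def)
    have v_le: "1 + y + (z + y) \<le> (2 + z) * (1 + y)" if "0 \<le> y" "0 \<le> z" for y z :: real
      using mult_nonneg_nonneg[OF that] by (simp add: algebra_simps)
    have "v n \<le> v0 * (1 + \<bar>real_of_int n\<bar>)" unfolding v_def v0_def by (rule v_le) (intro abs_ge_zero)+
    then have "(v n)\<^sup>2 \<le> (v0 * (1 + \<bar>real_of_int n\<bar>))\<^sup>2" using v_ge_1[of n] by (intro power_mono) auto
    also have "\<dots> = v0\<^sup>2 * (1 + \<bar>real_of_int n\<bar>)\<^sup>2" by (simp add: power_mult_distrib)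
    also have "\<dots> \<le> v0\<^sup>2 * (2 * (1 + y))"
    proof (intro mult_left_mono)
      have "0 \<le> (1 - \<bar>real_of_int n\<bar>)\<^sup>2" by simp
      then show "(1 + \<bar>real_of_int n\<bar>)\<^sup>2 \<le> 2 * (1 + y)" by (simp add: y_def power2_diff power2_sum)
    qed simp
    finally have v: "(v n)\<^sup>2 \<le> 2 * v0\<^sup>2 * (1 + y)" by (simp add: algebra_simps)
    have "1 + R + cmod (lam n) + \<bar>a1\<bar> + \<bar>k1\<bar> \<le> 1 + R + ((d + \<bar>a\<bar>) * y + \<bar>k\<bar>) + \<bar>a1\<bar> + \<bar>k1\<bar>"
      using norm_heat_symbol_le[of d a k n] d by (simp add: y_def)
    also have "\<dots> \<le> l0 * (1 + y)"
    proof -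
      have "0 \<le> (1 + R + \<bar>k\<bar> + \<bar>a1\<bar> + \<bar>k1\<bar>) * y + (d + \<bar>a\<bar>)" using y R_pos d by (intro add_nonneg_nonneg mult_nonneg_nonneg) auto
      then show ?thesis unfolding l0_def by (simp add: algebra_simps)
    qed
    finally have l: "1 + R + cmod (lam n) + \<bar>a1\<bar> + \<bar>k1\<bar> \<le> l0 * (1 + y)" .
    have cy: "0 < c * (1 + y)" using c y by simp
    \<comment> \<open>Exponent 3: one power of 1 + y is spent on the square of \<open>v\<close>, one
      on the symbol, and one is left for the claimed decay.\<close>
    have "exp (- (c * (1 + y))) * (c * (1 + y)) ^ 3 \<le> fact 3" using cy by (intro power_le_fact_exp) simp
    then have "exp (- (c * (1 + y))) * (c ^ 3 * (1 + y) ^ 3) \<le> 6" by (simp add: power_mult_distrib fact_numeral)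
    then have e1: "exp (- (c * (1 + y))) \<le> 6 / (c ^ 3 * (1 + y) ^ 3)" using c y by (subst pos_le_divide_eq) auto
    have e2: "exp (- (c * y)) = exp c * exp (- (c * (1 + y)))" by (simp add: mult_exp_exp algebra_simps)
    have ex: "exp (- (c * y)) \<le> exp c * (6 / (c ^ 3 * (1 + y) ^ 3))"
      unfolding e2 by (intro mult_left_mono e1) simp
    have \<kappa>: "\<kappa> n \<le> exp (\<bar>k\<bar> * \<epsilon>) * (exp c * (6 / (c ^ 3 * (1 + y) ^ 3)))"
      unfolding \<kappa>_def c_def[symmetric] y_def[symmetric] by (intro mult_left_mono ex) auto
    have "ze n \<le> (exp (\<bar>k\<bar> * \<epsilon>) * (exp c * (6 / (c ^ 3 * (1 + y) ^ 3)))) * (2 * v0\<^sup>2 * (1 + y)) * (l0 * (1 + y))"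
      unfolding ze_def
      using \<kappa> v l \<kappa>_pos[of n] c y R_pos by (intro mult_mono) auto
    also have "\<dots> = K / (1 + y)"
    proof -
      have "1 / (c ^ 3 * z ^ 3) * z * z = 1 / c ^ 3 / z" if "z > 0" for z
        using that c by (simp add: power3_eq_cube)
      from this[of "1 + y"] have *: "1 / (c ^ 3 * (1 + y) ^ 3) * (1 + y) * (1 + y) = 1 / c ^ 3 / (1 + y)" using y by simp
      have "(exp (\<bar>k\<bar> * \<epsilon>) * (exp c * (6 / (c ^ 3 * (1 + y) ^ 3)))) * (2 * v0\<^sup>2 * (1 + y)) * (l0 * (1 + y))
        = exp (\<bar>k\<bar> * \<epsilon>) * exp c * 6 * (2 * v0\<^sup>2) * l0 * (1 / (c ^ 3 * (1 + y) ^ 3) * (1 + y) * (1 + y))" by simp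
      then show ?thesis unfolding * K_def by simp
    qed
    finally show "ze n \<le> K / (1 + (real_of_int n)\<^sup>2)" unfolding y_def .
  qed
qed

end

section \<open>Summation over the atoms and over the modes\<close>

context flat_control
begin

lemma Th_bound: "cmod (Th n m l) \<le> \<kappa> n * C * ((fact m)\<^sup>2 * R ^ m) * exp (\<bar>Re l\<bar> * \<epsilon>) * (\<epsilon> - 0)"
  unfolding Th_def
proof (rule integral_bound)
  show "continuous_on {0..\<epsilon>} (\<lambda>t. h n m t * exp (of_real t * l))"
    by (intro continuous_intros continuous_on_h)
  fix t assume t: "t \<in> {0..\<epsilon>}"
  have "t * Re l \<le> \<bar>Re l\<bar> * \<epsilon>"
    using t order_trans[OF abs_ge_self[of "t * Re l"]] mult_left_mono[of t \<epsilon> "\<bar>Re l\<bar>"] by (simp add: abs_mult mult.commute)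
  then show "cmod (h n m t * exp (of_real t * l)) \<le> \<kappa> n * C * ((fact m)\<^sup>2 * R ^ m) * exp (\<bar>Re l\<bar> * \<epsilon>)"
    unfolding norm_mult using C R_pos \<kappa>_pos[of n] by (intro mult_mono h_bound) auto
qed (use \<epsilon> in simp)

lemma Y_bound: "cmod (Y n m i) \<le> Cx * (E * (2 * pi) ^ (2 * m) / fact (2 * m) / d ^ m) * ((p + 2 * pi) - p)"
  unfolding Y_def
proof (rule integral_bound)
  show "continuous_on X (\<lambda>x. \<xi> 0 x * Q n m x * cis (- of_int i * x))"
    by (intro continuous_intros continuous_on_\<xi> continuous_on_Q)
  fix x assume x: "x \<in> X"
  have "cmod (Q n m x) \<le> E * (2 * pi) ^ (2 * m) / fact (2 * m) / d ^ m"
  proof -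
    have "cmod (of_real d ^ m) = d ^ m" using d by (simp add: norm_power)
    then show ?thesis unfolding Q_def norm_divide
      using d by (simp only:) (intro divide_right_mono P_bound_gen[OF x], simp)
  qed
  then show "cmod (\<xi> 0 x * Q n m x * cis (- of_int i * x)) \<le> Cx * (E * (2 * pi) ^ (2 * m) / fact (2 * m) / d ^ m)"
    unfolding norm_mult norm_cis mult_1_right using \<xi>_bound[OF _ x, of 0] Cx by (intro mult_mono) auto
qed simp

text \<open>The remainder of the telescoping sum is controlled by the same balance as the atoms,
  with ratio 1/2.\<close>

lemma Th_Y_tendsto: "(\<lambda>N. Th n N l * Y n N i) \<longlonglongrightarrow> 0"
proof -
  define K where "K = \<kappa> n * C * exp (\<bar>Re l\<bar> * \<epsilon>) * \<epsilon> * (Cx * E * (2 * pi))"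
  have K: "K \<ge> 0" unfolding K_def using \<kappa>_pos[of n] C \<epsilon> Cx E_pos by simp
  show ?thesis
  proof (rule Lim_null_comparison)
    have "norm (Th n N l * Y n N i) \<le> K * (1 / 2) ^ N" for N
    proof -
      define f where "f = (fact (2 * N) :: real)"
      have f: "f > 0" by (simp add: f_def)
      have RL: "(2 * pi)\<^sup>2 * R / d = 1 / 2" using d by (simp add: R field_simps)
      have "norm (Th n N l * Y n N i) \<le> (\<kappa> n * C * ((fact N)\<^sup>2 * R ^ N) * exp (\<bar>Re l\<bar> * \<epsilon>) * (\<epsilon> - 0)) *
         (Cx * (E * (2 * pi) ^ (2 * N) / fact (2 * N) / d ^ N) * ((p + 2 * pi) - p))"
        unfolding norm_mult using C R_pos \<kappa>_pos[of n] \<epsilon> by (intro mult_mono Th_bound Y_bound) auto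
      also have "\<dots> = K * ((2 * pi)\<^sup>2 * R / d) ^ N * ((fact N)\<^sup>2 / f)"
      proof -
        have pw: "x ^ (2 * N) = (x\<^sup>2) ^ N" for x :: real by (rule power_mult)
        show ?thesis unfolding K_def f_def[symmetric] pw by (simp add: power_mult_distrib power_divide mult_ac)
      qed
      also have "\<dots> \<le> K * (1 / 2) ^ N * 1"
        unfolding RL using K f fact_square_le[of N] by (intro mult_left_mono) (auto simp: f_def)
      finally show ?thesis by simp
    qed
    then show "\<forall>\<^sub>F N in sequentially. norm (Th n N l * Y n N i) \<le> K * (1 / 2) ^ N" by simp
    show "(\<lambda>N. K * (1 / 2) ^ N) \<longlonglongrightarrow> 0" by (auto intro!: tendsto_eq_intros LIMSEQ_power_zero)
  qed
qed

definition "W n z = (\<Sum>j. atom n j z)"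
definition "Sj = (\<Sum>j. (real j + 1)\<^sup>2 * (1 / 2) ^ j)"

abbreviation "test l i \<equiv> (\<lambda>z :: real \<times> torus. exp (of_real (fst z) * l) * torus_exp (- i) (snd z))"

lemma test_meas: "test l i \<in> borel_measurable (lborel \<Otimes>\<^sub>M torus_measure)"
  by measurable

lemma test_bound: "s \<in> {0<..<\<epsilon>} \<Longrightarrow> cmod (test l i (s, Z)) \<le> exp (\<bar>Re l\<bar> * \<epsilon>)"
  using norm_exp_mult_torus_exp_le by simp

lemma summable_atom_bound: "summable (\<lambda>j. DD * ze n * ((real j + 1)\<^sup>2 * (1 / 2) ^ j))"
  by (intro summable_mult summable_square_half)

lemmas W_sum = suminf_controls[where F = "atom n" and M = "\<lambda>j. DD * ze n * ((real j + 1)\<^sup>2 * (1 / 2) ^ j)" and T = \<epsilon>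
  and w = "test l i" and C = "exp (\<bar>Re l\<bar> * \<epsilon>)", OF atom_meas atom_bound summable_atom_bound atom_supp test_meas test_bound, folded W_def] for n l i

lemma W_meas: "W n \<in> borel_measurable (lborel \<Otimes>\<^sub>M torus_measure)"
  using W_sum(1)[of n] by (simp add: W_def[abs_def])

lemma W_bound: "cmod (W n z) \<le> DD * Sj * ze n"
proof -
  have "(\<Sum>j. DD * ze n * ((real j + 1)\<^sup>2 * (1 / 2) ^ j)) = DD * ze n * Sj"
    unfolding Sj_def by (rule suminf_mult[OF summable_square_half])
  then show ?thesis using W_sum(2)[of n z] by (simp add: mult_ac)
qed

lemma W_supp: "s \<notin> {0<..<\<epsilon>} \<Longrightarrow> W n (s, Z) = 0"
  by (simp add: W_def atom_supp)

lemma W_supp_space: "torus_rep p Z \<in> {p + \<delta>..p + 2 * pi - \<delta>} \<Longrightarrow> W n (s, Z) = 0"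
  by (simp add: W_def atom_supp_space)

lemma W_moment_sums:
  "(\<lambda>j. (tau i - l) * (Th n (j - 1) l * Xh n j i)) sums (\<integral>z. W n z * test l i z \<partial>(lborel \<Otimes>\<^sub>M torus_measure))"
  using W_sum(3)[of n l i] unfolding atom_moment .

lemma W_moment_transport: "(\<integral>z. W n z * test (tau i) i z \<partial>(lborel \<Otimes>\<^sub>M torus_measure)) = 0"
  using W_moment_sums[of i "tau i" n] by (simp add: sums_iff)

text \<open>The atoms j = 0 and j = 1 share the time factor \<open>Th n 0\<close>. The term -
  \<open>Y n 0\<close> of \<open>Xh n 0\<close> therefore cancels the leading term of the
  telescoping sum, and only the orthogonality of the exponentials remains, weighted by the mass 1 of
  the bump.\<close>

lemma W_moment_heat: "(\<integral>z. W n z * test (lam i) i z \<partial>(lborel \<Otimes>\<^sub>M torus_measure)) = (if n = i then 2 * pi * (tau i - lam i) else 0)"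
proof -
  let ?c = "if n = i then 2 * of_real pi else 0 :: complex"
  have part: "(\<Sum>j<Suc N. Th n (j - 1) (lam i) * Xh n j i) = Th n 0 (lam i) * ?c - Th n N (lam i) * Y n N i" for N
    unfolding sum.lessThan_Suc_shift
    by (simp only: diff_Suc_1 diff_0_eq_0 telescope Xh_0) (simp add: algebra_simps)
  have "(\<lambda>N. \<Sum>j<Suc N. Th n (j - 1) (lam i) * Xh n j i) \<longlonglongrightarrow> Th n 0 (lam i) * ?c - 0"
    unfolding part by (intro tendsto_intros Th_Y_tendsto)
  then have "(\<lambda>j. Th n (j - 1) (lam i) * Xh n j i) sums (Th n 0 (lam i) * ?c)"
    unfolding sums_def by (subst filterlim_sequentially_Suc[symmetric]) simp
  then have "(\<lambda>j. (tau i - lam i) * (Th n (j - 1) (lam i) * Xh n j i)) sums ((tau i - lam i) * (Th n 0 (lam i) * ?c))"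
    by (rule sums_mult)
  then have "(\<integral>z. W n z * test (lam i) i z \<partial>(lborel \<Otimes>\<^sub>M torus_measure)) = (tau i - lam i) * (Th n 0 (lam i) * ?c)"
    using W_moment_sums[of i "lam i" n] sums_unique2 by blast
  then show ?thesis by (auto simp: Th_0)
qed

text \<open>Superpose the mode controls \<open>W n\<close> with the prescribed coefficients; bounded
  coefficients suffice because \<open>ze\<close> is summable over the modes.\<close>

lemma control_exists:
  fixes \<beta> :: "int \<Rightarrow> complex"
  assumes \<beta>: "\<And>n. cmod (\<beta> n) \<le> B"
  shows "\<exists>w Cw. w \<in> borel_measurable (lborel \<Otimes>\<^sub>M torus_measure) \<and> (\<forall>z. cmod (w z) \<le> Cw) \<and>
    (\<forall>s Z. s \<notin> {0<..<\<epsilon>} \<longrightarrow> w (s, Z) = 0) \<and>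
    (\<forall>s Z. torus_rep p Z \<in> {p + \<delta>..p + 2 * pi - \<delta>} \<longrightarrow> w (s, Z) = 0) \<and>
    (\<forall>i. (\<integral>z. w z * test (tau i) i z \<partial>(lborel \<Otimes>\<^sub>M torus_measure)) = 0) \<and>
    (\<forall>i. (\<integral>z. w z * test (lam i) i z \<partial>(lborel \<Otimes>\<^sub>M torus_measure)) = 2 * pi * \<beta> i * (tau i - lam i))"
proof -
  obtain K where K: "\<And>n. ze n \<le> K / (1 + (real_of_int n)\<^sup>2)" using ze_bound by blast
  define F where "F m z = \<beta> (int_decode m) * W (int_decode m) z" for m z
  define M where "M m = B * DD * Sj * K * (1 / (1 + (real_of_int (int_decode m))\<^sup>2))" for m
  have B: "0 \<le> B" using \<beta>[of 0] norm_ge_zero order_trans by blast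
  have DD: "0 \<le> DD" unfolding DD_def using C Cg A0 Cx by simp
  have Sj: "0 \<le> Sj" unfolding Sj_def by (intro suminf_nonneg summable_square_half) simp
  have F_meas: "F m \<in> borel_measurable (lborel \<Otimes>\<^sub>M torus_measure)" for m
    unfolding F_def[abs_def] using W_meas by (intro borel_measurable_times) auto
  have F_le: "cmod (F m z) \<le> M m" for m z
  proof -
    have "cmod (F m z) \<le> B * (DD * Sj * ze (int_decode m))"
      unfolding F_def norm_mult using B by (intro mult_mono \<beta> W_bound) auto
    also have "\<dots> \<le> B * (DD * Sj * (K / (1 + (real_of_int (int_decode m))\<^sup>2)))"
      using B DD Sj by (intro mult_left_mono K) auto
    finally show ?thesis by (simp add: M_def)
  qed
  have M: "summable M" unfolding M_def by (intro summable_mult summable_int_decode)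
  have F_supp: "F m (s, Z) = 0" if "s \<notin> {0<..<\<epsilon>}" for m s Z using W_supp[OF that] by (simp add: F_def)
  define w where "w z = (\<Sum>m. F m z)" for z
  note S = suminf_controls[OF F_meas F_le M F_supp test_meas test_bound]
  have S3: "(\<lambda>m. \<integral>z. F m z * test l i z \<partial>(lborel \<Otimes>\<^sub>M torus_measure)) sums (\<integral>z. w z * test l i z \<partial>(lborel \<Otimes>\<^sub>M torus_measure))" for l i
    unfolding w_def by (rule suminf_controls(3)[OF F_meas F_le M F_supp test_meas test_bound])
  show ?thesis
  proof (intro exI[of _ w] exI[of _ "\<Sum>m. M m"] conjI allI impI)
    show "w \<in> borel_measurable (lborel \<Otimes>\<^sub>M torus_measure)" using S(1) by (simp add: w_def[abs_def])
    show "cmod (w z) \<le> (\<Sum>m. M m)" for z using S(2) by (simp add: w_def)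
    show "w (s, Z) = 0" if "s \<notin> {0<..<\<epsilon>}" for s Z using F_supp[OF that] by (simp add: w_def)
    show "w (s, Z) = 0" if "torus_rep p Z \<in> {p + \<delta>..p + 2 * pi - \<delta>}" for s Z
      using W_supp_space[OF that] by (simp add: w_def F_def)
    fix i
    have mom: "(\<integral>z. F m z * test l i z \<partial>(lborel \<Otimes>\<^sub>M torus_measure)) = \<beta> (int_decode m) * (\<integral>z. W (int_decode m) z * test l i z \<partial>(lborel \<Otimes>\<^sub>M torus_measure))" for m l
      by (simp add: F_def mult.assoc)
    show "(\<integral>z. w z * test (tau i) i z \<partial>(lborel \<Otimes>\<^sub>M torus_measure)) = 0"
      using S3[of "tau i" i] unfolding mom W_moment_transport by (simp add: sums_iff)
    have "(\<lambda>m. if m = int_encode i then 2 * pi * \<beta> (int_decode m) * (tau i - lam i) else 0) sums (2 * pi * \<beta> (int_decode (int_encode i)) * (tau i - lam i))"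
      by (rule sums_single)
    moreover have "\<beta> (int_decode m) * (if int_decode m = i then 2 * pi * (tau i - lam i) else 0) = (if m = int_encode i then 2 * pi * \<beta> (int_decode m) * (tau i - lam i) else 0)" for m
      by (auto simp: int_encode_inverse int_decode_inverse)
    ultimately have "(\<lambda>m. \<beta> (int_decode m) * (if int_decode m = i then 2 * pi * (tau i - lam i) else 0)) sums (2 * pi * \<beta> i * (tau i - lam i))"
      by simp
    then show "(\<integral>z. w z * test (lam i) i z \<partial>(lborel \<Otimes>\<^sub>M torus_measure)) = 2 * pi * \<beta> i * (tau i - lam i)"
      using S3[of "lam i" i] unfolding mom W_moment_heat using sums_unique2 by blast
  qed
qed

end

text \<open>The control lives within \<delta> of the two ends of the cut, that is, near the single
  point p of the torus, which can be placed in any control region.\<close>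

theorem heat_control:
  fixes d a k a1 k1 \<epsilon> p \<delta> :: real and \<beta> :: "int \<Rightarrow> complex"
  assumes d: "d > 0" and \<epsilon>: "\<epsilon> > 0" and \<delta>: "0 < \<delta>" "\<delta> < pi" and \<beta>: "\<And>n. cmod (\<beta> n) \<le> B"
  shows "\<exists>w Cw. w \<in> borel_measurable (lborel \<Otimes>\<^sub>M torus_measure) \<and> (\<forall>z. cmod (w z) \<le> Cw) \<and>
    (\<forall>s Z. s \<notin> {0<..<\<epsilon>} \<longrightarrow> w (s, Z) = 0) \<and>
    (\<forall>s Z. torus_rep p Z \<in> {p + \<delta>..p + 2 * pi - \<delta>} \<longrightarrow> w (s, Z) = 0) \<and>
    (\<forall>i. (\<integral>z. w z * (exp (of_real (fst z) * transport_symbol a1 k1 i) * torus_exp (- i) (snd z)) \<partial>(lborel \<Otimes>\<^sub>M torus_measure)) = 0) \<and>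
    (\<forall>i. (\<integral>z. w z * (exp (of_real (fst z) * heat_symbol d a k i) * torus_exp (- i) (snd z)) \<partial>(lborel \<Otimes>\<^sub>M torus_measure))
       = 2 * pi * \<beta> i * (transport_symbol a1 k1 i - heat_symbol d a k i))"
proof -
  define R where "R = d / (2 * (2 * pi)\<^sup>2)"
  have "R > 0" using d by (simp add: R_def)
  then obtain \<theta> C where \<theta>: "\<forall>k t. (\<theta> k has_vector_derivative \<theta> (Suc k) t) (at t)"
     "\<forall>k t. t \<notin> {\<epsilon>/3<..<2*\<epsilon>/3} \<longrightarrow> \<theta> k t = (0::complex)"
     "\<forall>k t. cmod (\<theta> k t) \<le> C * (fact k)\<^sup>2 * R ^ k" "C \<ge> 0" "(\<theta> 0 has_integral 1) {0..\<epsilon>}"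
    using time_bump[OF _ \<epsilon>, of R] by blast
  obtain \<xi> Cx where \<xi>: "\<forall>k x. (\<xi> k has_vector_derivative \<xi> (Suc k) x) (at x)"
    "\<forall>x\<in>{p + \<delta>..p + 2 * pi - \<delta>}. \<xi> 0 x = (1::complex) \<and> (\<forall>k. \<xi> (Suc k) x = 0)"
    "\<forall>k. \<xi> k p = 0 \<and> \<xi> k (p + 2 * pi) = 0"
    "\<forall>k\<in>{..3}. \<forall>x\<in>{p..p + 2 * pi}. cmod (\<xi> k x) \<le> Cx"
    using space_cutoff[OF \<delta>, of p] by blast
  interpret flat_control d a k a1 k1 \<epsilon> p \<delta> \<theta> C R \<xi> Cx
    by unfold_locales (use d \<epsilon> R_def \<theta> \<xi> in auto)
  show ?thesis using control_exists[OF \<beta>] .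
qed

subsection \<open>Exact control of the transport equation\<close>

lemma gap_length_upper:
  assumes "x \<in> insert 0 (measure torus_measure ` components (- \<omega>))"
  shows "x \<le> gap_length \<omega>"
  unfolding gap_length_def
proof (rule cSup_upper[OF assms])
  have "measure torus_measure A \<le> 2 * pi" for A
    using torus_measure.bounded_measure[of A] by simp
  then show "bdd_above (insert 0 (measure torus_measure ` components (- \<omega>)))"
    by (intro bdd_aboveI[of _ "2 * pi"]) auto
qed

lemma gap_length_nonneg: "0 \<le> gap_length \<omega>"
  by (rule gap_length_upper) simp

text \<open>Otherwise the closed interval would map to a connected subset of the complement, hence
  into one component, whose measure would be at least L. This comparison of lengths needs L < 2 pi;
  a longer interval covers the whole torus and meets the nonempty region anyway.\<close>

lemma interval_meets_control_region:
  assumes \<omega>: "open \<omega>" "\<omega> \<noteq> {}" and L: "gap_length \<omega> < L"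
  shows "\<exists>x\<in>{q<..<q + L}. to_torus x \<in> \<omega>"
proof (rule ccontr)
  assume "\<not> (\<exists>x\<in>{q<..<q + L}. to_torus x \<in> \<omega>)"
  then have sub: "{q<..<q + L} \<subseteq> - (to_torus -` \<omega>)" by auto
  have L0: "0 < L" using L gap_length_nonneg[of \<omega>] by linarith
  have "closed (- (to_torus -` \<omega>))" using \<omega>(1) by (auto simp: open_torus_def)
  then have "closure {q<..<q + L} \<subseteq> - (to_torus -` \<omega>)" using sub by (rule closure_minimal[rotated])
  then have cl: "{q..q + L} \<subseteq> - (to_torus -` \<omega>)" using L0 by simp
  show False
  proof (cases "2 * pi \<le> L")
    case True
    obtain Z where Z: "Z \<in> \<omega>" using \<omega>(2) by blast
    have "torus_rep q Z \<in> {q..q + L}" using torus_rep_ge[of q Z] torus_rep_less[of q Z] True by simp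
    then show False using cl Z by auto
  next
    case False
    have "connected (to_torus ` {q..q + L})"
      by (intro connected_continuous_image continuous_on_subset[OF continuous_to_torus]) auto
    moreover have "to_torus ` {q..q + L} \<subseteq> - \<omega>" using cl by auto
    moreover have "to_torus ` {q..q + L} \<noteq> {}" using L0 by simp
    ultimately obtain C where C: "C \<in> components (- \<omega>)" "to_torus ` {q..q + L} \<subseteq> C"
      using exists_component_superset[of "to_torus ` {q..q + L}" "- \<omega>"] by blast
    have "closed (- \<omega>)" using \<omega>(1) by (simp add: closed_def)
    then have "closed C" using C(1) closed_components by blast
    then have Cb: "C \<in> sets borel" by simp
    have "ennreal L = emeasure lborel {q..q + L}" using L0 by simp
    also have "\<dots> = (\<integral>\<^sup>+x. indicator {q..q + L} x \<partial>lborel)" by simp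
    also have "\<dots> \<le> (\<integral>\<^sup>+x. indicator C (to_torus x) * indicator {q..<q + 2 * pi} x \<partial>lborel)"
    proof (rule nn_integral_mono)
      fix x
      have "to_torus x \<in> C" if "x \<in> {q..q + L}" using C(2) that by blast
      then show "indicator {q..q + L} x \<le> (indicator C (to_torus x) * indicator {q..<q + 2 * pi} x :: ennreal)"
        using False by (auto simp: indicator_def)
    qed
    also have "\<dots> = (\<integral>\<^sup>+Z. indicator C Z \<partial>torus_measure)"
      by (rule nn_integral_torus[symmetric]) (use Cb in simp)
    also have "\<dots> = emeasure torus_measure C" using Cb by simp
    finally have "ennreal L \<le> emeasure torus_measure C" .
    then have "L \<le> measure torus_measure C"
      unfolding torus_measure.emeasure_eq_measure by (simp add: ennreal_le_iff)
    then show False using gap_length_upper[OF insertI2[OF imageI[OF C(1)]]] L by linarith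
  qed
qed

section \<open>Translations of the torus\<close>

definition torus_shift :: "real \<Rightarrow> torus \<Rightarrow> torus" where
  "torus_shift b Z = to_torus (torus_rep 0 Z + b)"

lemma torus_shift_to_torus [simp]: "torus_shift b (to_torus x) = to_torus (x + b)"
proof -
  have "to_torus (torus_rep 0 (to_torus x)) = to_torus x" by simp
  then obtain k :: int where "torus_rep 0 (to_torus x) - x = 2 * pi * of_int k" unfolding to_torus_eq_iff by blast
  then have "torus_rep 0 (to_torus x) + b - (x + b) = 2 * pi * of_int k" by simp
  then show ?thesis unfolding torus_shift_def to_torus_eq_iff by blast
qed

lemma torus_shift_shift [simp]: "torus_shift b (torus_shift c Z) = torus_shift (b + c) Z"
  by (cases Z rule: torus_cases) (simp add: add_ac)

lemma torus_shift_0 [simp]: "torus_shift 0 Z = Z"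
  by (cases Z rule: torus_cases) simp

lemma torus_exp_shift: "torus_exp n (torus_shift b Z) = cis (of_int n * b) * torus_exp n Z"
  by (cases Z rule: torus_cases) (simp add: cis_mult algebra_simps)

lemma measurable_torus_shift [measurable]:
  assumes "f \<in> borel_measurable M" "g \<in> measurable M borel"
  shows "(\<lambda>x. torus_shift (f x) (g x)) \<in> measurable M borel"
  using assms unfolding torus_shift_def by measurable

text \<open>Cut the torus at - b before and at 0 after the translation; the statement becomes
  translation invariance of Lebesgue measure on the line.\<close>

lemma distr_torus_shift: "distr torus_measure borel (torus_shift b) = torus_measure"
proof (rule measure_eqI)
  fix A assume "A \<in> sets (distr torus_measure borel (torus_shift b))"
  then have A [measurable]: "A \<in> sets borel" by simp
  have "emeasure (distr torus_measure borel (torus_shift b)) A = (\<integral>\<^sup>+Z. indicator A Z \<partial>distr torus_measure borel (torus_shift b))"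
    by simp
  also have "\<dots> = (\<integral>\<^sup>+Z. indicator A (torus_shift b Z) \<partial>torus_measure)"
    by (subst nn_integral_distr) auto
  also have "\<dots> = (\<integral>\<^sup>+x. indicator A (to_torus (x + b)) * indicator {- b..<- b + 2 * pi} x \<partial>lborel)"
    by (subst nn_integral_torus[where p = "- b"]) auto
  also have "\<dots> = (\<integral>\<^sup>+x. indicator A (to_torus (b + 1 * x)) * indicator {0..<0 + 2 * pi} (b + 1 * x) \<partial>lborel)"
    by (intro nn_integral_cong) (auto simp: indicator_def add.commute)
  also have "\<dots> = (\<integral>\<^sup>+x. indicator A (to_torus x) * indicator {0..<0 + 2 * pi} x \<partial>lborel)"
    by (subst nn_integral_real_affine[of _ 1 b]) auto
  also have "\<dots> = (\<integral>\<^sup>+Z. indicator A Z \<partial>torus_measure)"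
    by (subst nn_integral_torus[where p = 0]) auto
  finally show "emeasure (distr torus_measure borel (torus_shift b)) A = emeasure torus_measure A" by simp
qed simp

lemma nn_integral_torus_shift:
  assumes "f \<in> borel_measurable borel"
  shows "(\<integral>\<^sup>+Z. f (torus_shift b Z) \<partial>torus_measure) = (\<integral>\<^sup>+Z. f Z \<partial>torus_measure)"
  using assms by (subst (2) distr_torus_shift[of b, symmetric]) (subst nn_integral_distr; simp)

lemma integral_torus_shift:
  fixes f :: "torus \<Rightarrow> 'b::{banach, second_countable_topology}"
  assumes "f \<in> borel_measurable borel"
  shows "(\<integral>Z. f (torus_shift b Z) \<partial>torus_measure) = (\<integral>Z. f Z \<partial>torus_measure)"
  using assms by (subst (2) distr_torus_shift[of b, symmetric]) (subst integral_distr; simp)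

text \<open>Tonelli: at each fixed time the translation preserves the L2 norm of f, and the time
  interval has finite length.\<close>

lemma square_integrable_transported:
  fixes u :: "real \<times> torus \<Rightarrow> real"
  assumes u: "u \<in> borel_measurable (lborel \<Otimes>\<^sub>M torus_measure)"
    and f: "square_integrable torus_measure f"
    and le: "\<And>s Z. \<bar>u (s, Z)\<bar> \<le> indicator {0<..<T} s * (K * \<bar>f (torus_shift (b * s) Z)\<bar>)"
  shows "square_integrable (lborel \<Otimes>\<^sub>M torus_measure) u"
proof -
  note [measurable] = u
  have fm [measurable]: "f \<in> borel_measurable borel" using f by (simp add: square_integrable_def measurable_cong_sets[OF sets_torus_measure refl])
  define I where "I = (\<integral>\<^sup>+Z. ennreal (K\<^sup>2 * (f Z)\<^sup>2) \<partial>torus_measure)"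
  have I: "I < \<infinity>"
    using f integrable_mult_right[of "K\<^sup>2" torus_measure "\<lambda>Z. (f Z)\<^sup>2"]
    unfolding I_def square_integrable_def by (subst nn_integral_eq_integral) auto
  have "(\<integral>\<^sup>+z. ennreal ((u z)\<^sup>2) \<partial>(lborel \<Otimes>\<^sub>M torus_measure)) = (\<integral>\<^sup>+s. (\<integral>\<^sup>+Z. ennreal ((u (s, Z))\<^sup>2) \<partial>torus_measure) \<partial>lborel)"
    by (rule torus_measure.nn_integral_fst[symmetric]) measurable
  also have "\<dots> \<le> (\<integral>\<^sup>+s. indicator {0<..<T} s * I \<partial>lborel)"
  proof (rule nn_integral_mono)
    fix s :: real
    have "(\<integral>\<^sup>+Z. ennreal ((u (s, Z))\<^sup>2) \<partial>torus_measure) \<le> (\<integral>\<^sup>+Z. indicator {0<..<T} s * ennreal (K\<^sup>2 * (f (torus_shift (b * s) Z))\<^sup>2) \<partial>torus_measure)"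
    proof (rule nn_integral_mono)
      fix Z
      have "(u (s, Z))\<^sup>2 \<le> (indicator {0<..<T} s * (K * \<bar>f (torus_shift (b * s) Z)\<bar>))\<^sup>2"
        using le[of s Z] by (metis abs_ge_zero power2_abs power_mono)
      also have "\<dots> = indicator {0<..<T} s * (K\<^sup>2 * (f (torus_shift (b * s) Z))\<^sup>2)"
        by (simp add: indicator_def power_mult_distrib)
      finally have "ennreal ((u (s, Z))\<^sup>2) \<le> ennreal (indicator {0<..<T} s * (K\<^sup>2 * (f (torus_shift (b * s) Z))\<^sup>2))" by (rule ennreal_leI)
      also have "\<dots> = indicator {0<..<T} s * ennreal (K\<^sup>2 * (f (torus_shift (b * s) Z))\<^sup>2)" by (simp add: indicator_def)
      finally show "ennreal ((u (s, Z))\<^sup>2) \<le> indicator {0<..<T} s * ennreal (K\<^sup>2 * (f (torus_shift (b * s) Z))\<^sup>2)" .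
    qed
    also have "\<dots> = indicator {0<..<T} s * (\<integral>\<^sup>+Z. ennreal (K\<^sup>2 * (f (torus_shift (b * s) Z))\<^sup>2) \<partial>torus_measure)"
      by (rule nn_integral_cmult) measurable
    also have "(\<integral>\<^sup>+Z. ennreal (K\<^sup>2 * (f (torus_shift (b * s) Z))\<^sup>2) \<partial>torus_measure) = I"
      unfolding I_def by (rule nn_integral_torus_shift[where f = "\<lambda>Z. ennreal (K\<^sup>2 * (f Z)\<^sup>2)"]) measurable
    finally show "(\<integral>\<^sup>+Z. ennreal ((u (s, Z))\<^sup>2) \<partial>torus_measure) \<le> indicator {0<..<T} s * I" .
  qed
  also have "\<dots> = emeasure lborel {0<..<T} * I" by (simp add: nn_integral_multc)
  also have "\<dots> < \<infinity>" using I by (cases "0 \<le> T") (auto simp: ennreal_mult_less_top)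
  finally show ?thesis unfolding square_integrable_def by (intro conjI u integrableI_nonneg) auto
qed

text \<open>The weight comes from the distance to the complement, so it is positive exactly on the
  region. D measures the weighted time that a characteristic spends there: it is positive because
  the characteristic sweeps an interval longer than every gap, and compactness of the circle gives
  the uniform lower bound m.\<close>

lemma weight_along_characteristics:
  assumes \<omega>: "open \<omega>" "\<omega> \<noteq> {}" and c: "c \<noteq> 0" and T: "gap_length \<omega> < \<bar>c\<bar> * T"
  obtains \<rho> :: "torus \<Rightarrow> real" and D m
  where "\<rho> \<in> borel_measurable borel" "\<And>Z. 0 \<le> \<rho> Z" "\<And>Z. \<rho> Z \<le> 1" "\<And>Z. \<rho> Z \<noteq> 0 \<Longrightarrow> Z \<in> \<omega>"
    "D \<in> borel_measurable borel" "0 < m" "\<And>Z. m \<le> D Z"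
    "\<And>Z. (\<integral>s. indicator {0<..<T} s * \<rho> (torus_shift (c * s) Z) \<partial>lborel) = D Z"
proof -
  obtain W where W: "closed W" "\<And>Z. torus_exp 1 Z \<in> W \<longleftrightarrow> Z \<notin> \<omega>"
    using torus_exp_closed_complement[OF \<omega>(1)] by blast
  define \<psi> where "\<psi> z = (if W = {} then 1 else min 1 (infdist z W))" for z
  define \<rho> where "\<rho> Z = \<psi> (torus_exp 1 Z)" for Z
  have T0: "0 < T"
  proof -
    have "0 < \<bar>c\<bar> * T" using T gap_length_nonneg[of \<omega>] by linarith
    then show ?thesis using c by (simp add: zero_less_mult_iff)
  qed
  have \<psi>: "continuous_on A \<psi>" for A
    unfolding \<psi>_def by (cases "W = {}") (auto intro!: continuous_intros)
  have \<rho>_to: "\<rho> (to_torus x) = \<psi> (cis x)" for x by (simp add: \<rho>_def)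
  have \<rho>_meas: "\<rho> \<in> borel_measurable borel"
  proof (rule measurable_continuous_torus)
    show "continuous_on UNIV (\<lambda>x. \<rho> (to_torus x))"
      unfolding \<rho>_to by (rule continuous_on_compose2[OF \<psi>[of UNIV]]) (auto intro!: continuous_intros)
  qed
  have \<rho>0: "0 \<le> \<rho> Z" "\<rho> Z \<le> 1" for Z by (auto simp: \<rho>_def \<psi>_def infdist_nonneg)
  have \<rho>_pos: "\<rho> Z \<noteq> 0 \<longleftrightarrow> Z \<in> \<omega>" for Z
  proof (cases "W = {}")
    case True
    then show ?thesis using W(2)[of Z] by (simp add: \<rho>_def \<psi>_def)
  next
    case False
    then have "infdist (torus_exp 1 Z) W = 0 \<longleftrightarrow> torus_exp 1 Z \<in> W"
      using W(1) in_closed_iff_infdist_zero by blast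
    then show ?thesis using W(2)[of Z] False by (auto simp: \<rho>_def \<psi>_def min_def)
  qed
  define Dr where "Dr y = integral {0..T} (\<lambda>s. \<rho> (to_torus (y + c * s)))" for y
  have cont_arg: "continuous_on A (\<lambda>s. \<rho> (to_torus (y + c * s)))" for A y
    unfolding \<rho>_to by (rule continuous_on_compose2[OF \<psi>[of UNIV]]) (auto intro!: continuous_intros)
  have Dr_cont: "continuous_on UNIV Dr"
    unfolding Dr_def[abs_def] interval_cbox
  proof (rule integral_continuous_on_param)
    show "continuous_on (UNIV \<times> cbox 0 T) (\<lambda>(y, s). \<rho> (to_torus (y + c * s)))"
      unfolding \<rho>_to split_def by (rule continuous_on_compose2[OF \<psi>[of UNIV]]) (auto intro!: continuous_intros)
  qed
  have Dr_pos: "0 < Dr y" for y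
  proof -
    have "\<exists>s\<in>{0..T}. to_torus (y + c * s) \<in> \<omega>"
    proof (cases "c > 0")
      case True
      obtain x where x: "x \<in> {y<..<y + c * T}" "to_torus x \<in> \<omega>"
        using interval_meets_control_region[OF \<omega>, of "c * T" y] T True by auto
      have "y + c * ((x - y) / c) = x" "0 \<le> (x - y) / c" "(x - y) / c \<le> T"
        using x True by (auto simp: field_simps)
      then show ?thesis using x(2) by (intro bexI[of _ "(x - y) / c"]) auto
    next
      case False
      then have c0: "c < 0" using c by simp
      \<comment> \<open>For negative speed the characteristic runs leftwards and sweeps the interval
        that ends at y.\<close>
      obtain x where x: "x \<in> {y + c * T<..<y + c * T + (- c) * T}" "to_torus x \<in> \<omega>"
        using interval_meets_control_region[OF \<omega>, of "(- c) * T" "y + c * T"] T c0 by auto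
      have "y + c * ((x - y) / c) = x" "0 \<le> (x - y) / c" "(x - y) / c \<le> T"
        using x c0 by (auto simp: field_simps)
      then show ?thesis using x(2) by (intro bexI[of _ "(x - y) / c"]) auto
    qed
    then obtain s where s: "s \<in> {0..T}" "\<rho> (to_torus (y + c * s)) \<noteq> 0" using \<rho>_pos by blast
    have "Dr y \<noteq> 0"
    proof
      assume "Dr y = 0"
      then have "\<forall>s\<in>{0..T}. \<rho> (to_torus (y + c * s)) = 0"
        unfolding Dr_def using T0 cont_arg \<rho>0 by (subst (asm) integral_eq_0_iff) auto
      then show False using s by blast
    qed
    moreover have "0 \<le> Dr y" unfolding Dr_def
      by (intro Henstock_Kurzweil_Integration.integral_nonneg integrable_continuous_real cont_arg) (use \<rho>0 in auto)
    ultimately show ?thesis by simp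
  qed
  have "\<exists>x\<in>{0..2 * pi}. \<forall>y\<in>{0..2 * pi}. Dr x \<le> Dr y"
    by (rule continuous_attains_inf) (auto intro: continuous_on_subset[OF Dr_cont])
  then obtain x0 where x0: "\<And>y. y \<in> {0..2 * pi} \<Longrightarrow> Dr x0 \<le> Dr y" by blast
  define D where "D Z = Dr (torus_rep 0 Z)" for Z
  show ?thesis
  proof (rule that[of \<rho> D "Dr x0"])
    have [measurable]: "Dr \<in> borel_measurable borel" by (rule borel_measurable_continuous_onI[OF Dr_cont])
    show "D \<in> borel_measurable borel" unfolding D_def[abs_def] by measurable
    show "Dr x0 \<le> D Z" for Z unfolding D_def using torus_rep_ge[of 0 Z] torus_rep_less[of 0 Z] by (intro x0) auto
    show "(\<integral>s. indicator {0<..<T} s * \<rho> (torus_shift (c * s) Z) \<partial>lborel) = D Z" for Z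
    proof -
      define y where "y = torus_rep 0 Z"
      have Z: "torus_shift b Z = to_torus (y + b)" for b by (simp add: torus_shift_def y_def)
      have int: "set_integrable lborel {0..T} (\<lambda>s. \<rho> (to_torus (y + c * s)))"
        by (rule borel_integrable_atLeastAtMost'[OF cont_arg])
      have "(\<integral>s. indicator {0<..<T} s * \<rho> (torus_shift (c * s) Z) \<partial>lborel) = (LINT s:{0<..<T}|lborel. \<rho> (to_torus (y + c * s)))"
        by (simp add: set_lebesgue_integral_def Z)
      also have "\<dots> = integral {0<..<T} (\<lambda>s. \<rho> (to_torus (y + c * s)))"
        by (rule set_borel_integral_eq_integral(2)[OF set_integrable_subset[OF int]]) auto
      also have "\<dots> = Dr y" unfolding Dr_def using integral_open_interval[of 0 T] by (simp add: box_real)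
      finally show ?thesis by (simp add: D_def y_def)
    qed
  qed (use \<rho>_meas \<rho>0 \<rho>_pos Dr_pos in auto)
qed

text \<open>On the characteristic starting at Z the free solution is exp(- k s) f Z. The control
  removes the share \<rho> / D of it per unit time, and these shares integrate to 1 by the
  definition of D.\<close>

theorem transport_control:
  assumes \<omega>: "open \<omega>" "\<omega> \<noteq> {}" and c: "c \<noteq> 0" and T: "gap_length \<omega> < \<bar>c\<bar> * T"
  shows "\<exists>u. square_integrable (lborel \<Otimes>\<^sub>M torus_measure) u \<and>
    (\<forall>s Z. u (s, Z) \<noteq> 0 \<longrightarrow> s \<in> {0<..<T} \<and> Z \<in> \<omega>) \<and>
    (\<forall>i. (\<integral>z. of_real (u z) * (exp (of_real (fst z) * transport_symbol c k i) * torus_exp (- i) (snd z)) \<partial>(lborel \<Otimes>\<^sub>M torus_measure))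
       = - (2 * pi * fourier_coeff i F))"
proof -
  interpret pair_sigma_finite lborel torus_measure by (rule pair_sigma_finite_lborel_torus)
  obtain f where f: "square_integrable torus_measure f" and F: "F = to_l2 f" by (rule l2_cases)
  have fm [measurable]: "f \<in> borel_measurable borel" using f by (simp add: square_integrable_def measurable_cong_sets[OF sets_torus_measure refl])
  obtain \<rho> :: "torus \<Rightarrow> real" and D m where \<rho>m [measurable]: "\<rho> \<in> borel_measurable borel" and \<rho>: "\<And>Z. 0 \<le> \<rho> Z" "\<And>Z. \<rho> Z \<le> 1" "\<And>Z. \<rho> Z \<noteq> 0 \<Longrightarrow> Z \<in> \<omega>"
    and Dm [measurable]: "D \<in> borel_measurable borel" and D: "0 < m" "\<And>Z. m \<le> D Z"
      "\<And>Z. (\<integral>s. indicator {0<..<T} s * \<rho> (torus_shift (c * s) Z) \<partial>lborel) = D Z"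
    using weight_along_characteristics[OF \<omega> c T] by blast
  have D_pos: "0 < D Z" for Z using D(1) D(2)[of Z] by linarith
  define g where "g Z = f Z / D Z" for Z
  have [measurable]: "g \<in> borel_measurable borel" unfolding g_def[abs_def] by measurable
  have g_le: "\<bar>g Z\<bar> \<le> (1 / m) * \<bar>f Z\<bar>" for Z
    using divide_left_mono[of m "D Z" "\<bar>f Z\<bar>"] D(1) D(2)[of Z] D_pos[of Z] by (simp add: g_def)
  define u where "u z = indicator {0<..<T} (fst z) * (- (exp (- (k * fst z)) * g (torus_shift (- c * fst z) (snd z)) * \<rho> (snd z)))" for z
  have u_meas: "u \<in> borel_measurable (lborel \<Otimes>\<^sub>M torus_measure)"
    unfolding u_def[abs_def] by measurable
  have u_sq: "square_integrable (lborel \<Otimes>\<^sub>M torus_measure) u"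
  proof (rule square_integrable_transported[OF u_meas f, where K = "exp (\<bar>k\<bar> * T) * (1 / m)" and b = "- c" and T = T])
    fix s Z
    show "\<bar>u (s, Z)\<bar> \<le> indicator {0<..<T} s * (exp (\<bar>k\<bar> * T) * (1 / m) * \<bar>f (torus_shift (- c * s) Z)\<bar>)"
    proof (cases "s \<in> {0<..<T}")
      case True
      have "- (k * s) \<le> \<bar>k\<bar> * T"
        using True order_trans[OF abs_ge_minus_self[of "k * s"]] mult_left_mono[of s T "\<bar>k\<bar>"] by (simp add: abs_mult)
      then have "exp (- (k * s)) * (\<bar>g (torus_shift (- c * s) Z)\<bar> * \<rho> Z) \<le> exp (\<bar>k\<bar> * T) * ((1 / m) * \<bar>f (torus_shift (- c * s) Z)\<bar> * 1)"
        using \<rho> g_le D(1) by (intro mult_mono) auto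
      then show ?thesis using True \<rho>(1)[of Z] by (simp add: u_def abs_mult mult.assoc)
    qed (simp add: u_def)
  qed
  have u_supp: "s \<in> {0<..<T} \<and> Z \<in> \<omega>" if "u (s, Z) \<noteq> 0" for s Z
    using that \<rho>(3)[of Z] by (auto simp: u_def indicator_def split: if_splits)
  \<comment> \<open>The control read along characteristics, up to the factor - exp(- k s). The
    transport exponential of the test function cancels against the translation, so its moments
    reduce to plain Fourier coefficients.\<close>
  define w where "w z = indicator {0<..<T} (fst z) * (g (snd z) * \<rho> (torus_shift (c * fst z) (snd z)))" for z
  have w_meas: "w \<in> borel_measurable (lborel \<Otimes>\<^sub>M torus_measure)"
    unfolding w_def[abs_def] by measurable
  have w_sq: "square_integrable (lborel \<Otimes>\<^sub>M torus_measure) w"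
  proof (rule square_integrable_transported[OF w_meas f, where K = "1 / m" and b = 0 and T = T])
    fix s Z
    have "\<bar>g Z\<bar> * \<rho> (torus_shift (c * s) Z) \<le> (1 / m) * \<bar>f Z\<bar> * 1"
      using \<rho> g_le D(1) by (intro mult_mono) auto
    then show "\<bar>w (s, Z)\<bar> \<le> indicator {0<..<T} s * (1 / m * \<bar>f (torus_shift (0 * s) Z)\<bar>)"
      using \<rho>(1) by (simp add: w_def abs_mult indicator_def)
  qed
  have mom: "(\<integral>z. of_real (u z) * (exp (of_real (fst z) * transport_symbol c k i) * torus_exp (- i) (snd z)) \<partial>(lborel \<Otimes>\<^sub>M torus_measure))
       = - (2 * pi * fourier_coeff i F)" for i
  proof -
    let ?t = "transport_symbol c k i"
    have intu: "integrable (lborel \<Otimes>\<^sub>M torus_measure) (\<lambda>z. of_real (u z) * (exp (of_real (fst z) * ?t) * torus_exp (- i) (snd z)))"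
    proof (rule integrable_control_weight[OF u_sq, where T = T and C = "exp (\<bar>Re ?t\<bar> * T)"])
      show "cmod (exp (of_real (fst (s, Z)) * ?t) * torus_exp (- i) (snd (s, Z))) \<le> exp (\<bar>Re ?t\<bar> * T)" if "s \<in> {0<..<T}" for s Z
        using norm_exp_mult_torus_exp_le[OF that] by simp
    qed (use u_supp in auto)
    have intw: "integrable (lborel \<Otimes>\<^sub>M torus_measure) (\<lambda>z. of_real (w z) * torus_exp (- i) (snd z))"
    proof (rule integrable_control_weight[OF w_sq, where T = T and C = 1])
      show "s \<in> {0<..<T}" if "w (s, Z) \<noteq> 0" for s Z using that by (auto simp: w_def indicator_def split: if_splits)
    qed auto
    have inner: "(\<integral>Z. of_real (u (s, Z)) * (exp (of_real s * ?t) * torus_exp (- i) Z) \<partial>torus_measure)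
       = - (\<integral>Z. of_real (w (s, Z)) * torus_exp (- i) Z \<partial>torus_measure)" for s
    proof -
      have "(\<integral>Z. of_real (u (s, Z)) * (exp (of_real s * ?t) * torus_exp (- i) Z) \<partial>torus_measure)
         = (\<integral>Z. of_real (u (s, torus_shift (c * s) Z)) * (exp (of_real s * ?t) * torus_exp (- i) (torus_shift (c * s) Z)) \<partial>torus_measure)"
      proof (rule integral_torus_shift[symmetric])
        have "(\<lambda>Z. u (s, Z)) \<in> borel_measurable torus_measure" using u_meas by measurable
        then have [measurable]: "(\<lambda>Z. u (s, Z)) \<in> borel_measurable borel" by (simp add: measurable_cong_sets[OF sets_torus_measure refl])
        show "(\<lambda>Z. of_real (u (s, Z)) * (exp (of_real s * ?t) * torus_exp (- i) Z)) \<in> borel_measurable borel" by measurable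
      qed
      also have "\<dots> = (\<integral>Z. - (of_real (w (s, Z)) * torus_exp (- i) Z) \<partial>torus_measure)"
      proof (rule Bochner_Integration.integral_cong[OF refl])
        fix Z
        have "exp (of_real s * ?t) = of_real (exp (k * s)) * exp (\<i> * of_int i * of_real c * of_real s)"
          by (simp add: transport_symbol_def exp_of_real[symmetric] mult_exp_exp algebra_simps)
        moreover have "torus_exp (- i) (torus_shift (c * s) Z) = exp (- (\<i> * of_int i * of_real c * of_real s)) * torus_exp (- i) Z"
          by (simp add: torus_exp_shift cis_conv_exp mult_ac)
        ultimately have e: "exp (of_real s * ?t) * torus_exp (- i) (torus_shift (c * s) Z) = of_real (exp (k * s)) * torus_exp (- i) Z"
          by (simp add: exp_minus)
        have "u (s, torus_shift (c * s) Z) = - (exp (- (k * s)) * w (s, Z))"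
          by (simp add: u_def w_def)
        then have "of_real (u (s, torus_shift (c * s) Z)) * (exp (of_real s * ?t) * torus_exp (- i) (torus_shift (c * s) Z))
           = - (of_real (exp (- (k * s)) * exp (k * s)) * of_real (w (s, Z)) * torus_exp (- i) Z)"
          unfolding e by simp
        also have "exp (- (k * s)) * exp (k * s) = 1" by (simp add: mult_exp_exp)
        finally show "of_real (u (s, torus_shift (c * s) Z)) * (exp (of_real s * ?t) * torus_exp (- i) (torus_shift (c * s) Z))
           = - (of_real (w (s, Z)) * torus_exp (- i) Z)" by simp
      qed
      finally show ?thesis by simp
    qed
    have "(\<integral>z. of_real (u z) * (exp (of_real (fst z) * ?t) * torus_exp (- i) (snd z)) \<partial>(lborel \<Otimes>\<^sub>M torus_measure))
      = (\<integral>s. - (\<integral>Z. of_real (w (s, Z)) * torus_exp (- i) Z \<partial>torus_measure) \<partial>lborel)"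
      using integral_fst'[OF intu] by (simp add: inner)
    also have "\<dots> = - (\<integral>s. (\<integral>Z. of_real (w (s, Z)) * torus_exp (- i) Z \<partial>torus_measure) \<partial>lborel)" by simp
    also have "(\<integral>s. (\<integral>Z. of_real (w (s, Z)) * torus_exp (- i) Z \<partial>torus_measure) \<partial>lborel)
       = (\<integral>Z. (\<integral>s. of_real (w (s, Z)) * torus_exp (- i) Z \<partial>lborel) \<partial>torus_measure)"
      using Fubini_integral[of "\<lambda>s Z. of_real (w (s, Z)) * torus_exp (- i) Z"] intw by (simp add: split_def)
    also have "\<dots> = (\<integral>Z. of_real (f Z) * torus_exp (- i) Z \<partial>torus_measure)"
    proof (rule Bochner_Integration.integral_cong[OF refl])
      fix Z
      have "(\<integral>s. w (s, Z) \<partial>lborel) = (\<integral>s. g Z * (indicator {0<..<T} s * \<rho> (torus_shift (c * s) Z)) \<partial>lborel)"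
        by (simp add: w_def mult_ac)
      also have "\<dots> = g Z * D Z" by (simp add: D(3))
      also have "\<dots> = f Z" using D_pos[of Z] by (simp add: g_def)
      finally show "(\<integral>s. of_real (w (s, Z)) * torus_exp (- i) Z \<partial>lborel) = of_real (f Z) * torus_exp (- i) Z"
        by simp
    qed
    also have "\<dots> = 2 * pi * fourier_coeff i F" by (simp add: F fourier_coeff_to_l2[OF f])
    finally show ?thesis .
  qed
  show ?thesis using u_sq u_supp mom by (intro exI[of _ u]) auto
qed

subsection \<open>Both components together\<close>

text \<open>The test functions of i and - i are conjugate to each other, so conjugate-symmetric
  moments are shared by w and its conjugate, and hence by the real part.\<close>

lemma real_control_moment:
  fixes w :: "real \<times> torus \<Rightarrow> complex" and l :: "int \<Rightarrow> complex"
  assumes w: "w \<in> borel_measurable (lborel \<Otimes>\<^sub>M torus_measure)" "\<And>z. cmod (w z) \<le> C"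
      "\<And>s Z. s \<notin> {0<..<T} \<Longrightarrow> w (s, Z) = 0"
    and l: "\<And>i. l (- i) = cnj (l i)"
    and m: "\<And>i. (\<integral>z. w z * (exp (of_real (fst z) * l i) * torus_exp (- i) (snd z)) \<partial>(lborel \<Otimes>\<^sub>M torus_measure)) = m i"
    and msym: "\<And>i. m (- i) = cnj (m i)"
  shows "(\<integral>z. of_real (Re (w z)) * (exp (of_real (fst z) * l i) * torus_exp (- i) (snd z)) \<partial>(lborel \<Otimes>\<^sub>M torus_measure)) = m i"
proof -
  let ?t = "\<lambda>i z. exp (of_real (fst z) * l i) * torus_exp (- i) (snd z)"
  note [measurable] = w(1)
  have int: "integrable (lborel \<Otimes>\<^sub>M torus_measure) (\<lambda>z. w z * ?t i z)" for i
  proof (rule integrable_bounded_in_time[where T = T and C = "C * exp (\<bar>Re (l i)\<bar> * T)"])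
    have C: "0 \<le> C" using w(2)[of undefined] norm_ge_zero order_trans by blast
    show "cmod (w z * ?t i z) \<le> C * exp (\<bar>Re (l i)\<bar> * T)" for z
    proof (cases "fst z \<in> {0<..<T}")
      case True
      then show ?thesis unfolding norm_mult[of "w z"]
        using C by (intro mult_mono w(2) norm_exp_mult_torus_exp_le) auto
    next
      case False
      then show ?thesis using w(3)[of "fst z" "snd z"] C by simp
    qed
  qed (auto simp: w(3))
  have "of_real (Re (w z)) * ?t i z = (w z * ?t i z + cnj (w z * ?t (- i) z)) / 2" for z
  proof -
    have "cnj (?t (- i) z) = ?t i z" by (simp add: exp_cnj l cnj_torus_exp)
    then have "w z * ?t i z + cnj (w z * ?t (- i) z) = (w z + cnj (w z)) * ?t i z" by (simp add: algebra_simps)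
    then show ?thesis by (simp only: complex_add_cnj) simp
  qed
  then have "(\<integral>z. of_real (Re (w z)) * ?t i z \<partial>(lborel \<Otimes>\<^sub>M torus_measure)) =
     (m i + cnj (m (- i))) / 2"
    using Bochner_Integration.integral_add[OF int[of i] integrable_cnj[OF int[of "- i"]]]
    by (simp only: integral_divide_zero Bochner_Integration.integral_cnj m)
  then show ?thesis by (simp add: msym)
qed

lemma time_shifted_moment:
  fixes w :: "real \<times> torus \<Rightarrow> complex"
  assumes w: "w \<in> borel_measurable (lborel \<Otimes>\<^sub>M torus_measure)" "\<And>z. cmod (w z) \<le> C"
      "\<And>s Z. s \<notin> {0<..<\<epsilon>} \<Longrightarrow> w (s, Z) = 0" and a: "0 \<le> a"
  shows "(\<integral>z. w (fst z - a, snd z) * (exp (of_real (fst z) * l) * torus_exp n (snd z)) \<partial>(lborel \<Otimes>\<^sub>M torus_measure))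
    = exp (of_real a * l) * (\<integral>z. w z * (exp (of_real (fst z) * l) * torus_exp n (snd z)) \<partial>(lborel \<Otimes>\<^sub>M torus_measure))"
proof -
  interpret pair_sigma_finite lborel torus_measure by (rule pair_sigma_finite_lborel_torus)
  note [measurable] = w(1)
  let ?P = "lborel \<Otimes>\<^sub>M torus_measure"
  have C: "0 \<le> C" using w(2)[of undefined] norm_ge_zero order_trans by blast
  have bd: "cmod (exp (of_real s * l) * torus_exp n Z) \<le> exp (\<bar>Re l\<bar> * (\<epsilon> + a))" if "0 \<le> s" "s \<le> \<epsilon> + a" for s Z
    using that order_trans[OF abs_ge_self[of "s * Re l"]] mult_left_mono[of s "\<epsilon> + a" "\<bar>Re l\<bar>"]
    by (simp add: norm_mult abs_mult mult.commute)
  \<comment> \<open>Stated for intermediate shifts b so that b = a covers the shifted control and b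
    = 0 the original one.\<close>
  have int: "integrable ?P (\<lambda>z. w (fst z - b, snd z) * (exp (of_real (fst z) * l) * torus_exp n (snd z)))"
    if b: "0 \<le> b" "b \<le> a" for b
  proof (rule integrable_bounded_in_time[where T = "\<epsilon> + a" and C = "C * exp (\<bar>Re l\<bar> * (\<epsilon> + a))"])
    show "cmod (w (fst z - b, snd z) * (exp (of_real (fst z) * l) * torus_exp n (snd z))) \<le> C * exp (\<bar>Re l\<bar> * (\<epsilon> + a))" for z
    proof (cases "fst z - b \<in> {0<..<\<epsilon>}")
      case True
      then show ?thesis unfolding norm_mult[of "w _"] using C b by (intro mult_mono w(2) bd) auto
    qed (use C in \<open>simp add: w(3)\<close>)
    have shift: "(\<lambda>z :: real \<times> torus. (fst z - b, snd z)) \<in> measurable ?P ?P" by measurable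
    show "(\<lambda>z. w (fst z - b, snd z) * (exp (of_real (fst z) * l) * torus_exp n (snd z))) \<in> borel_measurable ?P"
      using measurable_compose[OF shift w(1)] by measurable
  qed (use w(3) b in auto)
  define H where "H s = (\<integral>Z. w (s, Z) * (exp (of_real s * l) * torus_exp n Z) \<partial>torus_measure)" for s
  have "(\<integral>z. w (fst z - a, snd z) * (exp (of_real (fst z) * l) * torus_exp n (snd z)) \<partial>?P)
     = (\<integral>s. (\<integral>Z. w (s - a, Z) * (exp (of_real s * l) * torus_exp n Z) \<partial>torus_measure) \<partial>lborel)"
    using integral_fst'[OF int[of a]] a by simp
  also have "\<dots> = (\<integral>s. exp (of_real a * l) * H (s - a) \<partial>lborel)"
  proof (rule Bochner_Integration.integral_cong[OF refl])
    fix s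
    have "exp (of_real s * l) = exp (of_real a * l) * exp (of_real (s - a) * l)" by (simp add: mult_exp_exp algebra_simps)
    then show "(\<integral>Z. w (s - a, Z) * (exp (of_real s * l) * torus_exp n Z) \<partial>torus_measure) = exp (of_real a * l) * H (s - a)"
      unfolding H_def integral_mult_right_zero[symmetric]
      by (intro Bochner_Integration.integral_cong) (simp_all add: mult_ac)
  qed
  also have "\<dots> = exp (of_real a * l) * (\<integral>s. H (- a + 1 * s) \<partial>lborel)" by simp
  also have "(\<integral>s. H (- a + 1 * s) \<partial>lborel) = (\<integral>s. H s \<partial>lborel)"
    using lborel_integral_real_affine[of 1 H "- a"] by simp
  also have "(\<integral>s. H s \<partial>lborel) = (\<integral>z. w z * (exp (of_real (fst z) * l) * torus_exp n (snd z)) \<partial>?P)"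
    unfolding H_def using integral_fst'[OF int[of 0]] a by simp
  finally show ?thesis .
qed

text \<open>The real part of the difference of the symbols is (k1 - k) - d i^2, so the difference
  has modulus at least 1 for all but finitely many i. The exceptional quotients are absorbed in a
  finite sum, a zero difference giving quotient 0 by convention.\<close>

lemma bounded_quotients:
  fixes b :: "int \<Rightarrow> complex"
  assumes d: "d > 0" and b: "\<And>i. cmod (b i) \<le> B"
  shows "\<exists>B'. \<forall>i. cmod (b i / (transport_symbol a1 k1 i - heat_symbol d a k i)) \<le> B'"
proof -
  let ?\<mu> = "\<lambda>i. transport_symbol a1 k1 i - heat_symbol d a k i"
  let ?q = "\<lambda>i. b i / ?\<mu> i"
  obtain N :: nat where N: "(1 + \<bar>k1 - k\<bar>) / d < real N" using reals_Archimedean2 by blast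
  define A where "A = {- int N..int N}"
  have B: "0 \<le> B" using b[of 0] norm_ge_zero order_trans by blast
  have "cmod (?q i) \<le> B + (\<Sum>j\<in>A. cmod (?q j))" for i
  proof (cases "i \<in> A")
    case True
    then have "cmod (?q i) \<le> (\<Sum>j\<in>A. cmod (?q j))" by (intro member_le_sum) (auto simp: A_def)
    then show ?thesis using B by linarith
  next
    case False
    then have "real N \<le> \<bar>real_of_int i\<bar>" by (auto simp: A_def)
    then have "real N \<le> (real_of_int i)\<^sup>2" using abs_int_le_square[of i] by linarith
    then have "(1 + \<bar>k1 - k\<bar>) / d < (real_of_int i)\<^sup>2" using N by linarith
    then have big: "1 + \<bar>k1 - k\<bar> < d * (real_of_int i)\<^sup>2" using d by (simp add: field_simps)
    have "Re (?\<mu> i) = (k1 - k) - d * (real_of_int i)\<^sup>2"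
      by (simp add: transport_symbol_def heat_symbol_def power2_eq_square)
    then have "1 \<le> \<bar>Re (?\<mu> i)\<bar>" using big by linarith
    then have "1 \<le> cmod (?\<mu> i)" using abs_Re_le_cmod[of "?\<mu> i"] by linarith
    then have "cmod (?q i) \<le> B / 1" unfolding norm_divide using b[of i] B by (intro frac_le) auto
    moreover have "0 \<le> (\<Sum>j\<in>A. cmod (?q j))" by (intro sum_nonneg) auto
    ultimately show ?thesis by simp
  qed
  then show ?thesis by blast
qed

theorem steerable_if_compatible:
  fixes d a' a22 k11 k22 T :: real
    and B A K :: "real^2^2" and M :: "real^2" and f0 :: "l2^2"
  assumes d: "d > 0" and a': "a' \<noteq> 0"
    and BAKM: "B = vector [vector [0, 0], vector [0, d]]"
     "A = vector [vector [a', 0], vector [0, a22]]"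
     "K = vector [vector [k11, 0], vector [0, k22]]"
     "M = vector [1, 1]"
    and \<omega>: "open \<omega>" "\<omega> \<noteq> {}"
    and T: "T > gap_length \<omega> / \<bar>a'\<bar>"
    and res: "\<And>i. transport_symbol a' k11 i = heat_symbol d a22 k22 i \<Longrightarrow> fourier_coeff i (f0 $ 1) = fourier_coeff i (f0 $ 2)"
  shows "steerable_to_0 B A K M \<omega> T f0"
proof -
  let ?P = "lborel \<Otimes>\<^sub>M torus_measure"
  let ?tau = "transport_symbol a' k11" and ?lam = "heat_symbol d a22 k22"
  let ?t = "\<lambda>l i (z :: real \<times> torus). exp (of_real (fst z) * l) * torus_exp (- i) (snd z)"
  have sym: "?tau (- i) = cnj (?tau i)" "?lam (- i) = cnj (?lam i)" for i
    by (simp_all add: transport_symbol_def heat_symbol_def)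
  \<comment> \<open>T1 ends the transport stage. It still exceeds the critical time, and T - T1 is
    left for the heat stage.\<close>
  obtain T1 where T1: "gap_length \<omega> / \<bar>a'\<bar> < T1" "T1 < T" using dense[OF T] by blast
  have gap: "0 \<le> gap_length \<omega> / \<bar>a'\<bar>" using gap_length_nonneg[of \<omega>] by simp
  have T1_pos: "0 < T1" using T1 gap by linarith
  have "gap_length \<omega> < \<bar>a'\<bar> * T1" using T1(1) a' by (simp add: field_simps)
  then obtain u1 where u1: "square_integrable ?P u1"
    "\<And>s Z. u1 (s, Z) \<noteq> 0 \<Longrightarrow> s \<in> {0<..<T1} \<and> Z \<in> \<omega>"
    "\<And>i. (\<integral>z. of_real (u1 z) * ?t (?tau i) i z \<partial>?P) = - (2 * pi * fourier_coeff i (f0 $ 1))"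
    using transport_control[OF \<omega> a', of T1 k11 "f0 $ 1"] by blast
  have u1_supp: "s \<in> {0<..<T1}" if "u1 (s, Z) \<noteq> 0" for s Z using u1(2)[OF that] by simp
  have [measurable]: "u1 \<in> borel_measurable ?P" using u1(1) by (simp add: square_integrable_def)
  define \<epsilon> where "\<epsilon> = T - T1"
  have \<epsilon>: "\<epsilon> > 0" using T1 by (simp add: \<epsilon>_def)
  \<comment> \<open>The heat moments that the transport control produces as a side effect.\<close>
  define m where "m i = (\<integral>z. of_real (u1 z) * ?t (?lam i) i z \<partial>?P)" for i
  have m_sym: "m (- i) = cnj (m i)" for i
    unfolding m_def Bochner_Integration.integral_cnj[symmetric]
    by (rule Bochner_Integration.integral_cong) (simp_all add: sym exp_cnj cnj_torus_exp)
  \<comment> \<open>Minus the Fourier coefficient of the heat component at time T1, after the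
    transport control has acted; the second stage has to cancel it.\<close>
  define b where "b i = - exp (- (of_real T1 * ?lam i)) * (fourier_coeff i (f0 $ 2) + m i / (2 * pi))" for i
  have b_sym: "b (- i) = cnj (b i)" for i
    by (simp add: b_def sym m_sym fourier_coeff_uminus exp_cnj)
  have int1: "integrable ?P (\<lambda>z. of_real (u1 z) * w z)"
    if "w \<in> borel_measurable ?P" "\<And>s Z. s \<in> {0<..<T1} \<Longrightarrow> cmod (w (s, Z)) \<le> C" for w :: "real \<times> torus \<Rightarrow> complex" and C
    by (rule integrable_control_weight[OF u1(1) u1_supp that])
  have t_bound: "cmod (?t l i (s, Z)) \<le> exp (\<bar>Re l\<bar> * T1)" if "s \<in> {0<..<T1}" for l i s Z
    using norm_exp_mult_torus_exp_le[OF that] by simp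
  have t_meas: "?t l i \<in> borel_measurable ?P" for l i by measurable
  have int1_t: "integrable ?P (\<lambda>z. of_real (u1 z) * ?t l i z)" for l i
    by (rule int1[of "?t l i" "exp (\<bar>Re l\<bar> * T1)"]) (rule t_meas, rule t_bound)
  have decay: "cmod (exp (- (of_real r * ?lam i))) \<le> exp (\<bar>k22\<bar> * T1)" if "0 \<le> r" "r \<le> T1" for r i
  proof -
    have "Re (?lam i) = d * (real_of_int i)\<^sup>2 + k22" by (simp add: heat_symbol_def power2_eq_square)
    then have "- (r * Re (?lam i)) \<le> - (r * k22)" using that d by (simp add: distrib_left)
    also have "\<dots> \<le> \<bar>k22\<bar> * T1"
      using that order_trans[OF abs_ge_minus_self[of "r * k22"]] mult_left_mono[of r T1 "\<bar>k22\<bar>"]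
      by (simp add: abs_mult mult.commute)
    finally show ?thesis by simp
  qed
  define Cb where "Cb = exp (\<bar>k22\<bar> * T1)"
  define I1 where "I1 = (\<integral>z. norm (of_real (u1 z) * (1::complex)) \<partial>?P)"
  have i1: "integrable ?P (\<lambda>z. of_real (u1 z) * (1::complex))" by (rule int1[of _ 1]) auto
  \<comment> \<open>The bound must be applied to the product with exp(- T1 lam): \<open>m i\<close>
    alone may grow like exp(d T1 i^2), whereas under the integral the combined factor is exp(- (T1 -
    s) lam) with s \<le> T1.\<close>
  have b_bound: "cmod (b i) \<le> Cb * norm (f0 $ 2) + Cb * I1" for i
  proof -
    have "exp (- (of_real T1 * ?lam i)) * m i = (\<integral>z. exp (- (of_real T1 * ?lam i)) * (of_real (u1 z) * ?t (?lam i) i z) \<partial>?P)"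
      unfolding m_def by (rule integral_mult_right_zero[symmetric])
    also have "cmod \<dots> \<le> (\<integral>z. norm (exp (- (of_real T1 * ?lam i)) * (of_real (u1 z) * ?t (?lam i) i z)) \<partial>?P)"
      by (rule Bochner_Integration.integral_norm_bound)
    also have "\<dots> \<le> (\<integral>z. Cb * norm (of_real (u1 z) * (1::complex)) \<partial>?P)"
    proof (rule integral_mono)
      show "integrable ?P (\<lambda>z. norm (exp (- (of_real T1 * ?lam i)) * (of_real (u1 z) * ?t (?lam i) i z)))"
        by (intro integrable_norm integrable_mult_right int1_t)
      show "integrable ?P (\<lambda>z. Cb * norm (of_real (u1 z) * (1::complex)))" by (intro integrable_mult_right integrable_norm i1)
      fix z :: "real \<times> torus"
      show "norm (exp (- (of_real T1 * ?lam i)) * (of_real (u1 z) * ?t (?lam i) i z)) \<le> Cb * norm (of_real (u1 z) * (1::complex))"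
      proof (cases "u1 z = 0")
        case False
        then have s: "fst z \<in> {0<..<T1}" using u1_supp[of "fst z" "snd z"] by simp
        have "exp (- (of_real T1 * ?lam i)) * (of_real (u1 z) * ?t (?lam i) i z) = exp (- (of_real (T1 - fst z) * ?lam i)) * (of_real (u1 z) * torus_exp (- i) (snd z))"
          by (simp add: mult_exp_exp algebra_simps flip: mult.assoc)
        then show ?thesis using decay[of "T1 - fst z" i] s
          by (simp only: norm_mult cmod_torus_exp norm_one mult_1_right Cb_def) (intro mult_right_mono; simp)
      qed simp
    qed
    also have "\<dots> = Cb * I1" by (simp add: I1_def)
    finally have 1: "cmod (exp (- (of_real T1 * ?lam i)) * m i) \<le> Cb * I1" .
    have "cmod (exp (- (of_real T1 * ?lam i)) * (m i / (2 * pi))) = cmod (exp (- (of_real T1 * ?lam i)) * m i) / (2 * pi)"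
      by (simp only: times_divide_eq_right norm_divide) simp
    also have "\<dots> \<le> cmod (exp (- (of_real T1 * ?lam i)) * m i) / 1"
      using pi_gt3 by (intro divide_left_mono) auto
    finally have 2: "cmod (exp (- (of_real T1 * ?lam i)) * (m i / (2 * pi))) \<le> Cb * I1" using 1 by simp
    have 3: "cmod (exp (- (of_real T1 * ?lam i)) * fourier_coeff i (f0 $ 2)) \<le> Cb * norm (f0 $ 2)"
      unfolding norm_mult Cb_def using T1_pos by (intro mult_mono decay fourier_coeff_bound) auto
    have "b i = - (exp (- (of_real T1 * ?lam i)) * fourier_coeff i (f0 $ 2) + exp (- (of_real T1 * ?lam i)) * (m i / (2 * pi)))"
      by (simp add: b_def algebra_simps)
    then have "cmod (b i) = cmod (exp (- (of_real T1 * ?lam i)) * fourier_coeff i (f0 $ 2) + exp (- (of_real T1 * ?lam i)) * (m i / (2 * pi)))"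
      by (simp only: norm_minus_cancel)
    also have "\<dots> \<le> Cb * norm (f0 $ 2) + Cb * I1" by (intro norm_triangle_le add_mono 2 3)
    finally show ?thesis .
  qed
  define \<beta> where "\<beta> i = b i / (?tau i - ?lam i)" for i
  obtain B' where B': "\<And>i. cmod (\<beta> i) \<le> B'"
    using bounded_quotients[where b = b and d = d and a = a22 and k = k22 and ?a1.0 = a' and ?k1.0 = k11, OF d b_bound] unfolding \<beta>_def by blast
  \<comment> \<open>At a resonance the transport and heat moments of \<open>u1\<close> coincide and
    so do the initial coefficients, so \<open>u1\<close> has already removed the heat mode and b i =
    0.\<close>
  have \<beta>_mult: "\<beta> i * (?tau i - ?lam i) = b i" for i
  proof (cases "?tau i = ?lam i")
    case True
    have "m i = - (2 * pi * fourier_coeff i (f0 $ 2))"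
      using u1(3)[of i] res[OF True] unfolding m_def True by simp
    then show ?thesis using True by (simp add: b_def)
  qed (simp add: \<beta>_def)
  obtain p where p: "to_torus p \<in> \<omega>" using \<omega>(2) by (metis all_not_in_conv to_torus_rep)
  have "open (to_torus -` \<omega>)" using \<omega>(1) by (simp add: open_torus_def)
  then obtain r where r: "r > 0" "ball p r \<subseteq> to_torus -` \<omega>" using p open_contains_ball by (metis vimageI)
  \<comment> \<open>The number 3 only ensures \<delta> < pi, as the cutoff requires.\<close>
  define \<delta> where "\<delta> = min r 3"
  have \<delta>: "0 < \<delta>" "\<delta> < pi" "\<delta> \<le> r" using r pi_gt3 by (auto simp: \<delta>_def)
  have near: "Z \<in> \<omega>" if "torus_rep p Z \<notin> {p + \<delta>..p + 2 * pi - \<delta>}" for Z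
  proof (cases "torus_rep p Z < p + \<delta>")
    case True
    then have "torus_rep p Z \<in> ball p r" using torus_rep_ge[of p Z] \<delta>(3) by (auto simp: dist_real_def)
    then have "to_torus (torus_rep p Z) \<in> \<omega>" using r(2) by blast
    then show ?thesis by simp
  next
    case False
    \<comment> \<open>Close to the right end of the cut, the point is near p from the left after
      going back one period.\<close>
    then have "torus_rep p Z - 2 * pi \<in> ball p r"
      using that torus_rep_less[of p Z] \<delta>(3) by (auto simp: dist_real_def)
    then have "to_torus (torus_rep p Z - 2 * pi) \<in> \<omega>" using r(2) by blast
    moreover have "to_torus (torus_rep p Z - 2 * pi) = Z"
      using to_torus_period[of "torus_rep p Z" "- 1"] by simp
    ultimately show ?thesis by simp
  qed
  obtain w Cw where w: "w \<in> borel_measurable ?P" "\<forall>z. cmod (w z) \<le> Cw"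
    "\<forall>s Z. s \<notin> {0<..<\<epsilon>} \<longrightarrow> w (s, Z) = 0"
    "\<forall>s Z. torus_rep p Z \<in> {p + \<delta>..p + 2 * pi - \<delta>} \<longrightarrow> w (s, Z) = 0"
    "\<forall>i. (\<integral>z. w z * ?t (?tau i) i z \<partial>?P) = 0"
    "\<forall>i. (\<integral>z. w z * ?t (?lam i) i z \<partial>?P) = 2 * pi * \<beta> i * (?tau i - ?lam i)"
    using heat_control[where d = d and a = a22 and k = k22 and ?a1.0 = a' and ?k1.0 = k11 and p = p and \<beta> = \<beta>, OF d \<epsilon> \<delta>(1,2) B'] by blast
  note w_bound = w(2)[rule_format] and w_supp = w(3)[rule_format]
  define v where "v z = w (fst z - T1, snd z)" for z
  have shift: "(\<lambda>z :: real \<times> torus. (fst z - T1, snd z)) \<in> measurable ?P ?P" by measurable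
  have v_meas [measurable]: "v \<in> borel_measurable ?P" unfolding v_def[abs_def] by (rule measurable_compose[OF shift w(1)])
  have v_bound: "cmod (v z) \<le> Cw" for z unfolding v_def by (rule w_bound)
  have v_supp: "v (s, Z) = 0" if "s \<notin> {T1<..<T}" for s Z
    using that by (simp add: v_def w_supp \<epsilon>_def)
  have v_supp': "v (s, Z) = 0" if "s \<notin> {0<..<T}" for s Z
    using that T1_pos by (intro v_supp) auto
  have v_space: "Z \<in> \<omega>" if "v (s, Z) \<noteq> 0" for s Z
    using that w(4) near unfolding v_def by fastforce
  have v_mom: "(\<integral>z. v z * ?t (?tau i) i z \<partial>?P) = 0" "(\<integral>z. v z * ?t (?lam i) i z \<partial>?P) = exp (of_real T1 * ?lam i) * (2 * pi * b i)" for i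
    using time_shifted_moment[where \<epsilon> = \<epsilon> and a = T1, OF w(1) w_bound w_supp] T1_pos w(5,6) \<beta>_mult[of i]
    by (simp_all add: v_def mult.assoc)
  \<comment> \<open>The control must be real; taking the real part keeps the moments, since
    \<open>b\<close> and the symbols are conjugate symmetric.\<close>
  define u2 where "u2 z = Re (v z)" for z
  have u2_meas: "u2 \<in> borel_measurable ?P" unfolding u2_def[abs_def] by measurable
  have u2_tau: "(\<integral>z. of_real (u2 z) * ?t (?tau i) i z \<partial>?P) = 0" for i
    unfolding u2_def
    by (rule real_control_moment[OF v_meas v_bound v_supp', where l = ?tau and m = "\<lambda>_. 0"]) (simp_all add: sym v_mom)
  have u2_lam: "(\<integral>z. of_real (u2 z) * ?t (?lam i) i z \<partial>?P) = exp (of_real T1 * ?lam i) * (2 * pi * b i)" for i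
    unfolding u2_def
    by (rule real_control_moment[OF v_meas v_bound v_supp', where l = ?lam and m = "\<lambda>i. exp (of_real T1 * ?lam i) * (2 * pi * b i)"])
       (simp_all add: sym v_mom b_sym exp_cnj)
  have Cw: "0 \<le> Cw" using v_bound[of undefined] norm_ge_zero order_trans by blast
  have u2_sq: "square_integrable ?P u2"
  proof -
    have "integrable ?P (\<lambda>z. complex_of_real ((u2 z)\<^sup>2))"
    proof (rule integrable_bounded_in_time[where T = T and C = "Cw\<^sup>2"])
      show "(\<lambda>z. complex_of_real ((u2 z)\<^sup>2)) \<in> borel_measurable ?P" using u2_meas by measurable
      show "cmod (complex_of_real ((u2 z)\<^sup>2)) \<le> Cw\<^sup>2" for z
        using power_mono[OF order_trans[OF abs_Re_le_cmod v_bound[of z]], of 2] by (simp add: u2_def norm_power)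
    qed (simp add: u2_def v_supp')
    then have "integrable ?P (\<lambda>z. (u2 z)\<^sup>2)" by (subst (asm) complex_of_real_integrable_eq)
    then show ?thesis using u2_meas by (simp add: square_integrable_def)
  qed
  define u where "u z = u1 z + u2 z" for z
  have u_sq: "square_integrable ?P u" unfolding u_def by (rule square_integrable_add[OF u1(1) u2_sq])
  have u_supp: "s \<in> {0<..<T} \<and> Z \<in> \<omega>" if "u (s, Z) \<noteq> 0" for s Z
  proof -
    have "u1 (s, Z) \<noteq> 0 \<or> v (s, Z) \<noteq> 0" using that by (auto simp: u_def u2_def)
    then consider "u1 (s, Z) \<noteq> 0" | "v (s, Z) \<noteq> 0" by blast
    then show ?thesis
    proof cases
      case 1
      then show ?thesis using u1(2)[of s Z] T1 by auto
    next
      case 2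
      then show ?thesis using v_supp' v_space by blast
    qed
  qed
  have int2: "integrable ?P (\<lambda>z. of_real (u2 z) * ?t l i z)" for l i
  proof (rule integrable_control_weight[OF u2_sq, where T = T and C = "exp (\<bar>Re l\<bar> * T)"])
    show "s \<in> {0<..<T}" if "u2 (s, Z) \<noteq> 0" for s Z using that v_supp'[of s Z] unfolding u2_def by (metis zero_complex.sel(1))
    show "cmod (?t l i (s, Z)) \<le> exp (\<bar>Re l\<bar> * T)" if "s \<in> {0<..<T}" for s Z
      using norm_exp_mult_torus_exp_le[OF that] by simp
  qed (rule t_meas)
  have u_mom: "(\<integral>z. of_real (u z) * ?t l i z \<partial>?P) = (\<integral>z. of_real (u1 z) * ?t l i z \<partial>?P) + (\<integral>z. of_real (u2 z) * ?t l i z \<partial>?P)" for l i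
    unfolding u_def of_real_add distrib_right
    by (rule Bochner_Integration.integral_add[OF int1_t int2])
  show ?thesis
  proof (rule steerable_if_moments[OF d a' BAKM \<omega>(1) _ u_sq u_supp])
    show "0 \<le> T" using T1_pos T1 by simp
    show "(\<integral>z. of_real (u z) * ?t (?tau i) i z \<partial>?P) = - (2 * pi * fourier_coeff i (f0 $ 1))" for i
      unfolding u_mom u1(3) u2_tau by simp
    show "(\<integral>z. of_real (u z) * ?t (?lam i) i z \<partial>?P) = - (2 * pi * fourier_coeff i (f0 $ 2))" for i
    proof -
      have "exp (of_real T1 * ?lam i) * (2 * pi * b i) = - (exp (of_real T1 * ?lam i) * exp (- (of_real T1 * ?lam i))) * (2 * pi * fourier_coeff i (f0 $ 2) + m i)"
        by (simp add: b_def algebra_simps)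
      also have "exp (of_real T1 * ?lam i) * exp (- (of_real T1 * ?lam i)) = 1" by (simp add: mult_exp_exp)
      finally show ?thesis unfolding u_mom u2_lam m_def[symmetric] by simp
    qed
  qed
qed

text \<open>Translates equality of the means into compatibility at the resonant frequency 0.\<close>

lemma fourier_coeff_0: "fourier_coeff 0 F = of_real (integral_l2 F) / (2 * pi)"
proof -
  obtain f where f: "square_integrable torus_measure f" "F = to_l2 f" by (rule l2_cases)
  then show ?thesis by (simp add: fourier_coeff_to_l2 integral_l2_to_l2)
qed

text \<open>Each case lists the resonances, the frequencies where both symbols agree, and asks for
  compatibility only there. For a' = a22 they are given by d n^2 = k11 - k22, hence the quotient
  (k11 - k22) / d, of opposite sign to the one in the English statement. The real
  \<open>sqrt\<close> of a negative number is negative, so negative quotients belong to the third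
  case.\<close>

theorem proposition22:
  fixes d a' a22 k11 k22 T :: real
    and B A K :: "real^2^2" and M :: "real^2"
    and \<omega> :: "torus set"
  assumes "d > 0" and "a' \<noteq> 0"
    and "B = vector [vector [0, 0], vector [0, d]]"
    and "A = vector [vector [a', 0], vector [0, a22]]"
    and "K = vector [vector [k11, 0], vector [0, k22]]"
    and "M = vector [1, 1]"
    and "open \<omega>" and "\<omega> \<noteq> {}"
    and "T > gap_length \<omega> / \<bar>a'\<bar>"
  shows "(a' \<noteq> a22 \<and> k11 = k22 \<longrightarrow>
            (\<forall>f0 :: l2^2. integral_l2 (f0 $ 1) = integral_l2 (f0 $ 2) \<longrightarrow>
               steerable_to_0 B A K M \<omega> T f0))
       \<and> (a' \<noteq> a22 \<and> k11 \<noteq> k22 \<longrightarrow>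
            (\<forall>f0 :: l2^2. steerable_to_0 B A K M \<omega> T f0))
       \<and> (a' = a22 \<and> sqrt ((k11 - k22) / d) \<notin> \<nat> \<longrightarrow>
            (\<forall>f0 :: l2^2. steerable_to_0 B A K M \<omega> T f0))
       \<and> (\<forall>n0 :: nat. a' = a22 \<and> real n0 = sqrt ((k11 - k22) / d) \<longrightarrow>
            (\<forall>f0 :: l2^2. fourier_coeff (int n0) (f0 $ 1) = fourier_coeff (int n0) (f0 $ 2) \<and>
               fourier_coeff (- int n0) (f0 $ 1) = fourier_coeff (- int n0) (f0 $ 2) \<longrightarrow>
               steerable_to_0 B A K M \<omega> T f0))"
proof -
  note steer = steerable_if_compatible[OF assms]
  let ?res = "\<lambda>i. transport_symbol a' k11 i = heat_symbol d a22 k22 i"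
  \<comment> \<open>The imaginary parts differ by i (a' - a22), so only frequency 0 can be resonant,
    and there the real parts are \<open>k11\<close> and \<open>k22\<close>.\<close>
  have res0: "i = 0 \<and> k11 = k22" if "?res i" "a' \<noteq> a22" for i
  proof -
    have "Im (transport_symbol a' k11 i) = Im (heat_symbol d a22 k22 i)" using that(1) by simp
    then have "i = 0" using that(2) by (simp add: transport_symbol_def heat_symbol_def power2_eq_square)
    moreover have "Re (transport_symbol a' k11 i) = Re (heat_symbol d a22 k22 i)" using that(1) by simp
    ultimately show ?thesis by (simp add: transport_symbol_def heat_symbol_def)
  qed
  have res1: "sqrt ((k11 - k22) / d) = real (nat \<bar>i\<bar>)" if "?res i" "a' = a22" for i
    using that resonant_frequency_iff[OF assms(1), of i a22 k11 k22]
    by (simp add: transport_symbol_def heat_symbol_def)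
  show ?thesis
  proof (intro conjI impI allI)
    fix f0 :: "l2^2"
    assume "a' \<noteq> a22 \<and> k11 = k22" "integral_l2 (f0 $ 1) = integral_l2 (f0 $ 2)"
    then show "steerable_to_0 B A K M \<omega> T f0"
      using res0 by (intro steer) (metis fourier_coeff_0)
  next
    fix f0 :: "l2^2"
    assume "a' \<noteq> a22 \<and> k11 \<noteq> k22"
    then show "steerable_to_0 B A K M \<omega> T f0" using res0 by (intro steer) auto
  next
    fix f0 :: "l2^2"
    assume "a' = a22 \<and> sqrt ((k11 - k22) / d) \<notin> \<nat>"
    then show "steerable_to_0 B A K M \<omega> T f0" using res1 by (intro steer) (metis of_nat_in_Nats)
  next
    fix n0 :: nat and f0 :: "l2^2"
    assume n0: "a' = a22 \<and> real n0 = sqrt ((k11 - k22) / d)"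
      and f0: "fourier_coeff (int n0) (f0 $ 1) = fourier_coeff (int n0) (f0 $ 2) \<and>
               fourier_coeff (- int n0) (f0 $ 1) = fourier_coeff (- int n0) (f0 $ 2)"
    show "steerable_to_0 B A K M \<omega> T f0"
    proof (rule steer)
      fix i assume "?res i"
      then have "real (nat \<bar>i\<bar>) = real n0" using res1 n0 by metis
      then have "i = int n0 \<or> i = - int n0" by (auto simp: abs_if split: if_splits)
      then show "fourier_coeff i (f0 $ 1) = fourier_coeff i (f0 $ 2)" using f0 by blast
    qed
  qed
qed

end
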